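(* Let $\mathbb X=(X,\tau,\mathsf d,\mathfrak m)$ be an extended metric-topological measure space and $p\in(1,\infty)$. Then $$W^{1,p}(\mathbb X)\subseteq B^{1,p}(\mathbb X).$$ Moreover, it holds that $|Df|_B\leq|Df|$ for every $f\in W^{1,p}(\mathbb X)$.
   Context: An extended distance on a set $X$ is a symmetric function $\mathsf d\colon X\times X\to[0,+\infty]$ satisfying the triangle inequality and with $\mathsf d(x,y)=0$ iff $x=y$. For $f\colon X\to\mathbb R$ and $A\subseteq X$, $\mathrm{Lip}(f,A,\mathsf d)=\sup\{|f(x)-f(y)|/\mathsf d(x,y):x,y\in A,\ x\neq y\}$ (with $c/(+\infty)=0$, $\sup\varnothing=0$), $\mathrm{Lip}(f,\mathsf d)=\mathrm{Lip}(f,X,\mathsf d)$. $\mathrm{Lip}_b(X,\tau,\mathsf d)$ is the algebra of bounded $\tau$-continuous $\mathsf d$-Lipschitz functions $f\colon X\to\mathbb R$. $(X,\tau,\mathsf d)$ is an extended metric-topological space if $\tau$ is Hausdorff, $\mathsf d$ is an extended distance, $\tau$ is the initial topology of $\mathrm{Lip}_b(X,\tau,\mathsf d)$, and $\mathsf d(x,y)=\sup\{|f(x)-f(y)|:f\in\mathrm{Lip}_b(X,\tau,\mathsf d),\ \mathrm{Lip}(f,\mathsf d)\leq 1\}$ for all $x,y$. It becomes an extended metric-topological measure space when equipped with a finite Radon (inner regular with respect to $\tau$-compact sets) measure $\mathfrak m$ on the Borel sets of $\tau$. $\mathcal M_+(Y)$ denotes the finite Radon measures on a Hausdorff space $Y$.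 The asymptotic slope of $f\in\mathrm{Lip}_b(X,\tau,\mathsf d)$ is $\mathrm{lip}_{\mathsf d}(f)(x)=\inf\{\mathrm{Lip}(f,U,\mathsf d):x\in U\in\tau\}$. $\bigwedge$ denotes the $\mathfrak m$-essential infimum; a superscript $+$ denotes nonnegative elements; $L^0(\mathfrak m)$ is the algebra of real-valued $\tau$-Borel functions up to $\mathfrak m$-a.e. equality. $q$ denotes the conjugate exponent of $p$. The space $W^{1,p}(\mathbb X)$: a Lipschitz derivation on $\mathbb X$ is a linear map $b\colon\mathrm{Lip}_b(X,\tau,\mathsf d)\to L^0(\mathfrak m)$ with $b(fg)=f\,b(g)+g\,b(f)$ for all $f,g$; $hb$ denotes $f\mapsto h\,b(f)$. $b$ has divergence if $b(f)\in L^1(\mathfrak m)$ for every $f$ and there is a (unique) $\mathrm{div}(b)\in L^1(\mathfrak m)$ with $\int b(f)\,d\mathfrak m=-\int f\,\mathrm{div}(b)\,d\mathfrak m$ for every $f\in\mathrm{Lip}_b(X,\tau,\mathsf d)$. $\mathrm{Der}^q(\mathbb X)$ is the set of Lipschitz derivations $b$ for which there is $g\in L^q(\mathfrak m)^+$ with $|b(f)|\leq g\,\mathrm{lip}_{\mathsf d}(f)$ $\mathfrak m$-a.e. for every $f$; $|b|$ is the $\mathfrak m$-essential infimum of all such $g$. $\mathrm{Der}^q_q(\mathbb X)$ is the set of $b\in\mathrm{Der}^q(\mathbb X)$ having divergence with $\mathrm{div}(b)\in L^q(\mathfrak m)$. $W^{1,p}(\mathbb X)$ is the set of $f\in L^p(\mathfrak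 m)$ for which there is a (necessarily unique) linear operator $L_f\colon\mathrm{Der}^q_q(\mathbb X)\to L^1(\mathfrak m)$ such that: (i) there is $g\in L^p(\mathfrak m)^+$ with $|L_f(b)|\leq g|b|$ for every $b\in\mathrm{Der}^q_q(\mathbb X)$; (ii) $L_f(hb)=h\,L_f(b)$ for every $h\in\mathrm{Lip}_b(X,\tau,\mathsf d)$ and $b\in\mathrm{Der}^q_q(\mathbb X)$; (iii) $\int L_f(b)\,d\mathfrak m=-\int f\,\mathrm{div}(b)\,d\mathfrak m$ for every $b\in\mathrm{Der}^q_q(\mathbb X)$. For $f\in W^{1,p}(\mathbb X)$, $|Df|=\bigwedge\{g\in L^p(\mathfrak m)^+:|L_f(b)|\leq g|b|\ \forall b\in\mathrm{Der}^q_q(\mathbb X)\}$. Rectifiable arcs: equip $C([0,1];(X,\tau))$ with the compact-open topology $\tau_C$. For $\gamma,\sigma\in C([0,1];(X,\tau))$ write $\gamma\sim\sigma$ if $\gamma\circ\phi_\gamma=\sigma\circ\phi_\sigma$ for some continuous, non-decreasing, surjective maps $\phi_\gamma,\phi_\sigma\colon[0,1]\to[0,1]$; equip the quotient $\mathrm A(X,\tau)$ with the quotient topology $\tau_{\mathrm A}$. $\mathrm{RA}(X,\mathsf d)\subseteq\mathrm A(X,\tau)$ is the set of classes $[\gamma]$ of $\mathsf d$-continuous curves $\gamma$ with finite $\mathsf d$-length $\ell(\gamma)$ (total variation), with the topology induced by $\tau_{\mathrm A}$. Each $\gamma\in\mathrm{RA}(X,\mathsf d)$ has a well-defined length $\ell(\gamma)$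 and a unique constant $\mathsf d$-speed representative $R_\gamma\colon[0,1]\to X$, i.e. the variation of $R_\gamma$ on $[0,t]$ equals $\ell(\gamma)t$ for every $t\in[0,1]$. Set $\hat{\mathsf e}_t(\gamma)=R_\gamma(t)$, $\gamma_0=R_\gamma(0)$, $\gamma_1=R_\gamma(1)$, and $\int_\gamma f=\ell(\gamma)\int_0^1 f(R_\gamma(t))\,dt$ for Borel $f$ (bounded, or with values in $[0,+\infty]$). $\mathcal T_q$-test plans: a dynamic plan is $\pi\in\mathcal M_+(\mathrm{RA}(X,\mathsf d),\tau_{\mathrm A})$ with $\int\ell(\gamma)\,d\pi(\gamma)<+\infty$; its barycenter is the unique $\mu_\pi\in\mathcal M_+(X,\tau)$ with $\int f\,d\mu_\pi=\int(\int_\gamma f)\,d\pi(\gamma)$ for all bounded Borel $f$. It is a $\mathcal T_q$-test plan if $\mu_\pi\ll\mathfrak m$ and $(\hat{\mathsf e}_0)_\#\pi,(\hat{\mathsf e}_1)_\#\pi\ll\mathfrak m$, with all three densities in $L^q(\mathfrak m)$; $\mathcal T_q(\mathbb X)$ is the set of such plans. The space $B^{1,p}(\mathbb X)$: for $\tau$-Borel $f\colon X\to\mathbb R$ and $G\colon X\to[0,+\infty)$, $G$ is a $\mathcal T_q$-weak upper gradient of $f$ if for every $\pi\in\mathcal T_q(\mathbb X)$ one has $|f(\gamma_1)-f(\gamma_0)|\leq\int_\gamma G<+\infty$ for $\pi$-a.e. $\gamma$ (this depends only on the $\mathfrak m$-a.e. class of $f$). $B^{1,p}(\mathbb X)$ is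 the set of $f\in L^p(\mathfrak m)$ having a $\mathcal T_q$-weak upper gradient in $L^p(\mathfrak m)$, and $|Df|_B\in L^p(\mathfrak m)^+$ is the unique element having a representative that is a $\mathcal T_q$-weak upper gradient of $f$ and such that $|Df|_B\leq G$ $\mathfrak m$-a.e. for every $\mathcal T_q$-weak upper gradient $G$ of $f$. *)

theory Defs
  imports "HOL-Analysis.Analysis"
begin

text \<open>
  The underlying set \<open>X\<close> is the universe of a type \<open>'a :: t2_space\<close>, whose class topology is the
  Hausdorff topology \<open>\<tau>\<close>. The extended distance is a function \<open>d :: 'a \<Rightarrow> 'a \<Rightarrow> ennreal\<close>, unrelated
  a priori to the class topology.

  Elements of \<open>L\<^sup>0\<close>, \<open>L\<^sup>p\<close> are represented by measurable functions, and all identities and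
  inequalities between them are required only almost everywhere.
\<close>

section \<open>Extended metric-topological measure spaces\<close>

definition extended_distance :: "('a \<Rightarrow> 'a \<Rightarrow> ennreal) \<Rightarrow> bool" where
  "extended_distance d \<longleftrightarrow>
     (\<forall>x y. d x y = d y x) \<and>
     (\<forall>x y z. d x z \<le> d x y + d y z) \<and>
     (\<forall>x y. d x y = 0 \<longleftrightarrow> x = y)"

text \<open>In \<^typ>\<open>ennreal\<close>, \<open>c / \<infinity> = 0\<close> for finite \<open>c\<close>, and the supremum of the empty set is \<open>0\<close>.\<close>

definition Lip :: "('a \<Rightarrow> 'a \<Rightarrow> ennreal) \<Rightarrow> ('a \<Rightarrow> real) \<Rightarrow> 'a set \<Rightarrow> ennreal" where
  "Lip d f A = (SUP (x, y) \<in> {(x, y). x \<in> A \<and> y \<in> A \<and> x \<noteq> y}. ennreal \<bar>f x - f y\<bar> / d x y)"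

definition Lip_b :: "('a::topological_space \<Rightarrow> 'a \<Rightarrow> ennreal) \<Rightarrow> ('a \<Rightarrow> real) set" where
  "Lip_b d = {f. bounded (range f) \<and> continuous_on UNIV f \<and> Lip d f UNIV < \<infinity>}"

definition asymptotic_slope ::
    "('a::topological_space \<Rightarrow> 'a \<Rightarrow> ennreal) \<Rightarrow> ('a \<Rightarrow> real) \<Rightarrow> 'a \<Rightarrow> ennreal" where
  "asymptotic_slope d f x = (INF U \<in> {U. open U \<and> x \<in> U}. Lip d f U)"

definition emt_space :: "('a::t2_space \<Rightarrow> 'a \<Rightarrow> ennreal) \<Rightarrow> bool" where
  "emt_space d \<longleftrightarrow>
     extended_distance d \<and>
     (\<forall>U. open U \<longleftrightarrow> generate_topology {f -` V | f V. f \<in> Lip_b d \<and> open V} U) \<and>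
     (\<forall>x y. d x y = (SUP f \<in> {f \<in> Lip_b d. Lip d f UNIV \<le> 1}. ennreal \<bar>f x - f y\<bar>))"

text \<open>Finite Radon measures on the Borel sets of an abstract topology.\<close>

definition radon_measure :: "'b topology \<Rightarrow> 'b measure \<Rightarrow> bool" where
  "radon_measure T M \<longleftrightarrow>
     sets M = sets (sigma (topspace T) {U. openin T U}) \<and>
     finite_measure M \<and>
     (\<forall>B \<in> sets M. emeasure M B = (SUP K \<in> {K. compactin T K \<and> K \<subseteq> B}. emeasure M K))"

definition emtm_space :: "('a::t2_space \<Rightarrow> 'a \<Rightarrow> ennreal) \<Rightarrow> 'a measure \<Rightarrow> bool" where
  "emtm_space d m \<longleftrightarrow> emt_space d \<and> radon_measure euclidean m"

section \<open>Lebesgue spaces\<close>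

definition Lp :: "'a measure \<Rightarrow> real \<Rightarrow> ('a \<Rightarrow> real) set" where
  "Lp m p = {f \<in> borel_measurable m. integrable m (\<lambda>x. \<bar>f x\<bar> powr p)}"

definition Lp_nonneg :: "'a measure \<Rightarrow> real \<Rightarrow> ('a \<Rightarrow> real) set" where
  "Lp_nonneg m p = {f \<in> Lp m p. AE x in m. 0 \<le> f x}"

definition conjugate_exponent :: "real \<Rightarrow> real" where
  "conjugate_exponent p = p / (p - 1)"

text \<open>The essential infimum of a family of functions is its greatest lower bound with respect to
  the almost everywhere order. It is unique up to almost everywhere equality.\<close>

definition is_ess_inf :: "'a measure \<Rightarrow> ('a \<Rightarrow> real) set \<Rightarrow> ('a \<Rightarrow> real) \<Rightarrow> bool" where
  "is_ess_inf m S g \<longleftrightarrow>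
     g \<in> borel_measurable m \<and>
     (\<forall>h \<in> S. AE x in m. g x \<le> h x) \<and>
     (\<forall>k \<in> borel_measurable m. (\<forall>h \<in> S. AE x in m. k x \<le> h x) \<longrightarrow> (AE x in m. k x \<le> g x))"

definition ess_inf :: "'a measure \<Rightarrow> ('a \<Rightarrow> real) set \<Rightarrow> 'a \<Rightarrow> real" where
  "ess_inf m S = (SOME g. is_ess_inf m S g)"

section \<open>Lipschitz derivations and the space \<open>W\<close>\<close>

text \<open>A derivation maps functions in \<^term>\<open>Lip_b d\<close> to representatives of elements of \<open>L\<^sup>0\<close>; its
  values outside \<^term>\<open>Lip_b d\<close> are irrelevant.\<close>

type_synonym 'a derivation = "('a \<Rightarrow> real) \<Rightarrow> 'a \<Rightarrow> real"

definition lipschitz_derivation ::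
    "('a::topological_space \<Rightarrow> 'a \<Rightarrow> ennreal) \<Rightarrow> 'a measure \<Rightarrow> 'a derivation \<Rightarrow> bool" where
  "lipschitz_derivation d m b \<longleftrightarrow>
     (\<forall>f \<in> Lip_b d. b f \<in> borel_measurable m) \<and>
     (\<forall>f \<in> Lip_b d. \<forall>g \<in> Lip_b d. \<forall>\<alpha> \<beta> :: real.
        AE x in m. b (\<lambda>y. \<alpha> * f y + \<beta> * g y) x = \<alpha> * b f x + \<beta> * b g x) \<and>
     (\<forall>f \<in> Lip_b d. \<forall>g \<in> Lip_b d.
        AE x in m. b (\<lambda>y. f y * g y) x = f x * b g x + g x * b f x)"

definition is_divergence ::
    "('a::topological_space \<Rightarrow> 'a \<Rightarrow> ennreal) \<Rightarrow> 'a measure \<Rightarrow> 'a derivation \<Rightarrow> ('a \<Rightarrow> real) \<Rightarrow> bool" where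
  "is_divergence d m b D \<longleftrightarrow>
     (\<forall>f \<in> Lip_b d. integrable m (b f)) \<and> integrable m D \<and>
     (\<forall>f \<in> Lip_b d. (\<integral>x. b f x \<partial>m) = - (\<integral>x. f x * D x \<partial>m))"

definition derivation_bounds ::
    "('a::topological_space \<Rightarrow> 'a \<Rightarrow> ennreal) \<Rightarrow> 'a measure \<Rightarrow> real \<Rightarrow> 'a derivation \<Rightarrow> ('a \<Rightarrow> real) set" where
  "derivation_bounds d m q b = {g \<in> Lp_nonneg m q. \<forall>f \<in> Lip_b d.
     AE x in m. ennreal \<bar>b f x\<bar> \<le> ennreal (g x) * asymptotic_slope d f x}"

definition Der ::
    "('a::topological_space \<Rightarrow> 'a \<Rightarrow> ennreal) \<Rightarrow> 'a measure \<Rightarrow> real \<Rightarrow> 'a derivation set" where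
  "Der d m q = {b. lipschitz_derivation d m b \<and> derivation_bounds d m q b \<noteq> {}}"

definition derivation_norm ::
    "('a::topological_space \<Rightarrow> 'a \<Rightarrow> ennreal) \<Rightarrow> 'a measure \<Rightarrow> real \<Rightarrow> 'a derivation \<Rightarrow> 'a \<Rightarrow> real" where
  "derivation_norm d m q b = ess_inf m (derivation_bounds d m q b)"

definition Der_div ::
    "('a::topological_space \<Rightarrow> 'a \<Rightarrow> ennreal) \<Rightarrow> 'a measure \<Rightarrow> real \<Rightarrow> 'a derivation set" where
  "Der_div d m q = {b \<in> Der d m q. \<exists>D \<in> Lp m q. is_divergence d m b D}"

definition operator_bounds ::
    "('a::topological_space \<Rightarrow> 'a \<Rightarrow> ennreal) \<Rightarrow> 'a measure \<Rightarrow> real \<Rightarrow>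
       ('a derivation \<Rightarrow> 'a \<Rightarrow> real) \<Rightarrow> ('a \<Rightarrow> real) set" where
  "operator_bounds d m p L = {g \<in> Lp_nonneg m p. \<forall>b \<in> Der_div d m (conjugate_exponent p).
     AE x in m. \<bar>L b x\<bar> \<le> g x * derivation_norm d m (conjugate_exponent p) b x}"

text \<open>
  \<open>L\<close> is the operator \<open>L\<^sub>f\<close>. The second clause says that \<open>L\<close> is well defined on almost everywhere
  equivalence classes of derivations. In the last clause, \<open>D\<close> ranges over the representatives of
  the divergence of \<open>b\<close>.
\<close>

definition is_weak_derivative_operator ::
    "('a::topological_space \<Rightarrow> 'a \<Rightarrow> ennreal) \<Rightarrow> 'a measure \<Rightarrow> real \<Rightarrow> ('a \<Rightarrow> real) \<Rightarrow>
       ('a derivation \<Rightarrow> 'a \<Rightarrow> real) \<Rightarrow> bool" where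
  "is_weak_derivative_operator d m p f L \<longleftrightarrow>
     (let \<D> = Der_div d m (conjugate_exponent p) in
       (\<forall>b \<in> \<D>. integrable m (L b)) \<and>
       (\<forall>b \<in> \<D>. \<forall>c \<in> \<D>. (\<forall>g \<in> Lip_b d. AE x in m. b g x = c g x) \<longrightarrow> (AE x in m. L b x = L c x)) \<and>
       (\<forall>b \<in> \<D>. \<forall>c \<in> \<D>. \<forall>\<alpha> \<beta> :: real.
          AE x in m. L (\<lambda>g y. \<alpha> * b g y + \<beta> * c g y) x = \<alpha> * L b x + \<beta> * L c x) \<and>
       operator_bounds d m p L \<noteq> {} \<and>
       (\<forall>h \<in> Lip_b d. \<forall>b \<in> \<D>. AE x in m. L (\<lambda>g y. h y * b g y) x = h x * L b x) \<and>
       (\<forall>b \<in> \<D>. \<forall>D. is_divergence d m b D \<longrightarrow> (\<integral>x. L b x \<partial>m) = - (\<integral>x. f x * D x \<partial>m)))"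

definition W1p ::
    "('a::topological_space \<Rightarrow> 'a \<Rightarrow> ennreal) \<Rightarrow> 'a measure \<Rightarrow> real \<Rightarrow> ('a \<Rightarrow> real) set" where
  "W1p d m p = {f \<in> Lp m p. \<exists>L. is_weak_derivative_operator d m p f L}"

definition weak_derivative_operator ::
    "('a::topological_space \<Rightarrow> 'a \<Rightarrow> ennreal) \<Rightarrow> 'a measure \<Rightarrow> real \<Rightarrow> ('a \<Rightarrow> real) \<Rightarrow>
       'a derivation \<Rightarrow> 'a \<Rightarrow> real" where
  "weak_derivative_operator d m p f = (SOME L. is_weak_derivative_operator d m p f L)"

text \<open>The function \<open>|Df|\<close>.\<close>

definition W_gradient ::
    "('a::topological_space \<Rightarrow> 'a \<Rightarrow> ennreal) \<Rightarrow> 'a measure \<Rightarrow> real \<Rightarrow> ('a \<Rightarrow> real) \<Rightarrow> 'a \<Rightarrow> real" where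
  "W_gradient d m p f = ess_inf m (operator_bounds d m p (weak_derivative_operator d m p f))"

section \<open>Rectifiable arcs\<close>

text \<open>Curves are extensional functions, so that they are determined by their values on \<open>[0,1]\<close>.\<close>

definition curves :: "(real \<Rightarrow> 'a::topological_space) set" where
  "curves = {\<gamma> \<in> extensional {0..1}. continuous_on {0..1} \<gamma>}"

definition compact_open_topology :: "(real \<Rightarrow> 'a::topological_space) topology" where
  "compact_open_topology = topology_generated_by
     {{\<gamma> \<in> curves. \<gamma> ` K \<subseteq> U} | K U. compact K \<and> K \<subseteq> {0..1} \<and> open U}"

definition reparametrization :: "(real \<Rightarrow> real) \<Rightarrow> bool" where
  "reparametrization \<phi> \<longleftrightarrow>
     continuous_on {0..1} \<phi> \<and> mono_on {0..1} \<phi> \<and> \<phi> ` {0..1} = {0..1}"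

definition arc_rel :: "((real \<Rightarrow> 'a::topological_space) \<times> (real \<Rightarrow> 'a)) set" where
  "arc_rel = {(\<gamma>, \<sigma>). \<gamma> \<in> curves \<and> \<sigma> \<in> curves \<and>
     (\<exists>\<phi> \<psi>. reparametrization \<phi> \<and> reparametrization \<psi> \<and> (\<forall>t \<in> {0..1}. \<gamma> (\<phi> t) = \<sigma> (\<psi> t)))}"

type_synonym 'a arc = "(real \<Rightarrow> 'a) set"

definition arc_topology :: "'a::topological_space arc topology" where
  "arc_topology = topology (\<lambda>\<U>. \<U> \<subseteq> curves // arc_rel \<and>
     openin compact_open_topology {\<gamma> \<in> curves. arc_rel `` {\<gamma>} \<in> \<U>})"

lemma topspace_compact_open_topology: "topspace compact_open_topology = curves"
proof -
  have "curves \<in> {{\<gamma> \<in> curves. \<gamma> ` K \<subseteq> U} | K (U :: 'a set). compact K \<and> K \<subseteq> {0..1} \<and> open U}"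
    by (rule CollectI, rule exI[of _ "{}"], rule exI[of _ UNIV]) auto
  then show ?thesis
    unfolding compact_open_topology_def topology_generated_by_topspace by blast
qed

lemma openin_arc_topology:
  fixes \<U> :: "'a::topological_space arc set"
  shows "openin arc_topology \<U> \<longleftrightarrow> \<U> \<subseteq> curves // arc_rel \<and>
     openin compact_open_topology {\<gamma> \<in> curves. arc_rel `` {\<gamma>} \<in> \<U>}"
proof -
  have "istopology (\<lambda>\<U> :: 'a arc set. \<U> \<subseteq> curves // arc_rel \<and>
     openin compact_open_topology {\<gamma> \<in> curves. arc_rel `` {\<gamma>} \<in> \<U>})"
    (is "istopology (\<lambda>\<U>. ?P \<U>)")
    unfolding istopology_def
  proof (intro conjI allI impI)
    fix S T :: "'a arc set" assume "?P S" "?P T"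
    moreover have "{\<gamma> \<in> curves. arc_rel `` {\<gamma>} \<in> S \<inter> T} =
        {\<gamma> \<in> curves. arc_rel `` {\<gamma>} \<in> S} \<inter> {\<gamma> \<in> curves. arc_rel `` {\<gamma>} \<in> T}" by auto
    ultimately show "S \<inter> T \<subseteq> curves // arc_rel"
      and "openin compact_open_topology {\<gamma> \<in> curves. arc_rel `` {\<gamma>} \<in> S \<inter> T}" by auto
  next
    fix \<K> :: "'a arc set set" assume K: "\<forall>K\<in>\<K>. ?P K"
    then show "\<Union>\<K> \<subseteq> curves // arc_rel" by blast
    have "{\<gamma> \<in> curves. arc_rel `` {\<gamma>} \<in> \<Union>\<K>} = (\<Union>K\<in>\<K>. {\<gamma> \<in> curves. arc_rel `` {\<gamma>} \<in> K})" by auto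
    then show "openin compact_open_topology {\<gamma> \<in> curves. arc_rel `` {\<gamma>} \<in> \<Union>\<K>}"
      using K by auto
  qed
  then show ?thesis
    by (simp add: arc_topology_def topology_inverse')
qed

definition variation :: "('a \<Rightarrow> 'a \<Rightarrow> ennreal) \<Rightarrow> (real \<Rightarrow> 'a) \<Rightarrow> real \<Rightarrow> real \<Rightarrow> ennreal" where
  "variation d \<gamma> a b =
     (SUP (n, t) \<in> {(n :: nat, t :: nat \<Rightarrow> real). mono_on {..n} t \<and> t ` {..n} \<subseteq> {a..b}}.
        \<Sum>i<n. d (\<gamma> (t i)) (\<gamma> (t (Suc i))))"

definition d_continuous :: "('a \<Rightarrow> 'a \<Rightarrow> ennreal) \<Rightarrow> (real \<Rightarrow> 'a) \<Rightarrow> bool" where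
  "d_continuous d \<gamma> \<longleftrightarrow> (\<forall>s \<in> {0..1}. ((\<lambda>t. d (\<gamma> s) (\<gamma> t)) \<longlongrightarrow> 0) (at s within {0..1}))"

definition RA :: "('a::topological_space \<Rightarrow> 'a \<Rightarrow> ennreal) \<Rightarrow> 'a arc set" where
  "RA d = {arc_rel `` {\<gamma>} | \<gamma>. \<gamma> \<in> curves \<and> d_continuous d \<gamma> \<and> variation d \<gamma> 0 1 < \<infinity>}"

definition RA_topology :: "('a::topological_space \<Rightarrow> 'a \<Rightarrow> ennreal) \<Rightarrow> 'a arc topology" where
  "RA_topology d = subtopology arc_topology (RA d)"

text \<open>All representatives of an arc have the same length.\<close>

definition arc_length :: "('a \<Rightarrow> 'a \<Rightarrow> ennreal) \<Rightarrow> 'a arc \<Rightarrow> ennreal" where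
  "arc_length d \<Gamma> = variation d (SOME \<gamma>. \<gamma> \<in> \<Gamma>) 0 1"

definition constant_speed_rep :: "('a \<Rightarrow> 'a \<Rightarrow> ennreal) \<Rightarrow> 'a arc \<Rightarrow> real \<Rightarrow> 'a" where
  "constant_speed_rep d \<Gamma> =
     (THE R. R \<in> \<Gamma> \<and> (\<forall>t \<in> {0..1}. variation d R 0 t = arc_length d \<Gamma> * ennreal t))"

definition arc_eval :: "('a \<Rightarrow> 'a \<Rightarrow> ennreal) \<Rightarrow> real \<Rightarrow> 'a arc \<Rightarrow> 'a" where
  "arc_eval d t \<Gamma> = constant_speed_rep d \<Gamma> t"

text \<open>The integral along an arc, for bounded real-valued and for nonnegative functions.\<close>

definition arc_integral :: "('a \<Rightarrow> 'a \<Rightarrow> ennreal) \<Rightarrow> 'a arc \<Rightarrow> ('a \<Rightarrow> real) \<Rightarrow> real" where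
  "arc_integral d \<Gamma> f =
     enn2real (arc_length d \<Gamma>) * (LINT t:{0..1}|lborel. f (constant_speed_rep d \<Gamma> t))"

definition arc_nn_integral :: "('a \<Rightarrow> 'a \<Rightarrow> ennreal) \<Rightarrow> 'a arc \<Rightarrow> ('a \<Rightarrow> ennreal) \<Rightarrow> ennreal" where
  "arc_nn_integral d \<Gamma> f =
     arc_length d \<Gamma> * (\<integral>\<^sup>+ t \<in> {0..1}. f (constant_speed_rep d \<Gamma> t) \<partial>lborel)"

section \<open>Test plans and the space \<open>B\<close>\<close>

definition dynamic_plan ::
    "('a::topological_space \<Rightarrow> 'a \<Rightarrow> ennreal) \<Rightarrow> 'a arc measure \<Rightarrow> bool" where
  "dynamic_plan d \<pi> \<longleftrightarrow>
     radon_measure (RA_topology d) \<pi> \<and> (\<integral>\<^sup>+ \<Gamma>. arc_length d \<Gamma> \<partial>\<pi>) < \<infinity>"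

definition is_barycenter ::
    "('a::topological_space \<Rightarrow> 'a \<Rightarrow> ennreal) \<Rightarrow> 'a arc measure \<Rightarrow> 'a measure \<Rightarrow> bool" where
  "is_barycenter d \<pi> \<mu> \<longleftrightarrow>
     radon_measure euclidean \<mu> \<and>
     (\<forall>f \<in> borel_measurable borel. bounded (range f) \<longrightarrow>
        (\<integral>x. f x \<partial>\<mu>) = (\<integral>\<Gamma>. arc_integral d \<Gamma> f \<partial>\<pi>))"

definition ac_with_Lp_density :: "'a measure \<Rightarrow> real \<Rightarrow> 'a measure \<Rightarrow> bool" where
  "ac_with_Lp_density m q \<mu> \<longleftrightarrow>
     absolutely_continuous m \<mu> \<and> (\<exists>\<rho> \<in> Lp_nonneg m q. \<mu> = density m (\<lambda>x. ennreal (\<rho> x)))"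

definition test_plans ::
    "('a::topological_space \<Rightarrow> 'a \<Rightarrow> ennreal) \<Rightarrow> 'a measure \<Rightarrow> real \<Rightarrow> 'a arc measure set" where
  "test_plans d m q = {\<pi>. dynamic_plan d \<pi> \<and>
     (\<exists>\<mu>. is_barycenter d \<pi> \<mu> \<and> ac_with_Lp_density m q \<mu>) \<and>
     ac_with_Lp_density m q (distr \<pi> borel (arc_eval d 0)) \<and>
     ac_with_Lp_density m q (distr \<pi> borel (arc_eval d 1))}"

definition weak_upper_gradient ::
    "('a::topological_space \<Rightarrow> 'a \<Rightarrow> ennreal) \<Rightarrow> 'a measure \<Rightarrow> real \<Rightarrow>
       ('a \<Rightarrow> real) \<Rightarrow> ('a \<Rightarrow> real) \<Rightarrow> bool" where
  "weak_upper_gradient d m q f G \<longleftrightarrow>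
     f \<in> borel_measurable borel \<and> G \<in> borel_measurable borel \<and> (\<forall>x. 0 \<le> G x) \<and>
     (\<forall>\<pi> \<in> test_plans d m q. AE \<Gamma> in \<pi>.
        ennreal \<bar>f (arc_eval d 1 \<Gamma>) - f (arc_eval d 0 \<Gamma>)\<bar> \<le> arc_nn_integral d \<Gamma> (\<lambda>x. ennreal (G x)) \<and>
        arc_nn_integral d \<Gamma> (\<lambda>x. ennreal (G x)) < \<infinity>)"

definition B1p ::
    "('a::topological_space \<Rightarrow> 'a \<Rightarrow> ennreal) \<Rightarrow> 'a measure \<Rightarrow> real \<Rightarrow> ('a \<Rightarrow> real) set" where
  "B1p d m p =
     {f \<in> Lp m p. \<exists>G \<in> Lp m p. weak_upper_gradient d m (conjugate_exponent p) f G}"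

text \<open>The function \<open>|Df|\<^sub>B\<close>, unique up to almost everywhere equality. The chosen representative is
  itself a weak upper gradient.\<close>

definition B_gradient ::
    "('a::topological_space \<Rightarrow> 'a \<Rightarrow> ennreal) \<Rightarrow> 'a measure \<Rightarrow> real \<Rightarrow> ('a \<Rightarrow> real) \<Rightarrow> 'a \<Rightarrow> real" where
  "B_gradient d m p f = (SOME G.
     G \<in> Lp m p \<and> weak_upper_gradient d m (conjugate_exponent p) f G \<and>
     (\<forall>H. weak_upper_gradient d m (conjugate_exponent p) f H \<longrightarrow> (AE x in m. G x \<le> H x)))"

end

(* Let pi be a test plan whose barycenter has density rho and whose endpoint distributions have
   densities rho0 and rho1. Differentiating a Lipschitz function along the arcs and integrating with
   respect to pi gives a Lipschitz derivation b with |b| <= rho and divergence rho0 - rho1. For f in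
   W^{1,p} the properties of L_f then bound the absolute value of the integral of f(Z_1) - f(Z_0)
   over all arcs Z by the integral of the arc integrals of |Df|. The restrictions of pi to Borel sets
   of arcs are again test plans, so the bound holds for almost every arc: |Df| is a weak upper
   gradient.

   The minimal weak upper gradient is the essential infimum of all weak upper gradients, which is
   attained along a countable family. That the infimum of countably many weak upper gradients G_n is
   one follows by passing to random subarcs: if the arc is chosen from pi and two times s < t
   uniformly, the distribution of the subarc over [s,t] is again a test plan once pi is restricted to
   a suitable compact set of arcs. Hence, for almost every arc Z and almost all s < t, every G_n
   bounds |f(Z_t) - f(Z_s)| by its integral along Z over [s,t]. A function of one variable with this
   property is, up to a null set, absolutely continuous with derivative bounded by every G_n, hence
   by their infimum. *)
theory Submission
  imports Defs
begin

section \<open>Bounded continuous Lipschitz functions\<close>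

text \<open>Two obstacles shape the proof. The quotient topology sees an arc only through quantities
  that ignore the parametrization, so it is not clear that integrals of a derivative along an arc
  depend measurably on the arc. The cure is to use nonnegative kernels that are densities of a lower
  semicontinuous variation: the length, and the variation of the cost
  \<open>C * d x y + \<phi> y - \<phi> x\<close>. Counting only the pieces that stay in an open set
  gives the mass a kernel puts there; it is lower semicontinuous in the arc, and subtracting a
  multiple of the first kernel from the second leaves the derivative. Moreover the length is only
  lower semicontinuous, so the constant speed parametrization need not vary continuously with the
  arc. It does on compact sets on which the length is continuous; there, the distribution of random
  subarcs is again Radon. Since \<open>f\<close> is defined only almost everywhere, the two random
  times are drawn from \<open>[-1,2]\<close> and clamped to \<open>[0,1]\<close>: each end of the
  arc is then hit with positive probability, and the almost everywhere estimate reaches the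
  increment between the ends.\<close>

lemma Lip_le_iff:
  assumes "extended_distance d" "0 < C"
  shows "Lip d f A \<le> ennreal C \<longleftrightarrow> (\<forall>x\<in>A. \<forall>y\<in>A. ennreal \<bar>f x - f y\<bar> \<le> ennreal C * d x y)"
proof -
  \<comment> \<open>Positivity of \<open>C\<close> matters at infinite distance: the quotient is 0
    there, and \<open>ennreal C * \<infinity>\<close> imposes no condition, whereas
    \<open>0 * \<infinity> = 0\<close> would.\<close>
  have *: "(ennreal \<bar>f x - f y\<bar> / d x y \<le> ennreal C) = (ennreal \<bar>f x - f y\<bar> \<le> ennreal C * d x y)"
    if "x \<noteq> y" for x y
  proof (cases "d x y")
    case (real r)
    then have "r > 0" using that assms unfolding extended_distance_def
      by (metis ennreal_0 order_le_less)
    then show ?thesis using real assms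
      by (simp add: divide_ennreal ennreal_mult[symmetric] pos_divide_le_eq)
  next
    case top
    then show ?thesis using assms by (simp add: ennreal_mult_top)
  qed
  show ?thesis unfolding Lip_def SUP_le_iff
  proof (safe, goal_cases)
    case (1 x y)
    then show ?case using *[of x y] by (cases "x = y") auto
  next
    case (2 x y)
    then show ?case using *[of x y] by auto
  qed
qed

lemma Lip_b_iff:
  assumes "extended_distance d" shows "f \<in> Lip_b d \<longleftrightarrow> bounded (range f) \<and> continuous_on UNIV f \<and>
    (\<exists>C>0. \<forall>x y. ennreal \<bar>f x - f y\<bar> \<le> ennreal C * d x y)"
proof -
  have "Lip d f UNIV < \<infinity> \<longleftrightarrow> (\<exists>C>0. Lip d f UNIV \<le> ennreal C)"
  proof
    assume "Lip d f UNIV < \<infinity>"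
    then obtain r where "Lip d f UNIV = ennreal r" "r \<ge> 0" by (cases "Lip d f UNIV") auto
    then have "Lip d f UNIV \<le> ennreal (r + 1)" by (simp add: ennreal_leI)
    then show "\<exists>C>0. Lip d f UNIV \<le> ennreal C" using \<open>r \<ge> 0\<close> by (intro exI[of _ "r+1"]) auto
  next
    assume "\<exists>C>0. Lip d f UNIV \<le> ennreal C"
    then show "Lip d f UNIV < \<infinity>" by (metis ennreal_less_top infinity_ennreal_def le_less_trans)
  qed
  then show ?thesis unfolding Lip_b_def using Lip_le_iff[OF assms] by auto
qed

locale emt =
  fixes d :: "'a::t2_space => 'a => ennreal"
  assumes emt: "emt_space d"
begin

lemma ext_dist: "extended_distance d" using emt unfolding emt_space_def by blast

lemma d_sym: "d x y = d y x" and d_triangle: "d x z \<le> d x y + d y z" and d_eq_0: "d x y = 0 \<longleftrightarrow> x = y"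
  using ext_dist unfolding extended_distance_def by blast+

lemma d_self [simp]: "d x x = 0" by (simp add: d_eq_0)

lemma Lip_bE:
  assumes "f \<in> Lip_b d"
  obtains C where "C > 0" "\<And>x y. ennreal \<bar>f x - f y\<bar> \<le> ennreal C * d x y"
  using assms unfolding Lip_b_iff[OF ext_dist] by blast

lemma Lip_b_boundedE:
  assumes "f \<in> Lip_b d"
  obtains B where "B > 0" "\<And>x. \<bar>f x\<bar> \<le> B"
  using assms unfolding Lip_b_iff[OF ext_dist] bounded_pos by auto

lemma Lip_b_continuous: "f \<in> Lip_b d ==> continuous_on A f"
  unfolding Lip_b_def using continuous_on_subset by blast

lemma Lip_b_borel: "f \<in> Lip_b d ==> f \<in> borel_measurable borel"
  by (intro borel_measurable_continuous_onI Lip_b_continuous)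

lemma Lip_bI:
  assumes "\<And>x. \<bar>f x\<bar> \<le> B" "continuous_on UNIV f" "\<And>x y. ennreal \<bar>f x - f y\<bar> \<le> ennreal C * d x y"
  shows "f \<in> Lip_b d"
proof -
  have "ennreal \<bar>f x - f y\<bar> \<le> ennreal (max C 1) * d x y" for x y
    using assms(3)[of x y] by (meson dual_order.trans ennreal_leI max.cobounded1 mult_right_mono zero_le)
  moreover have "bounded (range f)" using assms(1) by (intro boundedI[of _ B]) auto
  ultimately show ?thesis using assms unfolding Lip_b_iff[OF ext_dist]
    by (auto intro!: exI[of _ "max C 1"])
qed

lemma Lip_b_const: "(\<lambda>x. c) \<in> Lip_b d" by (rule Lip_bI[of _ "\<bar>c\<bar>" 0]) auto

lemma Lip_b_lincomb:
  assumes "f \<in> Lip_b d" "g \<in> Lip_b d" shows "(\<lambda>x. \<alpha> * f x + \<beta> * g x) \<in> Lip_b d"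
proof -
  obtain C D where C: "C > 0" "\<And>x y. ennreal \<bar>f x - f y\<bar> \<le> ennreal C * d x y"
    and D: "D > 0" "\<And>x y. ennreal \<bar>g x - g y\<bar> \<le> ennreal D * d x y" using assms Lip_bE by metis
  obtain A B where A: "A > 0" "\<And>x. \<bar>f x\<bar> \<le> A" and B: "B > 0" "\<And>x. \<bar>g x\<bar> \<le> B"
    using assms Lip_b_boundedE by metis
  show ?thesis
  proof (rule Lip_bI[of _ "\<bar>\<alpha>\<bar> * A + \<bar>\<beta>\<bar> * B" "\<bar>\<alpha>\<bar> * C + \<bar>\<beta>\<bar> * D"])
    fix x y :: "'a"
    show "\<bar>\<alpha> * f x + \<beta> * g x\<bar> \<le> \<bar>\<alpha>\<bar> * A + \<bar>\<beta>\<bar> * B"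
    proof -
      have "\<bar>\<alpha> * f x\<bar> \<le> \<bar>\<alpha>\<bar> * A" "\<bar>\<beta> * g x\<bar> \<le> \<bar>\<beta>\<bar> * B"
        using A(2)[of x] B(2)[of x] by (auto simp: abs_mult intro: mult_left_mono)
      then show ?thesis by linarith
    qed
    have "\<bar>(\<alpha> * f x + \<beta> * g x) - (\<alpha> * f y + \<beta> * g y)\<bar> \<le> \<bar>\<alpha>\<bar> * \<bar>f x - f y\<bar> + \<bar>\<beta>\<bar> * \<bar>g x - g y\<bar>"
      unfolding abs_mult[symmetric] by (smt (verit) right_diff_distrib)
    then have "ennreal \<bar>(\<alpha> * f x + \<beta> * g x) - (\<alpha> * f y + \<beta> * g y)\<bar>
        \<le> ennreal \<bar>\<alpha>\<bar> * ennreal \<bar>f x - f y\<bar> + ennreal \<bar>\<beta>\<bar> * ennreal \<bar>g x - g y\<bar>"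
      by (simp add: ennreal_mult[symmetric] ennreal_plus[symmetric] ennreal_leI del: ennreal_plus)
    also have "... \<le> ennreal \<bar>\<alpha>\<bar> * (ennreal C * d x y) + ennreal \<bar>\<beta>\<bar> * (ennreal D * d x y)"
      by (intro add_mono mult_left_mono C D) auto
    also have "... = ennreal (\<bar>\<alpha>\<bar> * C + \<bar>\<beta>\<bar> * D) * d x y"
      using C D by (simp add: ennreal_mult distrib_right mult.assoc)
    finally show "ennreal \<bar>(\<alpha> * f x + \<beta> * g x) - (\<alpha> * f y + \<beta> * g y)\<bar> \<le> ..." .
    show "continuous_on UNIV (\<lambda>x. \<alpha> * f x + \<beta> * g x)"
      by (intro continuous_on_add continuous_on_mult continuous_on_const Lip_b_continuous assms)
  qed
qed

lemma Lip_b_mult: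
  assumes "f \<in> Lip_b d" "g \<in> Lip_b d" shows "(\<lambda>x. f x * g x) \<in> Lip_b d"
proof -
  obtain C D where C: "C > 0" "\<And>x y. ennreal \<bar>f x - f y\<bar> \<le> ennreal C * d x y"
    and D: "D > 0" "\<And>x y. ennreal \<bar>g x - g y\<bar> \<le> ennreal D * d x y" using assms Lip_bE by metis
  obtain A B where A: "A > 0" "\<And>x. \<bar>f x\<bar> \<le> A" and B: "B > 0" "\<And>x. \<bar>g x\<bar> \<le> B"
    using assms Lip_b_boundedE by metis
  show ?thesis
  proof (rule Lip_bI[of _ "A * B" "B * C + A * D"])
    fix x y :: "'a"
    show "\<bar>f x * g x\<bar> \<le> A * B" using A(1) A(2)[of x] B(2)[of x] by (simp add: abs_mult mult_mono)
    have "\<bar>f x * g x - f y * g y\<bar> = \<bar>g x * (f x - f y) + f y * (g x - g y)\<bar>"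
      by (simp add: algebra_simps)
    also have "... \<le> \<bar>g x\<bar> * \<bar>f x - f y\<bar> + \<bar>f y\<bar> * \<bar>g x - g y\<bar>"
      by (metis abs_mult abs_triangle_ineq)
    also have "... \<le> B * \<bar>f x - f y\<bar> + A * \<bar>g x - g y\<bar>" by (intro add_mono mult_right_mono A B) auto
    finally have "ennreal \<bar>f x * g x - f y * g y\<bar> \<le> ennreal B * ennreal \<bar>f x - f y\<bar> + ennreal A * ennreal \<bar>g x - g y\<bar>"
      using A B by (simp add: ennreal_mult[symmetric] ennreal_plus[symmetric] ennreal_leI del: ennreal_plus)
    also have "... \<le> ennreal B * (ennreal C * d x y) + ennreal A * (ennreal D * d x y)"
      by (intro add_mono mult_left_mono C D) auto
    also have "... = ennreal (B * C + A * D) * d x y"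
      using A B C D by (simp add: ennreal_mult distrib_right mult.assoc)
    finally show "ennreal \<bar>f x * g x - f y * g y\<bar> \<le> ..." .
    show "continuous_on UNIV (\<lambda>x. f x * g x)"
      by (intro continuous_on_add continuous_on_mult continuous_on_const Lip_b_continuous assms)
  qed
qed

text \<open>Tents are the elementary bumps: they vanish off the preimage of a ball, and since
  \<open>max 0 (1 - a)\<close> is 1-Lipschitz in \<open>a\<close>, the constant only grows by the
  factor \<open>1 / e\<close>.\<close>

lemma Lip_b_tent:
  assumes "f \<in> Lip_b d" "e > 0" shows "(\<lambda>y. max 0 (1 - \<bar>f y - c\<bar> / e)) \<in> Lip_b d"
proof -
  obtain C where C: "C > 0" "\<And>x y. ennreal \<bar>f x - f y\<bar> \<le> ennreal C * d x y"
    using assms Lip_bE by metis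
  show ?thesis
  proof (rule Lip_bI[of _ 1 "C / e"])
    fix x y :: "'a"
    show "\<bar>max 0 (1 - \<bar>f x - c\<bar> / e)\<bar> \<le> 1" using assms by auto
    have max0: "\<bar>max 0 (1 - a) - max 0 (1 - b)\<bar> \<le> \<bar>a - b\<bar>" for a b :: real by (auto simp: max_def)
    have "\<bar>\<bar>f x - c\<bar> / e - \<bar>f y - c\<bar> / e\<bar> \<le> \<bar>f x - f y\<bar> / e"
      using assms by (simp add: diff_divide_distrib[symmetric] divide_right_mono)
    then have "\<bar>max 0 (1 - \<bar>f x - c\<bar> / e) - max 0 (1 - \<bar>f y - c\<bar> / e)\<bar> \<le> (1/e) * \<bar>f x - f y\<bar>"
      using max0[of "\<bar>f x - c\<bar> / e" "\<bar>f y - c\<bar> / e"] by simp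
    then have "ennreal \<bar>max 0 (1 - \<bar>f x - c\<bar> / e) - max 0 (1 - \<bar>f y - c\<bar> / e)\<bar> \<le> ennreal (1/e) * ennreal \<bar>f x - f y\<bar>"
      using assms by (simp add: ennreal_mult[symmetric] ennreal_leI)
    also have "... \<le> ennreal (1/e) * (ennreal C * d x y)" by (intro mult_left_mono C) auto
    also have "... = ennreal (C / e) * d x y"
      using C assms by (simp add: mult.assoc[symmetric] ennreal_mult[symmetric])
    finally show "ennreal \<bar>max 0 (1 - \<bar>f x - c\<bar> / e) - max 0 (1 - \<bar>f y - c\<bar> / e)\<bar> \<le> ..." .
    have "continuous_on UNIV f" using assms Lip_b_continuous by blast
    then show "continuous_on UNIV (\<lambda>y. max 0 (1 - \<bar>f y - c\<bar> / e))" 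
      using assms by (auto intro!: continuous_intros)
  qed
qed

lemma open_iff_generated:
  "open U \<longleftrightarrow> generate_topology {f -` V | f V. f \<in> Lip_b d \<and> open V} U"
  using emt unfolding emt_space_def by blast

text \<open>Complete regularity in Lipschitz form, by induction over the generation of the topology:
  tents on subbasic sets, products for intersections, a single member for unions. The assumption
  that \<tau> is an initial topology enters here.\<close>

lemma ex_bump:
  assumes "open U" "x \<in> U"
  obtains u where "u \<in> Lip_b d" "u x = 1" "\<And>y. 0 \<le> u y" "\<And>y. u y \<le> 1" "\<And>y. y \<notin> U ==> u y = 0"
proof -
  have "\<forall>x\<in>U. \<exists>u\<in>Lip_b d. u x = 1 \<and> (\<forall>y. 0 \<le> u y \<and> u y \<le> 1 \<and> (y \<notin> U \<longrightarrow> u y = 0))"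
    using assms(1)[unfolded open_iff_generated]
  proof (induction rule: generate_topology.induct)
    case UNIV
    show ?case by (intro ballI bexI[of _ "\<lambda>_. 1"]) (auto simp: Lip_b_const)
  next
    case (Int A B)
    show ?case
    proof
      fix x assume x: "x \<in> A \<inter> B"
      obtain u where u: "u\<in>Lip_b d" "u x = 1" "\<forall>y. 0 \<le> u y \<and> u y \<le> 1 \<and> (y \<notin> A \<longrightarrow> u y = 0)"
        using Int(3) x by (meson IntD1)
      obtain v where v: "v\<in>Lip_b d" "v x = 1" "\<forall>y. 0 \<le> v y \<and> v y \<le> 1 \<and> (y \<notin> B \<longrightarrow> v y = 0)"
        using Int(4) x by (meson IntD2)
      show "\<exists>u\<in>Lip_b d. u x = 1 \<and> (\<forall>y. 0 \<le> u y \<and> u y \<le> 1 \<and> (y \<notin> A \<inter> B \<longrightarrow> u y = 0))"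
        by (rule bexI[of _ "\<lambda>y. u y * v y"]) (use u v in \<open>auto simp: Lip_b_mult mult_le_one\<close>)
    qed
  next
    case (UN K)
    show ?case
    proof
      fix x assume "x \<in> \<Union>K"
      then obtain k where k: "k \<in> K" "x \<in> k" by blast
      with UN obtain u where "u\<in>Lip_b d" "u x = 1" "\<forall>y. 0 \<le> u y \<and> u y \<le> 1 \<and> (y \<notin> k \<longrightarrow> u y = 0)"
        by blast
      then show "\<exists>u\<in>Lip_b d. u x = 1 \<and> (\<forall>y. 0 \<le> u y \<and> u y \<le> 1 \<and> (y \<notin> \<Union>K \<longrightarrow> u y = 0))"
        using k by blast
    qed
  next
    case (Basis S)
    then obtain f V where f: "S = f -` V" "f \<in> Lip_b d" "open V" by blast
    show ?case
    proof
      fix x assume "x \<in> S"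
      then obtain e where e: "e > 0" "ball (f x) e \<subseteq> V" using f open_contains_ball by blast
      have "max 0 (1 - \<bar>f y - f x\<bar> / e) = 0" if "y \<notin> S" for y
      proof -
        have "f y \<notin> ball (f x) e" using e that f by blast
        then have "\<not> \<bar>f y - f x\<bar> < e" by (simp add: dist_real_def abs_minus_commute)
        then show ?thesis using e by (simp add: max_def)
      qed
      then show "\<exists>u\<in>Lip_b d. u x = 1 \<and> (\<forall>y. 0 \<le> u y \<and> u y \<le> 1 \<and> (y \<notin> S \<longrightarrow> u y = 0))"
        using e by (intro bexI[of _ "\<lambda>y. max 0 (1 - \<bar>f y - f x\<bar> / e)"] conjI Lip_b_tent f allI) auto
    qed
  qed
  then show ?thesis using assms that by blast
qed

section \<open>Lower semicontinuity of the distance and of the auxiliary cost\<close>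

lemma d_eq_Sup: "d x y = (SUP f \<in> {f \<in> Lip_b d. Lip d f UNIV \<le> 1}. ennreal \<bar>f x - f y\<bar>)"
  using emt unfolding emt_space_def by blast

lemma Lip_1D: "Lip d f UNIV \<le> 1 ==> ennreal \<bar>f x - f y\<bar> \<le> d x y"
  using Lip_le_iff[OF ext_dist, of 1 f UNIV] by simp

lemma open_pair_greater:
  fixes F :: "'a => 'a => real"
  assumes "continuous_on UNIV (\<lambda>z. F (fst z) (snd z))" "c < ennreal (F x y)"
  obtains U V where "open U" "open V" "x \<in> U" "y \<in> V" "\<And>x' y'. x' \<in> U ==> y' \<in> V ==> c < ennreal (F x' y')"
proof -
  have "open {z. c < ennreal (F (fst z) (snd z))}"
    by (intro open_Collect_less continuous_on_const continuous_on_ennreal assms(1))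
  moreover have "(x, y) \<in> {z. c < ennreal (F (fst z) (snd z))}" using assms(2) by simp
  ultimately obtain U V where "open U" "open V" "(x, y) \<in> U \<times> V" "U \<times> V \<subseteq> {z. c < ennreal (F (fst z) (snd z))}"
    by (rule open_prod_elim)
  then show ?thesis by (intro that[of U V]) auto
qed

text \<open>Formally \<open>C d(x,y) + \<phi>(y) - \<phi>(x)\<close>; the supremum makes the lower semicontinuity evident.\<close>

definition cost :: "real => ('a => real) => 'a => 'a => ennreal" where
  "cost C \<phi> x y = (SUP f \<in> {f \<in> Lip_b d. Lip d f UNIV \<le> 1}. ennreal (C * \<bar>f x - f y\<bar> + \<phi> y - \<phi> x))"

text \<open>A supremum of functions that are continuous on the product space. Joint semicontinuity
  is the point, because both ends of a cell move when a curve is perturbed.\<close>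

lemma cost_lsc:
  assumes \<phi>: "continuous_on UNIV \<phi>" and "c < cost C \<phi> x y"
  obtains U V where "open U" "open V" "x \<in> U" "y \<in> V" "\<And>x' y'. x' \<in> U ==> y' \<in> V ==> c < cost C \<phi> x' y'"
proof -
  obtain f where f: "f \<in> Lip_b d" "Lip d f UNIV \<le> 1" "c < ennreal (C * \<bar>f x - f y\<bar> + \<phi> y - \<phi> x)"
    using assms(2) unfolding cost_def less_SUP_iff by auto
  have "continuous_on UNIV (\<lambda>z. C * \<bar>f (fst z) - f (snd z)\<bar> + \<phi> (snd z) - \<phi> (fst z))"
    by (intro continuous_intros continuous_on_compose2[OF Lip_b_continuous[OF f(1)]] continuous_on_compose2[OF \<phi>]) auto
  from open_pair_greater[of "\<lambda>x y. C * \<bar>f x - f y\<bar> + \<phi> y - \<phi> x", OF this f(3)]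
  obtain U V where UV: "open U" "open V" "x \<in> U" "y \<in> V" "\<And>x' y'. x' \<in> U ==> y' \<in> V ==> c < ennreal (C * \<bar>f x' - f y'\<bar> + \<phi> y' - \<phi> x')"
    by blast
  have "ennreal (C * \<bar>f x' - f y'\<bar> + \<phi> y' - \<phi> x') \<le> cost C \<phi> x' y'" for x' y' unfolding cost_def using f by (intro SUP_upper) auto
  then show ?thesis using that[OF UV(1-4)] UV(5) less_le_trans by blast
qed

lemma d_eq_cost: "d x y = cost 1 (\<lambda>_. 0) x y" unfolding d_eq_Sup[of x y] cost_def by simp

lemma d_lsc:
  assumes "c < d x y"
  obtains U V where "open U" "open V" "x \<in> U" "y \<in> V" "\<And>x' y'. x' \<in> U ==> y' \<in> V ==> c < d x' y'"
  by (rule cost_lsc[of "\<lambda>_. 0" c 1 x y, folded d_eq_cost, OF continuous_on_const assms]) (rule that)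

text \<open>Every competitor \<open>f\<close> is 1-Lipschitz, so the supremum sees at most the
  distance. Together with \<open>d_le_cost_add\<close> this squeezes the variation of the cost
  between bounds that agree.\<close>

lemma cost_le:
  assumes "0 \<le> C" "d x y \<le> ennreal D" "0 \<le> D" shows "cost C \<phi> x y \<le> ennreal (C * D + \<phi> y - \<phi> x)"
  unfolding cost_def
proof (rule SUP_least)
  fix f assume "f \<in> {f \<in> Lip_b d. Lip d f UNIV \<le> 1}"
  then have "ennreal \<bar>f x - f y\<bar> \<le> ennreal D" using Lip_1D[of f x y] assms(2) by auto
  then have "C * \<bar>f x - f y\<bar> \<le> C * D" using assms by (simp add: mult_left_mono)
  then show "ennreal (C * \<bar>f x - f y\<bar> + \<phi> y - \<phi> x) \<le> ennreal (C * D + \<phi> y - \<phi> x)" by (intro ennreal_leI) simp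
qed

text \<open>For each competitor \<open>f\<close> the terms in \<phi> cancel; the truncation of
  negative values to 0 by \<open>ennreal\<close> only enlarges the right-hand side.\<close>

lemma d_le_cost_add: "0 \<le> C ==> ennreal (2 * C) * d x y \<le> cost C \<phi> x y + cost C (\<lambda>x. - \<phi> x) x y"
  unfolding d_eq_Sup[of x y] SUP_mult_left_ennreal
proof (rule SUP_least)
  fix f assume f: "f \<in> {f \<in> Lip_b d. Lip d f UNIV \<le> 1}" and C: "0 \<le> C"
  let ?a = "C * \<bar>f x - f y\<bar> + \<phi> y - \<phi> x" and ?b = "C * \<bar>f x - f y\<bar> + - \<phi> y - - \<phi> x"
  have "ennreal (2 * C) * ennreal \<bar>f x - f y\<bar> = ennreal (?a + ?b)" using C by (simp add: ennreal_mult[symmetric])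
  also have "... \<le> ennreal (max 0 ?a + max 0 ?b)" by (rule ennreal_leI) simp
  also have "... = ennreal ?a + ennreal ?b" by (simp add: max_def ennreal_neg)
  also have "... \<le> cost C \<phi> x y + cost C (\<lambda>x. - \<phi> x) x y"
    unfolding cost_def by (rule add_mono; rule SUP_upper[OF f])
  finally show "ennreal (2 * C) * ennreal \<bar>f x - f y\<bar> \<le> cost C \<phi> x y + cost C (\<lambda>x. - \<phi> x) x y" .
qed

definition lipschitz_with :: "real => ('a => real) => bool" where
  "lipschitz_with C \<phi> \<longleftrightarrow> \<phi> \<in> Lip_b d \<and> C > 0 \<and> (\<forall>x y. ennreal \<bar>\<phi> x - \<phi> y\<bar> \<le> ennreal C * d x y)"

lemma lipschitz_with_real:
  assumes "lipschitz_with C \<phi>" "d x y < \<infinity>" shows "\<bar>\<phi> x - \<phi> y\<bar> \<le> C * enn2real (d x y)"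
proof -
  obtain r where r: "d x y = ennreal r" "r \<ge> 0" using assms by (cases "d x y") auto
  have "ennreal \<bar>\<phi> x - \<phi> y\<bar> \<le> ennreal C * d x y" using assms unfolding lipschitz_with_def by blast
  then have "ennreal \<bar>\<phi> x - \<phi> y\<bar> \<le> ennreal (C * r)"
    using r assms unfolding lipschitz_with_def by (simp add: ennreal_mult)
  then show ?thesis using r assms unfolding lipschitz_with_def by (subst (asm) ennreal_le_iff) auto
qed
end

section \<open>Variation of curves\<close>

definition partition_of :: "real => real => nat => (nat => real) => bool" where
  "partition_of a b n t \<longleftrightarrow> mono_on {..n} t \<and> t ` {..n} \<subseteq> {a..b}"

text \<open>The localization to \<open>U\<close> turns a variation into a measure: for open
  \<open>U\<close> the requirement on a cell is stable under small perturbations of the curve, and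
  finer partitions exhaust the time spent in \<open>U\<close>. The function \<open>c\<close> is a
  parameter so as to cover both the distance and \<open>cost\<close>.\<close>

definition gsum :: "('a => 'a => ennreal) => 'a set => (real => 'a) => nat => (nat => real) => ennreal" where
  "gsum c U \<gamma> n t = (\<Sum>i<n. if \<gamma> ` {t i..t (Suc i)} \<subseteq> U then c (\<gamma> (t i)) (\<gamma> (t (Suc i))) else 0)"

definition gvar :: "('a => 'a => ennreal) => 'a set => (real => 'a) => real => real => ennreal" where
  "gvar c U \<gamma> a b = (SUP (n, t) \<in> {(n, t). partition_of a b n t}. gsum c U \<gamma> n t)"

lemma variation_eq_gvar: "variation c \<gamma> a b = gvar c UNIV \<gamma> a b"
  unfolding variation_def gvar_def partition_of_def gsum_def by simp

lemma partition_of_mono: "partition_of a b n t ==> i \<le> j ==> j \<le> n ==> t i \<le> t j"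
  unfolding partition_of_def mono_on_def by auto

lemma partition_of_mem: "partition_of a b n t ==> i \<le> n ==> a \<le> t i \<and> t i \<le> b"
  unfolding partition_of_def by auto

lemma partition_ofI:
  assumes "\<And>i. i < n ==> t i \<le> t (Suc i)" "a \<le> t 0" "t n \<le> b" shows "partition_of a b n t"
proof -
  have *: "t i \<le> t j" if "i \<le> j" "j \<le> n" for i j using that
  proof (induction j)
    case (Suc j)
    show ?case
    proof (cases "i = Suc j")
      case False
      then have "t i \<le> t j" using Suc by auto
      also have "... \<le> t (Suc j)" using assms(1)[of j] Suc by auto
      finally show ?thesis .
    qed simp
  qed simp
  have "a \<le> t i" "t i \<le> b" if "i \<le> n" for i using *[of 0 i] *[of i n] that assms by auto
  then show ?thesis unfolding partition_of_def mono_on_def using * by auto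
qed

lemma gvar_ge: "partition_of a b n t ==> gsum c U \<gamma> n t \<le> gvar c U \<gamma> a b"
  unfolding gvar_def by (intro SUP_upper2[of "(n, t)"]) auto

lemma gvar_le: "(\<And>n t. partition_of a b n t ==> gsum c U \<gamma> n t \<le> B) ==> gvar c U \<gamma> a b \<le> B"
  unfolding gvar_def by (intro SUP_least) auto

lemma less_gvar_iff: "B < gvar c U \<gamma> a b \<longleftrightarrow> (\<exists>n t. partition_of a b n t \<and> B < gsum c U \<gamma> n t)"
  unfolding gvar_def less_SUP_iff by auto

lemma gvar_cong:
  assumes "\<And>t. a \<le> t ==> t \<le> b ==> \<gamma> t = \<sigma> t" shows "gvar c U \<gamma> a b = gvar c U \<sigma> a b"
proof -
  have "gsum c U \<gamma> n t = gsum c U \<sigma> n t" if "partition_of a b n t" for n t unfolding gsum_def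
  proof (intro sum.cong refl)
    fix i assume "i \<in> {..<n}"
    then have "a \<le> t i" "t i \<le> t (Suc i)" "t (Suc i) \<le> b"
      using partition_of_mem[OF that] partition_of_mono[OF that] by auto
    then have "\<gamma> x = \<sigma> x" if "x \<in> {t i..t (Suc i)}" for x using assms that by auto
    then have "\<gamma> ` {t i..t (Suc i)} = \<sigma> ` {t i..t (Suc i)}" "\<gamma> (t i) = \<sigma> (t i)" "\<gamma> (t (Suc i)) = \<sigma> (t (Suc i))"
      using \<open>t i \<le> t (Suc i)\<close> by auto
    then show "(if \<gamma> ` {t i..t (Suc i)} \<subseteq> U then c (\<gamma> (t i)) (\<gamma> (t (Suc i))) else 0) =
      (if \<sigma> ` {t i..t (Suc i)} \<subseteq> U then c (\<sigma> (t i)) (\<sigma> (t (Suc i))) else 0)" by simp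
  qed
  then show ?thesis unfolding gvar_def by (intro SUP_cong) auto
qed

lemma gvar_interval_mono: "a' \<le> a ==> b \<le> b' ==> gvar c U \<gamma> a b \<le> gvar c U \<gamma> a' b'"
  by (intro gvar_le gvar_ge) (force simp: partition_of_def)

lemma cell_le_gvar:
  assumes "a \<le> s" "s \<le> t" "t \<le> b" "\<gamma> ` {s..t} \<subseteq> U" shows "c (\<gamma> s) (\<gamma> t) \<le> gvar c U \<gamma> a b"
proof -
  have "partition_of a b 1 (\<lambda>i. if i = 0 then s else t)" by (rule partition_ofI) (use assms in auto)
  then show ?thesis using gvar_ge[of a b 1 "\<lambda>i. if i = 0 then s else t" c U \<gamma>] assms
    by (simp add: gsum_def)
qed

lemma SUP_add_le:
  fixes F :: "_ => ennreal" and G :: "_ => ennreal"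
  assumes "I \<noteq> {}" "J \<noteq> {}" "\<And>i j. i \<in> I ==> j \<in> J ==> F i + G j \<le> X"
  shows "(SUP i\<in>I. F i) + (SUP j\<in>J. G j) \<le> X"
proof -
  have "F i + (SUP j\<in>J. G j) \<le> X" if "i \<in> I" for i
    using assms(3)[OF that] by (subst ennreal_SUP_add_right[OF assms(2)]) (auto intro: SUP_least)
  then show ?thesis by (subst ennreal_SUP_add_left[OF assms(1), symmetric]) (auto intro: SUP_least)
qed

lemma gvar_superadd:
  assumes "a \<le> b" "b \<le> e" shows "gvar c U \<gamma> a b + gvar c U \<gamma> b e \<le> gvar c U \<gamma> a e"
proof -
  have *: "gsum c U \<gamma> n t + gsum c U \<gamma> m u \<le> gvar c U \<gamma> a e"
    if t: "partition_of a b n t" and u: "partition_of b e m u" for n t m u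
  proof -
    \<comment> \<open>Cell \<open>n\<close> of the concatenation joins the last point of
      \<open>t\<close> to the first point of \<open>u\<close>; its contribution is dropped, which is
      why only an inequality results.\<close>
    define w where "w i = (if i \<le> n then t i else u (i - Suc n))" for i
    have w: "partition_of a e (Suc (n + m)) w"
    proof (rule partition_ofI)
      fix i assume i: "i < Suc (n + m)"
      consider "i < n" | "i = n" | "i > n" by linarith
      then show "w i \<le> w (Suc i)"
      proof cases
        case 1
        then show ?thesis using partition_of_mono[OF t, of i "Suc i"] by (simp add: w_def)
      next
        case 2
        then show ?thesis using partition_of_mem[OF t, of n] partition_of_mem[OF u, of 0] by (simp add: w_def)
      next
        case 3
        then show ?thesis using partition_of_mono[OF u, of "i - Suc n" "i - n"] i by (simp add: w_def)
      qed
    next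
      show "a \<le> w 0" "w (Suc (n + m)) \<le> e"
        using partition_of_mem[OF t, of 0] partition_of_mem[OF u, of m] by (auto simp: w_def)
    qed
    let ?f = "\<lambda>t i. if \<gamma> ` {t i..t (Suc i)} \<subseteq> U then c (\<gamma> (t i)) (\<gamma> (t (Suc i))) else 0"
    have "gsum c U \<gamma> n t + gsum c U \<gamma> m u = (\<Sum>i<n. ?f w i) + (\<Sum>i\<in>{Suc n..<Suc (n + m)}. ?f w i)"
    proof -
      have "gsum c U \<gamma> m u = (\<Sum>i<m. ?f w (i + Suc n))"
        unfolding gsum_def w_def by (intro sum.cong refl) simp
      also have "... = (\<Sum>i\<in>{Suc n..<Suc (n + m)}. ?f w i)"
        using sum.shift_bounds_nat_ivl[of "?f w" 0 "Suc n" m] by (simp add: atLeast0LessThan add.commute)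
      finally have "gsum c U \<gamma> m u = ..." .
      moreover have "gsum c U \<gamma> n t = (\<Sum>i<n. ?f w i)"
        unfolding gsum_def w_def by (intro sum.cong refl) simp
      ultimately show ?thesis by simp
    qed
    also have "... = (\<Sum>i\<in>{..<n} \<union> {Suc n..<Suc (n + m)}. ?f w i)" by (subst sum.union_disjoint) auto
    also have "... \<le> (\<Sum>i<Suc (n + m). ?f w i)" by (rule sum_mono2) auto
    also have "... \<le> gvar c U \<gamma> a e" using gvar_ge[OF w] unfolding gsum_def .
    finally show ?thesis .
  qed
  have ne: "{(n, t). partition_of a b n t} \<noteq> {}" if "a \<le> b" for a b :: real
  proof -
    have "(0, \<lambda>_. a) \<in> {(n, t). partition_of a b n t}" using that by (auto intro: partition_ofI)
    then show ?thesis by blast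
  qed
  show ?thesis unfolding gvar_def[of c U \<gamma> a b] gvar_def[of c U \<gamma> b e]
    by (rule SUP_add_le) (use assms ne * in auto)
qed

lemma variation_add:
  assumes tri: "\<And>x y z. c x z \<le> c x y + c y z" and "a \<le> b" "b \<le> e"
  shows "variation c \<gamma> a e = variation c \<gamma> a b + variation c \<gamma> b e"
proof (rule antisym)
  show "variation c \<gamma> a b + variation c \<gamma> b e \<le> variation c \<gamma> a e"
    unfolding variation_eq_gvar by (rule gvar_superadd) fact+
  show "variation c \<gamma> a e \<le> variation c \<gamma> a b + variation c \<gamma> b e" unfolding variation_eq_gvar
  proof (rule gvar_le)
    fix n t assume t: "partition_of a e n t"
    \<comment> \<open>Clipping at \<open>b\<close> yields one partition of each half with the same
      indices. A cell on one side of \<open>b\<close> reappears there and degenerates on the other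
      side; only a cell that straddles \<open>b\<close> uses the triangle inequality.\<close>
    have 1: "partition_of a b n (\<lambda>i. min (t i) b)" and 2: "partition_of b e n (\<lambda>i. max (t i) b)"
    proof -
      have m: "t i \<le> t (Suc i)" if "i < n" for i using partition_of_mono[OF t, of i "Suc i"] that by simp
      have e: "a \<le> t 0" "t n \<le> e" using partition_of_mem[OF t, of 0] partition_of_mem[OF t, of n] by auto
      show "partition_of a b n (\<lambda>i. min (t i) b)"
        by (rule partition_ofI) (use m e assms in \<open>auto intro: min.mono order_trans[OF min.cobounded1]\<close>)
      show "partition_of b e n (\<lambda>i. max (t i) b)"
        by (rule partition_ofI) (use m e assms in \<open>auto intro: max.mono order_trans[OF _ max.cobounded1]\<close>)
    qed
    have "gsum c UNIV \<gamma> n t \<le> gsum c UNIV \<gamma> n (\<lambda>i. min (t i) b) + gsum c UNIV \<gamma> n (\<lambda>i. max (t i) b)"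
      unfolding gsum_def sum.distrib[symmetric]
    proof (rule sum_mono)
      fix i assume "i \<in> {..<n}"
      then have "t i \<le> t (Suc i)" using partition_of_mono[OF t] by auto
      then consider "t (Suc i) \<le> b" | "b \<le> t i" | "t i \<le> b" "b \<le> t (Suc i)" by linarith
      then have "c (\<gamma> (t i)) (\<gamma> (t (Suc i))) \<le> c (\<gamma> (min (t i) b)) (\<gamma> (min (t (Suc i)) b)) + c (\<gamma> (max (t i) b)) (\<gamma> (max (t (Suc i)) b))"
        by cases (use \<open>t i \<le> t (Suc i)\<close> tri in \<open>auto simp: min_def max_def intro: add_increasing add_increasing2\<close>)
      then show "(if \<gamma> ` {t i..t (Suc i)} \<subseteq> UNIV then c (\<gamma> (t i)) (\<gamma> (t (Suc i))) else 0) \<le>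
        (if \<gamma> ` {min (t i) b..min (t (Suc i)) b} \<subseteq> UNIV then c (\<gamma> (min (t i) b)) (\<gamma> (min (t (Suc i)) b)) else 0) +
        (if \<gamma> ` {max (t i) b..max (t (Suc i)) b} \<subseteq> UNIV then c (\<gamma> (max (t i) b)) (\<gamma> (max (t (Suc i)) b)) else 0)"
        by simp
    qed
    also have "... \<le> gvar c UNIV \<gamma> a b + gvar c UNIV \<gamma> b e" by (intro add_mono gvar_ge 1 2)
    finally show "gsum c UNIV \<gamma> n t \<le> gvar c UNIV \<gamma> a b + gvar c UNIV \<gamma> b e" .
  qed
qed

lemma variation_ge: "a \<le> s ==> s \<le> t ==> t \<le> b ==> c (\<gamma> s) (\<gamma> t) \<le> variation c \<gamma> a b"
  unfolding variation_eq_gvar by (rule cell_le_gvar) auto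

lemma variation_mono: "a' \<le> a ==> b \<le> b' ==> variation c \<gamma> a b \<le> variation c \<gamma> a' b'"
  unfolding variation_eq_gvar by (rule gvar_interval_mono)

lemma variation_refl:
  assumes "\<And>x. c x x = 0" shows "variation c \<gamma> a a = 0"
proof -
  have "gvar c UNIV \<gamma> a a \<le> 0"
  proof (rule gvar_le)
    fix n t assume t: "partition_of a a n t"
    have "t i = a" if "i \<le> n" for i using partition_of_mem[OF t that] by simp
    then show "gsum c UNIV \<gamma> n t \<le> 0" unfolding gsum_def using assms by (simp add: sum_nonpos)
  qed
  then show ?thesis by (simp add: variation_eq_gvar)
qed

text \<open>By the intermediate value theorem a continuous monotone map carries each cell onto the
  cell between the image points, so the cells counted for \<open>U\<close> correspond.\<close>

lemma gvar_reparam_le: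
  assumes "mono_on {a..b} \<phi>" "continuous_on {a..b} \<phi>"
  shows "gvar c U (\<lambda>s. \<gamma> (\<phi> s)) a b \<le> gvar c U \<gamma> (\<phi> a) (\<phi> b)"
proof (rule gvar_le)
  fix n t assume t: "partition_of a b n t"
  have mono: "\<phi> x \<le> \<phi> y" if "a \<le> x" "x \<le> y" "y \<le> b" for x y
    using assms(1) that unfolding mono_on_def by auto
  have p: "partition_of (\<phi> a) (\<phi> b) n (\<lambda>i. \<phi> (t i))"
    using partition_of_mem[OF t] partition_of_mono[OF t] by (intro partition_ofI mono) auto
  have "gsum c U (\<lambda>s. \<gamma> (\<phi> s)) n t = gsum c U \<gamma> n (\<lambda>i. \<phi> (t i))" unfolding gsum_def
  proof (intro sum.cong refl)
    fix i assume "i \<in> {..<n}"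
    then have i: "a \<le> t i" "t i \<le> t (Suc i)" "t (Suc i) \<le> b"
      using partition_of_mem[OF t] partition_of_mono[OF t] by auto
    have "\<phi> ` {t i..t (Suc i)} = {\<phi> (t i)..\<phi> (t (Suc i))}"
    proof
      show "\<phi> ` {t i..t (Suc i)} \<subseteq> {\<phi> (t i)..\<phi> (t (Suc i))}" using i mono by auto
      show "{\<phi> (t i)..\<phi> (t (Suc i))} \<subseteq> \<phi> ` {t i..t (Suc i)}"
        using i IVT'[of \<phi> "t i" _ "t (Suc i)"] continuous_on_subset[OF assms(2), of "{t i..t (Suc i)}"]
        by (fastforce simp: image_iff)
    qed
    then have "(\<lambda>s. \<gamma> (\<phi> s)) ` {t i..t (Suc i)} = \<gamma> ` {\<phi> (t i)..\<phi> (t (Suc i))}"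
      by (metis image_image)
    then show "(if (\<lambda>s. \<gamma> (\<phi> s)) ` {t i..t (Suc i)} \<subseteq> U then c (\<gamma> (\<phi> (t i))) (\<gamma> (\<phi> (t (Suc i)))) else 0) =
      (if \<gamma> ` {\<phi> (t i)..\<phi> (t (Suc i))} \<subseteq> U then c (\<gamma> (\<phi> (t i))) (\<gamma> (\<phi> (t (Suc i)))) else 0)" by simp
  qed
  then show "gsum c U (\<lambda>s. \<gamma> (\<phi> s)) n t \<le> gvar c U \<gamma> (\<phi> a) (\<phi> b)" using gvar_ge[OF p] by simp
qed

text \<open>For the converse, a partition is pulled back along a right inverse \<open>g\<close> of
  \<phi>. It is monotone but may jump, which is harmless: \<phi> maps the pulled back cell into the
  original one, so it is counted whenever the original is.\<close>

lemma gvar_reparam: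
  assumes mon: "mono_on {a..b} \<phi>" and con: "continuous_on {a..b} \<phi>" and "a \<le> b"
  shows "gvar c U (\<lambda>s. \<gamma> (\<phi> s)) a b = gvar c U \<gamma> (\<phi> a) (\<phi> b)"
proof (rule antisym[OF gvar_reparam_le[OF mon con]], rule gvar_le)
  fix n u assume u: "partition_of (\<phi> a) (\<phi> b) n u"
  have mono: "\<phi> x \<le> \<phi> y" if "a \<le> x" "x \<le> y" "y \<le> b" for x y
    using mon that unfolding mono_on_def by auto
  have "\<exists>s. a \<le> s \<and> s \<le> b \<and> \<phi> s = y" if "\<phi> a \<le> y" "y \<le> \<phi> b" for y
    using IVT'[of \<phi> a y b] that \<open>a \<le> b\<close> con by auto
  then obtain g where g: "\<And>y. \<phi> a \<le> y ==> y \<le> \<phi> b ==> a \<le> g y \<and> g y \<le> b \<and> \<phi> (g y) = y" by metis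
  have gmono: "g x \<le> g y" if "\<phi> a \<le> x" "x \<le> y" "y \<le> \<phi> b" for x y
  proof (rule ccontr)
    assume "\<not> g x \<le> g y"
    then have "\<phi> (g y) \<le> \<phi> (g x)" using g[of x] g[of y] that by (intro mono) auto
    then have "x = y" using g[of x] g[of y] that by simp
    then show False using \<open>\<not> g x \<le> g y\<close> by simp
  qed
  have p: "partition_of a b n (\<lambda>i. g (u i))"
    using partition_of_mem[OF u] partition_of_mono[OF u] g by (intro partition_ofI gmono) auto
  have "gsum c U \<gamma> n u \<le> gsum c U (\<lambda>s. \<gamma> (\<phi> s)) n (\<lambda>i. g (u i))" unfolding gsum_def
  proof (rule sum_mono)
    fix i assume "i \<in> {..<n}"
    then have i: "\<phi> a \<le> u i" "u i \<le> u (Suc i)" "u (Suc i) \<le> \<phi> b"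
      using partition_of_mem[OF u] partition_of_mono[OF u] by auto
    have *: "\<phi> (g (u i)) = u i" "\<phi> (g (u (Suc i))) = u (Suc i)" using g i by (auto intro: order_trans)
    have "\<phi> ` {g (u i)..g (u (Suc i))} \<subseteq> {u i..u (Suc i)}"
      using g[of "u i"] g[of "u (Suc i)"] i mono[of "g (u i)"] mono[of _ "g (u (Suc i))"] * by fastforce
    then have "(\<lambda>s. \<gamma> (\<phi> s)) ` {g (u i)..g (u (Suc i))} \<subseteq> U" if "\<gamma> ` {u i..u (Suc i)} \<subseteq> U"
      using that by fastforce
    then show "(if \<gamma> ` {u i..u (Suc i)} \<subseteq> U then c (\<gamma> (u i)) (\<gamma> (u (Suc i))) else 0) \<le>
      (if (\<lambda>s. \<gamma> (\<phi> s)) ` {g (u i)..g (u (Suc i))} \<subseteq> U then c (\<gamma> (\<phi> (g (u i)))) (\<gamma> (\<phi> (g (u (Suc i))))) else 0)"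
      using * by auto
  qed
  also have "... \<le> gvar c U (\<lambda>s. \<gamma> (\<phi> s)) a b" by (rule gvar_ge[OF p])
  finally show "gsum c U \<gamma> n u \<le> gvar c U (\<lambda>s. \<gamma> (\<phi> s)) a b" .
qed

text \<open>Counted cells are non-overlapping pieces of the time set \<open>E\<close> spent in
  \<open>U\<close>, which bounds the left side. Conversely the cells of uniform grids that stay in
  \<open>U\<close> exhaust \<open>E\<close>, and Fatou's lemma gives the other inequality.\<close>

lemma gvar_eq_nn_integral:
  fixes k :: "real => ennreal"
  assumes k: "k \<in> borel_measurable borel"
    and var: "\<And>s t. 0 \<le> s ==> s \<le> t ==> t \<le> 1 ==> variation c \<gamma> s t = (\<integral>\<^sup>+x\<in>{s..t}. k x \<partial>lborel)"
    and con: "continuous_on {0..1} \<gamma>" and U: "open U"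
  shows "gvar c U \<gamma> 0 1 = (\<integral>\<^sup>+x\<in>{0..1} \<inter> \<gamma> -` U. k x \<partial>lborel)"
proof (rule antisym)
  define E where "E = {0..1} \<inter> \<gamma> -` U"
  obtain V where V: "open V" "E = {0..1} \<inter> V"
    using continuous_openin_preimage_gen[OF con U] unfolding E_def openin_open by auto
  have Eb [measurable]: "E \<in> sets borel" using V by auto
  note k [measurable]
  have half: "(\<integral>\<^sup>+x\<in>{s<..t}. k x \<partial>lborel) = (\<integral>\<^sup>+x\<in>{s..t}. k x \<partial>lborel)" for s t :: real
    by (rule nn_integral_cong_AE) (use AE_lborel_singleton[of s] in \<open>eventually_elim, auto split: split_indicator\<close>)
  show "gvar c U \<gamma> 0 1 \<le> (\<integral>\<^sup>+x\<in>{0..1} \<inter> \<gamma> -` U. k x \<partial>lborel)"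
  proof (rule gvar_le)
    fix n t assume t: "partition_of 0 1 n t"
    have "m \<le> n ==> gsum c U \<gamma> m t \<le> (\<integral>\<^sup>+x\<in>E \<inter> {..t m}. k x \<partial>lborel)" for m
    proof (induction m)
      case 0
      then show ?case by (simp add: gsum_def)
    next
      case (Suc m)
      have m: "0 \<le> t m" "t m \<le> t (Suc m)" "t (Suc m) \<le> 1"
        using Suc partition_of_mem[OF t, of m] partition_of_mem[OF t, of "Suc m"] partition_of_mono[OF t, of m "Suc m"] by auto
      have "(if \<gamma> ` {t m..t (Suc m)} \<subseteq> U then c (\<gamma> (t m)) (\<gamma> (t (Suc m))) else 0) \<le> (\<integral>\<^sup>+x\<in>E \<inter> {t m<..t (Suc m)}. k x \<partial>lborel)"
      proof (cases "\<gamma> ` {t m..t (Suc m)} \<subseteq> U")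
        case True
        have "x \<in> E" if "t m < x" "x \<le> t (Suc m)" for x
        proof -
          have "\<gamma> x \<in> U" using True that by (intro subsetD[OF True] imageI) auto
          then show ?thesis using m that unfolding E_def by auto
        qed
        then have "E \<inter> {t m<..t (Suc m)} = {t m<..t (Suc m)}" by auto
        then show ?thesis using variation_ge[of "t m" "t m" "t (Suc m)" "t (Suc m)" c \<gamma>] var[of "t m" "t (Suc m)"] m True
          by (simp add: half)
      qed simp
      then have "gsum c U \<gamma> (Suc m) t \<le> (\<integral>\<^sup>+x\<in>E \<inter> {..t m}. k x \<partial>lborel) + (\<integral>\<^sup>+x\<in>E \<inter> {t m<..t (Suc m)}. k x \<partial>lborel)"
        using Suc unfolding gsum_def by (simp add: add_mono)
      also have "... = (\<integral>\<^sup>+x\<in>E \<inter> {..t (Suc m)}. k x \<partial>lborel)" by (subst nn_integral_add[symmetric])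
           (use m in \<open>auto intro!: nn_integral_cong split: split_indicator\<close>)
      finally show ?case .
    qed
    from this[of n] have "gsum c U \<gamma> n t \<le> (\<integral>\<^sup>+x\<in>E \<inter> {..t n}. k x \<partial>lborel)" by simp
    also have "... \<le> (\<integral>\<^sup>+x\<in>E. k x \<partial>lborel)" by (intro nn_integral_mono) (auto split: split_indicator)
    finally show "gsum c U \<gamma> n t \<le> (\<integral>\<^sup>+x\<in>{0..1} \<inter> \<gamma> -` U. k x \<partial>lborel)" unfolding E_def .
  qed
  define cell where "cell N i = {real i / real N<..real (Suc i) / real N}" for N i :: nat
  define ccell where "ccell N i = {real i / real N..real (Suc i) / real N}" for N i :: nat
  define W where "W N = (\<Union>i\<in>{i. i < N \<and> \<gamma> ` ccell N i \<subseteq> U}. cell N i)" for N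
  have cell_b [measurable]: "cell N i \<in> sets borel" for N i unfolding cell_def by simp
  have W_b [measurable]: "W N \<in> sets borel" for N unfolding W_def by (intro sets.finite_UN) auto
  have WN: "(\<integral>\<^sup>+x\<in>W N. k x \<partial>lborel) \<le> gvar c U \<gamma> 0 1" if N: "N > 0" for N
  proof -
    have "j \<le> N ==> (\<integral>\<^sup>+x\<in>W N \<inter> {..real j / real N}. k x \<partial>lborel) \<le> gvar c U \<gamma> 0 (real j / real N)" for j
    proof (induction j)
      case 0
      have "0 < x" if x: "x \<in> W N" for x
      proof -
        obtain i where "real i / real N < x" using x unfolding W_def cell_def by auto
        moreover have "0 \<le> real i / real N" by simp
        ultimately show ?thesis by linarith
      qed
      then have "W N \<inter> {..0} = {}" by force
      then show ?case by simp
    next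
      case (Suc j)
      have sub: "W N \<inter> {real j / real N<..real (Suc j) / real N} \<subseteq> (if \<gamma> ` ccell N j \<subseteq> U then cell N j else {})"
      proof
        fix x assume x: "x \<in> W N \<inter> {real j / real N<..real (Suc j) / real N}"
        then obtain i where i: "i < N" "\<gamma> ` ccell N i \<subseteq> U" "x \<in> cell N i" unfolding W_def by auto
        have "real i < real (Suc j)" "real j < real (Suc i)"
          using i(3) x N unfolding cell_def by (auto simp: field_simps)
        then have "i = j" by linarith
        then show "x \<in> (if \<gamma> ` ccell N j \<subseteq> U then cell N j else {})" using i by simp
      qed
      have le1: "real (Suc j) / real N \<le> 1" "real j / real N \<le> real (Suc j) / real N" using Suc N by (auto simp: field_simps)
      have "(\<integral>\<^sup>+x\<in>W N \<inter> {real j / real N<..real (Suc j) / real N}. k x \<partial>lborel) \<le> gvar c U \<gamma> (real j / real N) (real (Suc j) / real N)"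
      proof (cases "\<gamma> ` ccell N j \<subseteq> U")
        case True
        have "(\<integral>\<^sup>+x\<in>W N \<inter> {real j / real N<..real (Suc j) / real N}. k x \<partial>lborel) \<le> (\<integral>\<^sup>+x\<in>{real j / real N<..real (Suc j) / real N}. k x \<partial>lborel)"
          by (intro nn_integral_mono) (auto split: split_indicator)
        also have "... = variation c \<gamma> (real j / real N) (real (Suc j) / real N)"
          using var[of "real j / real N" "real (Suc j) / real N"] le1 by (simp add: half)
        also have "... \<le> gvar c U \<gamma> (real j / real N) (real (Suc j) / real N)"
          unfolding variation_eq_gvar
        proof (rule gvar_le)
          fix n t assume t: "partition_of (real j / real N) (real (Suc j) / real N) n t"
          have "gsum c UNIV \<gamma> n t = gsum c U \<gamma> n t" unfolding gsum_def
          proof (intro sum.cong refl)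
            fix i assume "i \<in> {..<n}"
            then have "{t i..t (Suc i)} \<subseteq> ccell N j"
              using partition_of_mem[OF t, of i] partition_of_mem[OF t, of "Suc i"] unfolding ccell_def by auto
            then have "\<gamma> ` {t i..t (Suc i)} \<subseteq> U" using True by blast
            then show "(if \<gamma> ` {t i..t (Suc i)} \<subseteq> UNIV then c (\<gamma> (t i)) (\<gamma> (t (Suc i))) else 0) =
              (if \<gamma> ` {t i..t (Suc i)} \<subseteq> U then c (\<gamma> (t i)) (\<gamma> (t (Suc i))) else 0)" by simp
          qed
          then show "gsum c UNIV \<gamma> n t \<le> gvar c U \<gamma> (real j / real N) (real (Suc j) / real N)" using gvar_ge[OF t] by simp
        qed
        finally show ?thesis .
      next
        case False
        then have "W N \<inter> {real j / real N<..real (Suc j) / real N} = {}" using sub by auto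
        then show ?thesis by simp
      qed
      moreover have "(\<integral>\<^sup>+x\<in>W N \<inter> {..real (Suc j) / real N}. k x \<partial>lborel) =
          (\<integral>\<^sup>+x\<in>W N \<inter> {..real j / real N}. k x \<partial>lborel) + (\<integral>\<^sup>+x\<in>W N \<inter> {real j / real N<..real (Suc j) / real N}. k x \<partial>lborel)"
        by (subst nn_integral_add[symmetric])
           (use le1(2) in \<open>auto intro!: nn_integral_cong split: split_indicator simp del: of_nat_Suc\<close>)
      ultimately have "(\<integral>\<^sup>+x\<in>W N \<inter> {..real (Suc j) / real N}. k x \<partial>lborel) \<le> gvar c U \<gamma> 0 (real j / real N) + gvar c U \<gamma> (real j / real N) (real (Suc j) / real N)"
        using Suc by (simp add: add_mono)
      also have "... \<le> gvar c U \<gamma> 0 (real (Suc j) / real N)"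
        by (rule gvar_superadd) (use le1 in auto)
      finally show ?case .
    qed
    from this[of N] have "(\<integral>\<^sup>+x\<in>W N \<inter> {..1}. k x \<partial>lborel) \<le> gvar c U \<gamma> 0 1" using N by simp
    moreover have "W N \<inter> {..1} = W N"
    proof -
      have "x \<le> 1" if x: "x \<in> W N" for x
      proof -
        obtain i where i: "i < N" "x \<le> real (Suc i) / real N" using x unfolding W_def cell_def by (auto simp del: of_nat_Suc)
        moreover have "real (Suc i) / real N \<le> 1" using i(1) by auto
        ultimately show ?thesis by linarith
      qed
      then show ?thesis by auto
    qed
    ultimately show ?thesis by simp
  qed
  \<comment> \<open>\<open>E\<close> is relatively open in \<open>[0,1]\<close>: a point of it has
    room \<open>e\<close>, and once the mesh is below \<open>e\<close> the closed cell around the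
    point lies in \<open>E\<close>.\<close>
  have ev: "eventually (\<lambda>N. x \<in> W N) sequentially" if x: "x \<in> E" "x \<noteq> 0" for x
  proof -
    obtain e where e: "e > 0" "\<And>y. \<bar>y - x\<bar> < e ==> y \<in> V"
      using V x unfolding open_dist dist_real_def by blast
    have x01: "0 < x" "x \<le> 1" using x unfolding E_def by auto
    obtain N0 where N0: "inverse (real (Suc N0)) < e" using reals_Archimedean e(1) by blast
    show ?thesis unfolding eventually_sequentially
    proof (intro exI[of _ "Suc N0"] allI impI)
      fix N assume N: "Suc N0 \<le> N"
      have Ne: "1 / real N < e" using N N0 by (smt (verit) inverse_eq_divide frac_le of_nat_le_iff of_nat_0_less_iff zero_less_Suc)
      define i where "i = nat (\<lceil>x * real N\<rceil> - 1)"
      have Np: "real N > 0" using N by simp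
      have "0 < x * real N" using x01 Np by simp
      then have cl: "1 \<le> \<lceil>x * real N\<rceil>" by linarith
      then have ri: "real i = of_int \<lceil>x * real N\<rceil> - 1" unfolding i_def by simp
      have i: "real i < x * real N" "x * real N \<le> real i + 1" using ri by linarith+
      have "x * real N \<le> real N" using x01 Np by simp
      then have "i < N" using i by linarith
      have xin: "x \<in> cell N i" using i Np unfolding cell_def by (auto simp: field_simps)
      have "\<gamma> ` ccell N i \<subseteq> U"
      proof
        fix z assume "z \<in> \<gamma> ` ccell N i"
        then obtain y where y: "z = \<gamma> y" "real i / real N \<le> y" "y \<le> real (Suc i) / real N" unfolding ccell_def by auto
        have "real (Suc i) / real N = real i / real N + 1 / real N" by (simp add: add_divide_distrib)
        then have "\<bar>y - x\<bar> < e" using y xin Ne unfolding cell_def by auto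
        moreover have "real (Suc i) / real N \<le> 1" "0 \<le> real i / real N" using \<open>i < N\<close> Np by (auto simp: field_simps)
        then have "0 \<le> y" "y \<le> 1" using y by linarith+
        ultimately have "y \<in> E" using e(2)[of y] unfolding V(2) by auto
        then show "z \<in> U" using y unfolding E_def by auto
      qed
      then show "x \<in> W N" unfolding W_def using xin \<open>i < N\<close> by auto
    qed
  qed
  have "(\<integral>\<^sup>+x\<in>E. k x \<partial>lborel) \<le> (\<integral>\<^sup>+x. liminf (\<lambda>N. k x * indicator (W N) x) \<partial>lborel)"
  proof (rule nn_integral_mono_AE, use AE_lborel_singleton[of 0] in eventually_elim)
    fix x :: real assume x: "x \<noteq> 0"
    show "k x * indicator E x \<le> liminf (\<lambda>N. k x * indicator (W N) x)"
    proof (cases "x \<in> E")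
      case True
      have "eventually (\<lambda>N. k x \<le> k x * indicator (W N) x) sequentially"
        using ev[OF True x] by eventually_elim simp
      then have "k x \<le> liminf (\<lambda>N. k x * indicator (W N) x)" by (rule Liminf_bounded)
      then show ?thesis using True by simp
    qed simp
  qed
  also have "... \<le> liminf (\<lambda>N. \<integral>\<^sup>+x. k x * indicator (W N) x \<partial>lborel)"
    by (rule nn_integral_liminf) measurable
  also have "... \<le> gvar c U \<gamma> 0 1"
  proof -
    have "eventually (\<lambda>N. (\<integral>\<^sup>+x. k x * indicator (W N) x \<partial>lborel) \<le> gvar c U \<gamma> 0 1) sequentially"
      using eventually_gt_at_top[of 0] by eventually_elim (rule WN)
    then show ?thesis by (intro order_trans[OF Liminf_le_Limsup Limsup_bounded]) auto
  qed
  finally show "(\<integral>\<^sup>+x\<in>{0..1} \<inter> \<gamma> -` U. k x \<partial>lborel) \<le> gvar c U \<gamma> 0 1" unfolding E_def .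
qed

section \<open>Rectifiable arcs\<close>

text \<open>Moves a strict bound from a sum to one summand; the summand must be positive because
  nothing lies below 0 in \<open>ennreal\<close>.\<close>

lemma less_add_ennrealE:
  fixes a b c :: ennreal
  assumes "c < a + b" "0 < b"
  obtains c2 where "c2 < b" "c < a + c2"
proof (cases b)
  case top
  obtain z where z: "c = ennreal z" "z \<ge> 0" using assms by (cases c) auto
  have "c < ennreal (z + 1)" using z by (simp add: ennreal_less_iff)
  also have "... \<le> a + ennreal (z + 1)" by (rule add_increasing) auto
  finally show ?thesis using that[of "ennreal (z + 1)"] top by simp
next
  case (real y)
  show ?thesis
  proof (cases a)
    case top
    then show ?thesis using that[of 0] assms by (auto simp: less_top)
  next
    case (real x)
    obtain z where z: "c = ennreal z" "z \<ge> 0" using assms by (cases c) auto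
    have *: "z < x + y" "y > 0" using assms real \<open>b = ennreal y\<close> \<open>0 \<le> y\<close> z
      by (auto simp: ennreal_plus[symmetric] ennreal_less_iff simp del: ennreal_plus)
    define w where "w = max 0 (y - (x + y - z) / 2)"
    have "w < y" "0 \<le> w" "z < x + w" using * real unfolding w_def by (auto simp: max_def field_simps)
    then show ?thesis using that[of "ennreal w"] real z \<open>b = ennreal y\<close>
      by (auto simp: ennreal_plus[symmetric] ennreal_less_iff simp del: ennreal_plus)
  qed
qed

text \<open>Finite sums of lower semicontinuous functions. The point \<open>p\<close> and the filter
  \<open>F\<close> are kept apart so that this applies to times, to curves and to sequences of
  points. Summands that vanish at \<open>p\<close> are split off, since no bound lies strictly below
  0.\<close>

lemma sum_lsc:
  fixes f :: "'i => 'b => ennreal"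
  assumes "finite I" "\<And>i c. i \<in> I ==> c < f i p ==> eventually (\<lambda>x. c < f i x) F"
    and "c < (\<Sum>i\<in>I. f i p)" shows "eventually (\<lambda>x. c < (\<Sum>i\<in>I. f i x)) F" using assms
proof (induction I arbitrary: c rule: finite_induct)
  case (insert i I)
  have lt: "c < f i p + (\<Sum>i\<in>I. f i p)" using insert by simp
  show ?case
  proof (cases "(\<Sum>i\<in>I. f i p) = 0")
    case True
    then have "eventually (\<lambda>x. c < f i x) F" using lt insert.prems(1)[of i c] by simp
    then show ?thesis
    proof eventually_elim
      case (elim x)
      then show ?case using insert.hyps by (simp add: less_le_trans[OF _ add_increasing2])
    qed
  next
    case False
    then have "0 < (\<Sum>i\<in>I. f i p)" by (simp add: zero_less_iff_neq_zero)
    then obtain c2 where c2: "c2 < (\<Sum>i\<in>I. f i p)" "c < f i p + c2"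
      using lt less_add_ennrealE by blast
    have ev2: "eventually (\<lambda>x. c2 < (\<Sum>i\<in>I. f i x)) F"
      by (rule insert.IH) (use insert.prems c2 in auto)
    show ?thesis
    proof (cases "f i p = 0")
      case True
      then have "c < c2" using c2 by simp
      show ?thesis using ev2
      proof eventually_elim
        case (elim x)
        then have "c < (\<Sum>i\<in>I. f i x)" using \<open>c < c2\<close> by simp
        then show ?case using insert.hyps by (simp add: less_le_trans[OF _ add_increasing])
      qed
    next
      case False
      then have "0 < f i p" by (simp add: zero_less_iff_neq_zero)
      moreover have "c < c2 + f i p" using c2 by (simp add: add.commute)
      ultimately obtain c1 where c1: "c1 < f i p" "c < c2 + c1" using less_add_ennrealE by blast
      have "eventually (\<lambda>x. c1 < f i x) F" using insert.prems(1)[of i c1] c1 by simp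
      then show ?thesis using ev2
      proof eventually_elim
        case (elim x)
        have "c < c1 + c2" using c1 by (simp add: add.commute)
        also have "... \<le> f i x + (\<Sum>i\<in>I. f i x)" using elim by (intro add_mono) auto
        finally show ?case using insert.hyps by simp
      qed
    qed
  qed
qed simp

lemma reparametrizationD:
  assumes "reparametrization \<phi>"
  shows "continuous_on {0..1} \<phi>" "mono_on {0..1} \<phi>" "\<phi> 0 = 0" "\<phi> 1 = 1"
    "\<And>s. 0 \<le> s ==> s \<le> 1 ==> 0 \<le> \<phi> s \<and> \<phi> s \<le> 1"
    "\<And>s t. 0 \<le> s ==> s \<le> t ==> t \<le> 1 ==> \<phi> s \<le> \<phi> t"
    "\<And>r. 0 \<le> r ==> r \<le> 1 ==> \<exists>s. 0 \<le> s \<and> s \<le> 1 \<and> \<phi> s = r"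
proof -
  show 1: "continuous_on {0..1} \<phi>" "mono_on {0..1} \<phi>"
    using assms unfolding reparametrization_def by auto
  have im: "\<phi> ` {0..1} = {0..1}" using assms unfolding reparametrization_def by auto
  show 2: "\<And>s t. 0 \<le> s ==> s \<le> t ==> t \<le> 1 ==> \<phi> s \<le> \<phi> t" using 1(2) unfolding mono_on_def by auto
  show 3: "\<And>s. 0 \<le> s ==> s \<le> 1 ==> 0 \<le> \<phi> s \<and> \<phi> s \<le> 1" using im by fastforce
  show 4: "\<exists>s. 0 \<le> s \<and> s \<le> 1 \<and> \<phi> s = r" if "0 \<le> r" "r \<le> 1" for r
  proof -
    have "r \<in> \<phi> ` {0..1}" using im that by simp
    then show ?thesis by auto
  qed
  show "\<phi> 0 = 0" using 4[of 0] 2[of 0] 3[of 0] by fastforce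
  show "\<phi> 1 = 1" using 4[of 1] 2[of _ 1] 3[of 1] by fastforce
qed

lemma reparametrizationI:
  assumes "continuous_on {0..1} \<phi>" "\<And>s t. 0 \<le> s ==> s \<le> t ==> t \<le> 1 ==> \<phi> s \<le> \<phi> t" "\<phi> 0 = 0" "\<phi> 1 = 1"
  shows "reparametrization \<phi>" unfolding reparametrization_def
proof (intro conjI assms(1))
  show "mono_on {0..1} \<phi>" using assms(2) unfolding mono_on_def by auto
  show "\<phi> ` {0..1} = {0..1}"
  proof
    show "\<phi> ` {0..1} \<subseteq> {0..1}" using assms(2)[of 0] assms(2)[of _ 1] assms(3,4) by auto
    show "{0..1} \<subseteq> \<phi> ` {0..1}"
    proof
      fix r :: real assume "r \<in> {0..1}"
      then obtain x where "0 \<le> x" "x \<le> 1" "\<phi> x = r" using IVT'[of \<phi> 0 r 1] assms by auto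
      then show "r \<in> \<phi> ` {0..1}" by auto
    qed
  qed
qed

lemma reparametrization_id: "reparametrization (\<lambda>s. s)" by (rule reparametrizationI) auto

text \<open>The pairs \<open>(x, y)\<close> with \<open>\<eta> x = \<theta> y\<close> contain a
  monotone path from \<open>(0,0)\<close> to \<open>(1,1)\<close>. It is parametrized by
  \<open>r = x + y\<close>, which runs through \<open>[0,2]\<close>: \<open>\<sigma> r\<close> is
  the least admissible \<open>x\<close> with \<open>\<theta> (r - x) \<le> \<eta> x\<close>. Both
  \<open>\<sigma> r\<close> and \<open>r - \<sigma> r\<close> are nondecreasing, hence 1-Lipschitz.
  In \<open>RA_memI\<close> this does the work of transitivity of \<open>arc_rel\<close>.\<close>

lemma reparametrization_pullback:
  assumes \<eta>: "reparametrization \<eta>" and \<theta>: "reparametrization \<theta>"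
  obtains \<phi> \<psi> where "reparametrization \<phi>" "reparametrization \<psi>" "\<And>t. 0 \<le> t ==> t \<le> 1 ==> \<eta> (\<phi> t) = \<theta> (\<psi> t)"
proof -
  note E = reparametrizationD[OF \<eta>] and T = reparametrizationD[OF \<theta>]
  \<comment> \<open>The bounds on \<open>s\<close> say exactly that \<open>s\<close> and
    \<open>r - s\<close> both lie in \<open>[0,1]\<close>.\<close>
  define S where "S r = {s. max 0 (r - 1) \<le> s \<and> s \<le> min 1 r \<and> \<theta> (r - s) \<le> \<eta> s}" for r :: real
  have ex: "\<exists>s\<in>S r. (\<forall>s'\<in>S r. s \<le> s') \<and> \<eta> s = \<theta> (r - s)" if r: "0 \<le> r" "r \<le> 2" for r
  proof -
    define a b where "a = max 0 (r - 1)" and "b = min 1 r"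
    have ab: "0 \<le> a" "a \<le> b" "b \<le> 1" "r - a \<le> 1" "0 \<le> r - b" using r unfolding a_def b_def by auto
    have con: "continuous_on {a..b} (\<lambda>s. \<eta> s - \<theta> (r - s))"
      by (intro continuous_intros continuous_on_subset[OF E(1)] continuous_on_compose2[OF T(1)]) (use ab in auto)
    have a0: "\<eta> a - \<theta> (r - a) \<le> 0"
    proof (cases "r \<le> 1")
      case True
      then have "a = 0" by (simp add: a_def)
      then show ?thesis using E T True r by auto
    next
      case False
      then have "r - a = 1" by (simp add: a_def)
      then show ?thesis using E(5)[of a] T(4) ab by auto
    qed
    have b0: "0 \<le> \<eta> b - \<theta> (r - b)"
    proof (cases "r \<le> 1")
      case True
      then have "r - b = 0" by (simp add: b_def)
      then show ?thesis using E(5)[of b] T(3) ab by auto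
    next
      case False
      then have "b = 1" by (simp add: b_def)
      then show ?thesis using E T False r by auto
    qed
    have Seq: "S r = {s \<in> {a..b}. 0 \<le> \<eta> s - \<theta> (r - s)}" unfolding S_def a_def b_def by auto
    have "closed {s \<in> {a..b}. 0 \<le> \<eta> s - \<theta> (r - s)}"
      using continuous_closed_preimage[OF con, of "{0..}"] by (simp add: vimage_def Int_def)
    then have "compact (S r)" unfolding Seq
      by (metis (no_types, lifting) compact_Icc compact_Int_closed inf.absorb2 mem_Collect_eq subsetI)
    moreover have "S r \<noteq> {}" using b0 ab unfolding Seq by auto
    ultimately obtain s where s: "s \<in> S r" "\<forall>s'\<in>S r. s \<le> s'" using compact_attains_inf by metis
    then have sab: "a \<le> s" "s \<le> b" "0 \<le> \<eta> s - \<theta> (r - s)" unfolding Seq by auto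
    \<comment> \<open>At the least element the inequality is an equality: the intermediate value
      theorem gives a solution of the equation that is no larger, so minimality identifies the
      two.\<close>
    obtain z where z: "a \<le> z" "z \<le> s" "\<eta> z - \<theta> (r - z) = 0"
      using IVT'[of "\<lambda>s. \<eta> s - \<theta> (r - s)" a 0 s] a0 sab continuous_on_subset[OF con, of "{a..s}"] by auto
    then have "z \<in> S r" unfolding Seq using sab by auto
    then have "z = s" using s z by force
    then show ?thesis using s z by auto
  qed
  then obtain \<sigma> where \<sigma>: "\<And>r. 0 \<le> r ==> r \<le> 2 ==> \<sigma> r \<in> S r \<and> (\<forall>s'\<in>S r. \<sigma> r \<le> s') \<and> \<eta> (\<sigma> r) = \<theta> (r - \<sigma> r)"
    by metis
  have m1: "\<sigma> r \<le> \<sigma> r'" if "0 \<le> r" "r \<le> r'" "r' \<le> 2" for r r'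
  proof (rule ccontr)
    assume "\<not> \<sigma> r \<le> \<sigma> r'"
    then have lt: "\<sigma> r' < \<sigma> r" by simp
    have S: "\<sigma> r \<in> S r" "\<sigma> r' \<in> S r'" using \<sigma> that by auto
    have "\<theta> (r - \<sigma> r') \<le> \<theta> (r' - \<sigma> r')" using S lt that unfolding S_def by (intro T(6)) auto
    also have "... \<le> \<eta> (\<sigma> r')" using S unfolding S_def by auto
    finally have "\<sigma> r' \<in> S r" using S lt that unfolding S_def by auto
    then show False using \<sigma>[of r] that lt by auto
  qed
  have m2: "\<sigma> r' \<le> \<sigma> r + (r' - r)" if "0 \<le> r" "r \<le> r'" "r' \<le> 2" for r r'
  proof (cases "\<sigma> r + (r' - r) \<le> 1")
    case True
    have S: "\<sigma> r \<in> S r" using \<sigma> that by auto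
    have "\<theta> (r' - (\<sigma> r + (r' - r))) \<le> \<eta> (\<sigma> r)" using S unfolding S_def by simp
    also have "... \<le> \<eta> (\<sigma> r + (r' - r))" using S True that unfolding S_def by (intro E(6)) auto
    finally have "\<sigma> r + (r' - r) \<in> S r'" using S True that unfolding S_def by auto
    then show ?thesis using \<sigma>[of r'] that by auto
  next
    case False
    then show ?thesis using \<sigma>[of r'] that unfolding S_def by auto
  qed
  have lip: "\<bar>\<sigma> r' - \<sigma> r\<bar> \<le> \<bar>r' - r\<bar>" if "0 \<le> r" "r \<le> 2" "0 \<le> r'" "r' \<le> 2" for r r'
    using m1[of r r'] m1[of r' r] m2[of r r'] m2[of r' r] that by linarith
  have con: "continuous_on {0..2} \<sigma>"
    unfolding continuous_on_iff dist_real_def using lip by (metis atLeastAtMost_iff le_less_trans)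
  have con2: "continuous_on {0..1} (\<lambda>t. \<sigma> (2 * t))"
    by (intro continuous_on_compose2[OF con] continuous_intros) auto
  have r1: "reparametrization (\<lambda>t. \<sigma> (2 * t))"
    by (rule reparametrizationI) (use m1 con2 \<sigma>[of 0] \<sigma>[of 2] in \<open>auto simp: S_def\<close>)
  have r2: "reparametrization (\<lambda>t. 2 * t - \<sigma> (2 * t))"
  proof (rule reparametrizationI)
    fix s t :: real assume "0 \<le> s" "s \<le> t" "t \<le> 1"
    then show "2 * s - \<sigma> (2 * s) \<le> 2 * t - \<sigma> (2 * t)" using m2[of "2 * s" "2 * t"] by simp
  qed (use con2 \<sigma>[of 0] \<sigma>[of 2] in \<open>auto simp: S_def intro!: continuous_intros\<close>)
  show ?thesis by (rule that[OF r1 r2]) (use \<sigma> in auto)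
qed

lemma arc_rel_refl: "\<gamma> \<in> curves ==> (\<gamma>, \<gamma>) \<in> arc_rel"
  unfolding arc_rel_def using reparametrization_id by blast

lemma arc_rel_sym: "(\<gamma>, \<sigma>) \<in> arc_rel ==> (\<sigma>, \<gamma>) \<in> arc_rel" unfolding arc_rel_def by fastforce

lemma arc_rel_gvar:
  assumes "(\<gamma>, \<sigma>) \<in> arc_rel" shows "gvar c U \<gamma> 0 1 = gvar c U \<sigma> 0 1"
proof -
  obtain \<phi> \<psi> where r: "reparametrization \<phi>" "reparametrization \<psi>" "\<And>t. t \<in> {0..1} ==> \<gamma> (\<phi> t) = \<sigma> (\<psi> t)"
    using assms unfolding arc_rel_def by auto
  note P = reparametrizationD[OF r(1)] and Q = reparametrizationD[OF r(2)]
  have "gvar c U \<gamma> 0 1 = gvar c U (\<lambda>s. \<gamma> (\<phi> s)) 0 1" using gvar_reparam[OF P(2,1), of c U \<gamma>] P by simp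
  also have "... = gvar c U (\<lambda>s. \<sigma> (\<psi> s)) 0 1" by (rule gvar_cong) (use r in auto)
  also have "... = gvar c U \<sigma> 0 1" using gvar_reparam[OF Q(2,1), of c U \<sigma>] Q by simp
  finally show ?thesis .
qed

text \<open>A common reparametrization takes the value \<open>s\<close> at some time; up to that
  time both curves run through the same points and have travelled the same variation.\<close>

lemma arc_rel_match:
  assumes "(\<gamma>, \<sigma>) \<in> arc_rel" "0 \<le> s" "s \<le> 1"
  obtains s' where "0 \<le> s'" "s' \<le> 1" "\<sigma> s' = \<gamma> s" "variation c \<sigma> 0 s' = variation c \<gamma> 0 s"
proof -
  obtain \<phi> \<psi> where r: "reparametrization \<phi>" "reparametrization \<psi>" "\<And>t. t \<in> {0..1} ==> \<gamma> (\<phi> t) = \<sigma> (\<psi> t)"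
    using assms unfolding arc_rel_def by auto
  note P = reparametrizationD[OF r(1)] and Q = reparametrizationD[OF r(2)]
  obtain t where t: "0 \<le> t" "t \<le> 1" "\<phi> t = s" using P(7) assms by metis
  have sub: "{0..t} \<subseteq> {0..1}" using t by auto
  have "variation c \<gamma> 0 s = gvar c UNIV (\<lambda>s. \<gamma> (\<phi> s)) 0 t"
    using gvar_reparam[OF mono_on_subset[OF P(2) sub] continuous_on_subset[OF P(1) sub], of c UNIV \<gamma>] P t
    by (simp add: variation_eq_gvar)
  also have "... = gvar c UNIV (\<lambda>s. \<sigma> (\<psi> s)) 0 t" by (rule gvar_cong) (use r t in auto)
  also have "... = variation c \<sigma> 0 (\<psi> t)"
    using gvar_reparam[OF mono_on_subset[OF Q(2) sub] continuous_on_subset[OF Q(1) sub], of c UNIV \<sigma>] Q t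
    by (simp add: variation_eq_gvar)
  finally show ?thesis using that[of "\<psi> t"] Q(5)[of t] t r(3)[of t] by auto
qed

context emt
begin

lemma variation_split:
  assumes "a \<le> b" "b \<le> e" shows "variation d \<gamma> a e = variation d \<gamma> a b + variation d \<gamma> b e"
  using variation_add[of d a b e \<gamma>, OF d_triangle assms] .

text \<open>Closeness in \<open>d\<close> forces closeness in the topology: a bump that equals 1 at
  \<open>R s\<close> and vanishes outside \<open>U\<close> is Lipschitz for
  \<open>d\<close>.\<close>

lemma lipschitz_imp_continuous:
  assumes "\<And>s t. s \<in> S ==> t \<in> S ==> s \<le> t ==> d (R s) (R t) \<le> ennreal (L * (t - s))" "L \<ge> 0"
  shows "continuous_on S R"
proof -
  have *: "d (R s) (R t) \<le> ennreal (L * \<bar>t - s\<bar>)" if "s \<in> S" "t \<in> S" for s t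
    using assms(1)[of s t] assms(1)[of t s] that d_sym[of "R s" "R t"] by (cases "s \<le> t") auto
  show ?thesis unfolding continuous_on_topological
  proof (intro ballI allI impI)
    fix s U assume s: "s \<in> S" and U: "open U" "R s \<in> U"
    obtain u where u: "u \<in> Lip_b d" "u (R s) = 1" "\<And>y. y \<notin> U ==> u y = 0"
      using ex_bump[OF U] by metis
    obtain C where C: "C > 0" "\<And>x y. ennreal \<bar>u x - u y\<bar> \<le> ennreal C * d x y" using Lip_bE[OF u(1)] by metis
    \<comment> \<open>Within this radius the bump changes by less than 1 and cannot reach 0; the
      summand 1 in \<open>L + 1\<close> keeps the denominator positive when
      \<open>L = 0\<close>.\<close>
    have "R t \<in> U" if t: "t \<in> S" "\<bar>t - s\<bar> < 1 / (C * (L + 1))" for t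
    proof (rule ccontr)
      assume "R t \<notin> U"
      then have "1 \<le> ennreal C * d (R s) (R t)" using C(2)[of "R s" "R t"] u by simp
      also have "... \<le> ennreal C * ennreal (L * \<bar>t - s\<bar>)" using * s t by (intro mult_left_mono) auto
      also have "... = ennreal (C * (L * \<bar>t - s\<bar>))" using C assms by (simp add: ennreal_mult)
      finally have "1 \<le> C * (L * \<bar>t - s\<bar>)" by simp
      also have "... \<le> C * ((L + 1) * \<bar>t - s\<bar>)" using C assms by (intro mult_left_mono mult_right_mono) auto
      also have "... = \<bar>t - s\<bar> * (C * (L + 1))" by simp
      also have "... < 1 / (C * (L + 1)) * (C * (L + 1))" using t C assms by (intro mult_strict_right_mono) auto
      also have "... = 1" using C assms by simp
      finally show False by simp
    qed
    then show "\<exists>A. open A \<and> s \<in> A \<and> (\<forall>y\<in>S. y \<in> A \<longrightarrow> R y \<in> U)"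
      using C assms by (intro exI[of _ "ball s (1 / (C * (L + 1)))"]) (auto simp: dist_real_def abs_minus_commute)
  qed
qed

text \<open>A partition whose sum exceeds \<open>c\<close> is clipped to the nearby time
  \<open>s\<close>; the finite sum is lower semicontinuous in \<open>s\<close> because
  \<open>d\<close> is lower semicontinuous and \<gamma> is continuous.\<close>

lemma variation_lsc:
  assumes con: "continuous_on {0..1} \<gamma>" and s0: "0 \<le> s0" "s0 \<le> 1"
  shows "c < variation d \<gamma> 0 s0 ==> eventually (\<lambda>s. c < variation d \<gamma> 0 s) (at s0 within {0..1})"
    and "c < variation d \<gamma> s0 1 ==> eventually (\<lambda>s. c < variation d \<gamma> s 1) (at s0 within {0..1})"
proof -
  have main: "eventually (\<lambda>s. c < (\<Sum>i<n. d (\<gamma> (g s (t i))) (\<gamma> (g s (t (Suc i)))))) (at s0 within {0..1})"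
    if lt: "c < (\<Sum>i<n. d (\<gamma> (g s0 (t i))) (\<gamma> (g s0 (t (Suc i)))))"
      and g: "\<And>i. i \<le> n ==> continuous_on {0..1} (\<lambda>s. g s (t i))" "\<And>s i. 0 \<le> s ==> s \<le> 1 ==> i \<le> n ==> g s (t i) \<in> {0..1}"
    for g :: "real => real => real" and n and t :: "nat => real" and c using lt
  proof (rule sum_lsc[where p = s0 and f = "\<lambda>i s. d (\<gamma> (g s (t i))) (\<gamma> (g s (t (Suc i))))", rotated 2])
    fix i c assume i: "i \<in> {..<n}" and c: "c < d (\<gamma> (g s0 (t i))) (\<gamma> (g s0 (t (Suc i))))"
    obtain U V where UV: "open U" "open V" "\<gamma> (g s0 (t i)) \<in> U" "\<gamma> (g s0 (t (Suc i))) \<in> V"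
      "\<And>x' y'. x' \<in> U ==> y' \<in> V ==> c < d x' y'" using d_lsc[OF c] by metis
    have cc: "continuous_on {0..1} (\<lambda>s. \<gamma> (g s (t j)))" if "j \<le> n" for j
      by (rule continuous_on_compose2[OF con g(1)[OF that]]) (use g(2) that in auto)
    have ev: "eventually (\<lambda>s. \<gamma> (g s (t j)) \<in> W) (at s0 within {0..1})" if "j \<le> n" "open W" "\<gamma> (g s0 (t j)) \<in> W" for j W
      using cc[OF that(1)] s0 that(2,3) unfolding continuous_on_def by (auto intro: topological_tendstoD)
    have "eventually (\<lambda>s. \<gamma> (g s (t i)) \<in> U) (at s0 within {0..1})"
      "eventually (\<lambda>s. \<gamma> (g s (t (Suc i))) \<in> V) (at s0 within {0..1})"
      using ev[OF _ UV(1,3)] ev[OF _ UV(2,4)] i by auto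
    then show "eventually (\<lambda>s. c < d (\<gamma> (g s (t i))) (\<gamma> (g s (t (Suc i))))) (at s0 within {0..1})"
      by eventually_elim (rule UV(5))
  qed simp
  have ev01: "eventually (\<lambda>s. s \<in> {0..1::real}) (at s0 within {0..1})" by (auto simp: eventually_at_filter)
  show "eventually (\<lambda>s. c < variation d \<gamma> 0 s) (at s0 within {0..1})" if c: "c < variation d \<gamma> 0 s0"
  proof -
    obtain n t where t: "partition_of 0 s0 n t" "c < gsum d UNIV \<gamma> n t"
      using c unfolding variation_eq_gvar less_gvar_iff by auto
    have ts: "0 \<le> t i" "t i \<le> s0" if "i \<le> n" for i using partition_of_mem[OF t(1) that] by auto
    have "(\<Sum>i<n. d (\<gamma> (min (t i) s0)) (\<gamma> (min (t (Suc i)) s0))) = gsum d UNIV \<gamma> n t"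
      unfolding gsum_def using ts by (intro sum.cong) (auto simp: min_def)
    then have "eventually (\<lambda>s. c < (\<Sum>i<n. d (\<gamma> (min (t i) s)) (\<gamma> (min (t (Suc i)) s)))) (at s0 within {0..1})"
      using t ts s0 by (intro main[where g = "\<lambda>s u. min u s"]) (auto intro!: continuous_intros simp: min_le_iff_disj intro: order_trans)
    with ev01 show ?thesis
    proof eventually_elim
      case (elim s)
      have p: "partition_of 0 s n (\<lambda>i. min (t i) s)"
        by (rule partition_ofI) (use elim ts partition_of_mono[OF t(1)] in \<open>auto intro: min.mono order_trans[OF min.cobounded1]\<close>)
      show ?case using elim gvar_ge[OF p, of d UNIV \<gamma>] by (auto simp: variation_eq_gvar gsum_def)
    qed
  qed
  show "eventually (\<lambda>s. c < variation d \<gamma> s 1) (at s0 within {0..1})" if c: "c < variation d \<gamma> s0 1"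
  proof -
    obtain n t where t: "partition_of s0 1 n t" "c < gsum d UNIV \<gamma> n t"
      using c unfolding variation_eq_gvar less_gvar_iff by auto
    have ts: "s0 \<le> t i" "t i \<le> 1" if "i \<le> n" for i using partition_of_mem[OF t(1) that] by auto
    have "(\<Sum>i<n. d (\<gamma> (max (t i) s0)) (\<gamma> (max (t (Suc i)) s0))) = gsum d UNIV \<gamma> n t"
      unfolding gsum_def using ts by (intro sum.cong) (auto simp: max_absorb1)
    then have "eventually (\<lambda>s. c < (\<Sum>i<n. d (\<gamma> (max (t i) s)) (\<gamma> (max (t (Suc i)) s)))) (at s0 within {0..1})"
      using t ts s0 by (intro main[where g = "\<lambda>s u. max u s"]) (auto intro!: continuous_intros simp: le_max_iff_disj intro: order_trans)
    with ev01 show ?thesis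
    proof eventually_elim
      case (elim s)
      have p: "partition_of s 1 n (\<lambda>i. max (t i) s)"
        by (rule partition_ofI) (use elim ts partition_of_mono[OF t(1)] in \<open>auto intro: max.mono order_trans[OF _ max.cobounded1]\<close>)
      show ?case using elim gvar_ge[OF p, of d UNIV \<gamma>] by (auto simp: variation_eq_gvar gsum_def)
    qed
  qed
qed

lemma variation_finite_mono: "variation d \<gamma> 0 1 < \<infinity> ==> 0 \<le> a ==> b \<le> 1 ==> variation d \<gamma> a b < \<infinity>"
  using variation_mono[of 0 a b 1 d \<gamma>] by (auto intro: le_less_trans)

text \<open>The variations before and after \<open>s\<close> are both lower semicontinuous and add
  up to the finite total, so each is upper semicontinuous as well.\<close>

lemma variation_continuous:
  assumes con: "continuous_on {0..1} \<gamma>" and fin: "variation d \<gamma> 0 1 < \<infinity>"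
  shows "continuous_on {0..1} (\<lambda>s. enn2real (variation d \<gamma> 0 s))" unfolding continuous_on_def
proof (intro ballI tendstoI)
  fix s0 e :: real assume s0: "s0 \<in> {0..1}" and e: "e > 0"
  let ?V = "\<lambda>s. enn2real (variation d \<gamma> 0 s)" and ?W = "\<lambda>s. enn2real (variation d \<gamma> s 1)"
  have V: "variation d \<gamma> 0 s = ennreal (?V s)" "variation d \<gamma> s 1 = ennreal (?W s)" "?V s + ?W s = ?V 1" if "s \<in> {0..1}" for s
  proof -
    show 1: "variation d \<gamma> 0 s = ennreal (?V s)" "variation d \<gamma> s 1 = ennreal (?W s)"
      using variation_finite_mono[OF fin, of 0 s] variation_finite_mono[OF fin, of s 1] that by auto
    show "?V s + ?W s = ?V 1" using variation_split[of 0 s 1 \<gamma>] that 1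
      by (metis atLeastAtMost_iff enn2real_nonneg enn2real_plus ennreal_less_top)
  qed
  have e1: "eventually (\<lambda>s. ?V s0 - e < ?V s) (at s0 within {0..1})"
  proof (cases "?V s0 - e < 0")
    case True
    then show ?thesis by (auto intro!: always_eventually less_le_trans[OF _ enn2real_nonneg])
  next
    case False
    then have "ennreal (?V s0 - e) < variation d \<gamma> 0 s0" using e by (subst V(1)[OF s0]) (simp add: ennreal_less_iff)
    from variation_lsc(1)[OF con _ _ this] s0 have "eventually (\<lambda>s. ennreal (?V s0 - e) < variation d \<gamma> 0 s) (at s0 within {0..1})" by auto
    then show ?thesis unfolding eventually_at_filter
      by eventually_elim (metis False V(1) ennreal_less_iff not_less)
  qed
  have e2: "eventually (\<lambda>s. ?W s0 - e < ?W s) (at s0 within {0..1})"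
  proof (cases "?W s0 - e < 0")
    case True
    then show ?thesis by (auto intro!: always_eventually less_le_trans[OF _ enn2real_nonneg])
  next
    case False
    then have "ennreal (?W s0 - e) < variation d \<gamma> s0 1" using e by (subst V(2)[OF s0]) (simp add: ennreal_less_iff)
    from variation_lsc(2)[OF con _ _ this] s0 have "eventually (\<lambda>s. ennreal (?W s0 - e) < variation d \<gamma> s 1) (at s0 within {0..1})" by auto
    then show ?thesis unfolding eventually_at_filter
      by eventually_elim (metis False V(2) ennreal_less_iff not_less)
  qed
  show "eventually (\<lambda>s. dist (?V s) (?V s0) < e) (at s0 within {0..1})"
    using e1 e2 unfolding eventually_at_filter
  proof eventually_elim
    case (elim s)
    show ?case
    proof (intro impI)
      assume "s \<noteq> s0" "s \<in> {0..1}"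
      then show "dist (?V s) (?V s0) < e" using elim V(3)[of s] V(3)[OF s0] by (auto simp: dist_real_def)
    qed
  qed
qed

section \<open>Constant speed representatives\<close>

lemma variation_eq_imp_eq:
  assumes fin: "variation d \<gamma> 0 1 < \<infinity>" and s: "0 \<le> s" "s \<le> 1" "0 \<le> t" "t \<le> 1"
    and eq: "variation d \<gamma> 0 s = variation d \<gamma> 0 t" shows "\<gamma> s = \<gamma> t"
proof -
  have *: "\<gamma> s = \<gamma> t" if "0 \<le> s" "s \<le> t" "t \<le> 1" "variation d \<gamma> 0 s = variation d \<gamma> 0 t" for s t
  proof -
    have "variation d \<gamma> 0 s + variation d \<gamma> s t = variation d \<gamma> 0 s + 0"
      using variation_split[of 0 s t \<gamma>] that by simp
    moreover have "variation d \<gamma> 0 s \<noteq> \<infinity>" using variation_finite_mono[OF fin, of 0 s] that by auto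
    ultimately have "variation d \<gamma> s t = 0" by (metis ennreal_add_left_cancel infinity_ennreal_def)
    then have "d (\<gamma> s) (\<gamma> t) = 0" using variation_ge[of s s t t d \<gamma>] that by simp
    then show ?thesis by (simp add: d_eq_0)
  qed
  show ?thesis
  proof (cases "s \<le> t")
    case True
    then show ?thesis using *[of s t] s eq by simp
  next
    case False
    then show ?thesis using *[of t s] s eq[symmetric] by simp
  qed
qed

text \<open>In spite of the name the speed is \<open>L\<close>, which is also the length on
  \<open>[0,1]\<close>. Prescribing the variation on every subinterval is convenient for
  restrictions of the curve.\<close>

definition unit_speed :: "real => (real => 'a) => bool" where
  "unit_speed L R \<longleftrightarrow> R \<in> curves \<and> L \<ge> 0 \<and> (\<forall>s t. 0 \<le> s \<longrightarrow> s \<le> t \<longrightarrow> t \<le> 1 \<longrightarrow> variation d R s t = ennreal (L * (t - s)))"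

lemma unit_speedI:
  assumes "R \<in> curves" "L \<ge> 0" "\<And>t. 0 \<le> t ==> t \<le> 1 ==> variation d R 0 t = ennreal (L * t)"
  shows "unit_speed L R"
proof -
  have "variation d R s t = ennreal (L * (t - s))" if "0 \<le> s" "s \<le> t" "t \<le> 1" for s t
  proof -
    have "ennreal (L * s) + variation d R s t = ennreal (L * t)"
      using variation_split[of 0 s t R] that assms by simp
    also have "... = ennreal (L * s) + ennreal (L * (t - s))"
    proof -
      have "L * t = L * s + L * (t - s)" by (simp add: algebra_simps)
      moreover have "0 \<le> L * s" "0 \<le> L * (t - s)" using that assms by auto
      ultimately show ?thesis by (metis ennreal_plus)
    qed
    finally show ?thesis by (metis ennreal_add_left_cancel ennreal_neq_top infinity_ennreal_def)
  qed
  then show ?thesis unfolding unit_speed_def using assms by blast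
qed

lemma unit_speed_d_le:
  assumes "unit_speed L R" "0 \<le> s" "s \<le> t" "t \<le> 1" shows "d (R s) (R t) \<le> ennreal (L * (t - s))"
  using variation_ge[of s s t t d R] assms unfolding unit_speed_def by auto

text \<open>Normalized arc length \<theta> is a reparametrization. A curve does not move while its
  variation stands still, so \<gamma> factors through \<theta>; any right inverse \<open>g\<close>
  of \<theta> produces the factor \<open>R\<close>, which is continuous because it is Lipschitz for
  \<open>d\<close>.\<close>

lemma ex_unit_speed:
  assumes \<gamma>: "\<gamma> \<in> curves" and fin: "variation d \<gamma> 0 1 < \<infinity>"
  obtains R where "(\<gamma>, R) \<in> arc_rel" "unit_speed (enn2real (variation d \<gamma> 0 1)) R"
proof -
  define L where "L = enn2real (variation d \<gamma> 0 1)"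
  have L: "variation d \<gamma> 0 1 = ennreal L" "L \<ge> 0" using fin by (auto simp: L_def)
  have con: "continuous_on {0..1} \<gamma>" and ext: "\<gamma> \<in> extensional {0..1}" using \<gamma> unfolding curves_def by auto
  define V where "V s = enn2real (variation d \<gamma> 0 s)" for s
  have V: "variation d \<gamma> 0 s = ennreal (V s)" if "s \<in> {0..1}" for s
    using variation_finite_mono[OF fin, of 0 s] that by (auto simp: V_def)
  have V0: "V 0 = 0" using variation_refl[of d \<gamma> 0] by (simp add: V_def)
  have V1: "V 1 = L" by (simp add: V_def L_def)
  have Vnn: "V s \<ge> 0" for s by (simp add: V_def)
  have Vd: "variation d \<gamma> s t = ennreal (V t - V s)" "V s \<le> V t" if "0 \<le> s" "s \<le> t" "t \<le> 1" for s t
  proof -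
    have eq: "ennreal (V s) + variation d \<gamma> s t = ennreal (V t)"
      using variation_split[of 0 s t \<gamma>] that V[of s] V[of t] by auto
    then have "ennreal (V s) \<le> ennreal (V t)" by (metis add_increasing2 order_refl zero_le)
    then show le: "V s \<le> V t" using Vnn[of t] by (simp add: ennreal_le_iff)
    have "ennreal (V t) = ennreal (V s) + ennreal (V t - V s)"
      using le Vnn[of s] by (simp add: ennreal_plus[symmetric] del: ennreal_plus)
    with eq show "variation d \<gamma> s t = ennreal (V t - V s)"
      by (metis ennreal_add_left_cancel ennreal_neq_top infinity_ennreal_def)
  qed
  show ?thesis
  proof (cases "L = 0")
    \<comment> \<open>For length 0 arc length cannot be normalized; the variation vanishes
      identically and the curve represents itself.\<close>
    case True
    have "variation d \<gamma> 0 t = 0" if "0 \<le> t" "t \<le> 1" for t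
      using variation_mono[of 0 0 t 1 d \<gamma>] that L True by simp
    then have "unit_speed L \<gamma>" using True by (intro unit_speedI \<gamma>) auto
    then show ?thesis using that arc_rel_refl[OF \<gamma>] by (simp add: L_def)
  next
    case False
    then have Lp: "L > 0" using L by simp
    define \<theta> where "\<theta> s = V s / L" for s
    have \<theta>: "reparametrization \<theta>"
    proof (rule reparametrizationI)
      show "continuous_on {0..1} \<theta>"
        using variation_continuous[OF con fin] Lp unfolding \<theta>_def V_def by (intro continuous_intros) auto
    qed (use Vd(2) V0 V1 Lp in \<open>auto simp: \<theta>_def divide_right_mono\<close>)
    note T = reparametrizationD[OF \<theta>]
    obtain g where g: "\<And>r. 0 \<le> r ==> r \<le> 1 ==> 0 \<le> g r \<and> g r \<le> 1 \<and> \<theta> (g r) = r" using T(7) by metis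
    define R where "R = restrict (\<lambda>r. \<gamma> (g r)) {0..1}"
    have Vg: "V (g r) = L * r" if "0 \<le> r" "r \<le> 1" for r
      using g[OF that] Lp by (auto simp: \<theta>_def field_simps)
    have R\<theta>: "R (\<theta> s) = \<gamma> s" if s: "0 \<le> s" "s \<le> 1" for s
    proof -
      have *: "0 \<le> \<theta> s" "\<theta> s \<le> 1" using T(5) s by auto
      have "V (g (\<theta> s)) = V s" using Vg[OF *] Lp by (simp add: \<theta>_def)
      then have "\<gamma> (g (\<theta> s)) = \<gamma> s" by (intro variation_eq_imp_eq[OF fin]) (use g[OF *] s V in auto)
      then show ?thesis using * by (simp add: R_def)
    qed
    have dR: "d (R r) (R r') \<le> ennreal (L * (r' - r))" if r: "r \<in> {0..1}" "r' \<in> {0..1}" "r \<le> r'" for r r'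
    proof (cases "g r \<le> g r'")
      case True
      then have "d (R r) (R r') \<le> variation d \<gamma> (g r) (g r')" using variation_ge[of "g r" "g r" "g r'" "g r'" d \<gamma>] r by (simp add: R_def)
      also have "... = ennreal (L * (r' - r))" using Vd(1)[of "g r" "g r'"] True g[of r] g[of r'] r Vg by (simp add: right_diff_distrib)
      finally show ?thesis .
    next
      case False
      then have "V (g r') \<le> V (g r)" using Vd(2)[of "g r'" "g r"] g[of r] g[of r'] r by auto
      then have "L * r' \<le> L * r" using Vg r by auto
      then have "r = r'" using Lp r by simp
      then show ?thesis by simp
    qed
    have "continuous_on {0..1} R" by (rule lipschitz_imp_continuous[OF _ L(2)]) (rule dR)
    then have Rc: "R \<in> curves" unfolding curves_def by (simp add: R_def)
    have rel: "(\<gamma>, R) \<in> arc_rel" unfolding arc_rel_def using \<gamma> Rc reparametrization_id \<theta> R\<theta> by force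
    have "unit_speed L R"
    proof (rule unit_speedI[OF Rc L(2)])
      fix t :: real assume t: "0 \<le> t" "t \<le> 1"
      have gt: "0 \<le> g t" "g t \<le> 1" "\<theta> (g t) = t" using g t by auto
      have sub: "{0..g t} \<subseteq> {0..1}" using gt by auto
      have "variation d R 0 t = gvar d UNIV R (\<theta> 0) (\<theta> (g t))" using gt T(3) by (simp add: variation_eq_gvar)
      also have "... = gvar d UNIV (\<lambda>s. R (\<theta> s)) 0 (g t)"
        using gvar_reparam[OF mono_on_subset[OF T(2) sub] continuous_on_subset[OF T(1) sub] gt(1), of d UNIV R] by simp
      also have "... = gvar d UNIV \<gamma> 0 (g t)" by (rule gvar_cong) (use gt R\<theta> in auto)
      also have "... = ennreal (L * t)" using V[of "g t"] gt Vg t by (simp add: variation_eq_gvar)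
      finally show "variation d R 0 t = ennreal (L * t)" .
    qed
    then show ?thesis using that rel by (simp add: L_def)
  qed
qed

definition rlen :: "'a arc => real" where "rlen Z = enn2real (arc_length d Z)"
abbreviation rep :: "'a arc => real => 'a" where "rep \<equiv> constant_speed_rep d"

lemma RA_memD:
  assumes "Z \<in> RA d" "\<gamma> \<in> Z"
  shows "\<gamma> \<in> curves" "arc_length d Z = variation d \<gamma> 0 1" "variation d \<gamma> 0 1 < \<infinity>"
    "variation d \<gamma> 0 1 = ennreal (rlen Z)"
proof -
  obtain \<gamma>0 where g0: "Z = arc_rel `` {\<gamma>0}" "\<gamma>0 \<in> curves" "variation d \<gamma>0 0 1 < \<infinity>"
    using assms unfolding RA_def by auto
  have v: "variation d \<sigma> 0 1 = variation d \<gamma>0 0 1" if "\<sigma> \<in> Z" for \<sigma>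
    using that g0 arc_rel_gvar[of \<gamma>0 \<sigma> d UNIV] by (auto simp: variation_eq_gvar)
  show "\<gamma> \<in> curves" using assms g0 unfolding arc_rel_def by auto
  show 1: "arc_length d Z = variation d \<gamma> 0 1"
    unfolding arc_length_def using v[OF assms(2)] v[of "SOME \<gamma>. \<gamma> \<in> Z"] assms(2) by (metis someI_ex)
  show 2: "variation d \<gamma> 0 1 < \<infinity>" using v[OF assms(2)] g0 by simp
  show "variation d \<gamma> 0 1 = ennreal (rlen Z)" unfolding rlen_def 1 using 2 by simp
qed

text \<open>Travelled variation is an intrinsic coordinate on an arc. Both points are compared with
  the defining curve \<open>\<gamma>0\<close>, since representatives are at this stage related to it
  and not to each other.\<close>

lemma RA_match:
  assumes "Z \<in> RA d" "\<gamma> \<in> Z" "\<sigma> \<in> Z" "0 \<le> s" "s \<le> 1" "0 \<le> t" "t \<le> 1" "variation d \<gamma> 0 s = variation d \<sigma> 0 t"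
  shows "\<gamma> s = \<sigma> t"
proof -
  obtain \<gamma>0 where g0: "Z = arc_rel `` {\<gamma>0}" "\<gamma>0 \<in> curves" "variation d \<gamma>0 0 1 < \<infinity>"
    using assms unfolding RA_def by auto
  have rel: "(\<gamma>, \<gamma>0) \<in> arc_rel" "(\<sigma>, \<gamma>0) \<in> arc_rel" using assms g0 arc_rel_sym by auto
  obtain s' where s': "0 \<le> s'" "s' \<le> 1" "\<gamma>0 s' = \<gamma> s" "variation d \<gamma>0 0 s' = variation d \<gamma> 0 s"
    using arc_rel_match[OF rel(1) assms(4,5)] by metis
  obtain t' where t': "0 \<le> t'" "t' \<le> 1" "\<gamma>0 t' = \<sigma> t" "variation d \<gamma>0 0 t' = variation d \<sigma> 0 t"
    using arc_rel_match[OF rel(2) assms(6,7)] by metis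
  have "\<gamma>0 s' = \<gamma>0 t'" by (rule variation_eq_imp_eq[OF g0(3)]) (use s' t' assms in auto)
  then show ?thesis using s' t' by simp
qed

lemma curves_eqI:
  assumes "R \<in> curves" "R' \<in> curves" "\<And>t. 0 \<le> t ==> t \<le> 1 ==> R t = R' t" shows "R = R'"
  by (rule extensionalityI[of _ "{0..1}"]) (use assms in \<open>auto simp: curves_def\<close>)

text \<open>Two constant speed representatives agree at each time by \<open>RA_match\<close>, so the
  definite description in \<open>constant_speed_rep\<close> denotes the one that
  \<open>ex_unit_speed\<close> provides.\<close>

lemma rep_in: assumes "Z \<in> RA d" shows "rep Z \<in> Z" "unit_speed (rlen Z) (rep Z)"
  and rep_unique: "\<And>R. R \<in> Z ==> unit_speed (rlen Z) R ==> rep Z = R"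
proof -
  obtain \<gamma>0 where g0: "Z = arc_rel `` {\<gamma>0}" "\<gamma>0 \<in> curves" "variation d \<gamma>0 0 1 < \<infinity>"
    using assms unfolding RA_def by auto
  have g0in: "\<gamma>0 \<in> Z" using g0 arc_rel_refl by auto
  obtain R where R: "(\<gamma>0, R) \<in> arc_rel" "unit_speed (enn2real (variation d \<gamma>0 0 1)) R"
    using ex_unit_speed[OF g0(2,3)] by metis
  have len: "arc_length d Z = ennreal (rlen Z)" "rlen Z \<ge> 0"
    using RA_memD[OF assms g0in] by (auto simp: rlen_def)
  have R': "R \<in> Z" "unit_speed (rlen Z) R" using R g0 RA_memD(2)[OF assms g0in] by (auto simp: rlen_def)
  have iff: "R \<in> Z \<and> (\<forall>t \<in> {0..1}. variation d R 0 t = arc_length d Z * ennreal t) \<longleftrightarrow> R \<in> Z \<and> unit_speed (rlen Z) R" for R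
  proof
    assume "R \<in> Z \<and> (\<forall>t \<in> {0..1}. variation d R 0 t = arc_length d Z * ennreal t)"
    then show "R \<in> Z \<and> unit_speed (rlen Z) R" using len RA_memD(1)[OF assms] by (auto intro!: unit_speedI simp: ennreal_mult)
  next
    assume "R \<in> Z \<and> unit_speed (rlen Z) R"
    then show "R \<in> Z \<and> (\<forall>t \<in> {0..1}. variation d R 0 t = arc_length d Z * ennreal t)"
      unfolding unit_speed_def using len by (auto simp: ennreal_mult)
  qed
  have uniq: "R1 = R2" if "R1 \<in> Z" "unit_speed (rlen Z) R1" "R2 \<in> Z" "unit_speed (rlen Z) R2" for R1 R2
  proof (rule curves_eqI)
    fix t :: real assume "0 \<le> t" "t \<le> 1"
    then show "R1 t = R2 t" using that by (intro RA_match[OF assms that(1,3)]) (auto simp: unit_speed_def)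
  qed (use that in \<open>auto simp: unit_speed_def\<close>)
  have rep: "rep Z = R" if "R \<in> Z" "unit_speed (rlen Z) R" for R
    unfolding constant_speed_rep_def iff using that uniq by (intro the_equality) auto
  show "rep Z \<in> Z" "unit_speed (rlen Z) (rep Z)" using rep[OF R'] R' by auto
  show "\<And>R. R \<in> Z ==> unit_speed (rlen Z) R ==> rep Z = R" using rep by blast
qed

lemma arc_length_eq: "Z \<in> RA d ==> arc_length d Z = ennreal (rlen Z)"
  and rlen_nonneg [simp]: "rlen Z \<ge> 0" using RA_memD(2,4)[OF _ rep_in(1)] by (auto simp: rlen_def)

lemma rep_curve: "Z \<in> RA d ==> rep Z \<in> curves" "Z \<in> RA d ==> continuous_on {0..1} (rep Z)"
  using rep_in(2) unfolding unit_speed_def curves_def by auto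

text \<open>Normalized arc length of \<alpha> is the required \<theta>. On an arc of length 0 the
  quotient degenerates and the identity serves instead.\<close>

lemma RA_factor:
  assumes "Z \<in> RA d" "\<alpha> \<in> Z"
  obtains \<theta> where "reparametrization \<theta>" "\<And>s. 0 \<le> s ==> s \<le> 1 ==> \<alpha> s = rep Z (\<theta> s)"
proof (cases "rlen Z = 0")
  case True
  have "\<alpha> s = rep Z s" if "0 \<le> s" "s \<le> 1" for s
  proof (rule RA_match[OF assms rep_in(1)[OF assms(1)] that that])
    have "variation d \<alpha> 0 s \<le> variation d \<alpha> 0 1" using that by (intro variation_mono) auto
    then have "variation d \<alpha> 0 s = 0" using RA_memD(4)[OF assms] True by simp
    then show "variation d \<alpha> 0 s = variation d (rep Z) 0 s" using rep_in(2)[OF assms(1)] True that unfolding unit_speed_def by simp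
  qed
  then show ?thesis using that reparametrization_id by blast
next
  case False
  then have Lp: "rlen Z > 0" using rlen_nonneg[of Z] by linarith
  note A = RA_memD[OF assms]
  define V where "V s = enn2real (variation d \<alpha> 0 s)" for s
  have V: "variation d \<alpha> 0 s = ennreal (V s)" if "s \<in> {0..1}" for s
    using variation_finite_mono[OF A(3), of 0 s] that by (auto simp: V_def)
  have mono: "V s \<le> V t" if "0 \<le> s" "s \<le> t" "t \<le> 1" for s t
  proof -
    have "ennreal (V s) \<le> ennreal (V t)" using variation_mono[of 0 0 s t d \<alpha>] that V[of s] V[of t] by simp
    moreover have "0 \<le> V t" by (simp add: V_def)
    ultimately show ?thesis by simp
  qed
  have "V 0 = 0" using variation_refl[of d \<alpha> 0] by (simp add: V_def)
  moreover have V1: "V 1 = rlen Z" using A by (simp add: V_def)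
  moreover have "continuous_on {0..1} V" using variation_continuous[OF _ A(3)] A(1) unfolding V_def curves_def by auto
  ultimately have \<theta>: "reparametrization (\<lambda>s. V s / rlen Z)"
    using mono Lp by (intro reparametrizationI continuous_intros) (auto simp: divide_right_mono)
  show ?thesis
  proof (rule that[OF \<theta>])
    fix s :: real assume s: "0 \<le> s" "s \<le> 1"
    have *: "0 \<le> V s / rlen Z" "V s / rlen Z \<le> 1" using reparametrizationD(5)[OF \<theta> s] by auto
    show "\<alpha> s = rep Z (V s / rlen Z)" by (rule RA_match[OF assms rep_in(1)[OF assms(1)] s *])
         (use V[of s] s rep_in(2)[OF assms(1)] Lp * in \<open>auto simp: unit_speed_def\<close>)
  qed
qed

text \<open>The defining curve and \<alpha> both factor through the constant speed representative;
  the pullback of the two factors is the common reparametrization that \<open>arc_rel\<close>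
  demands.\<close>

lemma RA_memI:
  assumes "Z \<in> RA d" "\<alpha> \<in> curves" "reparametrization \<theta>" "\<And>s. 0 \<le> s ==> s \<le> 1 ==> \<alpha> s = rep Z (\<theta> s)"
  shows "\<alpha> \<in> Z"
proof -
  obtain \<gamma>0 where g0: "Z = arc_rel `` {\<gamma>0}" "\<gamma>0 \<in> curves" "variation d \<gamma>0 0 1 < \<infinity>"
    using assms unfolding RA_def by auto
  have "\<gamma>0 \<in> Z" using g0 arc_rel_refl by auto
  then obtain \<eta> where \<eta>: "reparametrization \<eta>" "\<And>s. 0 \<le> s ==> s \<le> 1 ==> \<gamma>0 s = rep Z (\<eta> s)"
    using RA_factor[OF assms(1)] by metis
  obtain \<phi> \<psi> where pq: "reparametrization \<phi>" "reparametrization \<psi>" "\<And>t. 0 \<le> t ==> t \<le> 1 ==> \<eta> (\<phi> t) = \<theta> (\<psi> t)"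
    using reparametrization_pullback[OF \<eta>(1) assms(3)] by metis
  have "\<gamma>0 (\<phi> t) = \<alpha> (\<psi> t)" if "0 \<le> t" "t \<le> 1" for t
    using reparametrizationD(5)[OF pq(1) that] reparametrizationD(5)[OF pq(2) that] pq(3)[OF that] \<eta>(2) assms(4) by metis
  then have "\<forall>t\<in>{0..1}. \<gamma>0 (\<phi> t) = \<alpha> (\<psi> t)" by simp
  then have "(\<gamma>0, \<alpha>) \<in> arc_rel" unfolding arc_rel_def using g0(2) assms(2) pq(1,2) by blast
  then show ?thesis using g0 by auto
qed

lemma RA_eqI:
  assumes "Z \<in> RA d" "Z' \<in> RA d" "rep Z = rep Z'" shows "Z = Z'"
proof -
  have *: "Z \<subseteq> Z'" if G: "Z \<in> RA d" "Z' \<in> RA d" "rep Z = rep Z'" for Z Z'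
  proof
    fix \<alpha> assume a: "\<alpha> \<in> Z"
    obtain \<theta> where "reparametrization \<theta>" "\<And>s. 0 \<le> s ==> s \<le> 1 ==> \<alpha> s = rep Z (\<theta> s)"
      using RA_factor[OF G(1) a] by metis
    then show "\<alpha> \<in> Z'" using RA_memI[OF G(2) RA_memD(1)[OF G(1) a]] G(3) by metis
  qed
  show ?thesis using *[OF assms] *[OF assms(2,1) assms(3)[symmetric]] by blast
qed

text \<open>Lets explicitly constructed curves, such as restrictions to subintervals, be used as
  arcs whose representative is known.\<close>

lemma unit_speed_arc:
  assumes R: "unit_speed L R"
  shows "arc_rel `` {R} \<in> RA d" "rep (arc_rel `` {R}) = R" "rlen (arc_rel `` {R}) = L"
proof -
  have Rc: "R \<in> curves" and L: "L \<ge> 0" and v: "variation d R 0 1 = ennreal L" using R unfolding unit_speed_def by auto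
  have "d_continuous d R" unfolding d_continuous_def
  proof
    fix s :: real assume s: "s \<in> {0..1}"
    have le: "d (R s) (R t) \<le> ennreal (L * \<bar>t - s\<bar>)" if "t \<in> {0..1}" for t
      using unit_speed_d_le[OF R, of s t] unit_speed_d_le[OF R, of t s] s that d_sym[of "R s" "R t"] by (cases "s \<le> t") auto
    have "((\<lambda>t. ennreal (L * \<bar>t - s\<bar>)) \<longlongrightarrow> ennreal (L * \<bar>s - s\<bar>)) (at s within {0..1})"
      by (intro tendsto_ennrealI tendsto_intros)
    then have t0: "((\<lambda>t. ennreal (L * \<bar>t - s\<bar>)) \<longlongrightarrow> 0) (at s within {0..1})" by simp
    show "((\<lambda>t. d (R s) (R t)) \<longlongrightarrow> 0) (at s within {0..1})"
      by (rule tendsto_sandwich[OF _ _ tendsto_const t0]) (use le in \<open>auto simp: eventually_at_filter\<close>)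
  qed
  then show ra: "arc_rel `` {R} \<in> RA d" unfolding RA_def using Rc v by auto
  have Rin: "R \<in> arc_rel `` {R}" using arc_rel_refl[OF Rc] by auto
  show l: "rlen (arc_rel `` {R}) = L" using RA_memD(4)[OF ra Rin] v L by simp
  show "rep (arc_rel `` {R}) = R" using rep_unique[OF ra Rin] R l by simp
qed
end

section \<open>Densities of real functions\<close>

lemma borel_sets_Ioc: "sets borel = sigma_sets UNIV (range (\<lambda>(a, b). {a<..b::real}))"
  by (subst borel_sigma_sets_Ioc) simp

text \<open>Uniqueness of measures by disjoint induction over the generated \<sigma>-algebra, stated
  for a sum so that no difference of measures has to be formed. Finiteness of \<open>N\<close>
  bounds all three measures and permits cancellation at complements.\<close>

lemma emeasure_sum_eq_on_Ioc:
  fixes M M' N :: "real measure"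
  assumes sets: "sets M = sets borel" "sets M' = sets borel" "sets N = sets borel"
    and fin: "emeasure N UNIV < \<infinity>"
    and eq: "\<And>a b. a \<le> b ==> emeasure M {a<..b} + emeasure M' {a<..b} = emeasure N {a<..b}"
    and A: "A \<in> sets borel" shows "emeasure M A + emeasure M' A = emeasure N A"
proof -
  have eq': "emeasure M {a<..b} + emeasure M' {a<..b} = emeasure N {a<..b}" for a b
    using eq[of a b] by (cases "a \<le> b") auto
  have space: "space M = UNIV" "space M' = UNIV" "space N = UNIV"
    using sets[THEN sets_eq_imp_space_eq] by auto
  have lim: "(\<lambda>n. emeasure L {- real n<..real n}) \<longlonglongrightarrow> emeasure L UNIV" if "sets L = sets borel" for L
  proof -
    have "(\<Union>n. {- real n<..real n}) = UNIV"
    proof safe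
      fix x :: real
      obtain n where "\<bar>x\<bar> < real n" using reals_Archimedean2 by blast
      then show "x \<in> (\<Union>n. {- real n<..real n})" by (intro UN_I[of n]) auto
    qed simp
    moreover have "(\<lambda>n. emeasure L {- real n<..real n}) \<longlonglongrightarrow> emeasure L (\<Union>n. {- real n<..real n})"
    proof (rule Lim_emeasure_incseq)
      show "range (\<lambda>n. {- real n<..real n}) \<subseteq> sets L" by (simp add: that image_subset_iff)
      show "incseq (\<lambda>n. {- real n<..real n})" unfolding incseq_def
      proof (intro allI impI subsetI)
        fix m n :: nat and x assume "m \<le> n" "x \<in> {- real m<..real m}"
        moreover then have "real m \<le> real n" by simp
        ultimately show "x \<in> {- real n<..real n}" unfolding greaterThanAtMost_iff by linarith
      qed
    qed
    ultimately show ?thesis by simp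
  qed
  have univ: "emeasure M UNIV + emeasure M' UNIV = emeasure N UNIV"
    using tendsto_add[OF lim[OF sets(1)] lim[OF sets(2)]] lim[OF sets(3)]
    unfolding eq' by (rule LIMSEQ_unique)
  have finM: "emeasure M B \<noteq> \<infinity>" "emeasure M' B \<noteq> \<infinity>" "emeasure N B \<noteq> \<infinity>" for B
  proof -
    have "emeasure M UNIV \<le> emeasure N UNIV" "emeasure M' UNIV \<le> emeasure N UNIV"
      unfolding univ[symmetric] by auto
    moreover have "emeasure L B \<le> emeasure L UNIV" if "sets L = sets borel" for L
      using that sets_eq_imp_space_eq[OF that] emeasure_space[of L B] by simp
    ultimately show "emeasure M B \<noteq> \<infinity>" "emeasure M' B \<noteq> \<infinity>" "emeasure N B \<noteq> \<infinity>"
      using fin sets by (metis infinity_ennreal_def leD order_trans top.not_eq_extremum)+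
  qed
  have Int: "Int_stable (range (\<lambda>(a, b). {a<..b::real}))"
  proof (rule Int_stableI_image, safe)
    fix a b a' b' :: real
    show "\<exists>k\<in>UNIV. {a<..b} \<inter> {a'<..b'} = (case k of (a, b) => {a<..b})"
      by (intro bexI[of _ "(max a a', min b b')"]) auto
  qed
  have subset_UNIV_Pow: "range (\<lambda>(a, b). {a<..b::real}) \<subseteq> Pow UNIV" by simp
  have "A \<in> sigma_sets UNIV (range (\<lambda>(a, b). {a<..b::real}))" using A borel_sets_Ioc by simp
  from Int subset_UNIV_Pow this show ?thesis
  proof (induction rule: sigma_sets_induct_disjoint)
    case (basic A)
    then show ?case using eq' by auto
  next
    case empty
    show ?case by simp
  next
    case (compl A)
    then have Ab: "A \<in> sets borel" using borel_sets_Ioc by simp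
    have c: "emeasure L UNIV = emeasure L A + emeasure L (UNIV - A)" if "sets L = sets borel" for L
      using plus_emeasure[of A L "UNIV - A"] Ab that by auto
    have "(emeasure M A + emeasure M' A) + (emeasure M (UNIV - A) + emeasure M' (UNIV - A)) = emeasure N A + emeasure N (UNIV - A)"
      using univ c sets by (simp add: ac_simps)
    then show ?case using compl.IH finM by (metis ennreal_add_left_cancel infinity_ennreal_def)
  next
    case (union A)
    then have Ab: "range A \<subseteq> sets borel" using borel_sets_Ioc by auto
    have s: "emeasure L (\<Union> (range A)) = (\<Sum>i. emeasure L (A i))" if "sets L = sets borel" for L
      using suminf_emeasure[of A L] Ab that union by simp
    show ?case unfolding s[OF sets(1)] s[OF sets(2)] s[OF sets(3)]
      using union.IH by (simp add: suminf_add)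
  qed
qed

section \<open>Primitives and absolutely continuous functions\<close>

abbreviation ioc_integral :: "(real => real) => real => real => real" where
  "ioc_integral h a b \<equiv> (LINT x:{a<..b}|lborel. h x)"

definition prim :: "(real => real) => real => real" where
  "prim h x = (LINT y:{..x}|lborel. h y)"

lemma set_integrable_lborel: "integrable lborel h ==> A \<in> sets borel ==> set_integrable lborel A (h :: real => real)"
  unfolding set_integrable_def using integrable_mult_indicator[of A lborel h] by simp

lemma prim_diff:
  assumes h: "integrable lborel h" and "a \<le> b" shows "prim h b - prim h a = ioc_integral h a b"
proof -
  have "{..b} = {..a} \<union> {a<..b}" using assms by auto
  then have "prim h b = prim h a + ioc_integral h a b"
    unfolding prim_def using h by (simp add: set_integral_Un set_integrable_lborel disjoint_iff)
  then show ?thesis by simp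
qed

lemma isCont_prim:
  assumes h: "integrable lborel h" shows "isCont (prim h) a"
  unfolding continuous_at_sequentially comp_def
proof (intro allI impI)
  fix x :: "nat => real" assume x: "x \<longlonglongrightarrow> a"
  have [measurable]: "h \<in> borel_measurable borel" using h by auto
  show "(\<lambda>n. prim h (x n)) \<longlonglongrightarrow> prim h a" unfolding prim_def set_lebesgue_integral_def
  proof (rule integral_dominated_convergence[where w = "\<lambda>y. \<bar>h y\<bar>"])
    show "AE y in lborel. (\<lambda>n. indicator {..x n} y *\<^sub>R h y) \<longlonglongrightarrow> indicator {..a} y *\<^sub>R h y"
      using AE_lborel_singleton[of a]
    proof eventually_elim
      case (elim y)
      have "eventually (\<lambda>n. indicator {..x n} y = (indicator {..a} y :: real)) sequentially"
      proof (cases "y < a")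
        case True
        then show ?thesis using order_tendstoD(1)[OF x, of y] by (auto elim!: eventually_mono)
      next
        case False
        then have "a < y" using elim by simp
        then show ?thesis using order_tendstoD(2)[OF x, of y] by (auto elim!: eventually_mono)
      qed
      then have "eventually (\<lambda>n. indicator {..x n} y *\<^sub>R h y = indicator {..a} y *\<^sub>R h y) sequentially"
        by eventually_elim simp
      then show ?case by (rule tendsto_eventually)
    qed
  qed (use h in \<open>auto split: split_indicator\<close>)
qed

lemma emeasure_density_Ioc:
  assumes h: "integrable lborel h" "\<And>x. 0 \<le> h x" and A: "A \<in> sets borel"
  shows "emeasure (density lborel (\<lambda>x. ennreal (h x))) A = ennreal (LINT x:A|lborel. h x)"
proof -
  have [measurable]: "h \<in> borel_measurable borel" using h by auto
  have "emeasure (density lborel (\<lambda>x. ennreal (h x))) A = (\<integral>\<^sup>+x. ennreal (indicator A x *\<^sub>R h x) \<partial>lborel)"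
    using A by (auto simp: emeasure_density intro!: nn_integral_cong split: split_indicator)
  also have "... = ennreal (LINT x:A|lborel. h x)" unfolding set_lebesgue_integral_def
    by (rule nn_integral_eq_integral) (use h A integrable_mult_indicator[of A lborel h] in auto)
  finally show ?thesis .
qed

text \<open>The primitive of \<open>h\<close> is nondecreasing. Its Stieltjes measure plus the
  negative part of \<open>h\<close> equals the positive part on intervals, hence on Borel sets; on
  \<open>{x. h x < 0}\<close> the positive part has no mass, so the negative part has none.\<close>

lemma AE_nonneg_if_Ioc:
  assumes h: "integrable lborel h" and nn: "\<And>a b. a \<le> b ==> 0 \<le> ioc_integral h a b"
  shows "AE x in lborel. 0 \<le> h x"
proof -
  have [measurable]: "h \<in> borel_measurable borel" using h by auto
  define P N where "P = density lborel (\<lambda>x. ennreal (max 0 (h x)))" and "N = density lborel (\<lambda>x. ennreal (max 0 (- h x)))"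
  define M where "M = interval_measure (prim h)"
  have mono: "prim h x \<le> prim h y" if "x \<le> y" for x y using prim_diff[OF h that] nn[OF that] by simp
  have rc: "continuous (at_right a) (prim h)" for a
    using isCont_prim[OF h, of a] by (rule continuous_at_imp_continuous_at_within)
  have ip: "integrable lborel (\<lambda>x. max 0 (h x))" "integrable lborel (\<lambda>x. max 0 (- h x))" using h by auto
  have eq: "emeasure M {a<..b} + emeasure N {a<..b} = emeasure P {a<..b}" if "a \<le> b" for a b
  proof -
    have "ioc_integral (\<lambda>x. max 0 (h x)) a b - ioc_integral (\<lambda>x. max 0 (- h x)) a b = ioc_integral h a b"
      using ip by (subst set_integral_diff(2)[symmetric])
        (auto intro!: set_integrable_lborel set_lebesgue_integral_cong simp: max_def)
    moreover have "emeasure M {a<..b} = ennreal (ioc_integral h a b)"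
      unfolding M_def using that by (subst emeasure_interval_measure_Ioc) (auto simp: mono rc prim_diff[OF h])
    moreover have "0 \<le> ioc_integral (\<lambda>x. max 0 (- h x)) a b" 
      unfolding set_lebesgue_integral_def by (intro integral_nonneg_AE) (auto split: split_indicator)
    ultimately show ?thesis using nn[OF that] ip unfolding P_def N_def
      by (simp add: emeasure_density_Ioc ennreal_plus[symmetric] del: ennreal_plus)
  qed
  define A where "A = {x. h x < 0}"
  have A: "A \<in> sets borel" unfolding A_def by measurable
  have "emeasure M A + emeasure N A = emeasure P A"
  proof (rule emeasure_sum_eq_on_Ioc[OF _ _ _ _ eq A])
    show "emeasure P UNIV < \<infinity>" unfolding P_def using emeasure_density_Ioc[OF ip(1), of UNIV] by simp
  qed (auto simp: M_def N_def P_def)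
  moreover have "emeasure P A = 0"
  proof -
    have "(\<integral>\<^sup>+x\<in>A. ennreal (max 0 (h x)) \<partial>lborel) = (\<integral>\<^sup>+x. 0 \<partial>(lborel :: real measure))"
      by (intro nn_integral_cong) (auto simp: A_def max_def split: split_indicator)
    then show ?thesis unfolding P_def using A by (subst emeasure_density) auto
  qed
  ultimately have "emeasure N A = 0" by simp
  then have "AE x in lborel. ennreal (max 0 (- h x)) * indicator A x = 0"
    unfolding N_def using A by (subst (asm) emeasure_density) (auto simp: nn_integral_0_iff_AE)
  then show ?thesis
  proof eventually_elim
    case (elim x)
    show ?case
    proof (rule ccontr)
      assume "\<not> 0 \<le> h x"
      then show False using elim by (simp add: A_def max_def)
    qed
  qed
qed

text \<open>Absolute continuity with \<open>h\<close> in the role of the derivative. Working with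
  integrals over intervals replaces pointwise differentiation and makes \<open>h\<close> unique up
  to null sets.\<close>

definition has_density :: "(real => real) => (real => real) => bool" where
  "has_density g h \<longleftrightarrow> h \<in> borel_measurable borel \<and> integrable lborel h \<and> (\<forall>a b. a \<le> b \<longrightarrow> g b - g a = ioc_integral h a b)"

lemma ioc_integral_add: "integrable lborel h ==> integrable lborel k ==> ioc_integral (\<lambda>x. h x + k x) a b = ioc_integral h a b + ioc_integral k a b"
  by (intro set_integral_add(2) set_integrable_lborel) auto

lemma ioc_integral_diff: "integrable lborel h ==> integrable lborel k ==> ioc_integral (\<lambda>x. h x - k x) a b = ioc_integral h a b - ioc_integral k a b"
  by (intro set_integral_diff(2) set_integrable_lborel) auto

lemma has_density_le:
  assumes "has_density g h" "integrable lborel G" "\<And>a b. a \<le> b ==> g b - g a \<le> ioc_integral G a b"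
  shows "AE x in lborel. h x \<le> G x"
proof -
  have "AE x in lborel. 0 \<le> G x - h x"
    by (rule AE_nonneg_if_Ioc) (use assms in \<open>auto simp: has_density_def ioc_integral_diff\<close>)
  then show ?thesis by eventually_elim simp
qed

lemma has_density_unique:
  assumes "has_density g h" "has_density g k" shows "AE x in lborel. h x = k x"
proof -
  have "AE x in lborel. h x \<le> k x" "AE x in lborel. k x \<le> h x"
    by (rule has_density_le[OF assms(1)], use assms(2) in \<open>auto simp: has_density_def\<close>)
       (rule has_density_le[OF assms(2)], use assms(1) in \<open>auto simp: has_density_def\<close>)
  then show ?thesis by eventually_elim simp
qed

lemma has_density_uminus: "has_density g h ==> has_density (\<lambda>x. - g x) (\<lambda>x. - h x)"
  unfolding has_density_def set_lebesgue_integral_def by (simp, metis minus_diff_eq)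

lemma has_density_abs_le:
  assumes "has_density g h" "integrable lborel G" "\<And>a b. a \<le> b ==> \<bar>g b - g a\<bar> \<le> ioc_integral G a b"
  shows "AE x in lborel. \<bar>h x\<bar> \<le> G x"
proof -
  have "AE x in lborel. h x \<le> G x" by (rule has_density_le[OF assms(1,2)]) (use assms(3) in \<open>smt (verit)\<close>)
  moreover have "AE x in lborel. - h x \<le> G x"
    by (rule has_density_le[OF has_density_uminus[OF assms(1)] assms(2)]) (use assms(3) in \<open>smt (verit)\<close>)
  ultimately show ?thesis by eventually_elim auto
qed

lemma has_density_lincomb:
  assumes "has_density g h" "has_density g' h'"
  shows "has_density (\<lambda>x. \<alpha> * g x + \<beta> * g' x) (\<lambda>x. \<alpha> * h x + \<beta> * h' x)"
proof -
  have "ioc_integral (\<lambda>x. \<alpha> * h x + \<beta> * h' x) a b = \<alpha> * ioc_integral h a b + \<beta> * ioc_integral h' a b" for a b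
    using assms by (subst ioc_integral_add) (auto simp: has_density_def)
  then show ?thesis using assms unfolding has_density_def by (auto simp: algebra_simps)
qed

text \<open>With \<open>K\<close> the primitive of \<open>G\<close>, both \<open>K + g\<close> and
  \<open>K - g\<close> are nondecreasing, and their Stieltjes measures add up to
  \<open>2 * G\<close> times Lebesgue measure. Hence the first is absolutely continuous, and its
  Radon-Nikodym density minus \<open>G\<close> is a density of \<open>g\<close>.\<close>

lemma ex_density:
  assumes G: "integrable lborel G" "\<And>x. 0 \<le> G x" and g: "\<And>a b. a \<le> b ==> \<bar>g b - g a\<bar> \<le> ioc_integral G a b"
  obtains h where "has_density g h"
proof -
  have [measurable]: "G \<in> borel_measurable borel" using G by auto
  define K where "K = prim G"
  have K: "K b - K a = ioc_integral G a b" if "a \<le> b" for a b using prim_diff[OF G(1) that] by (simp add: K_def)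
  have Kc: "isCont K a" for a unfolding K_def by (rule isCont_prim[OF G(1)])
  have gc: "isCont g a" for a
  proof -
    have "\<bar>g x - g a\<bar> \<le> \<bar>K x - K a\<bar>" for x
      using g[of x a] g[of a x] K[of x a] K[of a x] by (cases "x \<le> a") (auto simp: abs_minus_commute)
    moreover have "((\<lambda>x. \<bar>K x - K a\<bar>) \<longlongrightarrow> \<bar>K a - K a\<bar>) (at a)"
      using Kc[of a] unfolding isCont_def by (intro tendsto_intros)
    ultimately have "((\<lambda>x. g x - g a) \<longlongrightarrow> 0) (at a)"
      using Lim_null_comparison[of "\<lambda>x. g x - g a" "\<lambda>x. \<bar>K x - K a\<bar>" "at a"] by simp
    then show ?thesis unfolding isCont_def by (rule LIM_zero_cancel)
  qed
  define M1 M2 N where "M1 = interval_measure (\<lambda>x. K x + g x)" and "M2 = interval_measure (\<lambda>x. K x - g x)"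
    and "N = density lborel (\<lambda>x. ennreal (2 * G x))"
  have m1: "K x + g x \<le> K y + g y" and m2: "K x - g x \<le> K y - g y" if "x \<le> y" for x y
    using K[OF that] g[OF that] by auto
  have rc: "continuous (at_right a) (\<lambda>x. K x + g x)" "continuous (at_right a) (\<lambda>x. K x - g x)" for a
    by (rule continuous_at_imp_continuous_at_within, intro continuous_add Kc gc)
       (rule continuous_at_imp_continuous_at_within, intro continuous_diff Kc gc)
  have e1: "emeasure M1 {a<..b} = ennreal (ioc_integral G a b + (g b - g a))" if "a \<le> b" for a b
  proof -
    have "emeasure M1 {a<..b} = ennreal ((K b + g b) - (K a + g a))"
      unfolding M1_def by (rule emeasure_interval_measure_Ioc[OF that]) (erule m1, rule rc(1))
    moreover have "(K b + g b) - (K a + g a) = ioc_integral G a b + (g b - g a)" using K[OF that] by simp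
    ultimately show ?thesis by simp
  qed
  have e2: "emeasure M2 {a<..b} = ennreal (ioc_integral G a b - (g b - g a))" if "a \<le> b" for a b
  proof -
    have "emeasure M2 {a<..b} = ennreal ((K b - g b) - (K a - g a))"
      unfolding M2_def by (rule emeasure_interval_measure_Ioc[OF that]) (erule m2, rule rc(2))
    moreover have "(K b - g b) - (K a - g a) = ioc_integral G a b - (g b - g a)" using K[OF that] by simp
    ultimately show ?thesis by simp
  qed
  have eq: "emeasure M1 {a<..b} + emeasure M2 {a<..b} = emeasure N {a<..b}" if "a \<le> b" for a b
    using g[OF that] G unfolding N_def e1[OF that] e2[OF that]
    by (subst emeasure_density_Ioc) (auto simp: ennreal_plus[symmetric] simp del: ennreal_plus)
  have sum: "emeasure M1 A + emeasure M2 A = emeasure N A" if "A \<in> sets borel" for A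
  proof (rule emeasure_sum_eq_on_Ioc[OF _ _ _ _ eq that])
    show "emeasure N UNIV < \<infinity>" unfolding N_def using G by (subst emeasure_density_Ioc) auto
  qed (auto simp: M1_def M2_def N_def)
  have sM: "sets M1 = sets borel" by (simp add: M1_def)
  have "absolutely_continuous lborel M1" unfolding absolutely_continuous_def
  proof
    fix A :: "real set" assume A: "A \<in> null_sets lborel"
    then have "A \<in> null_sets N"
      using absolutely_continuousI_density[of "\<lambda>x. ennreal (2 * G x)" lborel] unfolding absolutely_continuous_def N_def by auto
    then have "emeasure N A = 0" and Ab: "A \<in> sets borel" using A by (auto dest: null_setsD1 null_setsD2)
    then have "emeasure M1 A = 0" using sum[OF Ab] by simp
    then show "A \<in> null_sets M1" using Ab sM by (intro null_setsI) simp_all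
  qed
  then obtain f where f: "f \<in> borel_measurable lborel" "density lborel f = M1"
    using sigma_finite_measure.Radon_Nikodym[OF sigma_finite_lborel, of M1] sM by auto
  note f(1)[measurable]
  have "(\<integral>\<^sup>+x. f x \<partial>lborel) = emeasure M1 UNIV"
    unfolding f(2)[symmetric] by (subst emeasure_density) auto
  also have "... \<le> emeasure N UNIV" using sum[of UNIV] by (metis add_increasing2 order_refl zero_le sets.top space_borel)
  also have "... < \<infinity>" unfolding N_def using G by (subst emeasure_density_Ioc) auto
  finally have ffin: "(\<integral>\<^sup>+x. f x \<partial>lborel) < \<infinity>" .
  then have "AE x in lborel. f x \<noteq> \<infinity>" by (intro nn_integral_PInf_AE) auto
  then have fr: "AE x in lborel. f x = ennreal (enn2real (f x))" by eventually_elim (auto simp: less_top)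
  have "(\<integral>\<^sup>+x. ennreal (enn2real (f x)) \<partial>lborel) < \<infinity>" using ffin nn_integral_cong_AE[OF fr] by simp
  then have fi: "integrable lborel (\<lambda>x. enn2real (f x))" by (intro integrableI_nonneg) auto
  have fioc: "ioc_integral (\<lambda>x. enn2real (f x)) a b = ioc_integral G a b + (g b - g a)" if "a \<le> b" for a b
  proof -
    have "M1 = density lborel (\<lambda>x. ennreal (enn2real (f x)))"
      unfolding f(2)[symmetric] using fr by (intro density_cong) auto
    then have "ennreal (ioc_integral (\<lambda>x. enn2real (f x)) a b) = ennreal (ioc_integral G a b + (g b - g a))"
      using e1[OF that] emeasure_density_Ioc[OF fi, of "{a<..b}"] by simp
    moreover have "0 \<le> ioc_integral (\<lambda>x. enn2real (f x)) a b"
      unfolding set_lebesgue_integral_def by (intro integral_nonneg_AE) (auto split: split_indicator)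
    ultimately show ?thesis using g[OF that] by (subst (asm) ennreal_inj) auto
  qed
  have "has_density g (\<lambda>x. enn2real (f x) - G x)"
    unfolding has_density_def using fi G fioc by (auto simp: ioc_integral_diff)
  then show ?thesis using that by blast
qed

lemma ioc_integral_const: "a \<le> b ==> ioc_integral (\<lambda>_. c) a b = c * (b - a)"
  unfolding set_lebesgue_integral_def by simp

lemma abs_ioc_integral_le:
  assumes "integrable lborel h" "\<And>x. a < x ==> x \<le> b ==> \<bar>h x\<bar> \<le> c" "a \<le> b"
  shows "\<bar>ioc_integral h a b\<bar> \<le> c * (b - a)"
proof -
  have i: "integrable lborel (\<lambda>x. indicator {a<..b} x *\<^sub>R h x)" using assms(1) by (intro integrable_mult_indicator) auto
  have "\<bar>ioc_integral h a b\<bar> \<le> (\<integral>x. \<bar>indicator {a<..b} x *\<^sub>R h x\<bar> \<partial>lborel)"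
    unfolding set_lebesgue_integral_def using integral_norm_bound[of lborel "\<lambda>x. indicator {a<..b} x *\<^sub>R h x"] by simp
  also have "... \<le> (\<integral>x. indicator {a<..b} x *\<^sub>R c \<partial>lborel)"
    using i assms by (intro integral_mono) (auto split: split_indicator)
  also have "... = c * (b - a)" using assms(3) by simp
  finally show ?thesis .
qed

text \<open>Bounded densities make both factors Lipschitz. The defect \<open>E\<close> between the
  product and the primitive of the claimed density therefore has increments of second order, so its
  derivative is 0 and it is constant.\<close>

lemma has_density_mult:
  assumes d1: "has_density g1 h1" and d2: "has_density g2 h2"
    and b1: "\<And>x. \<bar>h1 x\<bar> \<le> C" and b2: "\<And>x. \<bar>h2 x\<bar> \<le> C" and gb: "\<And>x. \<bar>g1 x\<bar> \<le> B" "\<And>x. \<bar>g2 x\<bar> \<le> B"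
  shows "has_density (\<lambda>x. g1 x * g2 x) (\<lambda>x. g1 x * h2 x + g2 x * h1 x)"
proof -
  have C0: "C \<ge> 0" using b1[of 0] by linarith
  note d1' = d1[unfolded has_density_def] and d2' = d2[unfolded has_density_def]
  have lip: "\<bar>g1 y - g1 x\<bar> \<le> C * (y - x)" "\<bar>g2 y - g2 x\<bar> \<le> C * (y - x)" if "x \<le> y" for x y
    using abs_ioc_integral_le[of h1 x y C] abs_ioc_integral_le[of h2 x y C] d1' d2' b1 b2 that by auto
  have cont: "continuous_on UNIV f" if "\<And>x y. x \<le> y ==> \<bar>f y - f x\<bar> \<le> C * (y - x)" for f :: "real => real"
  proof -
    have "C-lipschitz_on UNIV f"
    proof (rule lipschitz_onI[OF _ C0])
      fix x y show "dist (f x) (f y) \<le> C * dist x y"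
        using that[of x y] that[of y x] by (cases "x \<le> y") (auto simp: dist_real_def abs_minus_commute)
    qed
    then show ?thesis by (rule lipschitz_on_continuous_on)
  qed
  have [measurable]: "g1 \<in> borel_measurable borel" "g2 \<in> borel_measurable borel" "h1 \<in> borel_measurable borel" "h2 \<in> borel_measurable borel"
    using cont[OF lip(1)] cont[OF lip(2)] d1' d2' by (auto intro: borel_measurable_continuous_onI)
  have int: "integrable lborel (\<lambda>x. g x * h x)" if "g \<in> borel_measurable borel" "\<And>x. \<bar>g x\<bar> \<le> B" "integrable lborel h" for g h :: "real => real"
  proof (rule Bochner_Integration.integrable_bound[of lborel "\<lambda>x. B * h x"])
    have B0: "B \<ge> 0" using that(2)[of 0] by linarith
    show "AE x in lborel. norm (g x * h x) \<le> norm (B * h x)"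
      using that(2) B0 by (auto simp: abs_mult intro!: mult_right_mono)
  qed (use that in auto)
  have bnd: "integrable lborel (\<lambda>x. c * h x)" if "integrable lborel h" for c and h :: "real => real" using that by simp
  let ?k = "\<lambda>x. g1 x * h2 x + g2 x * h1 x"
  have ik: "integrable lborel ?k" using d1' d2' gb by (intro Bochner_Integration.integrable_add int) auto
  define E where "E x = g1 x * g2 x - prim ?k x" for x
  have E: "\<bar>E y - E x\<bar> \<le> 2 * C^2 * (y - x)^2" if xy: "x \<le> y" for x y
  proof -
    have i1: "integrable lborel (\<lambda>z. (g1 y - g1 z) * h2 z)" "integrable lborel (\<lambda>z. (g2 x - g2 z) * h1 z)"
      using d1' d2' gb by (auto simp: left_diff_distrib intro!: Bochner_Integration.integrable_diff int bnd)
    \<comment> \<open>The product is expanded with \<open>g1\<close> at the right end and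
      \<open>g2\<close> at the left end; after comparison with \<open>?k\<close> each term carries a
      small factor \<open>g1 y - g1 z\<close> or \<open>g2 x - g2 z\<close>.\<close>
    have "g1 y * g2 y - g1 x * g2 x = g1 y * (g2 y - g2 x) + g2 x * (g1 y - g1 x)" by (simp add: algebra_simps)
    also have "... = ioc_integral (\<lambda>z. g1 y * h2 z) x y + ioc_integral (\<lambda>z. g2 x * h1 z) x y"
      using d1' d2' xy by simp
    finally have "E y - E x = ioc_integral (\<lambda>z. g1 y * h2 z) x y + ioc_integral (\<lambda>z. g2 x * h1 z) x y - ioc_integral ?k x y"
      using prim_diff[OF ik xy] by (simp add: E_def)
    also have "... = ioc_integral (\<lambda>z. g1 y * h2 z + g2 x * h1 z) x y - ioc_integral ?k x y"
      using d1' d2' by (subst ioc_integral_add) (auto intro: bnd)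
    also have "... = ioc_integral (\<lambda>z. (g1 y * h2 z + g2 x * h1 z) - ?k z) x y"
      using d1' d2' ik by (subst ioc_integral_diff) (auto intro!: bnd Bochner_Integration.integrable_add)
    also have "... = ioc_integral (\<lambda>z. (g1 y - g1 z) * h2 z + (g2 x - g2 z) * h1 z) x y"
      by (simp add: algebra_simps)
    finally have eq: "E y - E x = ..." .
    have "\<bar>(g1 y - g1 z) * h2 z + (g2 x - g2 z) * h1 z\<bar> \<le> 2 * C^2 * (y - x)" if z: "x < z" "z \<le> y" for z
    proof -
      have "\<bar>g1 y - g1 z\<bar> \<le> C * (y - x)" "\<bar>g2 x - g2 z\<bar> \<le> C * (y - x)"
        using lip(1)[of z y] lip(2)[of x z] z C0 mult_left_mono[of "y - z" "y - x" C] mult_left_mono[of "z - x" "y - x" C] by auto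
      then have "\<bar>(g1 y - g1 z) * h2 z\<bar> \<le> C * (y - x) * C" "\<bar>(g2 x - g2 z) * h1 z\<bar> \<le> C * (y - x) * C"
        using b1[of z] b2[of z] C0 z by (auto simp: abs_mult intro!: mult_mono)
      then show ?thesis by (simp add: power2_eq_square algebra_simps)
    qed
    then have "\<bar>E y - E x\<bar> \<le> 2 * C^2 * (y - x) * (y - x)"
      unfolding eq using i1 xy by (intro abs_ioc_integral_le) auto
    then show ?thesis by (simp add: power2_eq_square)
  qed
  have "DERIV E x :> 0" for x unfolding DERIV_def
  proof (rule Lim_null_comparison)
    show "eventually (\<lambda>h. norm ((E (x + h) - E x) / h) \<le> 2 * C^2 * \<bar>h\<bar>) (at 0)"
      unfolding eventually_at_filter
    proof (intro always_eventually allI impI)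
      fix h :: real assume "h \<noteq> 0"
      have "\<bar>E (x + h) - E x\<bar> \<le> 2 * C^2 * h^2"
        using E[of x "x + h"] E[of "x + h" x] by (cases "h \<ge> 0") (auto simp: abs_minus_commute)
      also have "... = 2 * C^2 * \<bar>h\<bar> * \<bar>h\<bar>" by (simp add: power2_eq_square)
      finally show "norm ((E (x + h) - E x) / h) \<le> 2 * C^2 * \<bar>h\<bar>"
        using \<open>h \<noteq> 0\<close> by (simp add: pos_divide_le_eq)
    qed
    have "((\<lambda>h. 2 * C^2 * \<bar>h\<bar>) \<longlongrightarrow> 2 * C^2 * \<bar>0\<bar>) (at 0)" by (intro tendsto_intros)
    then show "((\<lambda>h. 2 * C^2 * \<bar>h\<bar>) \<longlongrightarrow> 0) (at 0)" by simp
  qed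
  then have "E x = E y" for x y using DERIV_isconst_all by metis
  then have "g1 b * g2 b - g1 a * g2 a = ioc_integral ?k a b" if "a \<le> b" for a b
    using prim_diff[OF ik that] E_def by (smt (verit))
  then show ?thesis unfolding has_density_def using ik by auto
qed

section \<open>Measurability on the space of rectifiable arcs\<close>

text \<open>Joint lower semicontinuity, spelled out with open rectangles because the two ends of a
  cell are controlled by separate neighbourhoods.\<close>

definition lower_semicts :: "('a::topological_space => 'a => ennreal) => bool" where
  "lower_semicts c \<longleftrightarrow> (\<forall>r x y. r < c x y \<longrightarrow> (\<exists>U V. open U \<and> open V \<and> x \<in> U \<and> y \<in> V \<and> (\<forall>x'\<in>U. \<forall>y'\<in>V. r < c x' y')))"

lemma openin_compact_open:
  fixes U :: "'a::topological_space set"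
  assumes "compact K" "K \<subseteq> {0..1}" "open U"
  shows "openin compact_open_topology {\<gamma> \<in> curves. \<gamma> ` K \<subseteq> U}" unfolding compact_open_topology_def
  by (rule topology_generated_by_Basis) (use assms in blast)

lemma eventually_compact_open:
  fixes U :: "'a::topological_space set"
  assumes "compact K" "K \<subseteq> {0..1}" "open U" "\<gamma>0 ` K \<subseteq> U" "\<gamma>0 \<in> curves"
  shows "eventually (\<lambda>\<gamma>. \<gamma> ` K \<subseteq> U) (nhdsin compact_open_topology \<gamma>0)"
  unfolding eventually_nhdsin using openin_compact_open[OF assms(1-3)] assms(4,5)
  by (intro disjI2 exI[of _ "{\<gamma> \<in> curves. \<gamma> ` K \<subseteq> U}"]) auto

text \<open>A positive cell term survives under three open conditions on the curve: the compact
  piece stays in \<open>U\<close>, and its two ends stay where \<open>c\<close> exceeds the bound.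
  All three are subbasic in the compact-open topology.\<close>

lemma gsum_lsc:
  assumes c: "lower_semicts c" and U: "open U" and t: "partition_of 0 1 n t" and \<gamma>0: "\<gamma>0 \<in> curves"
    and r: "r < gsum c U \<gamma>0 n t"
  shows "eventually (\<lambda>\<gamma>. r < gsum c U \<gamma> n t) (nhdsin compact_open_topology \<gamma>0)"
  using r unfolding gsum_def
proof (rule sum_lsc[where p = \<gamma>0 and f = "\<lambda>i \<gamma>. if \<gamma> ` {t i..t (Suc i)} \<subseteq> U then c (\<gamma> (t i)) (\<gamma> (t (Suc i))) else 0", rotated 2])
  fix i r assume i: "i \<in> {..<n}" and r: "r < (if \<gamma>0 ` {t i..t (Suc i)} \<subseteq> U then c (\<gamma>0 (t i)) (\<gamma>0 (t (Suc i))) else 0)"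
  have ti: "t i \<in> {0..1}" "t (Suc i) \<in> {0..1}" using partition_of_mem[OF t, of i] partition_of_mem[OF t, of "Suc i"] i by auto
  have cell: "\<gamma>0 ` {t i..t (Suc i)} \<subseteq> U" and r': "r < c (\<gamma>0 (t i)) (\<gamma>0 (t (Suc i)))" using r by (auto split: if_splits)
  obtain V W where VW: "open V" "open W" "\<gamma>0 (t i) \<in> V" "\<gamma>0 (t (Suc i)) \<in> W" "\<And>x y. x \<in> V ==> y \<in> W ==> r < c x y"
    using c r' unfolding lower_semicts_def by metis
  have "eventually (\<lambda>\<gamma>. \<gamma> ` {t i..t (Suc i)} \<subseteq> U) (nhdsin compact_open_topology \<gamma>0)"
    "eventually (\<lambda>\<gamma>. \<gamma> ` {t i} \<subseteq> V) (nhdsin compact_open_topology \<gamma>0)"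
    "eventually (\<lambda>\<gamma>. \<gamma> ` {t (Suc i)} \<subseteq> W) (nhdsin compact_open_topology \<gamma>0)"
    by (rule eventually_compact_open; use ti cell VW U \<gamma>0 in simp)+
  then show "eventually (\<lambda>\<gamma>. r < (if \<gamma> ` {t i..t (Suc i)} \<subseteq> U then c (\<gamma> (t i)) (\<gamma> (t (Suc i))) else 0)) (nhdsin compact_open_topology \<gamma>0)"
    by eventually_elim (use VW(5) in auto)
qed simp

definition RAB :: "('a::topological_space => 'a => ennreal) => 'a arc measure" where
  "RAB d = sigma (topspace (RA_topology d)) {U. openin (RA_topology d) U}"

lemma topspace_RA: "topspace (RA_topology d) = RA d"
proof -
  have "openin arc_topology (curves // arc_rel :: 'a arc set)" unfolding openin_arc_topology
  proof
    have "{\<gamma> \<in> curves. arc_rel `` {\<gamma>} \<in> curves // arc_rel} = topspace (compact_open_topology :: (real => 'a) topology)"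
      unfolding topspace_compact_open_topology by (auto intro: quotientI)
    then show "openin compact_open_topology {\<gamma> \<in> curves. arc_rel `` {\<gamma>} \<in> (curves // arc_rel :: 'a arc set)}"
      by (metis openin_topspace)
  qed simp
  then have "curves // arc_rel \<subseteq> topspace (arc_topology :: 'a arc topology)" by (rule openin_subset)
  moreover have "RA d \<subseteq> curves // arc_rel" unfolding RA_def by (auto intro: quotientI)
  ultimately show ?thesis unfolding RA_topology_def by auto
qed

lemma space_RAB [simp]: "space (RAB d) = RA d"
  unfolding RAB_def by (simp add: space_measure_of_conv topspace_RA)

lemma openin_sets_RAB: "openin (RA_topology d) U ==> U \<in> sets (RAB d)"
  unfolding RAB_def by (subst sets_measure_of) (auto dest: openin_subset)

lemma closedin_sets_RAB: "closedin (RA_topology d) U ==> U \<in> sets (RAB d)"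
proof -
  assume U: "closedin (RA_topology d) U"
  then have "RA d - U \<in> sets (RAB d)" unfolding closedin_def topspace_RA by (auto intro: openin_sets_RAB)
  then have "space (RAB d) - (RA d - U) \<in> sets (RAB d)" by (rule sets.compl_sets)
  moreover have "RA d - (RA d - U) = U" using U closedin_subset[OF U] topspace_RA[of d] by auto
  ultimately show ?thesis by simp
qed

section \<open>Open sets of arcs and measurable kernels\<close>

context emt
begin

text \<open>Openness in the quotient is openness of the preimage, which is \<open>S\<close> itself
  by saturation. The concrete open sets of arcs below arise in this way, their defining property
  being read off the constant speed representative.\<close>

lemma openin_saturated:
  assumes S: "openin compact_open_topology S" and inv: "\<And>\<gamma> \<sigma>. \<gamma> \<in> S ==> (\<gamma>, \<sigma>) \<in> arc_rel ==> \<sigma> \<in> S"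
  shows "openin (RA_topology d) {Z \<in> RA d. rep Z \<in> S}"
proof -
  have Sc: "S \<subseteq> curves" using openin_subset[OF S] topspace_compact_open_topology by auto
  define \<U> where "\<U> = (\<lambda>\<gamma>. arc_rel `` {\<gamma>}) ` S"
  have "{\<gamma> \<in> curves. arc_rel `` {\<gamma>} \<in> \<U>} = S"
  proof
    show "S \<subseteq> {\<gamma> \<in> curves. arc_rel `` {\<gamma>} \<in> \<U>}" using Sc by (auto simp: \<U>_def)
    show "{\<gamma> \<in> curves. arc_rel `` {\<gamma>} \<in> \<U>} \<subseteq> S"
    proof
      fix \<gamma> assume g: "\<gamma> \<in> {\<gamma> \<in> curves. arc_rel `` {\<gamma>} \<in> \<U>}"
      then obtain \<sigma> where "\<sigma> \<in> S" "arc_rel `` {\<gamma>} = arc_rel `` {\<sigma>}" by (auto simp: \<U>_def)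
      then have "(\<sigma>, \<gamma>) \<in> arc_rel" using g arc_rel_refl[of \<gamma>] by blast
      then show "\<gamma> \<in> S" using inv \<open>\<sigma> \<in> S\<close> by blast
    qed
  qed
  moreover have "\<U> \<subseteq> curves // arc_rel" using Sc unfolding \<U>_def by (auto intro: quotientI)
  ultimately have "openin arc_topology \<U>" unfolding openin_arc_topology using S by simp
  moreover have "{Z \<in> RA d. rep Z \<in> S} = \<U> \<inter> RA d"
  proof safe
    fix Z assume G: "Z \<in> RA d" "rep Z \<in> S"
    obtain \<gamma>0 where g0: "Z = arc_rel `` {\<gamma>0}" using G unfolding RA_def by auto
    have "(\<gamma>0, rep Z) \<in> arc_rel" using rep_in(1)[OF G(1)] g0 by auto
    then show "Z \<in> \<U>" using inv[OF G(2) arc_rel_sym] g0 unfolding \<U>_def by blast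
  next
    fix Z assume G: "Z \<in> \<U>" "Z \<in> RA d"
    then obtain \<gamma> where g: "\<gamma> \<in> S" "Z = arc_rel `` {\<gamma>}" unfolding \<U>_def by auto
    then show "rep Z \<in> S" using inv[OF g(1)] rep_in(1)[OF G(2)] by auto
  qed
  ultimately show ?thesis unfolding RA_topology_def openin_subtopology by blast
qed

text \<open>Invariance under reparametrization makes the localized variation a function of the arc,
  and \<open>gsum_lsc\<close> makes it lower semicontinuous. Measurability of integrals along arcs
  rests on this.\<close>

lemma openin_gvar:
  assumes c: "lower_semicts c" and U: "open U"
  shows "openin (RA_topology d) {Z \<in> RA d. r < gvar c U (rep Z) 0 1}"
proof -
  have "openin compact_open_topology {\<gamma> \<in> curves. r < gvar c U \<gamma> 0 1}"
  proof (subst openin_subopen, safe)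
    fix \<gamma>0 :: "real => 'a" assume g: "\<gamma>0 \<in> curves" "r < gvar c U \<gamma>0 0 1"
    then obtain n t where t: "partition_of 0 1 n t" "r < gsum c U \<gamma>0 n t" unfolding less_gvar_iff by auto
    have "\<gamma>0 \<in> topspace compact_open_topology" using g topspace_compact_open_topology by auto
    then obtain S where S: "openin compact_open_topology S" "\<gamma>0 \<in> S" "\<forall>\<gamma>\<in>S. r < gsum c U \<gamma> n t"
      using gsum_lsc[OF c U t(1) g(1) t(2)] unfolding eventually_nhdsin by auto
    then show "\<exists>T. openin compact_open_topology T \<and> \<gamma>0 \<in> T \<and> T \<subseteq> {\<gamma> \<in> curves. r < gvar c U \<gamma> 0 1}"
      using t(1) openin_subset[OF S(1)] unfolding topspace_compact_open_topology less_gvar_iff by (intro exI[of _ S]) blast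
  qed
  then have "openin (RA_topology d) {Z \<in> RA d. rep Z \<in> {\<gamma> \<in> curves. r < gvar c U \<gamma> 0 1}}"
  proof (rule openin_saturated)
    fix \<gamma> \<sigma> assume "\<gamma> \<in> {\<gamma> \<in> curves. r < gvar c U \<gamma> 0 1}" and rel: "(\<gamma>, \<sigma>) \<in> arc_rel"
    moreover have "\<sigma> \<in> curves" using rel unfolding arc_rel_def by blast
    ultimately show "\<sigma> \<in> {\<gamma> \<in> curves. r < gvar c U \<gamma> 0 1}" using arc_rel_gvar[OF rel, of c U] by simp
  qed
  moreover have "{Z \<in> RA d. rep Z \<in> {\<gamma> \<in> curves. r < gvar c U \<gamma> 0 1}} = {Z \<in> RA d. r < gvar c U (rep Z) 0 1}"
    using rep_curve(1) by auto
  ultimately show ?thesis by simp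
qed

lemma lower_semicts_d: "lower_semicts d" unfolding lower_semicts_def using d_lsc by metis

lemma lower_semicts_cost: "lipschitz_with C \<phi> ==> lower_semicts (cost C \<phi>)"
  unfolding lower_semicts_def lipschitz_with_def using cost_lsc Lip_b_continuous by metis

text \<open>Extending the representative by its end points makes functions along an arc functions on
  the real line; later, times outside \<open>[0,1]\<close> stand for the ends.\<close>

definition crep :: "'a arc => real => 'a" where "crep Z t = rep Z (max 0 (min 1 t))"

lemma crep_eq: "0 \<le> t ==> t \<le> 1 ==> crep Z t = rep Z t" by (simp add: crep_def)

lemma crep_continuous: "Z \<in> RA d ==> continuous_on A (crep Z)" unfolding crep_def
  by (rule continuous_on_compose2[OF rep_curve(2)]) (auto intro!: continuous_intros)

lemma crep_measurable: "Z \<in> RA d ==> crep Z \<in> borel_measurable borel"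
  by (intro borel_measurable_continuous_onI crep_continuous)

definition kint :: "('a arc => real => ennreal) => 'a arc => ('a => ennreal) => ennreal" where
  "kint k Z u = (\<integral>\<^sup>+t\<in>{0..1}. (k Z t * u (crep Z t)) \<partial>lborel)"

definition arc_kernel :: "('a arc => real => ennreal) => bool" where
  "arc_kernel k \<longleftrightarrow> (\<forall>Z\<in>RA d. k Z \<in> borel_measurable borel) \<and>
     (\<forall>u\<in>borel_measurable borel. (\<lambda>Z. kint k Z u) \<in> borel_measurable (RAB d))"

lemma kint_measurable: "arc_kernel k ==> u \<in> borel_measurable borel ==> (\<lambda>Z. kint k Z u) \<in> borel_measurable (RAB d)"
  unfolding arc_kernel_def by blast

lemma kint_integrand_measurable:
  fixes k :: "'a arc => real => ennreal"
  assumes "k Z \<in> borel_measurable borel" "Z \<in> RA d" "u \<in> borel_measurable borel"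
  shows "(\<lambda>t. k Z t * u (crep Z t) * indicator {0..1} t) \<in> borel_measurable lborel"
proof -
  have 1: "(\<lambda>t. u (crep Z t)) \<in> borel_measurable lborel"
    using measurable_compose[OF crep_measurable[OF assms(2)] assms(3)] by simp
  have 2: "k Z \<in> borel_measurable lborel" using assms(1) by simp
  have 3: "(indicator {0..1} :: real => ennreal) \<in> borel_measurable lborel" by simp
  show ?thesis by (intro borel_measurable_times_ennreal 1 2 3)
qed

definition kmeas :: "('a arc => real => ennreal) => 'a arc => 'a measure" where
  "kmeas k Z = distr (density lborel (\<lambda>t. k Z t * indicator {0..1} t)) borel (crep Z)"

lemma sets_kmeas [simp, measurable_cong]: "sets (kmeas k Z) = sets borel" by (simp add: kmeas_def)

lemma kint_eq:
  assumes [measurable]: "k Z \<in> borel_measurable borel" and G: "Z \<in> RA d" and [measurable]: "u \<in> borel_measurable borel"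
  shows "kint k Z u = (\<integral>\<^sup>+x. u x \<partial>kmeas k Z)"
proof -
  note [measurable] = crep_measurable[OF G]
  show ?thesis unfolding kmeas_def kint_def by (simp add: nn_integral_distr nn_integral_density ac_simps)
qed

lemma kint_indicator: "k Z \<in> borel_measurable borel ==> Z \<in> RA d ==> B \<in> sets borel ==>
    kint k Z (indicator B) = emeasure (kmeas k Z) B" by (simp add: kint_eq)

text \<open>The image of the kernel has on an open set the mass given by the localized variation of
  the cost, which is Borel in the arc. Open sets are stable under intersection and generate the
  Borel sets, finiteness permits complements, and monotone approximation reaches all nonnegative
  functions.\<close>

lemma arc_kernelI:
  assumes c: "lower_semicts c"
    and k: "\<And>Z. Z \<in> RA d ==> k Z \<in> borel_measurable borel"
    and var: "\<And>Z s t. Z \<in> RA d ==> 0 \<le> s ==> s \<le> t ==> t \<le> 1 ==> variation c (rep Z) s t = (\<integral>\<^sup>+x\<in>{s..t}. k Z x \<partial>lborel)"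
    and fin: "\<And>Z. Z \<in> RA d ==> (\<integral>\<^sup>+x\<in>{0..1}. k Z x \<partial>lborel) < \<infinity>" shows "arc_kernel k"
  unfolding arc_kernel_def
proof (intro conjI ballI k)
  have kU: "emeasure (kmeas k Z) U = gvar c U (rep Z) 0 1" if "Z \<in> RA d" "open U" for Z U
  proof -
    have "gvar c U (rep Z) 0 1 = (\<integral>\<^sup>+x\<in>{0..1} \<inter> rep Z -` U. k Z x \<partial>lborel)"
      by (rule gvar_eq_nn_integral) (use k var rep_curve that in auto)
    also have "... = kint k Z (indicator U)" unfolding kint_def
      by (intro nn_integral_cong) (auto simp: crep_eq split: split_indicator)
    finally show ?thesis using kint_indicator[OF k] that by simp
  qed
  have kB: "(\<lambda>Z. emeasure (kmeas k Z) B) \<in> borel_measurable (RAB d)" if B: "B \<in> sets borel" for B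
  proof -
    have Int: "Int_stable {S. open (S :: 'a set)}" by (auto simp: Int_stable_def)
    have sub: "{S. open (S :: 'a set)} \<subseteq> Pow UNIV" by simp
    have basic: "(\<lambda>Z. emeasure (kmeas k Z) A) \<in> borel_measurable (RAB d)" if "open A" for A
    proof -
      have "(\<lambda>Z. gvar c A (rep Z) 0 1) \<in> borel_measurable (RAB d)"
        using openin_sets_RAB[OF openin_gvar[OF c that]] by (intro borel_measurableI_greater) auto
      then show ?thesis using kU that by (subst measurable_cong[where g = "\<lambda>Z. gvar c A (rep Z) 0 1"]) auto
    qed
    have "B \<in> sigma_sets UNIV {S. open S}" using B by (simp add: borel_def)
    from Int sub this show ?thesis
    proof (induction rule: sigma_sets_induct_disjoint)
      case (compl A)
      have A: "A \<in> sets borel" using compl by (simp add: borel_def)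
      have "emeasure (kmeas k Z) (UNIV - A) = emeasure (kmeas k Z) UNIV - emeasure (kmeas k Z) A" if G: "Z \<in> RA d" for Z
      proof (rule emeasure_Diff)
        have "emeasure (kmeas k Z) A \<le> emeasure (kmeas k Z) UNIV" by (rule emeasure_mono) auto
        also have "... = (\<integral>\<^sup>+x\<in>{0..1}. k Z x \<partial>lborel)" using kint_indicator[of k Z UNIV, OF k G] G by (simp add: kint_def)
        finally show "emeasure (kmeas k Z) A \<noteq> \<infinity>" using fin[OF G] by (auto simp: top_unique)
      qed (use A in auto)
      then show ?case using compl.IH basic[OF open_UNIV]
        by (subst measurable_cong[where g = "\<lambda>Z. emeasure (kmeas k Z) UNIV - emeasure (kmeas k Z) A"]) auto
    next
      case (union A)
      have "range A \<subseteq> sets borel" using union by (auto simp: borel_def)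
      then have "(\<Sum>i. emeasure (kmeas k Z) (A i)) = emeasure (kmeas k Z) (\<Union> (range A))" for Z
        using union.hyps(1) by (intro suminf_emeasure) auto
      moreover have "(\<lambda>Z. \<Sum>i. emeasure (kmeas k Z) (A i)) \<in> borel_measurable (RAB d)" using union.IH by measurable
      ultimately show ?case by simp
    qed (use basic in auto)
  qed
  fix u :: "'a => ennreal" assume u: "u \<in> borel_measurable borel"
  then have "(\<lambda>Z. \<integral>\<^sup>+x. u x \<partial>kmeas k Z) \<in> borel_measurable (RAB d)"
  proof (induction rule: borel_measurable_induct)
    case (cong f g)
    then have "f = g" by auto
    then show ?case using cong by simp
  next
    case (set A)
    then show ?case using kB by simp
  next
    case (mult u r)
    then show ?case by (simp add: nn_integral_cmult)
  next
    case (add u v)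
    then show ?case by (simp add: nn_integral_add)
  next
    case (seq U)
    then show ?case by (simp add: nn_integral_monotone_convergence_SUP image_comp)
  qed
  then show "(\<lambda>Z. kint k Z u) \<in> borel_measurable (RAB d)"
    by (subst measurable_cong[OF kint_eq]) (use k u in auto)
qed

text \<open>\<open>N\<close> is the average of the measures \<open>kmeas k Z\<close> over \<pi>. For
  the length kernel it is the barycenter; for \<open>der_kernel\<close> it carries the
  derivation.\<close>

lemma ex_mixture:
  assumes k: "arc_kernel k" and \<pi>: "sets \<pi> = sets (RAB d)"
  obtains N where "sets N = sets borel" "\<And>u. u \<in> borel_measurable borel ==> (\<integral>\<^sup>+x. u x \<partial>N) = (\<integral>\<^sup>+Z. kint k Z u \<partial>\<pi>)"
proof -
  have sp: "space \<pi> = RA d" using sets_eq_imp_space_eq[OF \<pi>] by simp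
  have ke: "kint k Z u = (\<integral>\<^sup>+x. u x \<partial>kmeas k Z)" if "Z \<in> space \<pi>" "u \<in> borel_measurable borel" for Z u
    using k that unfolding arc_kernel_def sp by (intro kint_eq) auto
  have km: "(\<lambda>Z. \<integral>\<^sup>+x. u x \<partial>kmeas k Z) \<in> borel_measurable \<pi>" if "u \<in> borel_measurable borel" for u
    using kint_measurable[OF k that] unfolding measurable_cong_sets[OF \<pi> refl, symmetric]
    by (rule measurable_cong[THEN iffD1, rotated]) (rule ke[OF _ that])
  have kB: "(\<lambda>Z. emeasure (kmeas k Z) B) \<in> borel_measurable \<pi>" if "B \<in> sets borel" for B
    using km[of "indicator B"] that by simp
  define \<mu> where "\<mu> B = (\<integral>\<^sup>+Z. emeasure (kmeas k Z) B \<partial>\<pi>)" for B :: "'a set"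
  define N where "N = measure_of UNIV (sets borel) \<mu>"
  have sN: "sets N = sets borel" unfolding N_def by (metis sets.sets_measure_of_eq space_borel)
  have ca: "countably_additive (sets N) \<mu>" unfolding countably_additive_def
  proof (intro allI impI)
    fix A :: "nat => 'a set" assume A: "range A \<subseteq> sets N" "disjoint_family A"
    have "(\<Sum>i. \<mu> (A i)) = (\<integral>\<^sup>+Z. (\<Sum>i. emeasure (kmeas k Z) (A i)) \<partial>\<pi>)"
      unfolding \<mu>_def by (rule nn_integral_suminf[symmetric]) (rule kB, use A sN in auto)
    also have "... = \<mu> (\<Union> (range A))" unfolding \<mu>_def using A sN by (intro nn_integral_cong suminf_emeasure) auto
    finally show "(\<Sum>i. \<mu> (A i)) = \<mu> (\<Union> (range A))" .
  qed
  have eN: "emeasure N B = \<mu> B" if "B \<in> sets borel" for B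
    by (rule emeasure_measure_of[OF N_def]) (use ca that sN in \<open>auto simp: positive_def \<mu>_def\<close>)
  have nm [simp]: "v \<in> borel_measurable N \<longleftrightarrow> v \<in> borel_measurable borel" for v :: "'a => ennreal"
    by (simp add: measurable_cong_sets[OF sN refl])
  have "(\<integral>\<^sup>+x. u x \<partial>N) = (\<integral>\<^sup>+Z. (\<integral>\<^sup>+x. u x \<partial>kmeas k Z) \<partial>\<pi>)" if "u \<in> borel_measurable borel" for u
    using that
  proof (induction rule: borel_measurable_induct)
    case (cong f g)
    then have "f = g" by auto
    then show ?case using cong by simp
  next
    case (set A)
    then show ?case using eN[OF set] sN by (simp add: \<mu>_def)
  next
    case (mult u r)
    then show ?case using km by (simp add: nn_integral_cmult)
  next
    case (add u v)
    then show ?case using km by (simp add: nn_integral_add)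
  next
    case (seq U)
    have "incseq (\<lambda>i Z. \<integral>\<^sup>+x. U i x \<partial>kmeas k Z)"
      using seq(3) unfolding incseq_def le_fun_def by (auto intro!: nn_integral_mono)
    then have "(SUP i. \<integral>\<^sup>+Z. (\<integral>\<^sup>+x. U i x \<partial>kmeas k Z) \<partial>\<pi>) = (\<integral>\<^sup>+Z. (SUP i. \<integral>\<^sup>+x. U i x \<partial>kmeas k Z) \<partial>\<pi>)"
      using km seq by (intro nn_integral_monotone_convergence_SUP[symmetric]) auto
    then show ?case using seq by (simp add: nn_integral_monotone_convergence_SUP image_comp)
  qed
  then have "(\<integral>\<^sup>+x. u x \<partial>N) = (\<integral>\<^sup>+Z. kint k Z u \<partial>\<pi>)" if "u \<in> borel_measurable borel" for u
    using that ke[OF _ that] by (simp cong: nn_integral_cong)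
  then show ?thesis using that sN by blast
qed

end

section \<open>Derivatives along arcs\<close>

lemma integrable_Ioc_const: "integrable lborel (\<lambda>t. indicator {p<..q::real} t * (c::real))"
proof -
  have "emeasure lborel {p<..q} < \<infinity>" by (cases "p \<le> q") auto
  then have "integrable lborel (indicator {p<..q} :: real => real)" by (intro integrable_real_indicator) auto
  then show ?thesis by (rule integrable_mult_left)
qed

context emt
begin

text \<open>An extended representative moves only during this interval, which is half-open to match
  the integrals over half-open intervals in \<open>has_density\<close>.\<close>

definition unit_ind :: "real => real" where "unit_ind = indicator {0<..1}"

lemma unit_ind_ioc: "a \<le> b ==> ioc_integral (\<lambda>x. c * unit_ind x) a b = c * (max 0 (min 1 b) - max 0 (min 1 a))"
proof -
  assume ab: "a \<le> b"
  have "ioc_integral (\<lambda>x. c * unit_ind x) a b = (\<integral>x. indicator {max 0 a<..min 1 b} x *\<^sub>R c \<partial>lborel)"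
    unfolding set_lebesgue_integral_def unit_ind_def by (intro Bochner_Integration.integral_cong) (auto split: split_indicator)
  also have "... = c * (max 0 (min 1 b) - max 0 (min 1 a))"
  proof (cases "max 0 a \<le> min 1 b")
    case True
    then show ?thesis using ab by (auto simp: max_def min_def)
  next
    case False
    then have "{max 0 a<..min 1 b} = {}" "max 0 (min 1 b) = max 0 (min 1 a)" using ab by (auto simp: max_def min_def split: if_splits)
    then show ?thesis by simp
  qed
  finally show ?thesis .
qed

lemma unit_ind_integrable: "integrable lborel (\<lambda>x. c * unit_ind x)" unfolding unit_ind_def by simp

lemma crep_d_le:
  assumes "Z \<in> RA d" "a \<le> b"
  shows "d (crep Z a) (crep Z b) \<le> ennreal (rlen Z * (max 0 (min 1 b) - max 0 (min 1 a)))"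
  unfolding crep_def by (rule unit_speed_d_le[OF rep_in(2)[OF assms(1)]]) (use assms(2) in auto)

lemma lipschitz_with_crep:
  assumes \<phi>: "lipschitz_with C \<phi>" and G: "Z \<in> RA d" "a \<le> b"
  shows "\<bar>\<phi> (crep Z b) - \<phi> (crep Z a)\<bar> \<le> C * rlen Z * (max 0 (min 1 b) - max 0 (min 1 a))"
proof -
  have d: "d (crep Z a) (crep Z b) \<le> ennreal (rlen Z * (max 0 (min 1 b) - max 0 (min 1 a)))"
    by (rule crep_d_le[OF G])
  then have fin: "d (crep Z a) (crep Z b) < \<infinity>" by (auto intro: le_less_trans)
  have "enn2real (d (crep Z a) (crep Z b)) \<le> rlen Z * (max 0 (min 1 b) - max 0 (min 1 a))"
    using d G by (intro enn2real_leI) (auto intro!: mult_nonneg_nonneg)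
  then show ?thesis using lipschitz_with_real[OF \<phi> fin] \<phi> mult_left_mono[of _ _ C] unfolding lipschitz_with_def
    by (smt (verit) mult.assoc)
qed

lemma ex_lipschitz_with: "\<phi> \<in> Lip_b d ==> \<exists>C. lipschitz_with C \<phi>"
  unfolding lipschitz_with_def using Lip_bE by metis

text \<open>One admissible Lipschitz constant, fixed for each function. It serves as a shift and as
  a crude bound; the sharp bound comes later from the asymptotic slope.\<close>

definition lipc :: "('a => real) => real" where "lipc \<phi> = (SOME C. lipschitz_with C \<phi>)"

lemma lipc: "\<phi> \<in> Lip_b d ==> lipschitz_with (lipc \<phi>) \<phi>"
  unfolding lipc_def by (rule someI_ex) (rule ex_lipschitz_with)

lemma lipc_pos: "\<phi> \<in> Lip_b d ==> lipc \<phi> > 0" using lipc unfolding lipschitz_with_def by blast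

lemma ex_arc_deriv:
  assumes \<phi>: "\<phi> \<in> Lip_b d" and G: "Z \<in> RA d"
  shows "\<exists>h. has_density (\<lambda>t. \<phi> (crep Z t)) h \<and> (\<forall>t. \<bar>h t\<bar> \<le> lipc \<phi> * rlen Z * unit_ind t)"
proof -
  let ?G = "\<lambda>t. lipc \<phi> * rlen Z * unit_ind t"
  have Gi: "integrable lborel ?G" by (rule unit_ind_integrable)
  have Gn: "0 \<le> ?G t" for t using lipc_pos[OF \<phi>] by (auto simp: unit_ind_def)
  have le: "\<bar>\<phi> (crep Z b) - \<phi> (crep Z a)\<bar> \<le> ioc_integral ?G a b" if "a \<le> b" for a b
    unfolding unit_ind_ioc[OF that] by (rule lipschitz_with_crep[OF lipc[OF \<phi>] G that])
  obtain h where h: "has_density (\<lambda>t. \<phi> (crep Z t)) h" using ex_density[OF Gi Gn le] by blast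
  have bd: "AE t in lborel. \<bar>h t\<bar> \<le> ?G t" using has_density_abs_le[OF h Gi le] .
  \<comment> \<open>Clamping alters the density only on a null set and makes the bound valid at
    every time, so it can be used without exceptional sets.\<close>
  define h' where "h' t = max (- ?G t) (min (?G t) (h t))" for t
  have [measurable]: "h \<in> borel_measurable borel" using h unfolding has_density_def by blast
  have [measurable]: "unit_ind \<in> borel_measurable borel" unfolding unit_ind_def by simp
  have h'm [measurable]: "h' \<in> borel_measurable borel" unfolding h'_def by measurable
  have ae: "AE t in lborel. h' t = h t" using bd by eventually_elim (auto simp: h'_def)
  have "integrable lborel h'" using h ae unfolding has_density_def by (subst integrable_cong_AE[of _ _ h]) auto
  moreover have "ioc_integral h' a b = ioc_integral h a b" for a b
    unfolding set_lebesgue_integral_def using ae by (intro integral_cong_AE) auto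
  ultimately have "has_density (\<lambda>t. \<phi> (crep Z t)) h'" using h unfolding has_density_def by simp
  moreover have "\<bar>h' t\<bar> \<le> ?G t" for t using Gn[of t] by (auto simp: h'_def)
  ultimately show ?thesis by blast
qed

definition arc_deriv :: "('a => real) => 'a arc => real => real" where
  "arc_deriv \<phi> Z = (SOME h. has_density (\<lambda>t. \<phi> (crep Z t)) h \<and> (\<forall>t. \<bar>h t\<bar> \<le> lipc \<phi> * rlen Z * unit_ind t))"

lemma arc_deriv:
  assumes "\<phi> \<in> Lip_b d" "Z \<in> RA d"
  shows "has_density (\<lambda>t. \<phi> (crep Z t)) (arc_deriv \<phi> Z)" "\<bar>arc_deriv \<phi> Z t\<bar> \<le> lipc \<phi> * rlen Z * unit_ind t"
  using someI_ex[OF ex_arc_deriv[OF assms]] unfolding arc_deriv_def[symmetric] by auto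

lemma arc_deriv_measurable: "\<phi> \<in> Lip_b d ==> Z \<in> RA d ==> arc_deriv \<phi> Z \<in> borel_measurable borel"
  using arc_deriv(1) unfolding has_density_def by blast

lemma arc_deriv_bound:
  assumes "\<phi> \<in> Lip_b d" "Z \<in> RA d" shows "\<bar>arc_deriv \<phi> Z t\<bar> \<le> lipc \<phi> * rlen Z"
proof -
  have "lipc \<phi> * rlen Z * unit_ind t \<le> lipc \<phi> * rlen Z"
    using lipc_pos[OF assms(1)] by (auto simp: unit_ind_def split: split_indicator)
  then show ?thesis using arc_deriv(2)[OF assms, of t] by linarith
qed

text \<open>Both sides are densities of the same function of time, and densities are unique up to
  null sets. The product rule below follows the same pattern.\<close>

lemma arc_deriv_lincomb:
  assumes "\<phi> \<in> Lip_b d" "\<psi> \<in> Lip_b d" "Z \<in> RA d"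
  shows "AE t in lborel. arc_deriv (\<lambda>x. \<alpha> * \<phi> x + \<beta> * \<psi> x) Z t = \<alpha> * arc_deriv \<phi> Z t + \<beta> * arc_deriv \<psi> Z t"
  by (rule has_density_unique[OF arc_deriv(1)[OF Lip_b_lincomb[OF assms(1,2)] assms(3)]
      has_density_lincomb[OF arc_deriv(1)[OF assms(1,3)] arc_deriv(1)[OF assms(2,3)]]])

lemma arc_deriv_mult:
  assumes \<phi>: "\<phi> \<in> Lip_b d" and \<psi>: "\<psi> \<in> Lip_b d" and G: "Z \<in> RA d"
  shows "AE t in lborel. arc_deriv (\<lambda>x. \<phi> x * \<psi> x) Z t = \<phi> (crep Z t) * arc_deriv \<psi> Z t + \<psi> (crep Z t) * arc_deriv \<phi> Z t"
proof -
  obtain A B where A: "\<And>x. \<bar>\<phi> x\<bar> \<le> A" and B: "\<And>x. \<bar>\<psi> x\<bar> \<le> B" using \<phi> \<psi> Lip_b_boundedE by metis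
  define C where "C = max (lipc \<phi> * rlen Z) (lipc \<psi> * rlen Z)"
  have "has_density (\<lambda>t. \<phi> (crep Z t) * \<psi> (crep Z t)) (\<lambda>t. \<phi> (crep Z t) * arc_deriv \<psi> Z t + \<psi> (crep Z t) * arc_deriv \<phi> Z t)"
  proof (rule has_density_mult[where C = C and B = "max A B"])
    show "\<bar>arc_deriv \<phi> Z t\<bar> \<le> C" "\<bar>arc_deriv \<psi> Z t\<bar> \<le> C" for t
      using arc_deriv_bound[OF \<phi> G, of t] arc_deriv_bound[OF \<psi> G, of t] unfolding C_def by auto
    show "\<bar>\<phi> (crep Z t)\<bar> \<le> max A B" "\<bar>\<psi> (crep Z t)\<bar> \<le> max A B" for t
      using A B by (auto simp: le_max_iff_disj)
  qed (rule arc_deriv(1)[OF \<phi> G], rule arc_deriv(1)[OF \<psi> G])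
  then show ?thesis by (rule has_density_unique[OF arc_deriv(1)[OF Lip_b_mult[OF \<phi> \<psi>] G]])
qed

lemma asymptotic_slope_less:
  assumes "asymptotic_slope d \<phi> x < r"
  obtains U where "open U" "x \<in> U" "Lip d \<phi> U < r"
  using assms unfolding asymptotic_slope_def INF_less_iff by auto

lemma open_slope_less: "open {x. asymptotic_slope d \<phi> x < r}"
proof (subst open_subopen, safe)
  fix x assume "asymptotic_slope d \<phi> x < r"
  then obtain U where U: "open U" "x \<in> U" "Lip d \<phi> U < r" using asymptotic_slope_less by blast
  have "asymptotic_slope d \<phi> y < r" if "y \<in> U" for y
    unfolding asymptotic_slope_def INF_less_iff using U that by auto
  then show "\<exists>T. open T \<and> x \<in> T \<and> T \<subseteq> {x. asymptotic_slope d \<phi> x < r}" using U by blast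
qed

lemma slope_measurable: "asymptotic_slope d \<phi> \<in> borel_measurable borel"
  by (rule borel_measurableI_less) (use open_slope_less in auto)

text \<open>On an interval where \<phi> along the arc is Lipschitz with constant
  \<open>r * rlen Z\<close>, this constant bounds the density almost everywhere. Rational intervals
  and rational \<open>r\<close> leave a single null set; off it, a neighbourhood with Lipschitz
  constant below \<open>r\<close> supplies such an interval around \<open>t\<close>.\<close>

lemma arc_deriv_slope:
  assumes \<phi>: "\<phi> \<in> Lip_b d" and G: "Z \<in> RA d"
  shows "AE t in lborel. t \<in> {0..1} \<longrightarrow> ennreal \<bar>arc_deriv \<phi> Z t\<bar> \<le> ennreal (rlen Z) * asymptotic_slope d \<phi> (crep Z t)"
proof -
  let ?h = "arc_deriv \<phi> Z"
  note hd = arc_deriv(1)[OF \<phi> G, unfolded has_density_def]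
  have ae: "AE t in lborel. t \<in> {p<..<q} \<longrightarrow> \<bar>?h t\<bar> \<le> r * rlen Z"
    if r: "r > 0" and lip: "\<And>a b. p \<le> a ==> a \<le> b ==> b \<le> q ==> \<bar>\<phi> (crep Z b) - \<phi> (crep Z a)\<bar> \<le> r * rlen Z * (b - a)" for p q r :: real
  proof (cases "p < q")
    case True
    \<comment> \<open>Freezing the curve outside \<open>[p,q]\<close> turns the local estimate into
      one for all intervals, as \<open>has_density_abs_le\<close> demands.\<close>
    define cl where "cl x = max p (min q x)" for x
    have h0: "has_density (\<lambda>x. \<phi> (crep Z (cl x))) (\<lambda>t. indicator {p<..q} t * ?h t)"
      unfolding has_density_def
    proof (intro conjI allI impI)
      show "integrable lborel (\<lambda>t. indicator {p<..q} t * ?h t)"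
        using integrable_mult_indicator[of "{p<..q}" lborel ?h] hd by simp
      show "(\<lambda>t. indicator {p<..q} t * ?h t) \<in> borel_measurable borel" using hd by auto
      fix a b :: real assume ab: "a \<le> b"
      have "ioc_integral (\<lambda>t. indicator {p<..q} t * ?h t) a b = ioc_integral ?h (cl a) (cl b)"
        unfolding set_lebesgue_integral_def cl_def using ab True
        by (intro Bochner_Integration.integral_cong) (auto split: split_indicator)
      moreover have "cl a \<le> cl b" using ab by (auto simp: cl_def)
      ultimately show "\<phi> (crep Z (cl b)) - \<phi> (crep Z (cl a)) = ioc_integral (\<lambda>t. indicator {p<..q} t * ?h t) a b"
        using hd by simp
    qed
    have Gi: "integrable lborel (\<lambda>t. indicator {p<..q} t * (r * rlen Z))" by (rule integrable_Ioc_const)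
    have "AE t in lborel. \<bar>indicator {p<..q} t * ?h t\<bar> \<le> indicator {p<..q} t * (r * rlen Z)"
    proof (rule has_density_abs_le[OF h0 Gi])
      fix a b :: real assume ab: "a \<le> b"
      have cab: "p \<le> cl a" "cl a \<le> cl b" "cl b \<le> q" using ab True by (auto simp: cl_def)
      have "ioc_integral (\<lambda>t. indicator {p<..q} t * (r * rlen Z)) a b = ioc_integral (\<lambda>_. r * rlen Z) (cl a) (cl b)"
        unfolding set_lebesgue_integral_def cl_def using ab True
        by (intro Bochner_Integration.integral_cong) (auto split: split_indicator)
      also have "... = r * rlen Z * (cl b - cl a)" by (rule ioc_integral_const[OF cab(2)])
      finally have eq: "ioc_integral (\<lambda>t. indicator {p<..q} t * (r * rlen Z)) a b = r * rlen Z * (cl b - cl a)" .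
      show "\<bar>\<phi> (crep Z (cl b)) - \<phi> (crep Z (cl a))\<bar> \<le> ioc_integral (\<lambda>t. indicator {p<..q} t * (r * rlen Z)) a b"
        unfolding eq by (rule lip[OF cab])
    qed
    then show ?thesis by eventually_elim auto
  qed simp
  have "AE t in lborel. \<forall>p\<in>\<rat>. \<forall>q\<in>\<rat>. \<forall>r\<in>\<rat>. r > 0 \<longrightarrow>
      (\<forall>a b. p \<le> a \<longrightarrow> a \<le> b \<longrightarrow> b \<le> q \<longrightarrow> \<bar>\<phi> (crep Z b) - \<phi> (crep Z a)\<bar> \<le> r * rlen Z * (b - a)) \<longrightarrow>
      t \<in> {p<..<q} \<longrightarrow> \<bar>?h t\<bar> \<le> r * rlen Z"
    by (intro AE_ball_countable' countable_rat AE_impI) (use ae in \<open>auto simp: AE_all_countable intro!: AE_impI\<close>)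
  then show ?thesis
  proof eventually_elim
    case (elim t)
    show ?case
    proof
      assume t: "t \<in> {0..1}"
      have key: "ennreal \<bar>?h t\<bar> \<le> ennreal (rlen Z) * ennreal r" if r: "r \<in> \<rat>" "r > 0" "asymptotic_slope d \<phi> (crep Z t) < ennreal r" for r
      proof -
        obtain U where U: "open U" "crep Z t \<in> U" "Lip d \<phi> U < ennreal r" using asymptotic_slope_less[OF r(3)] by blast
        have LU: "ennreal \<bar>\<phi> x - \<phi> y\<bar> \<le> ennreal r * d x y" if "x \<in> U" "y \<in> U" for x y
          using Lip_le_iff[OF ext_dist r(2), of \<phi> U] U(3) that by (auto simp: less_imp_le)
        have "open (crep Z -` U)" using crep_continuous[OF G] U(1) by (rule open_vimage[rotated])
        then obtain e where e: "e > 0" "\<And>s. \<bar>s - t\<bar> < e ==> crep Z s \<in> U"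
          using U(2) unfolding open_dist dist_real_def by blast
        obtain p where p: "p \<in> \<rat>" "t - e < p" "p < t" using Rats_dense_in_real[of "t - e" t] e by auto
        obtain q where q: "q \<in> \<rat>" "t < q" "q < t + e" using Rats_dense_in_real[of t "t + e"] e by auto
        have "\<bar>\<phi> (crep Z b) - \<phi> (crep Z a)\<bar> \<le> r * rlen Z * (b - a)" if ab: "p \<le> a" "a \<le> b" "b \<le> q" for a b
        proof -
          have "ennreal \<bar>\<phi> (crep Z a) - \<phi> (crep Z b)\<bar> \<le> ennreal r * d (crep Z a) (crep Z b)"
            using ab p q by (intro LU e) auto
          also have "... \<le> ennreal r * ennreal (rlen Z * (max 0 (min 1 b) - max 0 (min 1 a)))"
            by (intro mult_left_mono crep_d_le G ab) simp
          also have "... \<le> ennreal r * ennreal (rlen Z * (b - a))"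
            using ab by (intro mult_left_mono ennreal_leI) auto
          also have "... = ennreal (r * rlen Z * (b - a))" using r by (simp add: ennreal_mult' mult.assoc)
          finally show ?thesis using ab r by (subst (asm) ennreal_le_iff) (auto simp: abs_minus_commute)
        qed
        then have "\<bar>?h t\<bar> \<le> r * rlen Z" using elim p q r by auto
        then have "ennreal \<bar>?h t\<bar> \<le> ennreal (rlen Z * r)" by (intro ennreal_leI) (simp add: mult.commute)
        then show ?thesis using r by (simp add: ennreal_mult)
      qed
      show "ennreal \<bar>?h t\<bar> \<le> ennreal (rlen Z) * asymptotic_slope d \<phi> (crep Z t)"
      proof (cases "asymptotic_slope d \<phi> (crep Z t)")
        case (real s)
        have "\<bar>?h t\<bar> \<le> rlen Z * s"
        proof (rule ccontr)
          assume n: "\<not> ?thesis"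
          then have L: "0 < rlen Z" using arc_deriv_bound[OF \<phi> G, of t] by (cases "rlen Z = 0") (auto simp: less_le)
          then have "s < \<bar>?h t\<bar> / rlen Z" using n by (simp add: field_simps)
          then obtain r where r: "r \<in> \<rat>" "s < r" "r < \<bar>?h t\<bar> / rlen Z" using Rats_dense_in_real by blast
          have "ennreal \<bar>?h t\<bar> \<le> ennreal (rlen Z * r)"
            using key[of r] real r L by (auto simp: ennreal_less_iff ennreal_mult)
          then show False using r L real by (simp add: ennreal_le_iff field_simps)
        qed
        then show ?thesis using real by (simp add: ennreal_mult[symmetric] ennreal_leI)
      next
        \<comment> \<open>An infinite slope gives no trivial bound only when the length is 0, and
          then the density vanishes by \<open>arc_deriv_bound\<close>.\<close>
        case top
        have "\<bar>?h t\<bar> \<le> lipc \<phi> * rlen Z" by (rule arc_deriv_bound[OF \<phi> G])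
        then show ?thesis using top by (cases "rlen Z = 0") (auto simp: ennreal_mult_top)
      qed
    qed
  qed
qed

text \<open>The kernels \<open>L\<close> and \<open>C L + \<phi>'\<close>: the second is nonnegative, and their difference recovers the
  derivative.\<close>

definition len_kernel :: "'a arc => real => ennreal" where "len_kernel Z t = ennreal (rlen Z)"
definition der_kernel :: "('a => real) => 'a arc => real => ennreal" where
  "der_kernel \<phi> Z t = ennreal (lipc \<phi> * rlen Z + arc_deriv \<phi> Z t)"

lemma nn_integral_Icc_const: "a \<le> b ==> c \<ge> 0 ==> (\<integral>\<^sup>+x\<in>{a..b::real}. ennreal c \<partial>lborel) = ennreal (c * (b - a))"
  by (simp add: nn_integral_cmult_indicator ennreal_mult)

lemma arc_kernel_len: "arc_kernel len_kernel"
proof (rule arc_kernelI[OF lower_semicts_d])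
  fix Z and s t :: real assume G: "Z \<in> RA d" and st: "0 \<le> s" "s \<le> t" "t \<le> 1"
  show "variation d (rep Z) s t = (\<integral>\<^sup>+x\<in>{s..t}. len_kernel Z x \<partial>lborel)"
    using rep_in(2)[OF G] st unfolding unit_speed_def len_kernel_def by (simp add: nn_integral_Icc_const)
next
  fix Z assume "Z \<in> RA d"
  show "(\<integral>\<^sup>+x\<in>{0..1}. len_kernel Z x \<partial>lborel) < \<infinity>" unfolding len_kernel_def by (simp add: nn_integral_Icc_const)
next
  fix Z :: "'a arc"
  have "len_kernel Z = (\<lambda>t. ennreal (rlen Z))" by (simp add: fun_eq_iff len_kernel_def)
  then show "len_kernel Z \<in> borel_measurable borel" by simp
qed

text \<open>Each cell costs at most the increment of the nondecreasing function \<open>F\<close>,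
  and these increments telescope. Monotonicity of \<open>F\<close> also ensures that
  \<open>ennreal\<close> truncates nothing.\<close>

lemma variation_cost_le:
  assumes \<phi>: "lipschitz_with C \<phi>" and G: "Z \<in> RA d" and st: "0 \<le> s" "s \<le> t" "t \<le> 1"
  shows "variation (cost C \<phi>) (rep Z) s t \<le> ennreal (C * rlen Z * (t - s) + \<phi> (rep Z t) - \<phi> (rep Z s))"
  unfolding variation_eq_gvar
proof (rule gvar_le)
  fix n u assume u: "partition_of s t n u"
  have C: "0 \<le> C" using \<phi> unfolding lipschitz_with_def by simp
  define F where "F x = C * rlen Z * x + \<phi> (rep Z x)" for x
  have F: "F x \<le> F y" if "0 \<le> x" "x \<le> y" "y \<le> 1" for x y
    using lipschitz_with_crep[OF \<phi> G that(2)] that by (simp add: F_def crep_eq algebra_simps)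
  have ui: "0 \<le> u i" "u i \<le> u (Suc i)" "u (Suc i) \<le> 1" if "i < n" for i
    using partition_of_mem[OF u, of i] partition_of_mem[OF u, of "Suc i"] partition_of_mono[OF u, of i "Suc i"] that st by auto
  have "gsum (cost C \<phi>) UNIV (rep Z) n u \<le> (\<Sum>i<n. ennreal (F (u (Suc i)) - F (u i)))"
    unfolding gsum_def
  proof (rule sum_mono)
    fix i assume "i \<in> {..<n}"
    then have i: "0 \<le> u i" "u i \<le> u (Suc i)" "u (Suc i) \<le> 1" using ui by auto
    have "cost C \<phi> (rep Z (u i)) (rep Z (u (Suc i))) \<le> ennreal (C * (rlen Z * (u (Suc i) - u i)) + \<phi> (rep Z (u (Suc i))) - \<phi> (rep Z (u i)))"
      by (rule cost_le[OF C unit_speed_d_le[OF rep_in(2)[OF G] i]]) (use i in simp)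
    then show "(if rep Z ` {u i..u (Suc i)} \<subseteq> UNIV then cost C \<phi> (rep Z (u i)) (rep Z (u (Suc i))) else 0) \<le> ennreal (F (u (Suc i)) - F (u i))"
      by (simp add: F_def algebra_simps)
  qed
  also have "... = ennreal (F (u n) - F (u 0))"
    using F[OF ui] by (subst sum_ennreal) (auto simp: sum_lessThan_telescope[of "\<lambda>i. F (u i)"])
  also have "... \<le> ennreal (F t - F s)"
    using F[of s "u 0"] F[of "u n" t] partition_of_mem[OF u, of 0] partition_of_mem[OF u, of n] st by (intro ennreal_leI) auto
  finally show "gsum (cost C \<phi>) UNIV (rep Z) n u \<le> ennreal (C * rlen Z * (t - s) + \<phi> (rep Z t) - \<phi> (rep Z s))"
    by (simp add: F_def algebra_simps)
qed

text \<open>Equality holds since the upper bounds for \<open>\<phi>\<close> and \<open>-\<phi>\<close> add up to the lower bound \<open>2 C L (t - s)\<close>.\<close>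

lemma variation_cost:
  assumes \<phi>: "lipschitz_with C \<phi>" and G: "Z \<in> RA d" and st: "0 \<le> s" "s \<le> t" "t \<le> 1"
  shows "variation (cost C \<phi>) (rep Z) s t = ennreal (C * rlen Z * (t - s) + \<phi> (rep Z t) - \<phi> (rep Z s))"
proof (rule antisym[OF variation_cost_le[OF assms]])
  let ?R = "rep Z" and ?A = "C * rlen Z * (t - s)" and ?D = "\<phi> (rep Z t) - \<phi> (rep Z s)"
  have C: "0 \<le> C" using \<phi> unfolding lipschitz_with_def by simp
  have \<phi>': "lipschitz_with C (\<lambda>x. - \<phi> x)"
    using \<phi> Lip_b_lincomb[of \<phi> \<phi> "-1" 0] unfolding lipschitz_with_def by (simp add: abs_minus_commute)
  have D: "\<bar>?D\<bar> \<le> ?A" using lipschitz_with_crep[OF \<phi> G st(2)] st by (simp add: crep_eq)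
  have "ennreal (2 * C) * variation d ?R s t \<le> variation (cost C \<phi>) ?R s t + variation (cost C (\<lambda>x. - \<phi> x)) ?R s t"
    unfolding variation_eq_gvar gvar_def[of d] SUP_mult_left_ennreal
  proof (rule SUP_least, clarify)
    fix n u assume u: "partition_of s t n u"
    have "ennreal (2 * C) * gsum d UNIV ?R n u \<le> gsum (cost C \<phi>) UNIV ?R n u + gsum (cost C (\<lambda>x. - \<phi> x)) UNIV ?R n u"
      unfolding gsum_def sum_distrib_left sum.distrib[symmetric] by (intro sum_mono) (simp add: d_le_cost_add[OF C])
    also have "... \<le> gvar (cost C \<phi>) UNIV ?R s t + gvar (cost C (\<lambda>x. - \<phi> x)) UNIV ?R s t" by (intro add_mono gvar_ge u)
    finally show "ennreal (2 * C) * gsum d UNIV ?R n u \<le> ..." .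
  qed
  also have "variation d ?R s t = ennreal (rlen Z * (t - s))" using rep_in(2)[OF G] st unfolding unit_speed_def by blast
  also have "ennreal (2 * C) * ennreal (rlen Z * (t - s)) = ennreal ((?A - ?D) + (?A + ?D))"
    using C st by (subst ennreal_mult[symmetric]) (auto simp: algebra_simps mult_right_mono)
  also have "... = ennreal (?A - ?D) + ennreal (?A + ?D)" using D by (intro ennreal_plus) auto
  also have "variation (cost C \<phi>) ?R s t + variation (cost C (\<lambda>x. - \<phi> x)) ?R s t \<le> ennreal (?A - ?D) + variation (cost C \<phi>) ?R s t"
    using add_left_mono[OF variation_cost_le[OF \<phi>' G st], of "variation (cost C \<phi>) ?R s t"] by (simp add: add.commute algebra_simps)
  finally have "ennreal (?A + ?D) \<le> variation (cost C \<phi>) ?R s t" by (simp add: ennreal_add_left_cancel_le)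
  then show "ennreal (?A + \<phi> (?R t) - \<phi> (?R s)) \<le> variation (cost C \<phi>) ?R s t" by (simp add: algebra_simps)
qed

lemma der_kernel_nonneg: "\<phi> \<in> Lip_b d ==> Z \<in> RA d ==> 0 \<le> lipc \<phi> * rlen Z + arc_deriv \<phi> Z t"
  using arc_deriv_bound[of \<phi> Z t] by linarith

text \<open>By \<open>variation_cost\<close> the shifted derivative is a density for the variation
  of a lower semicontinuous cost, so \<open>arc_kernelI\<close> applies to it.\<close>

lemma arc_kernel_der:
  assumes \<phi>: "\<phi> \<in> Lip_b d" shows "arc_kernel (der_kernel \<phi>)"
proof (rule arc_kernelI[OF lower_semicts_cost[OF lipc[OF \<phi>]]])
  have m: "arc_deriv \<phi> Z \<in> borel_measurable borel" if "Z \<in> RA d" for Z by (rule arc_deriv_measurable[OF \<phi> that])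
  show meas: "der_kernel \<phi> Z \<in> borel_measurable borel" if "Z \<in> RA d" for Z
    unfolding der_kernel_def using m[OF that] by measurable
  show var: "variation (cost (lipc \<phi>) \<phi>) (rep Z) s t = (\<integral>\<^sup>+x\<in>{s..t}. der_kernel \<phi> Z x \<partial>lborel)"
    if G: "Z \<in> RA d" and st: "0 \<le> s" "s \<le> t" "t \<le> 1" for Z s t
  proof -
    note hd = arc_deriv(1)[OF \<phi> G, unfolded has_density_def]
    have i1: "integrable lborel (\<lambda>x. indicator {s<..t} x * (lipc \<phi> * rlen Z))" by (rule integrable_Ioc_const)
    have i2: "integrable lborel (\<lambda>x. indicator {s<..t} x * arc_deriv \<phi> Z x)"
      using integrable_mult_indicator[of "{s<..t}" lborel "arc_deriv \<phi> Z"] hd by simp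
    have "(\<integral>\<^sup>+x\<in>{s..t}. der_kernel \<phi> Z x \<partial>lborel) = (\<integral>\<^sup>+x. ennreal (indicator {s<..t} x * (lipc \<phi> * rlen Z) + indicator {s<..t} x * arc_deriv \<phi> Z x) \<partial>lborel)"
      by (rule nn_integral_cong_AE) (use AE_lborel_singleton[of s] in \<open>eventually_elim, auto simp: der_kernel_def split: split_indicator\<close>)
    also have "... = ennreal (\<integral>x. indicator {s<..t} x * (lipc \<phi> * rlen Z) + indicator {s<..t} x * arc_deriv \<phi> Z x \<partial>lborel)"
      by (rule nn_integral_eq_integral[OF Bochner_Integration.integrable_add[OF i1 i2]])
         (use der_kernel_nonneg[OF \<phi> G] in \<open>auto split: split_indicator\<close>)
    also have "(\<integral>x. indicator {s<..t} x * (lipc \<phi> * rlen Z) + indicator {s<..t} x * arc_deriv \<phi> Z x \<partial>lborel) =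
        lipc \<phi> * rlen Z * (t - s) + \<phi> (rep Z t) - \<phi> (rep Z s)"
    proof -
      have "(\<integral>x. indicator {s<..t} x * arc_deriv \<phi> Z x \<partial>lborel) = \<phi> (rep Z t) - \<phi> (rep Z s)"
        using hd[THEN conjunct2, THEN conjunct2, rule_format, OF st(2)] st by (simp add: set_lebesgue_integral_def crep_eq)
      then show ?thesis using i1 i2 st(2) by simp
    qed
    finally show ?thesis using variation_cost[OF lipc[OF \<phi>] G st] by simp
  qed
  show "(\<integral>\<^sup>+x\<in>{0..1}. der_kernel \<phi> Z x \<partial>lborel) < \<infinity>" if "Z \<in> RA d" for Z
    by (subst var[OF that, symmetric]) (auto simp: variation_cost[OF lipc[OF \<phi>] that])
qed
end

section \<open>The derivation induced by a plan\<close>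

text \<open>The hypothesis is tested on the set where the claim fails; finiteness of the integral of
  \<open>g\<close> allows the subtraction.\<close>

lemma AE_le_of_nn_integral_le:
  fixes f g :: "'b => ennreal"
  assumes f: "f \<in> borel_measurable M" and g: "g \<in> borel_measurable M" and fin: "(\<integral>\<^sup>+x. g x \<partial>M) < \<infinity>"
    and le: "\<And>A. A \<in> sets M ==> (\<integral>\<^sup>+x\<in>A. f x \<partial>M) \<le> (\<integral>\<^sup>+x\<in>A. g x \<partial>M)" shows "AE x in M. f x \<le> g x"
proof -
  note [measurable] = f g
  define B where "B = {x \<in> space M. g x < f x}"
  have B [measurable]: "B \<in> sets M" unfolding B_def by measurable
  have gB: "(\<integral>\<^sup>+x\<in>B. g x \<partial>M) < \<infinity>"
    using fin by (rule le_less_trans[rotated]) (intro nn_integral_mono, auto split: split_indicator)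
  have "(\<integral>\<^sup>+x. (f x * indicator B x - g x * indicator B x) \<partial>M) = (\<integral>\<^sup>+x\<in>B. f x \<partial>M) - (\<integral>\<^sup>+x\<in>B. g x \<partial>M)"
    using gB by (intro nn_integral_diff) (auto simp: B_def split: split_indicator)
  also have "... = 0" using le[OF B] gB by (simp add: diff_eq_0_iff_ennreal)
  finally have "AE x in M. f x * indicator B x - g x * indicator B x = 0" by (subst (asm) nn_integral_0_iff_AE) auto
  then show ?thesis using AE_space
  proof eventually_elim
    case (elim x)
    show ?case
    proof (rule ccontr)
      assume n: "\<not> f x \<le> g x"
      then have "x \<in> B" using elim(2) by (auto simp: B_def not_le)
      then have "f x - g x = 0" using elim(1) by simp
      then show False using n by (simp add: diff_eq_0_iff_ennreal)
    qed
  qed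
qed

lemma AE_nonneg_of_set_integral:
  fixes F :: "'b => real"
  assumes F: "integrable M F" and nn: "\<And>A. A \<in> sets M ==> 0 \<le> (\<integral>x. indicator A x * F x \<partial>M)"
  shows "AE x in M. 0 \<le> F x"
proof -
  have [measurable]: "F \<in> borel_measurable M" using F by auto
  define A where "A = {x \<in> space M. F x < 0}"
  have A: "A \<in> sets M" unfolding A_def by measurable
  have i: "integrable M (\<lambda>x. indicator A x * F x)" using integrable_mult_indicator[OF A F] by simp
  have "(\<integral>x. - (indicator A x * F x) \<partial>M) = 0"
  proof (rule antisym)
    show "(\<integral>x. - (indicator A x * F x) \<partial>M) \<le> 0" using nn[OF A] i by simp
    show "0 \<le> (\<integral>x. - (indicator A x * F x) \<partial>M)" by (intro integral_nonneg_AE) (auto simp: A_def split: split_indicator)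
  qed
  then have "AE x in M. - (indicator A x * F x) = 0"
    using i by (subst (asm) integral_nonneg_eq_0_iff_AE) (auto simp: A_def split: split_indicator)
  then show ?thesis using AE_space by eventually_elim (auto simp: A_def split: split_indicator_asm if_splits)
qed

lemma AE_le_of_set_integral:
  fixes F G :: "'b => real"
  assumes F: "integrable M F" and G: "integrable M G"
    and le: "\<And>A. A \<in> sets M ==> (\<integral>x. indicator A x * F x \<partial>M) \<le> (\<integral>x. indicator A x * G x \<partial>M)"
  shows "AE x in M. F x \<le> G x"
proof -
  have "AE x in M. 0 \<le> G x - F x"
  proof (rule AE_nonneg_of_set_integral)
    fix A assume A: "A \<in> sets M"
    have "integrable M (\<lambda>x. indicator A x * F x)" "integrable M (\<lambda>x. indicator A x * G x)"
      using integrable_mult_indicator[OF A F] integrable_mult_indicator[OF A G] by auto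
    then show "0 \<le> (\<integral>x. indicator A x * (G x - F x) \<partial>M)" using le[OF A] by (simp add: right_diff_distrib)
  qed (use F G in auto)
  then show ?thesis by eventually_elim simp
qed

lemma AE_eq_of_set_integral:
  fixes F G :: "'b => real"
  assumes "integrable M F" "integrable M G"
    and "\<And>A. A \<in> sets M ==> (\<integral>x. indicator A x * F x \<partial>M) = (\<integral>x. indicator A x * G x \<partial>M)"
  shows "AE x in M. F x = G x"
proof -
  have "AE x in M. F x \<le> G x" "AE x in M. G x \<le> F x" using assms by (auto intro!: AE_le_of_set_integral)
  then show ?thesis by eventually_elim simp
qed

lemma nn_integral_transfer:
  fixes f :: "'b => real" and g :: "'c => real"
  assumes f: "f \<in> borel_measurable M" "\<And>x. x \<in> space M ==> 0 \<le> f x" and g: "integrable N g" "\<And>x. 0 \<le> g x"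
    and eq: "(\<integral>\<^sup>+x. ennreal (f x) \<partial>M) = (\<integral>\<^sup>+x. ennreal (g x) \<partial>N)"
  shows "integrable M f" "(\<integral>x. f x \<partial>M) = (\<integral>x. g x \<partial>N)"
proof -
  have ge: "(\<integral>\<^sup>+x. ennreal (g x) \<partial>N) = ennreal (\<integral>x. g x \<partial>N)" by (rule nn_integral_eq_integral[OF g(1)]) (use g in auto)
  show i: "integrable M f" by (rule integrableI_nonneg[OF f(1)]) (use f(2) eq ge in auto)
  have "(\<integral>\<^sup>+x. ennreal (f x) \<partial>M) = ennreal (\<integral>x. f x \<partial>M)" by (rule nn_integral_eq_integral[OF i]) (use f(2) in auto)
  then have "ennreal (\<integral>x. f x \<partial>M) = ennreal (\<integral>x. g x \<partial>N)" using eq ge by simp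
  moreover have "0 \<le> (\<integral>x. f x \<partial>M)" "0 \<le> (\<integral>x. g x \<partial>N)" using f(2) g(2) by (auto intro!: integral_nonneg_AE)
  ultimately show "(\<integral>x. f x \<partial>M) = (\<integral>x. g x \<partial>N)" by simp
qed

text \<open>The Radon-Nikodym density is cut off at \<rho>, so that the bound holds at every point
  and not merely almost everywhere.\<close>

lemma dominated_density:
  fixes \<rho> :: "'b => real"
  assumes M: "finite_measure M" and N: "sets N = sets M" and \<rho>: "integrable M \<rho>" "\<And>x. 0 \<le> \<rho> x"
    and le: "\<And>B. B \<in> sets M ==> emeasure N B \<le> (\<integral>\<^sup>+x\<in>B. ennreal (\<rho> x) \<partial>M)"
  obtains \<rho>' where "\<rho>' \<in> borel_measurable M" "\<And>x. 0 \<le> \<rho>' x" "\<And>x. \<rho>' x \<le> \<rho> x" "N = density M (\<lambda>x. ennreal (\<rho>' x))"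
proof -
  interpret finite_measure M by (rule M)
  have [measurable]: "\<rho> \<in> borel_measurable M" using \<rho> by auto
  have "absolutely_continuous M N" unfolding absolutely_continuous_def
  proof
    fix A assume A: "A \<in> null_sets M"
    then have As: "A \<in> sets M" by auto
    have "AE x in M. x \<notin> A" using A by (rule AE_not_in)
    then have "(\<integral>\<^sup>+x\<in>A. ennreal (\<rho> x) \<partial>M) = (\<integral>\<^sup>+x. 0 \<partial>M)" by (intro nn_integral_cong_AE) auto
    then have "emeasure N A = 0" using le[OF As] by simp
    then show "A \<in> null_sets N" using As N by (intro null_setsI) simp_all
  qed
  then obtain f where f [measurable]: "f \<in> borel_measurable M" and fN: "density M f = N" using Radon_Nikodym[OF _ N] by auto
  have "AE x in M. f x \<le> ennreal (\<rho> x)"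
  proof (rule AE_le_of_nn_integral_le[OF f])
    show "(\<integral>\<^sup>+x. ennreal (\<rho> x) \<partial>M) < \<infinity>" using \<rho> by (subst nn_integral_eq_integral) auto
    fix A assume A: "A \<in> sets M"
    then show "(\<integral>\<^sup>+x\<in>A. f x \<partial>M) \<le> (\<integral>\<^sup>+x\<in>A. ennreal (\<rho> x) \<partial>M)"
      using le[OF A] unfolding fN[symmetric] by (simp add: emeasure_density)
  qed simp
  then have ae: "AE x in M. f x = ennreal (min (\<rho> x) (enn2real (f x)))"
  proof eventually_elim
    case (elim x)
    then have "f x < \<infinity>" by (auto intro: le_less_trans)
    then have "f x = ennreal (enn2real (f x))" by simp
    moreover then have "enn2real (f x) \<le> \<rho> x" using elim \<rho>(2)[of x] by (metis ennreal_le_iff)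
    ultimately show ?case by (simp add: min_def)
  qed
  show ?thesis
  proof (rule that[of "\<lambda>x. min (\<rho> x) (enn2real (f x))"])
    show "N = density M (\<lambda>x. ennreal (min (\<rho> x) (enn2real (f x))))"
      unfolding fN[symmetric] using ae by (intro density_cong) auto
  qed (use \<rho> in auto)
qed

lemma integrable_unit:
  assumes "g \<in> borel_measurable borel" "\<And>t. \<bar>g t\<bar> \<le> K"
  shows "integrable lborel (\<lambda>t. indicator {0..1::real} t * (g t :: real))"
proof (rule Bochner_Integration.integrable_bound[of lborel "\<lambda>t. indicator {0..1} t * K"])
  show "integrable lborel (\<lambda>t. indicator {0..1::real} t * K)" by (intro integrable_mult_left integrable_real_indicator) auto
  show "AE t in lborel. norm (indicator {0..1} t * g t) \<le> norm (indicator {0..1} t * K)"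
    using assms(2) by (auto split: split_indicator intro!: order_trans[OF _ abs_ge_self])
qed (use assms(1) in measurable)

locale emtm = emt d for d :: "'a::t2_space => 'a => ennreal" +
  fixes m :: "'a measure"
  assumes radon_m: "radon_measure euclidean m"
begin

lemma sets_m [measurable_cong, simp]: "sets m = sets borel"
  using radon_m unfolding radon_measure_def by (simp add: borel_def)

lemma space_m [simp]: "space m = UNIV" using sets_eq_imp_space_eq[OF sets_m] by simp

lemma fin_m: "finite_measure m" using radon_m unfolding radon_measure_def by simp

lemma meas_m: "borel_measurable m = borel_measurable borel" by (rule measurable_cong_sets) auto

lemma integrable_bounded_mult:
  assumes "integrable m \<rho>" "h \<in> borel_measurable borel" "\<And>x. \<bar>h x\<bar> \<le> (B::real)"
  shows "integrable m (\<lambda>x. h x * \<rho> x)"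
proof (rule Bochner_Integration.integrable_bound[of m "\<lambda>x. B * \<rho> x"])
  have "B \<ge> 0" using assms(3) abs_ge_zero order_trans by blast
  then show "AE x in m. norm (h x * \<rho> x) \<le> norm (B * \<rho> x)"
    using assms(3) by (auto simp: abs_mult intro!: mult_right_mono)
  show "(\<lambda>x. h x * \<rho> x) \<in> borel_measurable m" using assms by (auto simp: meas_m)
qed (use assms(1) in simp)

text \<open>The class leaves out Radon regularity, so that restrictions to Borel sets of arcs stay
  in it; the three densities are nonnegative everywhere and integrable, while membership in
  \<open>Lp\<close> is carried along separately.\<close>

definition arc_plan :: "'a arc measure => ('a => real) => ('a => real) => ('a => real) => bool" where
  "arc_plan \<pi> \<rho> \<rho>0 \<rho>1 \<longleftrightarrow> sets \<pi> = sets (RAB d) \<and> finite_measure \<pi> \<and>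
     (\<forall>x. 0 \<le> \<rho> x \<and> 0 \<le> \<rho>0 x \<and> 0 \<le> \<rho>1 x) \<and> integrable m \<rho> \<and> integrable m \<rho>0 \<and> integrable m \<rho>1 \<and>
     (\<forall>u\<in>borel_measurable borel. (\<integral>\<^sup>+Z. kint len_kernel Z u \<partial>\<pi>) = (\<integral>\<^sup>+x. ennreal (\<rho> x) * u x \<partial>m) \<and>
        (\<integral>\<^sup>+Z. u (rep Z 0) \<partial>\<pi>) = (\<integral>\<^sup>+x. ennreal (\<rho>0 x) * u x \<partial>m) \<and>
        (\<integral>\<^sup>+Z. u (rep Z 1) \<partial>\<pi>) = (\<integral>\<^sup>+x. ennreal (\<rho>1 x) * u x \<partial>m))"

text \<open>Reparametrizations fix 0 and 1, so prescribing an open set for the value there is a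
  saturated condition on curves.\<close>

lemma endpoint_measurable:
  "(\<lambda>Z. rep Z 0) \<in> measurable (RAB d) borel" "(\<lambda>Z. rep Z 1) \<in> measurable (RAB d) borel"
proof -
  have *: "(\<lambda>Z. rep Z t) \<in> measurable (RAB d) borel"
    if t: "t \<in> {0..1}" "\<And>\<phi>. reparametrization \<phi> ==> \<phi> t = t" for t
  proof (rule borel_measurableI)
    fix U :: "'a set" assume U: "open U"
    have "openin compact_open_topology {\<gamma> \<in> curves. \<gamma> ` {t} \<subseteq> U}" by (rule openin_compact_open) (use t U in auto)
    then have "openin (RA_topology d) {Z \<in> RA d. rep Z \<in> {\<gamma> \<in> curves. \<gamma> ` {t} \<subseteq> U}}"
    proof (rule openin_saturated)
      fix \<gamma> \<sigma> assume g: "\<gamma> \<in> {\<gamma> \<in> curves. \<gamma> ` {t} \<subseteq> U}" and rel: "(\<gamma>, \<sigma>) \<in> arc_rel"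
      obtain \<phi> \<psi> where pq: "reparametrization \<phi>" "reparametrization \<psi>" "\<forall>s\<in>{0..1}. \<gamma> (\<phi> s) = \<sigma> (\<psi> s)" and s: "\<sigma> \<in> curves"
        using rel unfolding arc_rel_def by auto
      then have "\<gamma> t = \<sigma> t" using t(2)[OF pq(1)] t(2)[OF pq(2)] t(1) by metis
      then show "\<sigma> \<in> {\<gamma> \<in> curves. \<gamma> ` {t} \<subseteq> U}" using g s by simp
    qed
    moreover have "{Z \<in> RA d. rep Z \<in> {\<gamma> \<in> curves. \<gamma> ` {t} \<subseteq> U}} = (\<lambda>Z. rep Z t) -` U \<inter> space (RAB d)"
      using rep_curve(1) by auto
    ultimately show "(\<lambda>Z. rep Z t) -` U \<inter> space (RAB d) \<in> sets (RAB d)" using openin_sets_RAB by metis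
  qed
  show "(\<lambda>Z. rep Z 0) \<in> measurable (RAB d) borel" "(\<lambda>Z. rep Z 1) \<in> measurable (RAB d) borel"
    by (rule *; use reparametrizationD in simp)+
qed

text \<open>This is the integral of \<open>h\<close> along the arc with respect to length;
  \<open>dint \<phi> h\<close> is its integral against the differential of \<phi>. Both are real
  valued in order to allow for signs.\<close>

definition lint :: "('a => real) => 'a arc => real" where
  "lint h Z = (\<integral>t. indicator {0..1} t * (h (crep Z t) * rlen Z) \<partial>lborel)"
definition dint :: "('a => real) => ('a => real) => 'a arc => real" where
  "dint \<phi> h Z = (\<integral>t. indicator {0..1} t * (h (crep Z t) * arc_deriv \<phi> Z t) \<partial>lborel)"

definition bdd_borel :: "('a => real) => bool" where
  "bdd_borel h \<longleftrightarrow> h \<in> borel_measurable borel \<and> (\<exists>B. \<forall>x. \<bar>h x\<bar> \<le> B)"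

lemma bdd_borel_measurable: "bdd_borel h ==> h \<in> borel_measurable borel"
  unfolding bdd_borel_def by blast

lemma bdd_borel_crep:
  assumes "bdd_borel h" "Z \<in> RA d" shows "(\<lambda>t. h (crep Z t)) \<in> borel_measurable borel"
  using measurable_compose[OF crep_measurable[OF assms(2)] bdd_borel_measurable[OF assms(1)]] .

lemma lint_integrable:
  assumes h: "bdd_borel h" and G: "Z \<in> RA d"
  shows "integrable lborel (\<lambda>t. indicator {0..1} t * (h (crep Z t) * rlen Z))"
proof -
  obtain B where B: "\<And>x. \<bar>h x\<bar> \<le> B" using h unfolding bdd_borel_def by auto
  have "(\<lambda>t. h (crep Z t) * rlen Z) \<in> borel_measurable borel" using bdd_borel_crep[OF h G] by measurable
  then show ?thesis by (rule integrable_unit[of _ "B * rlen Z"]) (use B in \<open>auto simp: abs_mult intro: mult_right_mono\<close>)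
qed

lemma dint_integrable:
  assumes h: "bdd_borel h" and \<phi>: "\<phi> \<in> Lip_b d" and G: "Z \<in> RA d"
  shows "integrable lborel (\<lambda>t. indicator {0..1} t * (h (crep Z t) * arc_deriv \<phi> Z t))"
proof -
  obtain B where B: "\<And>x. \<bar>h x\<bar> \<le> B" using h unfolding bdd_borel_def by auto
  have "B \<ge> 0" using B[of undefined] by linarith
  have "(\<lambda>t. h (crep Z t) * arc_deriv \<phi> Z t) \<in> borel_measurable borel"
    using bdd_borel_crep[OF h G] arc_deriv_measurable[OF \<phi> G] by measurable
  then show ?thesis by (rule integrable_unit[of _ "B * (lipc \<phi> * rlen Z)"])
       (use B \<open>B \<ge> 0\<close> arc_deriv_bound[OF \<phi> G] in \<open>auto simp: abs_mult intro!: mult_mono\<close>)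
qed

lemma lint_nonneg: "(\<And>x. 0 \<le> h x) ==> 0 \<le> lint h Z"
  unfolding lint_def by (intro integral_nonneg_AE) auto

lemma kint_len:
  assumes h: "bdd_borel h" "\<And>x. 0 \<le> h x" and G: "Z \<in> RA d"
  shows "kint len_kernel Z (\<lambda>x. ennreal (h x)) = ennreal (lint h Z)"
proof -
  have "kint len_kernel Z (\<lambda>x. ennreal (h x)) = (\<integral>\<^sup>+t. ennreal (indicator {0..1} t * (h (crep Z t) * rlen Z)) \<partial>lborel)"
    unfolding kint_def len_kernel_def using h(2)
    by (intro nn_integral_cong) (auto simp: ennreal_mult mult.commute split: split_indicator)
  also have "... = ennreal (lint h Z)" unfolding lint_def
    by (rule nn_integral_eq_integral[OF lint_integrable[OF h(1) G]]) (use h(2) in auto)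
  finally show ?thesis .
qed

lemma kint_der:
  assumes h: "bdd_borel h" "\<And>x. 0 \<le> h x" and \<phi>: "\<phi> \<in> Lip_b d" and G: "Z \<in> RA d"
  shows "kint (der_kernel \<phi>) Z (\<lambda>x. ennreal (h x)) = ennreal (lipc \<phi> * lint h Z + dint \<phi> h Z)" "0 \<le> lipc \<phi> * lint h Z + dint \<phi> h Z"
proof -
  let ?f = "\<lambda>t. lipc \<phi> * (indicator {0..1} t * (h (crep Z t) * rlen Z)) + indicator {0..1} t * (h (crep Z t) * arc_deriv \<phi> Z t)"
  have nn: "0 \<le> h (crep Z t) * (lipc \<phi> * rlen Z + arc_deriv \<phi> Z t)" for t
    using h(2) der_kernel_nonneg[OF \<phi> G] by simp
  then have f0: "0 \<le> ?f t" for t using nn[of t] by (auto simp: algebra_simps split: split_indicator)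
  have "kint (der_kernel \<phi>) Z (\<lambda>x. ennreal (h x)) = (\<integral>\<^sup>+t. ennreal (?f t) \<partial>lborel)"
    unfolding kint_def der_kernel_def using h(2) der_kernel_nonneg[OF \<phi> G]
    by (intro nn_integral_cong) (auto simp: ennreal_mult[symmetric] algebra_simps split: split_indicator)
  also have "... = ennreal (\<integral>t. ?f t \<partial>lborel)"
    by (rule nn_integral_eq_integral) (use f0 lint_integrable[OF h(1) G] dint_integrable[OF h(1) \<phi> G] in auto)
  also have eq: "(\<integral>t. ?f t \<partial>lborel) = lipc \<phi> * lint h Z + dint \<phi> h Z"
    unfolding lint_def dint_def using lint_integrable[OF h(1) G] dint_integrable[OF h(1) \<phi> G] by simp
  finally show "kint (der_kernel \<phi>) Z (\<lambda>x. ennreal (h x)) = ennreal (lipc \<phi> * lint h Z + dint \<phi> h Z)" .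
  show "0 \<le> lipc \<phi> * lint h Z + dint \<phi> h Z" unfolding eq[symmetric] using f0 by (intro integral_nonneg_AE) auto
qed

section \<open>From a plan to a derivation\<close>

context
  fixes \<pi> \<rho> \<rho>0 \<rho>1
  assumes plan: "arc_plan \<pi> \<rho> \<rho>0 \<rho>1"
begin

lemma plan_sets: "sets \<pi> = sets (RAB d)" and plan_space: "space \<pi> = RA d" and plan_fin: "finite_measure \<pi>"
  using plan sets_eq_imp_space_eq[of \<pi> "RAB d"] unfolding arc_plan_def by auto

lemma plan_meas: "measurable \<pi> N = measurable (RAB d) N"
  by (rule measurable_cong_sets[OF plan_sets refl])

lemma plan_dens_nonneg: "0 \<le> \<rho> x" "0 \<le> \<rho>0 x" "0 \<le> \<rho>1 x"
  and plan_dens_integrable: "integrable m \<rho>" "integrable m \<rho>0" "integrable m \<rho>1"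
  using plan unfolding arc_plan_def by auto

lemma plan_dens_measurable: "\<rho> \<in> borel_measurable borel" "\<rho>0 \<in> borel_measurable borel" "\<rho>1 \<in> borel_measurable borel"
  using plan_dens_integrable[THEN borel_measurable_integrable] by (auto simp: meas_m)

lemma plan_kint: "u \<in> borel_measurable borel ==> (\<integral>\<^sup>+Z. kint len_kernel Z u \<partial>\<pi>) = (\<integral>\<^sup>+x. ennreal (\<rho> x) * u x \<partial>m)"
  and plan_end0: "u \<in> borel_measurable borel ==> (\<integral>\<^sup>+Z. u (rep Z 0) \<partial>\<pi>) = (\<integral>\<^sup>+x. ennreal (\<rho>0 x) * u x \<partial>m)"
  and plan_end1: "u \<in> borel_measurable borel ==> (\<integral>\<^sup>+Z. u (rep Z 1) \<partial>\<pi>) = (\<integral>\<^sup>+x. ennreal (\<rho>1 x) * u x \<partial>m)"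
  using plan unfolding arc_plan_def by auto

text \<open>\<open>n\<close> is the density of the mixture of the shifted kernels. The factor 2
  appears because \<open>\<bar>arc_deriv \<phi> Z t\<bar> \<le> lipc \<phi> * rlen Z\<close> bounds
  the kernel by twice the shift.\<close>

definition is_plan_dens :: "('a => real) => ('a => real) => bool" where
  "is_plan_dens \<phi> n \<longleftrightarrow> n \<in> borel_measurable borel \<and> (\<forall>x. 0 \<le> n x \<and> n x \<le> 2 * lipc \<phi> * \<rho> x) \<and>
    (\<forall>u\<in>borel_measurable borel. (\<integral>\<^sup>+Z. kint (der_kernel \<phi>) Z u \<partial>\<pi>) = (\<integral>\<^sup>+x. ennreal (n x) * u x \<partial>m))"

lemma ex_plan_dens:
  assumes \<phi>: "\<phi> \<in> Lip_b d" shows "\<exists>n. is_plan_dens \<phi> n"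
proof -
  obtain N where N: "sets N = sets borel" "\<And>u. u \<in> borel_measurable borel ==> (\<integral>\<^sup>+x. u x \<partial>N) = (\<integral>\<^sup>+Z. kint (der_kernel \<phi>) Z u \<partial>\<pi>)"
    using ex_mixture[OF arc_kernel_der[OF \<phi>] plan_sets] by metis
  note lp = lipc_pos[OF \<phi>]
  have le: "emeasure N B \<le> (\<integral>\<^sup>+x\<in>B. ennreal (2 * lipc \<phi> * \<rho> x) \<partial>m)" if B: "B \<in> sets m" for B
  proof -
    have Bb [measurable]: "B \<in> sets borel" using B by simp
    have km: "(\<lambda>Z. kint len_kernel Z (indicator B)) \<in> borel_measurable \<pi>"
      unfolding plan_meas by (rule kint_measurable[OF arc_kernel_len]) simp
    have "emeasure N B = (\<integral>\<^sup>+x. indicator B x \<partial>N)" using N(1) by simp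
    also have "... = (\<integral>\<^sup>+Z. kint (der_kernel \<phi>) Z (indicator B) \<partial>\<pi>)" by (rule N(2)) simp
    also have "... \<le> (\<integral>\<^sup>+Z. ennreal (2 * lipc \<phi>) * kint len_kernel Z (indicator B) \<partial>\<pi>)"
    proof (rule nn_integral_mono)
      fix Z assume "Z \<in> space \<pi>"
      then have G: "Z \<in> RA d" by (simp add: plan_space)
      have kl: "len_kernel Z = (\<lambda>t. ennreal (rlen Z))" by (simp add: fun_eq_iff len_kernel_def)
      have "kint (der_kernel \<phi>) Z (indicator B) \<le> (\<integral>\<^sup>+t. ennreal (2 * lipc \<phi>) * (len_kernel Z t * indicator B (crep Z t) * indicator {0..1} t) \<partial>lborel)"
        unfolding kint_def
      proof (rule nn_integral_mono)
        fix t
        have "der_kernel \<phi> Z t \<le> ennreal (2 * lipc \<phi>) * len_kernel Z t"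
        proof -
          have "lipc \<phi> * rlen Z + arc_deriv \<phi> Z t \<le> 2 * lipc \<phi> * rlen Z" using arc_deriv_bound[OF \<phi> G, of t] by (simp add: abs_le_iff algebra_simps)
          then have "ennreal (lipc \<phi> * rlen Z + arc_deriv \<phi> Z t) \<le> ennreal (2 * lipc \<phi> * rlen Z)" by (rule ennreal_leI)
          then show ?thesis unfolding der_kernel_def len_kernel_def using lp by (simp add: ennreal_mult)
        qed
        then show "der_kernel \<phi> Z t * indicator B (crep Z t) * indicator {0..1} t \<le> ennreal (2 * lipc \<phi>) * (len_kernel Z t * indicator B (crep Z t) * indicator {0..1} t)"
          by (auto split: split_indicator)
      qed
      also have "... = ennreal (2 * lipc \<phi>) * kint len_kernel Z (indicator B)"
        unfolding kint_def by (rule nn_integral_cmult) (rule kint_integrand_measurable[OF _ G], auto simp: kl)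
      finally show "kint (der_kernel \<phi>) Z (indicator B) \<le> ennreal (2 * lipc \<phi>) * kint len_kernel Z (indicator B)" .
    qed
    also have "... = ennreal (2 * lipc \<phi>) * (\<integral>\<^sup>+x. ennreal (\<rho> x) * indicator B x \<partial>m)"
      using km by (simp add: nn_integral_cmult plan_kint)
    also have "... = (\<integral>\<^sup>+x\<in>B. ennreal (2 * lipc \<phi> * \<rho> x) \<partial>m)"
      using plan_dens_measurable lp plan_dens_nonneg
      by (subst nn_integral_cmult[symmetric]) (auto simp: meas_m ennreal_mult mult.assoc intro!: nn_integral_cong)
    finally show ?thesis .
  qed
  have sN: "sets N = sets m" using N(1) by simp
  have i0: "integrable m (\<lambda>x. 2 * lipc \<phi> * \<rho> x)" using plan_dens_integrable(1) by simp
  have n0: "0 \<le> 2 * lipc \<phi> * \<rho> x" for x using plan_dens_nonneg(1) lp by simp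
  obtain n where n: "n \<in> borel_measurable m" "\<And>x. 0 \<le> n x" "\<And>x. n x \<le> 2 * lipc \<phi> * \<rho> x" "N = density m (\<lambda>x. ennreal (n x))"
    using dominated_density[OF fin_m sN i0 n0 le] by blast
  have "(\<integral>\<^sup>+Z. kint (der_kernel \<phi>) Z u \<partial>\<pi>) = (\<integral>\<^sup>+x. ennreal (n x) * u x \<partial>m)" if "u \<in> borel_measurable borel" for u
    using N(2)[OF that] n that by (simp add: nn_integral_density meas_m)
  then show ?thesis unfolding is_plan_dens_def using n by (auto simp: meas_m)
qed

text \<open>Removing \<open>lipc \<phi> * \<rho>\<close>, the contribution of the shift to the
  mixture, leaves the density of the signed measure formed by the derivatives along the
  arcs.\<close>

definition plan_derivation :: "'a derivation" where
  "plan_derivation \<phi> x = (SOME n. is_plan_dens \<phi> n) x - lipc \<phi> * \<rho> x"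

lemma plan_derivation_measurable: "\<phi> \<in> Lip_b d ==> plan_derivation \<phi> \<in> borel_measurable borel"
  and plan_derivation_bound: "\<phi> \<in> Lip_b d ==> \<bar>plan_derivation \<phi> x\<bar> \<le> lipc \<phi> * \<rho> x"
proof -
  assume \<phi>: "\<phi> \<in> Lip_b d"
  have n: "is_plan_dens \<phi> (SOME n. is_plan_dens \<phi> n)" using someI_ex[OF ex_plan_dens[OF \<phi>]] .
  have e: "plan_derivation \<phi> = (\<lambda>x. (SOME n. is_plan_dens \<phi> n) x - lipc \<phi> * \<rho> x)" by (simp add: fun_eq_iff plan_derivation_def)
  show "plan_derivation \<phi> \<in> borel_measurable borel"
    unfolding e using n plan_dens_measurable(1) unfolding is_plan_dens_def by (intro borel_measurable_diff borel_measurable_times) auto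
  have "0 \<le> (SOME n. is_plan_dens \<phi> n) x" "(SOME n. is_plan_dens \<phi> n) x \<le> 2 * lipc \<phi> * \<rho> x"
    using n unfolding is_plan_dens_def by auto
  then show "\<bar>plan_derivation \<phi> x\<bar> \<le> lipc \<phi> * \<rho> x" unfolding plan_derivation_def by auto
qed

lemma plan_derivation_integrable:
  assumes \<phi>: "\<phi> \<in> Lip_b d" shows "integrable m (plan_derivation \<phi>)"
proof (rule Bochner_Integration.integrable_bound[of m "\<lambda>x. lipc \<phi> * \<rho> x"])
  show "AE x in m. norm (plan_derivation \<phi> x) \<le> norm (lipc \<phi> * \<rho> x)"
  proof -
    have "norm (plan_derivation \<phi> x) \<le> norm (lipc \<phi> * \<rho> x)" for x
      using plan_derivation_bound[OF \<phi>, of x] by (metis abs_ge_self order_trans real_norm_def)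
    then show ?thesis by simp
  qed
qed (use plan_dens_integrable(1) plan_derivation_measurable[OF \<phi>] in \<open>auto simp: meas_m\<close>)

lemma plan_lint_nonneg:
  assumes h: "bdd_borel h" "\<And>x. 0 \<le> h x"
  shows "integrable \<pi> (lint h)" "(\<integral>Z. lint h Z \<partial>\<pi>) = (\<integral>x. h x * \<rho> x \<partial>m)"
proof -
  obtain B where B: "\<And>x. \<bar>h x\<bar> \<le> B" using h unfolding bdd_borel_def by auto
  note hm = bdd_borel_measurable[OF h(1)]
  have hm': "(\<lambda>x. ennreal (h x)) \<in> borel_measurable borel" using hm by simp
  have m: "lint h \<in> borel_measurable \<pi>"
  proof (rule measurable_cong[THEN iffD1])
    show "(\<lambda>Z. enn2real (kint len_kernel Z (\<lambda>x. ennreal (h x)))) \<in> borel_measurable \<pi>"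
      unfolding plan_meas by (intro borel_measurable_enn2real kint_measurable[OF arc_kernel_len hm'])
    show "enn2real (kint len_kernel Z (\<lambda>x. ennreal (h x))) = lint h Z" if "Z \<in> space \<pi>" for Z
      using kint_len[OF h, of Z] that lint_nonneg[of h Z, OF h(2)] by (simp add: plan_space)
  qed
  have eq: "(\<integral>\<^sup>+Z. ennreal (lint h Z) \<partial>\<pi>) = (\<integral>\<^sup>+x. ennreal (h x * \<rho> x) \<partial>m)"
  proof -
    have "(\<integral>\<^sup>+Z. ennreal (lint h Z) \<partial>\<pi>) = (\<integral>\<^sup>+Z. kint len_kernel Z (\<lambda>x. ennreal (h x)) \<partial>\<pi>)"
      by (intro nn_integral_cong) (simp add: kint_len[OF h] plan_space)
    also have "... = (\<integral>\<^sup>+x. ennreal (h x * \<rho> x) \<partial>m)"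
      unfolding plan_kint[OF hm'] using h(2) plan_dens_nonneg by (intro nn_integral_cong) (simp add: ennreal_mult[symmetric] mult.commute)
    finally show ?thesis .
  qed
  show "integrable \<pi> (lint h)" "(\<integral>Z. lint h Z \<partial>\<pi>) = (\<integral>x. h x * \<rho> x \<partial>m)"
    using nn_integral_transfer[OF m _ integrable_bounded_mult[OF plan_dens_integrable(1) hm B] _ eq] lint_nonneg[of h, OF h(2)] h(2) plan_dens_nonneg by auto
qed

text \<open>The identity for the shifted kernel minus \<open>lipc \<phi>\<close> times the identity
  for length. Nonnegative \<open>h\<close> keeps the computation within \<open>nn_integral\<close>;
  general \<open>h\<close> is reached afterwards by adding a constant.\<close>

lemma plan_dint_nonneg:
  assumes h: "bdd_borel h" "\<And>x. 0 \<le> h x" and \<phi>: "\<phi> \<in> Lip_b d"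
  shows "integrable \<pi> (dint \<phi> h)" "(\<integral>Z. dint \<phi> h Z \<partial>\<pi>) = (\<integral>x. h x * plan_derivation \<phi> x \<partial>m)"
proof -
  define n where "n = (SOME n. is_plan_dens \<phi> n)"
  have n: "n \<in> borel_measurable borel" "\<And>x. 0 \<le> n x" "\<And>x. n x \<le> 2 * lipc \<phi> * \<rho> x"
    "\<And>u. u \<in> borel_measurable borel ==> (\<integral>\<^sup>+Z. kint (der_kernel \<phi>) Z u \<partial>\<pi>) = (\<integral>\<^sup>+x. ennreal (n x) * u x \<partial>m)"
  proof -
    have "is_plan_dens \<phi> n" unfolding n_def using someI_ex[OF ex_plan_dens[OF \<phi>]] .
    then show "n \<in> borel_measurable borel" "\<And>x. 0 \<le> n x" "\<And>x. n x \<le> 2 * lipc \<phi> * \<rho> x"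
      "\<And>u. u \<in> borel_measurable borel ==> (\<integral>\<^sup>+Z. kint (der_kernel \<phi>) Z u \<partial>\<pi>) = (\<integral>\<^sup>+x. ennreal (n x) * u x \<partial>m)"
      unfolding is_plan_dens_def by auto
  qed
  obtain B where B: "\<And>x. \<bar>h x\<bar> \<le> B" using h unfolding bdd_borel_def by auto
  note hm = bdd_borel_measurable[OF h(1)]
  have hm': "(\<lambda>x. ennreal (h x)) \<in> borel_measurable borel" using hm by simp
  have ni: "integrable m n"
  proof (rule Bochner_Integration.integrable_bound[of m "\<lambda>x. 2 * lipc \<phi> * \<rho> x"])
    have "norm (n x) \<le> norm (2 * lipc \<phi> * \<rho> x)" for x using n(2)[of x] n(3)[of x] by simp
    then show "AE x in m. norm (n x) \<le> norm (2 * lipc \<phi> * \<rho> x)" by simp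
  qed (use plan_dens_integrable(1) n(1) in \<open>auto simp: meas_m\<close>)
  let ?F = "\<lambda>Z. lipc \<phi> * lint h Z + dint \<phi> h Z"
  have F0: "0 \<le> ?F Z" if "Z \<in> space \<pi>" for Z using kint_der(2)[OF h \<phi>] that by (simp add: plan_space)
  have m: "?F \<in> borel_measurable \<pi>"
  proof (rule measurable_cong[THEN iffD1])
    show "(\<lambda>Z. enn2real (kint (der_kernel \<phi>) Z (\<lambda>x. ennreal (h x)))) \<in> borel_measurable \<pi>"
      unfolding plan_meas by (intro borel_measurable_enn2real kint_measurable[OF arc_kernel_der[OF \<phi>] hm'])
    show "enn2real (kint (der_kernel \<phi>) Z (\<lambda>x. ennreal (h x))) = ?F Z" if "Z \<in> space \<pi>" for Z
      using kint_der[OF h \<phi>, of Z] that by (simp add: plan_space)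
  qed
  have eq: "(\<integral>\<^sup>+Z. ennreal (?F Z) \<partial>\<pi>) = (\<integral>\<^sup>+x. ennreal (h x * n x) \<partial>m)"
  proof -
    have "(\<integral>\<^sup>+Z. ennreal (?F Z) \<partial>\<pi>) = (\<integral>\<^sup>+Z. kint (der_kernel \<phi>) Z (\<lambda>x. ennreal (h x)) \<partial>\<pi>)"
      by (intro nn_integral_cong) (simp add: kint_der[OF h \<phi>] plan_space)
    also have "... = (\<integral>\<^sup>+x. ennreal (h x * n x) \<partial>m)"
      unfolding n(4)[OF hm'] using h(2) n(2) by (intro nn_integral_cong) (simp add: ennreal_mult[symmetric] mult.commute)
    finally show ?thesis .
  qed
  have hn: "integrable m (\<lambda>x. h x * n x)" "integrable m (\<lambda>x. h x * \<rho> x)"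
    using integrable_bounded_mult[OF _ hm B] ni plan_dens_integrable(1) by auto
  have F: "integrable \<pi> ?F" "(\<integral>Z. ?F Z \<partial>\<pi>) = (\<integral>x. h x * n x \<partial>m)"
    using nn_integral_transfer[OF m F0 hn(1) _ eq] h(2) n(2) by auto
  note l = plan_lint_nonneg[OF h]
  have e: "dint \<phi> h = (\<lambda>Z. ?F Z - lipc \<phi> * lint h Z)" by (simp add: fun_eq_iff)
  have "integrable \<pi> (\<lambda>Z. ?F Z - lipc \<phi> * lint h Z)" using F(1) l(1) by (intro Bochner_Integration.integrable_diff) auto
  then show "integrable \<pi> (dint \<phi> h)" using e by simp
  have "(\<integral>Z. dint \<phi> h Z \<partial>\<pi>) = (\<integral>Z. ?F Z - lipc \<phi> * lint h Z \<partial>\<pi>)" by simp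
  also have "... = (\<integral>Z. ?F Z \<partial>\<pi>) - (\<integral>Z. lipc \<phi> * lint h Z \<partial>\<pi>)"
    using F(1) l(1) by (intro Bochner_Integration.integral_diff) auto
  also have "... = (\<integral>x. h x * n x \<partial>m) - lipc \<phi> * (\<integral>x. h x * \<rho> x \<partial>m)" using F(2) l(2) by simp
  also have "... = (\<integral>x. h x * n x - lipc \<phi> * (h x * \<rho> x) \<partial>m)" using hn by simp
  also have "... = (\<integral>x. h x * plan_derivation \<phi> x \<partial>m)"
    unfolding plan_derivation_def n_def[symmetric] by (simp add: algebra_simps)
  finally show "(\<integral>Z. dint \<phi> h Z \<partial>\<pi>) = (\<integral>x. h x * plan_derivation \<phi> x \<partial>m)" .
qed

lemma plan_dint:
  assumes h: "bdd_borel h" and \<phi>: "\<phi> \<in> Lip_b d"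
  shows "integrable \<pi> (dint \<phi> h)" "(\<integral>Z. dint \<phi> h Z \<partial>\<pi>) = (\<integral>x. h x * plan_derivation \<phi> x \<partial>m)"
proof -
  obtain B where B: "\<And>x. \<bar>h x\<bar> \<le> B" using h unfolding bdd_borel_def by auto
  have "B \<ge> 0" using B[of undefined] by linarith
  note hm = bdd_borel_measurable[OF h]
  have p: "bdd_borel (\<lambda>x. h x + B)" "\<And>x. 0 \<le> h x + B"
    unfolding bdd_borel_def using hm B by (auto intro!: exI[of _ "2 * B"] simp: abs_le_iff) (smt (verit))+
  have q: "bdd_borel (\<lambda>x. B)" unfolding bdd_borel_def by auto
  have e: "dint \<phi> h Z = dint \<phi> (\<lambda>x. h x + B) Z - dint \<phi> (\<lambda>x. B) Z" if "Z \<in> RA d" for Z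
    unfolding dint_def using dint_integrable[OF p(1) \<phi> that] dint_integrable[OF q \<phi> that]
    by (subst Bochner_Integration.integral_diff[symmetric]) (auto simp: algebra_simps)
  note P = plan_dint_nonneg[OF p \<phi>] and Q = plan_dint_nonneg[OF q \<open>B \<ge> 0\<close> \<phi>]
  show "integrable \<pi> (dint \<phi> h)"
    using P(1) Q(1) by (subst Bochner_Integration.integrable_cong[OF refl e]) (auto simp: plan_space)
  have "(\<integral>Z. dint \<phi> h Z \<partial>\<pi>) = (\<integral>Z. dint \<phi> (\<lambda>x. h x + B) Z - dint \<phi> (\<lambda>x. B) Z \<partial>\<pi>)"
    by (intro Bochner_Integration.integral_cong e) (auto simp: plan_space)
  also have "... = (\<integral>x. (h x + B) * plan_derivation \<phi> x \<partial>m) - (\<integral>x. B * plan_derivation \<phi> x \<partial>m)"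
    using P Q by simp
  also have "... = (\<integral>x. h x * plan_derivation \<phi> x \<partial>m)"
    using integrable_bounded_mult[OF plan_derivation_integrable[OF \<phi>] hm B] plan_derivation_integrable[OF \<phi>]
    by (simp add: distrib_right)
  finally show "(\<integral>Z. dint \<phi> h Z \<partial>\<pi>) = (\<integral>x. h x * plan_derivation \<phi> x \<partial>m)" .
qed

lemma bdd_borel_Lip_b: "f \<in> Lip_b d ==> bdd_borel f"
  unfolding bdd_borel_def using Lip_b_borel Lip_b_boundedE by metis

lemma bdd_borel_indicator: "A \<in> sets borel ==> bdd_borel (indicator A)"
  unfolding bdd_borel_def by (auto intro!: exI[of _ 1] split: split_indicator)

lemma bdd_borel_mult:
  assumes "bdd_borel f" "bdd_borel g" shows "bdd_borel (\<lambda>x. f x * g x)"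
proof -
  obtain A B where A: "\<And>x. \<bar>f x\<bar> \<le> A" and B: "\<And>x. \<bar>g x\<bar> \<le> B" using assms unfolding bdd_borel_def by auto
  have "A \<ge> 0" using A[of undefined] by linarith
  have "\<bar>f x * g x\<bar> \<le> A * B" for x using A[of x] B[of x] \<open>A \<ge> 0\<close> by (simp add: abs_mult mult_mono)
  then show ?thesis using assms unfolding bdd_borel_def by auto
qed

text \<open>Testing with indicators moves the claim to the arcs: \<open>plan_dint\<close> turns both
  sides into averages over \<pi> of integrals along arcs, where the rule holds for almost every
  time. The product rule uses the same scheme.\<close>

lemma plan_derivation_lincomb:
  assumes f: "f \<in> Lip_b d" and g: "g \<in> Lip_b d"
  shows "AE x in m. plan_derivation (\<lambda>y. \<alpha> * f y + \<beta> * g y) x = \<alpha> * plan_derivation f x + \<beta> * plan_derivation g x"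
proof (rule AE_eq_of_set_integral)
  note fg = Lip_b_lincomb[OF f g, of \<alpha> \<beta>]
  fix A assume "A \<in> sets m"
  then have A: "bdd_borel (indicator A)" using bdd_borel_indicator by simp
  note I = plan_dint[OF A f] plan_dint[OF A g] plan_dint[OF A fg]
  have "dint (\<lambda>y. \<alpha> * f y + \<beta> * g y) (indicator A) Z = \<alpha> * dint f (indicator A) Z + \<beta> * dint g (indicator A) Z" if G: "Z \<in> RA d" for Z
  proof -
    note J = dint_integrable[OF A f G] dint_integrable[OF A g G] dint_integrable[OF A fg G]
    have "dint (\<lambda>y. \<alpha> * f y + \<beta> * g y) (indicator A) Z =
      (\<integral>t. \<alpha> * (indicator {0..1} t * (indicator A (crep Z t) * arc_deriv f Z t)) + \<beta> * (indicator {0..1} t * (indicator A (crep Z t) * arc_deriv g Z t)) \<partial>lborel)"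
      unfolding dint_def by (rule integral_cong_AE)
         (use J[THEN borel_measurable_integrable] arc_deriv_lincomb[OF f g G, of \<alpha> \<beta>] in \<open>auto elim!: eventually_mono simp: algebra_simps\<close>)
    then show ?thesis unfolding dint_def using J by simp
  qed
  then have "(\<integral>Z. dint (\<lambda>y. \<alpha> * f y + \<beta> * g y) (indicator A) Z \<partial>\<pi>) = (\<integral>Z. \<alpha> * dint f (indicator A) Z + \<beta> * dint g (indicator A) Z \<partial>\<pi>)"
    by (intro Bochner_Integration.integral_cong) (auto simp: plan_space)
  also have "... = \<alpha> * (\<integral>x. indicator A x * plan_derivation f x \<partial>m) + \<beta> * (\<integral>x. indicator A x * plan_derivation g x \<partial>m)" using I by simp
  also have "... = (\<integral>x. indicator A x * (\<alpha> * plan_derivation f x + \<beta> * plan_derivation g x) \<partial>m)"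
  proof -
    have "integrable m (\<lambda>x. indicator A x * plan_derivation f x)" "integrable m (\<lambda>x. indicator A x * plan_derivation g x)"
      using integrable_mult_indicator[OF \<open>A \<in> sets m\<close> plan_derivation_integrable[OF f]]
        integrable_mult_indicator[OF \<open>A \<in> sets m\<close> plan_derivation_integrable[OF g]] by simp_all
    then show ?thesis by (simp add: distrib_left mult.left_commute)
  qed
  finally show "(\<integral>x. indicator A x * plan_derivation (\<lambda>y. \<alpha> * f y + \<beta> * g y) x \<partial>m) = ..." using I by simp
qed (use plan_derivation_integrable f g Lip_b_lincomb in auto)

lemma plan_derivation_mult:
  assumes f: "f \<in> Lip_b d" and g: "g \<in> Lip_b d"
  shows "AE x in m. plan_derivation (\<lambda>y. f y * g y) x = f x * plan_derivation g x + g x * plan_derivation f x"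
proof (rule AE_eq_of_set_integral)
  note fg = Lip_b_mult[OF f g]
  have int: "integrable m (\<lambda>x. f x * plan_derivation g x)" "integrable m (\<lambda>x. g x * plan_derivation f x)"
    using f g bdd_borel_Lip_b plan_derivation_integrable integrable_bounded_mult unfolding bdd_borel_def by metis+
  then show "integrable m (\<lambda>x. f x * plan_derivation g x + g x * plan_derivation f x)" by simp
  fix A assume "A \<in> sets m"
  then have A: "bdd_borel (indicator A)" using bdd_borel_indicator by simp
  note Af = bdd_borel_mult[OF A bdd_borel_Lip_b[OF f]] and Ag = bdd_borel_mult[OF A bdd_borel_Lip_b[OF g]]
  note I = plan_dint[OF Ag f] plan_dint[OF Af g] plan_dint[OF A fg]
  have "dint (\<lambda>y. f y * g y) (indicator A) Z = dint g (\<lambda>x. indicator A x * f x) Z + dint f (\<lambda>x. indicator A x * g x) Z" if G: "Z \<in> RA d" for Z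
  proof -
    note J = dint_integrable[OF Ag f G] dint_integrable[OF Af g G] dint_integrable[OF A fg G]
    have "dint (\<lambda>y. f y * g y) (indicator A) Z =
      (\<integral>t. (indicator {0..1} t * ((indicator A (crep Z t) * f (crep Z t)) * arc_deriv g Z t)) + (indicator {0..1} t * ((indicator A (crep Z t) * g (crep Z t)) * arc_deriv f Z t)) \<partial>lborel)"
      unfolding dint_def by (rule integral_cong_AE)
         (use J[THEN borel_measurable_integrable] arc_deriv_mult[OF f g G] in \<open>auto elim!: eventually_mono simp: algebra_simps\<close>)
    then show ?thesis unfolding dint_def using J by simp
  qed
  then have "(\<integral>Z. dint (\<lambda>y. f y * g y) (indicator A) Z \<partial>\<pi>) = (\<integral>Z. dint g (\<lambda>x. indicator A x * f x) Z + dint f (\<lambda>x. indicator A x * g x) Z \<partial>\<pi>)"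
    by (intro Bochner_Integration.integral_cong) (auto simp: plan_space)
  also have "... = (\<integral>x. (indicator A x * f x) * plan_derivation g x \<partial>m) + (\<integral>x. (indicator A x * g x) * plan_derivation f x \<partial>m)" using I by simp
  also have "... = (\<integral>x. indicator A x * (f x * plan_derivation g x + g x * plan_derivation f x) \<partial>m)"
  proof -
    have "integrable m (\<lambda>x. indicator A x * (f x * plan_derivation g x))" "integrable m (\<lambda>x. indicator A x * (g x * plan_derivation f x))"
      using integrable_mult_indicator[OF \<open>A \<in> sets m\<close> int(1)] integrable_mult_indicator[OF \<open>A \<in> sets m\<close> int(2)] by simp_all
    then show ?thesis by (simp add: distrib_left mult.assoc)
  qed
  finally show "(\<integral>x. indicator A x * plan_derivation (\<lambda>y. f y * g y) x \<partial>m) = ..." using I by simp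
qed (use plan_derivation_integrable f g Lip_b_mult in auto)

lemma slope_le_lipc: "\<phi> \<in> Lip_b d ==> asymptotic_slope d \<phi> x \<le> ennreal (lipc \<phi>)"
proof -
  assume \<phi>: "\<phi> \<in> Lip_b d"
  have "asymptotic_slope d \<phi> x \<le> Lip d \<phi> UNIV" unfolding asymptotic_slope_def by (rule INF_lower) auto
  also have "... \<le> ennreal (lipc \<phi>)"
    using Lip_le_iff[OF ext_dist lipc_pos[OF \<phi>]] lipc[OF \<phi>] unfolding lipschitz_with_def by auto
  finally show ?thesis .
qed

text \<open>On each arc the derivative is dominated by speed times slope for almost every time, and
  averaging against indicators transfers this to \<open>m\<close>. The slope is bounded by
  \<open>lipc \<phi>\<close>, so the real valued \<open>s\<close> can replace it.\<close>

lemma plan_derivation_slope: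
  assumes \<phi>: "\<phi> \<in> Lip_b d"
  shows "AE x in m. ennreal \<bar>plan_derivation \<phi> x\<bar> \<le> ennreal (\<rho> x) * asymptotic_slope d \<phi> x"
proof -
  define s where "s x = enn2real (asymptotic_slope d \<phi> x)" for x
  have s: "asymptotic_slope d \<phi> x = ennreal (s x)" "0 \<le> s x" "s x \<le> lipc \<phi>" for x
  proof -
    have "asymptotic_slope d \<phi> x < \<infinity>" using slope_le_lipc[OF \<phi>, of x] by (auto intro: le_less_trans)
    then show "asymptotic_slope d \<phi> x = ennreal (s x)" "0 \<le> s x" by (auto simp: s_def)
    then show "s x \<le> lipc \<phi>" using slope_le_lipc[OF \<phi>, of x] lipc_pos[OF \<phi>] by (simp add: ennreal_le_iff)
  qed
  have sm: "s \<in> borel_measurable borel" unfolding s_def[abs_def] using slope_measurable by measurable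
  have sb: "bdd_borel s" unfolding bdd_borel_def using sm s by (auto intro!: exI[of _ "lipc \<phi>"])
  have int: "integrable m (\<lambda>x. s x * \<rho> x)"
    by (rule integrable_bounded_mult[OF plan_dens_integrable(1) sm]) (use s in auto)
  have key: "\<bar>\<integral>x. indicator A x * plan_derivation \<phi> x \<partial>m\<bar> \<le> (\<integral>x. indicator A x * (s x * \<rho> x) \<partial>m)" if "A \<in> sets m" for A
  proof -
    have A: "bdd_borel (indicator A)" using bdd_borel_indicator that by simp
    note As = bdd_borel_mult[OF A sb]
    have As0: "0 \<le> indicator A x * s x" for x using s by simp
    note I = plan_dint[OF A \<phi>] and L = plan_lint_nonneg[OF As As0]
    have le: "\<bar>dint \<phi> (indicator A) Z\<bar> \<le> lint (\<lambda>x. indicator A x * s x) Z" if G: "Z \<in> RA d" for Z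
    proof -
      note J = dint_integrable[OF A \<phi> G] lint_integrable[OF As G]
      have "\<bar>dint \<phi> (indicator A) Z\<bar> \<le> (\<integral>t. \<bar>indicator {0..1} t * (indicator A (crep Z t) * arc_deriv \<phi> Z t)\<bar> \<partial>lborel)"
        unfolding dint_def by (rule integral_abs_bound)
      also have "... \<le> lint (\<lambda>x. indicator A x * s x) Z" unfolding lint_def
      proof (rule integral_mono_AE)
        show "AE t in lborel. \<bar>indicator {0..1} t * (indicator A (crep Z t) * arc_deriv \<phi> Z t)\<bar> \<le> indicator {0..1} t * (indicator A (crep Z t) * s (crep Z t) * rlen Z)"
          using arc_deriv_slope[OF \<phi> G]
        proof eventually_elim
          case (elim t)
          have "\<bar>arc_deriv \<phi> Z t\<bar> \<le> s (crep Z t) * rlen Z" if "t \<in> {0..1}"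
          proof -
            have "ennreal \<bar>arc_deriv \<phi> Z t\<bar> \<le> ennreal (s (crep Z t) * rlen Z)"
              using elim that s by (simp add: ennreal_mult mult.commute)
            then show ?thesis using s by (subst (asm) ennreal_le_iff) auto
          qed
          then show ?case by (auto split: split_indicator)
        qed
      qed (use J in auto)
      finally show ?thesis .
    qed
    have "\<bar>\<integral>x. indicator A x * plan_derivation \<phi> x \<partial>m\<bar> = \<bar>\<integral>Z. dint \<phi> (indicator A) Z \<partial>\<pi>\<bar>" using I by simp
    also have "... \<le> (\<integral>Z. \<bar>dint \<phi> (indicator A) Z\<bar> \<partial>\<pi>)" by (rule integral_abs_bound)
    also have "... \<le> (\<integral>Z. lint (\<lambda>x. indicator A x * s x) Z \<partial>\<pi>)"
      using I(1) L(1) le by (intro integral_mono) (auto simp: plan_space)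
    also have "... = (\<integral>x. indicator A x * (s x * \<rho> x) \<partial>m)" using L(2) by (simp add: mult.assoc)
    finally show ?thesis .
  qed
  have "AE x in m. plan_derivation \<phi> x \<le> s x * \<rho> x"
    by (rule AE_le_of_set_integral[OF plan_derivation_integrable[OF \<phi>] int]) (use key in \<open>auto simp: abs_le_iff\<close>)
  moreover have "AE x in m. - plan_derivation \<phi> x \<le> s x * \<rho> x"
    by (rule AE_le_of_set_integral[OF _ int]) (use plan_derivation_integrable[OF \<phi>] key in \<open>auto simp: abs_le_iff\<close>)
  ultimately show ?thesis
  proof eventually_elim
    case (elim x)
    then have "ennreal \<bar>plan_derivation \<phi> x\<bar> \<le> ennreal (s x * \<rho> x)" by (intro ennreal_leI) auto
    then show ?case using s plan_dens_nonneg by (simp add: ennreal_mult mult.commute)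
  qed
qed

lemma plan_distr: "distr \<pi> borel (\<lambda>Z. rep Z 0) = density m (\<lambda>x. ennreal (\<rho>0 x))"
  "distr \<pi> borel (\<lambda>Z. rep Z 1) = density m (\<lambda>x. ennreal (\<rho>1 x))"
proof -
  have "distr \<pi> borel e = density m (\<lambda>x. ennreal (r x))" if e: "e \<in> measurable \<pi> borel" and r: "r \<in> borel_measurable borel"
    and eq: "\<And>u. u \<in> borel_measurable borel ==> (\<integral>\<^sup>+Z. u (e Z) \<partial>\<pi>) = (\<integral>\<^sup>+x. ennreal (r x) * u x \<partial>m)" for e r
  proof (rule measure_eqI)
    fix B assume "B \<in> sets (distr \<pi> borel e)"
    then have B: "B \<in> sets borel" by simp
    have "emeasure (distr \<pi> borel e) B = (\<integral>\<^sup>+x. indicator B x \<partial>distr \<pi> borel e)" using B by simp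
    also have "... = (\<integral>\<^sup>+Z. indicator B (e Z) \<partial>\<pi>)" by (rule nn_integral_distr) (use e B in auto)
    also have "... = emeasure (density m (\<lambda>x. ennreal (r x))) B" using B r by (simp add: eq emeasure_density meas_m)
    finally show "emeasure (distr \<pi> borel e) B = emeasure (density m (\<lambda>x. ennreal (r x))) B" .
  qed simp
  then show "distr \<pi> borel (\<lambda>Z. rep Z 0) = density m (\<lambda>x. ennreal (\<rho>0 x))" "distr \<pi> borel (\<lambda>Z. rep Z 1) = density m (\<lambda>x. ennreal (\<rho>1 x))"
    using endpoint_measurable plan_dens_measurable plan_end0 plan_end1 by (auto simp: plan_meas)
qed

lemma plan_endpoints:
  assumes f: "f \<in> borel_measurable borel" and i: "integrable m (\<lambda>x. f x * \<rho>0 x)" "integrable m (\<lambda>x. f x * \<rho>1 x)"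
  shows "integrable \<pi> (\<lambda>Z. f (rep Z 0))" "(\<integral>Z. f (rep Z 0) \<partial>\<pi>) = (\<integral>x. f x * \<rho>0 x \<partial>m)"
    "integrable \<pi> (\<lambda>Z. f (rep Z 1))" "(\<integral>Z. f (rep Z 1) \<partial>\<pi>) = (\<integral>x. f x * \<rho>1 x \<partial>m)"
proof -
  have main: "integrable \<pi> (\<lambda>Z. f (e Z)) \<and> (\<integral>Z. f (e Z) \<partial>\<pi>) = (\<integral>x. f x * r x \<partial>m)"
    if e: "e \<in> measurable \<pi> borel" and r: "\<And>x. 0 \<le> r x" "r \<in> borel_measurable borel" "integrable m (\<lambda>x. f x * r x)"
      and eq: "distr \<pi> borel e = density m (\<lambda>x. ennreal (r x))" for e r
  proof
    have "integrable (distr \<pi> borel e) f"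
      unfolding eq using f r by (subst integrable_density) (auto simp: meas_m mult.commute)
    then show "integrable \<pi> (\<lambda>Z. f (e Z))" by (rule integrable_distr[OF e])
    have "(\<integral>Z. f (e Z) \<partial>\<pi>) = (\<integral>x. f x \<partial>distr \<pi> borel e)" by (rule integral_distr[OF e f, symmetric])
    also have "... = (\<integral>x. f x * r x \<partial>m)" unfolding eq using f r by (subst integral_density) (auto simp: meas_m mult.commute)
    finally show "(\<integral>Z. f (e Z) \<partial>\<pi>) = (\<integral>x. f x * r x \<partial>m)" .
  qed
  show "integrable \<pi> (\<lambda>Z. f (rep Z 0))" "(\<integral>Z. f (rep Z 0) \<partial>\<pi>) = (\<integral>x. f x * \<rho>0 x \<partial>m)"
    "integrable \<pi> (\<lambda>Z. f (rep Z 1))" "(\<integral>Z. f (rep Z 1) \<partial>\<pi>) = (\<integral>x. f x * \<rho>1 x \<partial>m)"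
    using main[OF _ _ _ _ plan_distr(1)] main[OF _ _ _ _ plan_distr(2)] endpoint_measurable plan_dens_nonneg plan_dens_measurable i by (auto simp: plan_meas)
qed

text \<open>With weight 1 the integral of the derivative along an arc is the increment of
  \<open>f\<close> between its ends. The minus sign in the definition of the divergence puts the
  initial density first.\<close>

lemma plan_is_divergence: "is_divergence d m plan_derivation (\<lambda>x. \<rho>0 x - \<rho>1 x)"
  unfolding is_divergence_def
proof (intro conjI ballI plan_derivation_integrable)
  show "integrable m (\<lambda>x. \<rho>0 x - \<rho>1 x)" using plan_dens_integrable by simp
  fix f assume f: "f \<in> Lip_b d"
  have one: "bdd_borel (\<lambda>_. 1)" unfolding bdd_borel_def by auto
  obtain B where B: "\<And>x. \<bar>f x\<bar> \<le> B" using Lip_b_boundedE[OF f] by metis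
  have i: "integrable m (\<lambda>x. f x * \<rho>0 x)" "integrable m (\<lambda>x. f x * \<rho>1 x)"
    using integrable_bounded_mult[OF _ Lip_b_borel[OF f] B] plan_dens_integrable by auto
  note E = plan_endpoints[OF Lip_b_borel[OF f] i]
  have "(\<integral>x. plan_derivation f x \<partial>m) = (\<integral>Z. dint f (\<lambda>_. 1) Z \<partial>\<pi>)" using plan_dint(2)[OF one f] by simp
  also have "... = (\<integral>Z. f (rep Z 1) - f (rep Z 0) \<partial>\<pi>)"
  proof (intro Bochner_Integration.integral_cong refl)
    fix Z assume "Z \<in> space \<pi>"
    then have G: "Z \<in> RA d" by (simp add: plan_space)
    have "dint f (\<lambda>_. 1) Z = ioc_integral (arc_deriv f Z) 0 1"
      unfolding dint_def set_lebesgue_integral_def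
      by (rule integral_cong_AE) (use arc_deriv_measurable[OF f G] AE_lborel_singleton[of 0] in \<open>auto elim!: eventually_mono split: split_indicator\<close>)
    also have "... = f (crep Z 1) - f (crep Z 0)" using arc_deriv(1)[OF f G] unfolding has_density_def by simp
    finally show "dint f (\<lambda>_. 1) Z = f (rep Z 1) - f (rep Z 0)" by (simp add: crep_eq)
  qed
  also have "... = (\<integral>x. f x * \<rho>1 x \<partial>m) - (\<integral>x. f x * \<rho>0 x \<partial>m)" using E by simp
  also have "... = - (\<integral>x. f x * (\<rho>0 x - \<rho>1 x) \<partial>m)" using i by (simp add: right_diff_distrib)
  finally show "(\<integral>x. plan_derivation f x \<partial>m) = - (\<integral>x. f x * (\<rho>0 x - \<rho>1 x) \<partial>m)" .
qed

lemma plan_derivation_bounds: "\<rho> \<in> Lp_nonneg m q ==> \<rho> \<in> derivation_bounds d m q plan_derivation"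
  unfolding derivation_bounds_def using plan_derivation_slope by simp

lemma plan_derivation_Der: "\<rho> \<in> Lp_nonneg m q ==> plan_derivation \<in> Der d m q"
  unfolding Der_def lipschitz_derivation_def meas_m
  using plan_derivation_bounds[of q] plan_derivation_measurable plan_derivation_lincomb plan_derivation_mult by blast
end
end

section \<open>Essential infima\<close>

text \<open>Among infima of sequences in \<open>S\<close>, one minimizes the integral of
  \<open>arctan\<close>: it is bounded, so the integral is finite, and strictly increasing, so any
  decrease on a set of positive measure is detected. Nearly minimal sequences merge into one;
  adjoining a further member cannot lower the integral, hence the infimum lies below that
  member.\<close>

lemma ex_ess_inf_seq:
  fixes S :: "('b => real) set"
  assumes M: "finite_measure M" and S: "S \<noteq> {}" "S \<subseteq> borel_measurable M" "\<And>g. g \<in> S ==> AE x in M. 0 \<le> g x"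
  obtains g :: "nat => 'b => real" where "range g \<subseteq> S" "is_ess_inf M S (\<lambda>x. INF n. max 0 (g n x))"
proof -
  interpret finite_measure M by (rule M)
  \<comment> \<open>Truncation at 0 gives the infimum a lower bound at every point and alters
    members of \<open>S\<close> only on null sets.\<close>
  define I where "I g x = (INF n. max 0 (g n x))" for g :: "nat => 'b => real" and x
  define seqs where "seqs = {g :: nat => 'b => real. range g \<subseteq> S}"
  have bdd: "bdd_below (range (\<lambda>n. max 0 (g n x)))" for g :: "nat => 'b => real" and x
    by (rule bdd_belowI[of _ 0]) auto
  have I_le: "I g x \<le> max 0 (g n x)" for g n x unfolding I_def by (rule cINF_lower[OF bdd]) simp
  have I_ge: "c \<le> I g x" if "\<And>n. c \<le> max 0 (g n x)" for c g x unfolding I_def using that by (intro cINF_greatest) auto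
  have I0: "0 \<le> I g x" for g x by (rule I_ge) simp
  have Im: "I g \<in> borel_measurable M" if "g \<in> seqs" for g
  proof -
    have "g n \<in> borel_measurable M" for n using that S(2) unfolding seqs_def by auto
    then show ?thesis unfolding I_def by (intro borel_measurable_cINF bdd) auto
  qed
  define \<Phi> where "\<Phi> g = (\<integral>x. arctan (I g x) \<partial>M)" for g
  have ai: "integrable M (\<lambda>x. arctan (I g x))" if "g \<in> seqs" for g
  proof (rule integrable_const_bound[of _ "pi / 2"])
    show "AE x in M. norm (arctan (I g x)) \<le> pi / 2"
    proof (rule AE_I2)
      fix x show "norm (arctan (I g x)) \<le> pi / 2" using arctan_lbound[of "I g x"] arctan_ubound[of "I g x"] by simp
    qed
    show "(\<lambda>x. arctan (I g x)) \<in> borel_measurable M" using Im[OF that] by measurable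
  qed
  have \<Phi>0: "0 \<le> \<Phi> g" for g unfolding \<Phi>_def using I0 by (intro integral_nonneg_AE) auto
  have bddP: "bdd_below (\<Phi> ` seqs)" by (rule bdd_belowI[of _ 0]) (use \<Phi>0 in auto)
  define c where "c = (INF g\<in>seqs. \<Phi> g)"
  obtain s0 where "s0 \<in> S" using S by auto
  then have ne: "seqs \<noteq> {}" unfolding seqs_def by (auto intro: exI[of _ "\<lambda>_. s0"])
  have "\<exists>G\<in>seqs. \<Phi> G < c + inverse (real (Suc k))" for k
    using cINF_less_iff[OF ne bddP, of "c + inverse (real (Suc k))"] unfolding c_def by simp
  then obtain G where G: "\<And>k. G k \<in> seqs" "\<And>k. \<Phi> (G k) < c + inverse (real (Suc k))" by metis
  \<comment> \<open>The pair coding runs through all terms of all the sequences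
    \<open>G k\<close>.\<close>
  define g where "g j = G (fst (prod_decode j)) (snd (prod_decode j))" for j
  have gs: "g \<in> seqs" using G(1) unfolding seqs_def g_def by auto
  have Ig: "I g x \<le> I (G k) x" for k x
  proof (rule I_ge)
    fix n show "I g x \<le> max 0 (G k n x)" using I_le[of g x "prod_encode (k, n)"] by (simp add: g_def)
  qed
  have "\<Phi> g \<le> \<Phi> (G k)" for k unfolding \<Phi>_def
    using Ig by (intro integral_mono ai gs G(1)) (simp add: arctan_le_iff)
  then have "\<Phi> g \<le> c + inverse (real (Suc k))" for k using G(2)[of k] by (meson less_imp_le order_trans)
  then have "\<Phi> g \<le> c" by (intro LIMSEQ_le_const[OF LIMSEQ_inverse_real_of_nat_add[of c]]) auto
  have le: "AE x in M. I g x \<le> h x" if h: "h \<in> S" for h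
  proof -
    define g' where "g' n = (case n of 0 => h | Suc j => g j)" for n
    have g's: "g' \<in> seqs" using gs h unfolding seqs_def g'_def by (auto split: nat.splits dest: range_subsetD)
    have I': "I g' x \<le> I g x" for x
    proof (rule I_ge)
      fix n show "I g' x \<le> max 0 (g n x)" using I_le[of g' x "Suc n"] by (simp add: g'_def)
    qed
    have "c \<le> \<Phi> g'" unfolding c_def by (rule cINF_lower[OF bddP g's])
    then have "(\<integral>x. arctan (I g x) - arctan (I g' x) \<partial>M) \<le> 0"
      using \<open>\<Phi> g \<le> c\<close> ai[OF gs] ai[OF g's] unfolding \<Phi>_def by simp
    moreover have nn: "AE x in M. 0 \<le> arctan (I g x) - arctan (I g' x)" using I' by (simp add: arctan_le_iff)
    moreover have "0 \<le> (\<integral>x. arctan (I g x) - arctan (I g' x) \<partial>M)" by (rule integral_nonneg_AE[OF nn])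
    ultimately have "AE x in M. arctan (I g x) - arctan (I g' x) = 0"
      using integral_nonneg_eq_0_iff_AE[OF Bochner_Integration.integrable_diff[OF ai[OF gs] ai[OF g's]] nn] by simp
    with S(3)[OF h] show ?thesis
    proof eventually_elim
      case (elim x)
      then have "I g x = I g' x" by (simp add: arctan_eq_iff)
      then show ?case using I_le[of g' x 0] elim by (simp add: g'_def)
    qed
  qed
  have "is_ess_inf M S (\<lambda>x. INF n. max 0 (g n x))" unfolding is_ess_inf_def I_def[symmetric]
  proof (intro conjI ballI impI Im[OF gs] le)
    fix k assume k: "\<forall>h\<in>S. AE x in M. k x \<le> h x"
    have "AE x in M. \<forall>n. k x \<le> g n x" using k gs unfolding seqs_def by (subst AE_all_countable) auto
    then show "AE x in M. k x \<le> I g x" by eventually_elim (auto intro!: I_ge simp: le_max_iff_disj)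
  qed
  then show ?thesis using that gs unfolding seqs_def by blast
qed

lemma ess_inf_eq_AE:
  assumes "is_ess_inf M S g" shows "AE x in M. ess_inf M S x = g x"
proof -
  have e: "is_ess_inf M S (ess_inf M S)" unfolding ess_inf_def using someI[of "is_ess_inf M S" g] assms by simp
  have "AE x in M. ess_inf M S x \<le> g x" "AE x in M. g x \<le> ess_inf M S x"
    using assms e unfolding is_ess_inf_def by auto
  then show ?thesis by eventually_elim simp
qed

section \<open>The gradient of a Sobolev function is a weak upper gradient\<close>

lemma Lp_mult_integrable:
  assumes p: "1 < p" and f: "f \<in> Lp M p" and g: "g \<in> Lp M (conjugate_exponent p)"
  shows "integrable M (\<lambda>x. f x * g x)"
proof (rule Bochner_Integration.integrable_bound[of M "\<lambda>x. \<bar>f x\<bar> powr p + \<bar>g x\<bar> powr conjugate_exponent p"])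
  show "integrable M (\<lambda>x. \<bar>f x\<bar> powr p + \<bar>g x\<bar> powr conjugate_exponent p)" using f g unfolding Lp_def by auto
  show "(\<lambda>x. f x * g x) \<in> borel_measurable M" using f g unfolding Lp_def by auto
  \<comment> \<open>A crude Young inequality without constants: if
    \<open>b \<le> a powr (p - 1)\<close>, the product is at most \<open>a powr p\<close>; otherwise
    \<open>a\<close> is bounded by a power of \<open>b\<close>.\<close>
  have "a * b \<le> a powr p + b powr conjugate_exponent p" if "0 \<le> a" "0 \<le> b" for a b :: real
  proof (cases "b \<le> a powr (p - 1)")
    case True
    show ?thesis
    proof (cases "a = 0")
      case False
      then have "a * b \<le> a powr 1 * a powr (p - 1)" using True that by (intro mult_mono) auto
      also have "... = a powr (1 + (p - 1))" by (simp only: powr_add)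
      also have "... = a powr p" by simp
      finally show ?thesis by (simp add: add_increasing2)
    qed simp
  next
    case False
    moreover have "0 \<le> a powr (p - 1)" by simp
    ultimately have b: "a powr (p - 1) < b" "b > 0" by linarith+
    have "a = (a powr (p - 1)) powr (1 / (p - 1))" using that p by (simp add: powr_powr)
    also have "... \<le> b powr (1 / (p - 1))" using b p by (intro powr_mono2) auto
    finally have "a * b \<le> b powr (1 / (p - 1)) * b powr 1" using b by (intro mult_mono) auto
    also have "... = b powr (1 / (p - 1) + 1)" by (simp add: powr_add)
    also have "1 / (p - 1) + 1 = conjugate_exponent p" using p by (simp add: conjugate_exponent_def field_simps)
    finally show ?thesis by (simp add: add_increasing)
  qed
  from this[OF abs_ge_zero abs_ge_zero]
  show "AE x in M. norm (f x * g x) \<le> norm (\<bar>f x\<bar> powr p + \<bar>g x\<bar> powr conjugate_exponent p)"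
    by (auto simp: abs_mult)
qed

lemma Lp_dominated:
  assumes "g \<in> Lp M q" "f \<in> borel_measurable M" "AE x in M. \<bar>f x\<bar> \<le> \<bar>g x\<bar>" "0 \<le> q"
  shows "f \<in> Lp M q" unfolding Lp_def
proof (intro CollectI conjI assms(2))
  show "integrable M (\<lambda>x. \<bar>f x\<bar> powr q)"
  proof (rule Bochner_Integration.integrable_bound[of M "\<lambda>x. \<bar>g x\<bar> powr q"])
    show "AE x in M. norm (\<bar>f x\<bar> powr q) \<le> norm (\<bar>g x\<bar> powr q)"
      using assms(3) by eventually_elim (auto intro!: powr_mono2 assms(4))
  qed (use assms(1,2) in \<open>auto simp: Lp_def\<close>)
qed

lemma Lp_max:
  assumes "f \<in> Lp M q" "g \<in> Lp M q" shows "(\<lambda>x. max (f x) (g x)) \<in> Lp M q" unfolding Lp_def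
proof (intro CollectI conjI)
  show "(\<lambda>x. max (f x) (g x)) \<in> borel_measurable M" using assms unfolding Lp_def by auto
  show "integrable M (\<lambda>x. \<bar>max (f x) (g x)\<bar> powr q)"
  proof (rule Bochner_Integration.integrable_bound[of M "\<lambda>x. \<bar>f x\<bar> powr q + \<bar>g x\<bar> powr q"])
    show "AE x in M. norm (\<bar>max (f x) (g x)\<bar> powr q) \<le> norm (\<bar>f x\<bar> powr q + \<bar>g x\<bar> powr q)"
      by (auto simp: max_def)
  qed (use assms in \<open>auto simp: Lp_def\<close>)
qed

lemma Lp_cmult:
  assumes "f \<in> Lp M q" shows "(\<lambda>x. c * f x) \<in> Lp M q"
proof -
  have "(\<lambda>x. \<bar>c * f x\<bar> powr q) = (\<lambda>x. \<bar>c\<bar> powr q * \<bar>f x\<bar> powr q)" by (simp add: abs_mult powr_mult)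
  then show ?thesis using assms unfolding Lp_def by auto
qed

lemma Lp_add_nonneg:
  assumes "f \<in> Lp M q" "g \<in> Lp M q" "0 \<le> q" "\<And>x. 0 \<le> f x" "\<And>x. 0 \<le> g x"
  shows "(\<lambda>x. f x + g x) \<in> Lp M q"
proof (rule Lp_dominated[OF Lp_cmult[OF Lp_max[OF assms(1,2)], of 2]])
  show "AE x in M. \<bar>f x + g x\<bar> \<le> \<bar>2 * max (f x) (g x)\<bar>"
  proof (rule AE_I2)
    fix x show "\<bar>f x + g x\<bar> \<le> \<bar>2 * max (f x) (g x)\<bar>" using assms(4)[of x] assms(5)[of x] by (auto simp: max_def)
  qed
qed (use assms in \<open>auto simp: Lp_def\<close>)

section \<open>Test plans as arc plans, and the Sobolev operator\<close>

context emtm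
begin

lemma arc_nn_integral_eq:
  assumes G: "Z \<in> RA d" and u: "u \<in> borel_measurable borel"
  shows "arc_nn_integral d Z u = kint len_kernel Z u"
proof -
  have "(\<lambda>t. 1 * u (crep Z t) * indicator {0..1} t) \<in> borel_measurable lborel"
    by (rule kint_integrand_measurable[of "\<lambda>_ _. 1"]) (use G u in auto)
  then have "kint len_kernel Z u = ennreal (rlen Z) * (\<integral>\<^sup>+t\<in>{0..1}. u (crep Z t) \<partial>lborel)"
    unfolding kint_def len_kernel_def by (subst nn_integral_cmult[symmetric]) (auto simp: mult.assoc)
  moreover have "(\<integral>\<^sup>+t\<in>{0..1}. u (crep Z t) \<partial>lborel) = (\<integral>\<^sup>+t\<in>{0..1}. u (rep Z t) \<partial>lborel)"
    by (intro nn_integral_cong) (auto simp: crep_eq split: split_indicator)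
  ultimately show ?thesis unfolding arc_nn_integral_def using arc_length_eq[OF G] by simp
qed

lemma kint_len_one: "Z \<in> RA d ==> kint len_kernel Z (\<lambda>_. 1) = ennreal (rlen Z)"
  unfolding kint_def len_kernel_def by (simp add: nn_integral_Icc_const)

lemma arc_length_measurable: "arc_length d \<in> borel_measurable (RAB d)"
proof (rule measurable_cong[THEN iffD1])
  show "(\<lambda>Z. kint len_kernel Z (\<lambda>_. 1)) \<in> borel_measurable (RAB d)" by (rule kint_measurable[OF arc_kernel_len]) simp
qed (simp add: kint_len_one arc_length_eq)

lemma rlen_measurable: "rlen \<in> borel_measurable (RAB d)"
  unfolding rlen_def[abs_def] using arc_length_measurable by measurable

lemma arc_integral_indicator:
  assumes G: "Z \<in> RA d" and B: "B \<in> sets borel"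
  shows "arc_integral d Z (indicator B) = enn2real (kint len_kernel Z (indicator B))"
proof -
  have bB: "bdd_borel (indicator B)" unfolding bdd_borel_def using B by (auto intro!: exI[of _ 1] split: split_indicator)
  have "lint (indicator B) Z = (\<integral>t. rlen Z * (indicator {0..1} t *\<^sub>R indicator B (rep Z t)) \<partial>lborel)"
    unfolding lint_def by (intro Bochner_Integration.integral_cong) (auto simp: crep_eq split: split_indicator)
  also have "... = arc_integral d Z (indicator B)"
    unfolding arc_integral_def set_lebesgue_integral_def rlen_def by simp
  finally have "lint (indicator B) Z = arc_integral d Z (indicator B)" .
  moreover have "kint len_kernel Z (indicator B) = ennreal (lint (indicator B) Z)"
    using kint_len[OF bB _ G] by (simp add: ennreal_indicator)
  ultimately show ?thesis using lint_nonneg[of "indicator B" Z] by simp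
qed

lemma test_plan_RAB: "\<pi> \<in> test_plans d m q ==> sets \<pi> = sets (RAB d)"
  unfolding test_plans_def dynamic_plan_def radon_measure_def RAB_def by auto

lemma kint_mono: "(\<And>x. u x \<le> v x) ==> kint k Z u \<le> kint k Z v"
  unfolding kint_def by (intro nn_integral_mono mult_right_mono mult_left_mono) auto

lemma Lp_nonneg_version:
  assumes "\<rho> \<in> Lp_nonneg m q" "q > 1"
  obtains \<rho>' where "\<rho>' \<in> Lp m q" "\<And>x. 0 \<le> \<rho>' x" "AE x in m. \<rho>' x = \<rho> x" "integrable m \<rho>'"
proof -
  have L: "\<rho> \<in> Lp m q" "AE x in m. 0 \<le> \<rho> x" using assms unfolding Lp_nonneg_def by auto
  have ae: "AE x in m. max 0 (\<rho> x) = \<rho> x" using L(2) by eventually_elim simp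
  have m: "\<rho> \<in> borel_measurable m" using L unfolding Lp_def by simp
  have L': "(\<lambda>x. max 0 (\<rho> x)) \<in> Lp m q" by (rule Lp_dominated[OF L(1)]) (use m assms in auto)
  interpret finite_measure m by (rule fin_m)
  have "integrable m (\<lambda>x. max 0 (\<rho> x))"
  proof (rule Bochner_Integration.integrable_bound[of m "\<lambda>x. 1 + \<bar>max 0 (\<rho> x)\<bar> powr q"])
    show "integrable m (\<lambda>x. 1 + \<bar>max 0 (\<rho> x)\<bar> powr q)" using L' unfolding Lp_def by auto
    have pw: "a \<le> 1 + a powr q" if "0 \<le> a" for a :: real
    proof (cases "a \<le> 1")
      case False
      then have "a powr 1 \<le> a powr q" using assms by (intro powr_mono) auto
      then show ?thesis using False by simp
    qed (simp add: add_increasing2)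
    have *: "max 0 (\<rho> x) \<le> 1 + max 0 (\<rho> x) powr q" for x by (rule pw) simp
    show "AE x in m. norm (max 0 (\<rho> x)) \<le> norm (1 + \<bar>max 0 (\<rho> x)\<bar> powr q)"
    proof (rule AE_I2)
      fix x show "norm (max 0 (\<rho> x)) \<le> norm (1 + \<bar>max 0 (\<rho> x)\<bar> powr q)" using *[of x] by simp
    qed
  qed (use m in auto)
  then show ?thesis using that[of "\<lambda>x. max 0 (\<rho> x)"] L' ae by auto
qed

lemma nn_integral_endpoint:
  assumes e: "e \<in> measurable \<pi> borel" and r: "integrable m r" "distr \<pi> borel e = density m (\<lambda>x. ennreal (r x))"
    and u: "u \<in> borel_measurable borel" shows "(\<integral>\<^sup>+Z. u (e Z) \<partial>\<pi>) = (\<integral>\<^sup>+x. ennreal (r x) * u x \<partial>m)"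
proof -
  have "(\<integral>\<^sup>+Z. u (e Z) \<partial>\<pi>) = (\<integral>\<^sup>+x. u x \<partial>distr \<pi> borel e)" by (rule nn_integral_distr[symmetric]) (use e u in auto)
  also have "... = (\<integral>\<^sup>+x. ennreal (r x) * u x \<partial>m)"
    unfolding r(2) using u r(1) by (intro nn_integral_density) (auto simp: meas_m dest: borel_measurable_integrable)
  finally show ?thesis .
qed

text \<open>Dominating three measures on Borel sets is enough: Radon-Nikodym yields the densities,
  and they inherit the bounds. It serves both restrictions of a plan and the plan of random
  subarcs.\<close>

lemma ex_arc_plan:
  assumes s: "sets \<pi> = sets (RAB d)" and fin: "finite_measure \<pi>"
    and R: "\<And>x. 0 \<le> R x" "integrable m R" and R0: "\<And>x. 0 \<le> R0 x" "integrable m R0" and R1: "\<And>x. 0 \<le> R1 x" "integrable m R1"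
    and len: "\<And>B. B \<in> sets borel ==> (\<integral>\<^sup>+Z. kint len_kernel Z (indicator B) \<partial>\<pi>) \<le> (\<integral>\<^sup>+x\<in>B. ennreal (R x) \<partial>m)"
    and e0: "\<And>B. B \<in> sets borel ==> (\<integral>\<^sup>+Z. indicator B (rep Z 0) \<partial>\<pi>) \<le> (\<integral>\<^sup>+x\<in>B. ennreal (R0 x) \<partial>m)"
    and e1: "\<And>B. B \<in> sets borel ==> (\<integral>\<^sup>+Z. indicator B (rep Z 1) \<partial>\<pi>) \<le> (\<integral>\<^sup>+x\<in>B. ennreal (R1 x) \<partial>m)"
  obtains \<rho> \<rho>0 \<rho>1 where "arc_plan \<pi> \<rho> \<rho>0 \<rho>1" "\<And>x. \<rho> x \<le> R x" "\<And>x. \<rho>0 x \<le> R0 x" "\<And>x. \<rho>1 x \<le> R1 x"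
proof -
  have dens: "\<exists>r. (\<forall>x. 0 \<le> r x \<and> r x \<le> S x) \<and> integrable m r \<and> N = density m (\<lambda>x. ennreal (r x))"
    if N: "sets N = sets borel" and S: "\<And>x. 0 \<le> S x" "integrable m S"
      and le: "\<And>B. B \<in> sets borel ==> (\<integral>\<^sup>+x. indicator B x \<partial>N) \<le> (\<integral>\<^sup>+x\<in>B. ennreal (S x) \<partial>m)" for N S
  proof -
    have sN: "sets N = sets m" using N by simp
    have le': "emeasure N B \<le> (\<integral>\<^sup>+x\<in>B. ennreal (S x) \<partial>m)" if "B \<in> sets m" for B using le[of B] that N by simp
    obtain r where r: "r \<in> borel_measurable m" "\<And>x. 0 \<le> r x" "\<And>x. r x \<le> S x" "N = density m (\<lambda>x. ennreal (r x))"
      using dominated_density[OF fin_m sN S(2,1) le'] by blast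
    have "integrable m r" by (rule Bochner_Integration.integrable_bound[OF S(2) r(1)]) (use r S in auto)
    then show ?thesis using r by blast
  qed
  obtain N where N: "sets N = sets borel" "\<And>u. u \<in> borel_measurable borel ==> (\<integral>\<^sup>+x. u x \<partial>N) = (\<integral>\<^sup>+Z. kint len_kernel Z u \<partial>\<pi>)"
    using ex_mixture[OF arc_kernel_len s] by metis
  have "(\<integral>\<^sup>+x. indicator B x \<partial>N) \<le> (\<integral>\<^sup>+x\<in>B. ennreal (R x) \<partial>m)" if "B \<in> sets borel" for B using len[OF that] N(2)[of "indicator B"] that by simp
  from dens[OF N(1) R this] obtain \<rho> where r: "\<forall>x. 0 \<le> \<rho> x \<and> \<rho> x \<le> R x" "integrable m \<rho>" "N = density m (\<lambda>x. ennreal (\<rho> x))" by blast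
  have ends: "\<exists>r. (\<forall>x. 0 \<le> r x \<and> r x \<le> S x) \<and> integrable m r \<and>
      (\<forall>u\<in>borel_measurable borel. (\<integral>\<^sup>+Z. u (e Z) \<partial>\<pi>) = (\<integral>\<^sup>+x. ennreal (r x) * u x \<partial>m))"
    if e: "e \<in> measurable (RAB d) borel" and S: "\<And>x. 0 \<le> S x" "integrable m S"
      and le: "\<And>B. B \<in> sets borel ==> (\<integral>\<^sup>+Z. indicator B (e Z) \<partial>\<pi>) \<le> (\<integral>\<^sup>+x\<in>B. ennreal (S x) \<partial>m)" for e S
  proof -
    have e': "e \<in> measurable \<pi> borel" using e unfolding measurable_cong_sets[OF s refl] .
    have "(\<integral>\<^sup>+x. indicator B x \<partial>distr \<pi> borel e) \<le> (\<integral>\<^sup>+x\<in>B. ennreal (S x) \<partial>m)" if "B \<in> sets borel" for B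
      using le[OF that] that e' by (subst nn_integral_distr) auto
    from dens[OF sets_distr S this] obtain r where "\<forall>x. 0 \<le> r x \<and> r x \<le> S x" "integrable m r" "distr \<pi> borel e = density m (\<lambda>x. ennreal (r x))" by blast
    then show ?thesis using nn_integral_endpoint[OF e'] by blast
  qed
  obtain \<rho>0 where r0: "\<forall>x. 0 \<le> \<rho>0 x \<and> \<rho>0 x \<le> R0 x" "integrable m \<rho>0"
      "\<forall>u\<in>borel_measurable borel. (\<integral>\<^sup>+Z. u (rep Z 0) \<partial>\<pi>) = (\<integral>\<^sup>+x. ennreal (\<rho>0 x) * u x \<partial>m)"
    using ends[OF endpoint_measurable(1) R0 e0] by auto
  obtain \<rho>1 where r1: "\<forall>x. 0 \<le> \<rho>1 x \<and> \<rho>1 x \<le> R1 x" "integrable m \<rho>1"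
      "\<forall>u\<in>borel_measurable borel. (\<integral>\<^sup>+Z. u (rep Z 1) \<partial>\<pi>) = (\<integral>\<^sup>+x. ennreal (\<rho>1 x) * u x \<partial>m)"
    using ends[OF endpoint_measurable(2) R1 e1] by auto
  have "(\<integral>\<^sup>+Z. kint len_kernel Z u \<partial>\<pi>) = (\<integral>\<^sup>+x. ennreal (\<rho> x) * u x \<partial>m)" if "u \<in> borel_measurable borel" for u
    using N(2)[OF that] r(2,3) that by (simp add: nn_integral_density meas_m borel_measurable_integrable)
  then have "arc_plan \<pi> \<rho> \<rho>0 \<rho>1" unfolding arc_plan_def using s fin r r0 r1 by auto
  then show ?thesis using that r r0 r1 by blast
qed

text \<open>The barycenter is given by Bochner integrals of bounded functions. On indicators these
  are the masses of the mixture of the length kernel, so the two measures coincide, and the identity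
  extends to all nonnegative Borel functions.\<close>

lemma test_plan_arc_plan:
  assumes \<pi>: "\<pi> \<in> test_plans d m q" and q: "1 < q"
  obtains \<rho> \<rho>0 \<rho>1 where "arc_plan \<pi> \<rho> \<rho>0 \<rho>1" "\<rho> \<in> Lp m q" "\<rho>0 \<in> Lp m q" "\<rho>1 \<in> Lp m q"
proof -
  note s = test_plan_RAB[OF \<pi>]
  have sp: "space \<pi> = RA d" using sets_eq_imp_space_eq[OF s] by simp
  have fin: "finite_measure \<pi>" and lfin: "(\<integral>\<^sup>+Z. arc_length d Z \<partial>\<pi>) < \<infinity>"
    using \<pi> unfolding test_plans_def dynamic_plan_def radon_measure_def by auto
  obtain \<mu> where \<mu>: "is_barycenter d \<pi> \<mu>" "ac_with_Lp_density m q \<mu>" using \<pi> unfolding test_plans_def by auto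
  have dens: "\<exists>r. r \<in> Lp m q \<and> (\<forall>x. 0 \<le> r x) \<and> integrable m r \<and> N = density m (\<lambda>x. ennreal (r x))" if N: "ac_with_Lp_density m q N" for N
  proof -
    obtain r0 where r0: "r0 \<in> Lp_nonneg m q" "N = density m (\<lambda>x. ennreal (r0 x))" using N unfolding ac_with_Lp_density_def by auto
    obtain r where r: "r \<in> Lp m q" "\<And>x. 0 \<le> r x" "AE x in m. r x = r0 x" "integrable m r"
      using Lp_nonneg_version[OF r0(1) q] by metis
    have "N = density m (\<lambda>x. ennreal (r x))" unfolding r0(2)
      using r r0(1) by (intro density_cong) (auto simp: Lp_nonneg_def Lp_def elim!: eventually_mono)
    then show ?thesis using r by blast
  qed
  obtain \<rho> where r: "\<rho> \<in> Lp m q" "\<And>x. 0 \<le> \<rho> x" "integrable m \<rho>" "\<mu> = density m (\<lambda>x. ennreal (\<rho> x))" using dens[OF \<mu>(2)] by auto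
  obtain \<rho>0 where r0: "\<rho>0 \<in> Lp m q" "\<And>x. 0 \<le> \<rho>0 x" "integrable m \<rho>0" "distr \<pi> borel (arc_eval d 0) = density m (\<lambda>x. ennreal (\<rho>0 x))"
    using dens[of "distr \<pi> borel (arc_eval d 0)"] \<pi> unfolding test_plans_def by auto
  obtain \<rho>1 where r1: "\<rho>1 \<in> Lp m q" "\<And>x. 0 \<le> \<rho>1 x" "integrable m \<rho>1" "distr \<pi> borel (arc_eval d 1) = density m (\<lambda>x. ennreal (\<rho>1 x))"
    using dens[of "distr \<pi> borel (arc_eval d 1)"] \<pi> unfolding test_plans_def by auto
  have mm: "r \<in> borel_measurable borel" if "r \<in> Lp m q" for r using that unfolding Lp_def by (simp add: meas_m)
  obtain N where N: "sets N = sets borel" "\<And>u. u \<in> borel_measurable borel ==> (\<integral>\<^sup>+x. u x \<partial>N) = (\<integral>\<^sup>+Z. kint len_kernel Z u \<partial>\<pi>)"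
    using ex_mixture[OF arc_kernel_len s] by metis
  have \<mu>f: "finite_measure \<mu>" and \<mu>s: "sets \<mu> = sets borel" using \<mu>(1) r(4) unfolding is_barycenter_def radon_measure_def by auto
  have "N = \<mu>"
  proof (rule measure_eqI)
    show "sets N = sets \<mu>" using N \<mu>s by simp
    fix B assume "B \<in> sets N"
    then have B: "B \<in> sets borel" using N by simp
    have km: "(\<lambda>Z. kint len_kernel Z (indicator B)) \<in> borel_measurable \<pi>"
      unfolding measurable_cong_sets[OF s refl] using B by (intro kint_measurable[OF arc_kernel_len]) simp
    have kle: "kint len_kernel Z (indicator B) \<le> arc_length d Z" if "Z \<in> RA d" for Z
    proof -
      have "kint len_kernel Z (indicator B) \<le> kint len_kernel Z (\<lambda>_. 1)" by (rule kint_mono) (auto split: split_indicator)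
      then show ?thesis using kint_len_one[OF that] arc_length_eq[OF that] by simp
    qed
    have kf: "ennreal (enn2real (kint len_kernel Z (indicator B))) = kint len_kernel Z (indicator B)" if "Z \<in> RA d" for Z
      using kle[OF that] arc_length_eq[OF that] by (metis ennreal_enn2real ennreal_less_top le_less_trans)
    have "(\<integral>\<^sup>+Z. kint len_kernel Z (indicator B) \<partial>\<pi>) \<le> (\<integral>\<^sup>+Z. arc_length d Z \<partial>\<pi>)"
      using kle sp by (intro nn_integral_mono) auto
    then have kfin: "(\<integral>\<^sup>+Z. kint len_kernel Z (indicator B) \<partial>\<pi>) < \<infinity>" using lfin by (auto intro: le_less_trans)
    have eqk: "(\<integral>\<^sup>+Z. ennreal (enn2real (kint len_kernel Z (indicator B))) \<partial>\<pi>) = (\<integral>\<^sup>+Z. kint len_kernel Z (indicator B) \<partial>\<pi>)"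
      using kf sp by (intro nn_integral_cong) auto
    have i: "integrable \<pi> (\<lambda>Z. enn2real (kint len_kernel Z (indicator B)))"
      by (rule integrableI_nonneg) (use km kfin eqk in auto)
    have "emeasure N B = (\<integral>\<^sup>+Z. kint len_kernel Z (indicator B) \<partial>\<pi>)" using N(2)[of "indicator B"] N(1) B by simp
    also have "... = ennreal (\<integral>Z. enn2real (kint len_kernel Z (indicator B)) \<partial>\<pi>)"
      unfolding eqk[symmetric] by (rule nn_integral_eq_integral[OF i]) simp
    also have "(\<integral>Z. enn2real (kint len_kernel Z (indicator B)) \<partial>\<pi>) = (\<integral>Z. arc_integral d Z (indicator B) \<partial>\<pi>)"
      using arc_integral_indicator[OF _ B] sp by (intro Bochner_Integration.integral_cong) auto
    also have "... = (\<integral>x. indicator B x \<partial>\<mu>)"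
    proof -
      have "(indicator B :: 'a => real) \<in> borel_measurable borel" "bounded (range (indicator B :: 'a => real))"
        using B by (auto intro!: boundedI[of _ 1] split: split_indicator)
      then show ?thesis using \<mu>(1)[unfolded is_barycenter_def, THEN conjunct2, rule_format, of "indicator B"] by simp
    qed
    also have "ennreal (\<integral>x. indicator B x \<partial>\<mu>) = emeasure \<mu> B"
      using \<mu>f \<mu>s B by (simp add: finite_measure.emeasure_eq_measure)
    finally show "emeasure N B = emeasure \<mu> B" .
  qed
  then have k: "(\<integral>\<^sup>+Z. kint len_kernel Z u \<partial>\<pi>) = (\<integral>\<^sup>+x. ennreal (\<rho> x) * u x \<partial>m)" if "u \<in> borel_measurable borel" for u
    using N(2)[OF that] r(4) that mm[OF r(1)] by (simp add: nn_integral_density meas_m)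
  have em: "arc_eval d t = (\<lambda>Z. rep Z t)" for t by (simp add: arc_eval_def[abs_def])
  note e = nn_integral_endpoint[OF _ r0(3,4)[unfolded em]] nn_integral_endpoint[OF _ r1(3,4)[unfolded em]]
  have "(\<lambda>Z. rep Z 0) \<in> measurable \<pi> borel" "(\<lambda>Z. rep Z 1) \<in> measurable \<pi> borel"
    using endpoint_measurable unfolding measurable_cong_sets[OF s refl] by auto
  then have "arc_plan \<pi> \<rho> \<rho>0 \<rho>1" unfolding arc_plan_def using s fin r r0 r1 k e by auto
  then show ?thesis using that r(1) r0(1) r1(1) by blast
qed

text \<open>Restriction decreases all three measures, so the old densities still dominate
  them.\<close>

lemma arc_plan_restrict:
  assumes plan: "arc_plan \<pi> \<rho> \<rho>0 \<rho>1" and A: "A \<in> sets \<pi>"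
  obtains \<rho>' \<rho>0' \<rho>1' where "arc_plan (density \<pi> (indicator A)) \<rho>' \<rho>0' \<rho>1'"
    "\<And>x. \<rho>' x \<le> \<rho> x" "\<And>x. \<rho>0' x \<le> \<rho>0 x" "\<And>x. \<rho>1' x \<le> \<rho>1 x"
proof -
  note P = plan_sets[OF plan] plan_space[OF plan] and nn = plan_dens_nonneg[OF plan] and ii = plan_dens_integrable[OF plan]
  let ?\<pi> = "density \<pi> (indicator A)"
  have s: "sets ?\<pi> = sets (RAB d)" using P by simp
  have Ai: "(indicator A :: _ => ennreal) \<in> borel_measurable \<pi>" using A by simp
  have le: "(\<integral>\<^sup>+Z. F Z \<partial>?\<pi>) \<le> (\<integral>\<^sup>+Z. F Z \<partial>\<pi>)" if "F \<in> borel_measurable (RAB d)" for F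
    using that Ai by (subst nn_integral_density) (auto simp: plan_meas[OF plan] intro!: nn_integral_mono split: split_indicator)
  have fin: "finite_measure ?\<pi>"
  proof (rule finite_measureI)
    interpret finite_measure \<pi> by (rule plan_fin[OF plan])
    have "emeasure ?\<pi> (space ?\<pi>) = emeasure \<pi> A" using A Ai by (subst emeasure_density) (auto simp: sets.sets_into_space Int_absorb2 intro: nn_integral_cong[THEN trans])
    then show "emeasure ?\<pi> (space ?\<pi>) \<noteq> \<infinity>" by simp
  qed
  show ?thesis
  proof (rule ex_arc_plan[OF s fin nn(1) ii(1) nn(2) ii(2) nn(3) ii(3)])
    fix B :: "'a set" assume "B \<in> sets borel"
    then have u [simp]: "(indicator B :: 'a => ennreal) \<in> borel_measurable borel" by simp
    show "(\<integral>\<^sup>+Z. kint len_kernel Z (indicator B) \<partial>?\<pi>) \<le> (\<integral>\<^sup>+x\<in>B. ennreal (\<rho> x) \<partial>m)"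
      using le[OF kint_measurable[OF arc_kernel_len u]] unfolding plan_kint[OF plan u] .
    show "(\<integral>\<^sup>+Z. indicator B (rep Z 0) \<partial>?\<pi>) \<le> (\<integral>\<^sup>+x\<in>B. ennreal (\<rho>0 x) \<partial>m)"
      using le[OF measurable_compose[OF endpoint_measurable(1) u]] unfolding plan_end0[OF plan u] .
    show "(\<integral>\<^sup>+Z. indicator B (rep Z 1) \<partial>?\<pi>) \<le> (\<integral>\<^sup>+x\<in>B. ennreal (\<rho>1 x) \<partial>m)"
      using le[OF measurable_compose[OF endpoint_measurable(2) u]] unfolding plan_end1[OF plan u] .
  qed (use that in blast)
qed

text \<open>An essential infimum exists once there is one bound, so the choice in
  \<open>ess_inf\<close> is meaningful; nonnegativity follows from its maximality among lower
  bounds.\<close>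

lemma derivation_norm_le:
  assumes "g \<in> derivation_bounds d m q b"
  shows "AE x in m. derivation_norm d m q b x \<le> g x" "AE x in m. 0 \<le> derivation_norm d m q b x"
proof -
  let ?S = "derivation_bounds d m q b"
  have S: "?S \<noteq> {}" "?S \<subseteq> borel_measurable m" "\<And>g. g \<in> ?S ==> AE x in m. 0 \<le> g x"
    using assms unfolding derivation_bounds_def Lp_nonneg_def Lp_def by auto
  obtain G :: "nat => _" where "is_ess_inf m ?S (\<lambda>x. INF n. max 0 (G n x))" using ex_ess_inf_seq[OF fin_m S] by metis
  then have e: "is_ess_inf m ?S (derivation_norm d m q b)" unfolding derivation_norm_def ess_inf_def
    using someI[of "is_ess_inf m ?S"] by blast
  then show "AE x in m. derivation_norm d m q b x \<le> g x" using assms unfolding is_ess_inf_def by auto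
  show "AE x in m. 0 \<le> derivation_norm d m q b x"
    by (rule e[unfolded is_ess_inf_def, THEN conjunct2, THEN conjunct2, rule_format, of "\<lambda>_. 0"]) (use S(3) in auto)
qed

text \<open>The operator bound survives the passage to the essential infimum because a countable
  family attains it: the exceptional sets remain null, and dividing by the norm of \<open>b\<close>
  where it is positive allows the infimum to be taken pointwise.\<close>

lemma W_gradient_version:
  assumes p: "1 < p" and f: "f \<in> W1p d m p"
  obtains W L where "W \<in> borel_measurable borel" "\<And>x. 0 \<le> W x" "W \<in> Lp m p" "AE x in m. W x = W_gradient d m p f x"
    "is_weak_derivative_operator d m p f L"
    "\<And>b. b \<in> Der_div d m (conjugate_exponent p) ==> AE x in m. \<bar>L b x\<bar> \<le> W x * derivation_norm d m (conjugate_exponent p) b x"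
proof -
  define L where "L = weak_derivative_operator d m p f"
  have L: "is_weak_derivative_operator d m p f L"
    unfolding L_def weak_derivative_operator_def using f someI_ex[of "is_weak_derivative_operator d m p f"] unfolding W1p_def by auto
  let ?S = "operator_bounds d m p L"
  have S: "?S \<noteq> {}" "?S \<subseteq> borel_measurable m" "\<And>g. g \<in> ?S ==> AE x in m. 0 \<le> g x"
    using L unfolding is_weak_derivative_operator_def Let_def operator_bounds_def Lp_nonneg_def Lp_def by auto
  obtain g :: "nat => _" where g: "range g \<subseteq> ?S" "is_ess_inf m ?S (\<lambda>x. INF n. max 0 (g n x))" using ex_ess_inf_seq[OF fin_m S] by metis
  define W where "W x = (INF n. max 0 (g n x))" for x
  have bdd: "bdd_below (range (\<lambda>n. max 0 (g n x)))" for x by (rule bdd_belowI[of _ 0]) auto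
  have W0: "0 \<le> W x" for x unfolding W_def by (rule cINF_greatest) auto
  have Wm: "W \<in> borel_measurable m" using g(2) unfolding is_ess_inf_def W_def by simp
  have gS: "g n \<in> ?S" for n using g(1) by auto
  have Wle: "AE x in m. W x \<le> g n x" for n using g(2) gS unfolding is_ess_inf_def W_def by auto
  have g0: "g 0 \<in> Lp m p" using gS[of 0] unfolding operator_bounds_def Lp_nonneg_def by auto
  have WL: "W \<in> Lp m p"
  proof (rule Lp_dominated[OF g0 Wm])
    show "AE x in m. \<bar>W x\<bar> \<le> \<bar>g 0 x\<bar>" using Wle[of 0] by eventually_elim (use W0 in auto)
  qed (use p in simp)
  have eq: "AE x in m. W x = W_gradient d m p f x"
    using ess_inf_eq_AE[OF g(2)] unfolding W_gradient_def L_def[symmetric] W_def by eventually_elim simp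
  have bound: "AE x in m. \<bar>L b x\<bar> \<le> W x * derivation_norm d m (conjugate_exponent p) b x"
    if b: "b \<in> Der_div d m (conjugate_exponent p)" for b
  proof -
    let ?N = "derivation_norm d m (conjugate_exponent p) b"
    obtain g' where "g' \<in> derivation_bounds d m (conjugate_exponent p) b" using b unfolding Der_div_def Der_def by auto
    then have N0: "AE x in m. 0 \<le> ?N x" by (rule derivation_norm_le(2))
    have "AE x in m. \<forall>n. \<bar>L b x\<bar> \<le> g n x * ?N x"
      using gS b unfolding operator_bounds_def by (subst AE_all_countable) auto
    with N0 show ?thesis
    proof eventually_elim
      case (elim x)
      show ?case
      proof (cases "?N x = 0")
        case True
        then show ?thesis using elim by auto
      next
        case False
        then have "?N x > 0" using elim by simp
        have "\<bar>L b x\<bar> / ?N x \<le> W x" unfolding W_def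
        proof (rule cINF_greatest)
          fix n
          have "\<bar>L b x\<bar> / ?N x \<le> g n x" using elim \<open>?N x > 0\<close> by (simp add: pos_divide_le_eq)
          then show "\<bar>L b x\<bar> / ?N x \<le> max 0 (g n x)" by simp
        qed simp
        then show ?thesis using \<open>?N x > 0\<close> by (simp add: pos_divide_le_eq)
      qed
    qed
  qed
  show ?thesis by (rule that[OF _ W0 WL eq L bound]) (use Wm in \<open>simp add: meas_m\<close>)
qed

lemma conjugate_exponent_gt: "1 < p ==> 1 < conjugate_exponent p"
  unfolding conjugate_exponent_def by (simp add: field_simps)

lemma operator_bound_weak_upper_gradient:
  assumes p: "1 < p" and f: "f \<in> Lp m p" and L: "is_weak_derivative_operator d m p f L"
    and W: "W \<in> borel_measurable borel" "\<And>x. 0 \<le> W x" "W \<in> Lp m p"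
    and bound: "\<And>b. b \<in> Der_div d m (conjugate_exponent p) ==> AE x in m. \<bar>L b x\<bar> \<le> W x * derivation_norm d m (conjugate_exponent p) b x"
  shows "weak_upper_gradient d m (conjugate_exponent p) f W"
proof -
  define q where "q = conjugate_exponent p"
  have q: "q > 1" unfolding q_def by (rule conjugate_exponent_gt[OF p])
  have fm: "f \<in> borel_measurable borel" using f unfolding Lp_def by (simp add: meas_m)
  have WL: "W \<in> Lp m p" by (rule W(3))
  have W': "(\<lambda>x. ennreal (W x)) \<in> borel_measurable borel" using W(1) by simp
  have main: "AE Z in \<pi>. ennreal \<bar>f (arc_eval d 1 Z) - f (arc_eval d 0 Z)\<bar> \<le> arc_nn_integral d Z (\<lambda>x. ennreal (W x)) \<and>
        arc_nn_integral d Z (\<lambda>x. ennreal (W x)) < \<infinity>" if \<pi>: "\<pi> \<in> test_plans d m q" for \<pi>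
  proof -
    obtain \<rho> \<rho>0 \<rho>1 where plan: "arc_plan \<pi> \<rho> \<rho>0 \<rho>1" and Lr: "\<rho> \<in> Lp m q" "\<rho>0 \<in> Lp m q" "\<rho>1 \<in> Lp m q"
      using test_plan_arc_plan[OF \<pi> q] by metis
    note ps = plan_sets[OF plan] plan_space[OF plan]
    define w where "w Z = kint len_kernel Z (\<lambda>x. ennreal (W x))" for Z
    have wm [measurable]: "w \<in> borel_measurable \<pi>"
      unfolding w_def[abs_def] plan_meas[OF plan] by (rule kint_measurable[OF arc_kernel_len W'])
    have Wr: "integrable m (\<lambda>x. W x * r x)" "integrable m (\<lambda>x. f x * r x)" if "r \<in> Lp m q" for r
      using Lp_mult_integrable[OF p WL, of r] Lp_mult_integrable[OF p f, of r] that by (auto simp: q_def)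
    have nnW: "(\<integral>\<^sup>+x. ennreal (r x) * ennreal (W x) \<partial>m) = ennreal (\<integral>x. W x * r x \<partial>m)" if "r \<in> Lp m q" "\<And>x. 0 \<le> r x" for r
    proof -
      have "(\<integral>\<^sup>+x. ennreal (r x) * ennreal (W x) \<partial>m) = (\<integral>\<^sup>+x. ennreal (W x * r x) \<partial>m)"
        using that W(2) by (intro nn_integral_cong) (simp add: ennreal_mult mult.commute)
      also have "... = ennreal (\<integral>x. W x * r x \<partial>m)" by (rule nn_integral_eq_integral[OF Wr(1)[OF that(1)]]) (use that W(2) in auto)
      finally show ?thesis .
    qed
    have "(\<integral>\<^sup>+Z. w Z \<partial>\<pi>) < \<infinity>"
      unfolding w_def plan_kint[OF plan W'] nnW[OF Lr(1) plan_dens_nonneg(1)[OF plan]] by simp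
    \<comment> \<open>Finite integrals along almost every arc come from pairing \<open>W\<close> in
      \<open>Lp m p\<close> with the barycenter density in \<open>Lp m q\<close>.\<close>
    then have wfin: "AE Z in \<pi>. w Z \<noteq> \<infinity>" by (intro nn_integral_PInf_AE wm) auto
    have weq: "(\<integral>\<^sup>+Z. ennreal (enn2real (w Z)) \<partial>\<pi>) = (\<integral>\<^sup>+Z. w Z \<partial>\<pi>)"
      using wfin by (intro nn_integral_cong_AE) (auto elim!: eventually_mono simp: less_top)
    have wi: "integrable \<pi> (\<lambda>Z. enn2real (w Z))"
      by (rule integrableI_nonneg) (use \<open>(\<integral>\<^sup>+Z. w Z \<partial>\<pi>) < \<infinity>\<close> weq in auto)
    define D where "D Z = f (rep Z 1) - f (rep Z 0)" for Z
    note E = plan_endpoints[OF plan fm Wr(2)[OF Lr(2)] Wr(2)[OF Lr(3)]]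
    have Di: "integrable \<pi> D" unfolding D_def[abs_def] using E by simp
    \<comment> \<open>It suffices to compare integrals over every measurable set \<open>A\<close> of
      arcs, and each \<open>A\<close> receives its own derivation, that of the restricted
      plan.\<close>
    have key: "\<bar>\<integral>Z. indicator A Z * D Z \<partial>\<pi>\<bar> \<le> (\<integral>Z. indicator A Z * enn2real (w Z) \<partial>\<pi>)" if A: "A \<in> sets \<pi>" for A
    proof -
      let ?\<pi> = "density \<pi> (indicator A)"
      obtain \<rho>' \<rho>0' \<rho>1' where plan': "arc_plan ?\<pi> \<rho>' \<rho>0' \<rho>1'" and le: "\<And>x. \<rho>' x \<le> \<rho> x" "\<And>x. \<rho>0' x \<le> \<rho>0 x" "\<And>x. \<rho>1' x \<le> \<rho>1 x"
        using arc_plan_restrict[OF plan A] by metis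
      note nn' = plan_dens_nonneg[OF plan'] and mm' = plan_dens_measurable[OF plan']
      have L': "\<rho>' \<in> Lp m q" "\<rho>0' \<in> Lp m q" "\<rho>1' \<in> Lp m q"
      proof -
        have dom: "r' \<in> Lp m q" if "r \<in> Lp m q" "r' \<in> borel_measurable borel" "\<And>x. 0 \<le> r' x" "\<And>x. r' x \<le> r x" for r r'
        proof (rule Lp_dominated[OF that(1)])
          have "\<bar>r' x\<bar> \<le> \<bar>r x\<bar>" for x using that(3)[of x] that(4)[of x] by simp
          then show "AE x in m. \<bar>r' x\<bar> \<le> \<bar>r x\<bar>" by simp
        qed (use that(2) q in \<open>auto simp: meas_m\<close>)
        show "\<rho>' \<in> Lp m q" "\<rho>0' \<in> Lp m q" "\<rho>1' \<in> Lp m q"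
          using dom[OF Lr(1) mm'(1) nn'(1) le(1)] dom[OF Lr(2) mm'(2) nn'(2) le(2)] dom[OF Lr(3) mm'(3) nn'(3) le(3)] by auto
      qed
      define b where "b = plan_derivation ?\<pi> \<rho>'"
      have rb: "\<rho>' \<in> derivation_bounds d m q b"
        unfolding b_def by (rule plan_derivation_bounds[OF plan']) (use L' nn' in \<open>auto simp: Lp_nonneg_def\<close>)
      have bD: "b \<in> Der d m q" unfolding b_def by (rule plan_derivation_Der[OF plan']) (use L' nn' in \<open>auto simp: Lp_nonneg_def\<close>)
      have div: "is_divergence d m b (\<lambda>x. \<rho>0' x - \<rho>1' x)" unfolding b_def by (rule plan_is_divergence[OF plan'])
      have "(\<lambda>x. \<rho>0' x - \<rho>1' x) \<in> Lp m q"
      proof (rule Lp_dominated[OF Lp_max[OF L'(2,3)]])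
        show "AE x in m. \<bar>\<rho>0' x - \<rho>1' x\<bar> \<le> \<bar>max (\<rho>0' x) (\<rho>1' x)\<bar>"
        proof (rule AE_I2)
          fix x show "\<bar>\<rho>0' x - \<rho>1' x\<bar> \<le> \<bar>max (\<rho>0' x) (\<rho>1' x)\<bar>" using nn'(2)[of x] nn'(3)[of x] by (auto simp: max_def)
        qed
      qed (use q mm' in \<open>auto simp: meas_m\<close>)
      then have bdiv: "b \<in> Der_div d m q" unfolding Der_div_def using bD div by auto
      have Lint: "integrable m (L b)" "(\<integral>x. L b x \<partial>m) = - (\<integral>x. f x * (\<rho>0' x - \<rho>1' x) \<partial>m)"
        using L bdiv div unfolding is_weak_derivative_operator_def Let_def q_def by auto
      have LW: "AE x in m. \<bar>L b x\<bar> \<le> W x * \<rho>' x"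
        using bound[of b] bdiv derivation_norm_le(1)[OF rb] unfolding q_def
        by (auto elim!: eventually_elim2 intro: order_trans mult_left_mono W(2))
      note E' = plan_endpoints[OF plan' fm Wr(2)[OF L'(2)] Wr(2)[OF L'(3)]]
      have "(\<integral>Z. indicator A Z * D Z \<partial>\<pi>) = (\<integral>Z. D Z \<partial>?\<pi>)"
      proof -
        have "?\<pi> = density \<pi> (\<lambda>Z. ennreal (indicator A Z))" by (simp add: ennreal_indicator)
        then show ?thesis using integral_density[of D \<pi> "indicator A"] Di A by auto
      qed
      also have "... = (\<integral>x. f x * \<rho>1' x \<partial>m) - (\<integral>x. f x * \<rho>0' x \<partial>m)" unfolding D_def using E' by simp
      also have "... = (\<integral>x. L b x \<partial>m)" using Lint(2) Wr(2)[OF L'(2)] Wr(2)[OF L'(3)] by (simp add: right_diff_distrib)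
      finally have "\<bar>\<integral>Z. indicator A Z * D Z \<partial>\<pi>\<bar> \<le> (\<integral>x. \<bar>L b x\<bar> \<partial>m)" by (simp add: integral_abs_bound)
      also have "... \<le> (\<integral>x. W x * \<rho>' x \<partial>m)" by (rule integral_mono_AE) (use Lint Wr(1)[OF L'(1)] LW in auto)
      finally have le1: "\<bar>\<integral>Z. indicator A Z * D Z \<partial>\<pi>\<bar> \<le> (\<integral>x. W x * \<rho>' x \<partial>m)" .
      have "ennreal (\<integral>x. W x * \<rho>' x \<partial>m) = (\<integral>\<^sup>+Z. w Z \<partial>?\<pi>)"
        unfolding w_def plan_kint[OF plan' W'] nnW[OF L'(1) nn'(1)] ..
      also have "... = (\<integral>\<^sup>+Z. ennreal (indicator A Z * enn2real (w Z)) \<partial>\<pi>)"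
        using A wfin by (subst nn_integral_density) (auto intro!: nn_integral_cong_AE elim!: eventually_mono simp: less_top split: split_indicator)
      also have "... = ennreal (\<integral>Z. indicator A Z * enn2real (w Z) \<partial>\<pi>)"
        by (rule nn_integral_eq_integral) (use integrable_mult_indicator[OF A wi] in auto)
      finally have "ennreal (\<integral>x. W x * \<rho>' x \<partial>m) = ennreal (\<integral>Z. indicator A Z * enn2real (w Z) \<partial>\<pi>)" .
      moreover have "0 \<le> (\<integral>x. W x * \<rho>' x \<partial>m)" "0 \<le> (\<integral>Z. indicator A Z * enn2real (w Z) \<partial>\<pi>)"
        using W(2) nn' by (auto intro!: integral_nonneg_AE)
      ultimately show ?thesis using le1 by simp
    qed
    have "AE Z in \<pi>. D Z \<le> enn2real (w Z)"
      by (rule AE_le_of_set_integral[OF Di wi]) (use key in \<open>auto simp: abs_le_iff\<close>)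
    moreover have "AE Z in \<pi>. - D Z \<le> enn2real (w Z)"
      by (rule AE_le_of_set_integral[OF _ wi]) (use Di key in \<open>auto simp: abs_le_iff\<close>)
    ultimately show ?thesis using wfin AE_space
    proof eventually_elim
      case (elim Z)
      then have G: "Z \<in> RA d" by (simp add: ps)
      have "ennreal \<bar>D Z\<bar> \<le> ennreal (enn2real (w Z))" using elim by (intro ennreal_leI) auto
      also have "... = w Z" using elim by (auto simp: less_top)
      finally show ?case using elim arc_nn_integral_eq[OF G W'] by (auto simp: D_def arc_eval_def w_def less_top)
    qed
  qed
  show ?thesis unfolding weak_upper_gradient_def q_def[symmetric] using fm W(1,2) main by auto
qed
end

section \<open>The topology of the space of rectifiable arcs\<close>

lemma openin_if_eventually:
  assumes "S \<subseteq> topspace T" "\<And>x. x \<in> S ==> eventually (\<lambda>y. y \<in> S) (nhdsin T x)" shows "openin T S"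
proof (subst openin_subopen, intro ballI)
  fix x assume "x \<in> S"
  then have "x \<in> topspace T" "eventually (\<lambda>y. y \<in> S) (nhdsin T x)" using assms by auto
  then obtain U where "openin T U" "x \<in> U" "\<forall>y\<in>U. y \<in> S" unfolding eventually_nhdsin by auto
  then show "\<exists>U. openin T U \<and> x \<in> U \<and> U \<subseteq> S" by blast
qed

lemma eventually_curves: "\<gamma>0 \<in> curves ==> eventually (\<lambda>\<gamma>. \<gamma> \<in> curves) (nhdsin compact_open_topology \<gamma>0)"
  unfolding eventually_nhdsin topspace_compact_open_topology
  by (intro disjI2 exI[of _ curves]) (metis openin_topspace topspace_compact_open_topology)

text \<open>\<theta> is \<open>\<psi>\<close> after a right inverse of \<open>\<phi>\<close>. It may
  jump, so composing with it does not produce curves, but it matches the images of whole intervals,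
  which is what conditions on cells need.\<close>

lemma arc_rel_lift:
  assumes "(\<gamma>, \<sigma>) \<in> arc_rel"
  obtains \<theta> :: "real => real" where "\<theta> 0 = 0" "\<theta> 1 = 1" "\<And>x y. 0 \<le> x ==> x \<le> y ==> y \<le> 1 ==> \<theta> x \<le> \<theta> y"
    "\<And>x y. 0 \<le> x ==> x \<le> y ==> y \<le> 1 ==> \<sigma> ` {\<theta> x..\<theta> y} = \<gamma> ` {x..y}"
proof -
  obtain \<phi> \<psi> where r: "reparametrization \<phi>" "reparametrization \<psi>" "\<And>t. t \<in> {0..1} ==> \<gamma> (\<phi> t) = \<sigma> (\<psi> t)"
    using assms unfolding arc_rel_def by auto
  note P = reparametrizationD[OF r(1)] and Q = reparametrizationD[OF r(2)]
  obtain g0 where g0: "\<And>y. 0 \<le> y ==> y \<le> 1 ==> 0 \<le> g0 y \<and> g0 y \<le> 1 \<and> \<phi> (g0 y) = y" using P(7) by metis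
  \<comment> \<open>Where \<open>\<phi>\<close> is constant near an end, an arbitrary inverse may
    miss 0 or 1; these values are therefore prescribed.\<close>
  define g where "g y = (if y = 0 then 0 else if y = 1 then 1 else g0 y)" for y
  have g: "0 \<le> g y \<and> g y \<le> 1 \<and> \<phi> (g y) = y" if "0 \<le> y" "y \<le> 1" for y
    using g0[OF that] P(3,4) by (auto simp: g_def)
  have gm: "g x \<le> g y" if "0 \<le> x" "x \<le> y" "y \<le> 1" for x y
  proof (rule ccontr)
    assume "\<not> g x \<le> g y"
    then have "\<phi> (g y) \<le> \<phi> (g x)" using g[of x] g[of y] that by (intro P(6)) auto
    then have "x = y" using g[of x] g[of y] that by simp
    then show False using \<open>\<not> g x \<le> g y\<close> by simp
  qed
  have im: "\<phi> ` {a..b} = {\<phi> a..\<phi> b}" if c: "continuous_on {0..1} \<phi>" and m: "\<And>s t. 0 \<le> s ==> s \<le> t ==> t \<le> 1 ==> \<phi> s \<le> \<phi> t"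
    and ab: "0 \<le> a" "a \<le> b" "b \<le> 1" for \<phi> :: "real => real" and a b
  proof
    show "\<phi> ` {a..b} \<subseteq> {\<phi> a..\<phi> b}" using ab m by auto
    show "{\<phi> a..\<phi> b} \<subseteq> \<phi> ` {a..b}"
    proof
      fix y assume "y \<in> {\<phi> a..\<phi> b}"
      then obtain x where "a \<le> x" "x \<le> b" "\<phi> x = y"
        using IVT'[of \<phi> a y b] continuous_on_subset[OF c, of "{a..b}"] ab by auto
      then show "y \<in> \<phi> ` {a..b}" by auto
    qed
  qed
  show ?thesis
  proof (rule that[of "\<lambda>y. \<psi> (g y)"])
    show "\<psi> (g 0) = 0" "\<psi> (g 1) = 1" using Q by (auto simp: g_def)
    fix x y :: real assume xy: "0 \<le> x" "x \<le> y" "y \<le> 1"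
    have gxy: "0 \<le> g x" "g x \<le> g y" "g y \<le> 1" using g[of x] g[of y] gm[OF xy] xy by auto
    show "\<psi> (g x) \<le> \<psi> (g y)" using gxy by (intro Q(6))
    have "\<sigma> ` {\<psi> (g x)..\<psi> (g y)} = (\<lambda>t. \<sigma> (\<psi> t)) ` {g x..g y}" using im[OF Q(1,6) gxy] by (metis image_image)
    also have "... = (\<lambda>t. \<gamma> (\<phi> t)) ` {g x..g y}" by (intro image_cong refl) (use r(3) gxy in auto)
    also have "... = \<gamma> ` {\<phi> (g x)..\<phi> (g y)}" using im[OF P(1,6) gxy] by (metis image_image)
    also have "... = \<gamma> ` {x..y}" using g[of x] g[of y] xy by simp
    finally show "\<sigma> ` {\<psi> (g x)..\<psi> (g y)} = \<gamma> ` {x..y}" .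
  qed
qed

section \<open>Separation of arcs\<close>

context emt
begin

text \<open>Together with \<open>misses\<close> this forms a pair of disjoint open conditions, by
  which distinct arcs are separated. The threshold 1/2 leaves room on both sides for bumps with
  values in \<open>[0,1]\<close>.\<close>

definition visits :: "nat => (nat => 'a => real) => (real => 'a) set" where
  "visits n u = {\<gamma> \<in> curves. \<exists>s. partition_of 0 1 n s \<and> (\<forall>i\<le>n. 1/2 < u i (\<gamma> (s i)))}"

text \<open>A finite certificate against an ordered visit: every monotone assignment of the indices
  to cells of a partition meets a cell on which the corresponding function stays small. Finitely
  many assignments and compact cells make this an open condition.\<close>

definition misses :: "nat => (nat => 'a => real) => (real => 'a) set" where
  "misses n u = {\<gamma> \<in> curves. \<exists>N p. partition_of 0 1 N p \<and> p 0 = 0 \<and> p N = 1 \<and>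
     (\<forall>j. mono_on {..n} j \<and> j ` {..n} \<subseteq> {..<N} \<longrightarrow> (\<exists>i\<le>n. \<gamma> ` {p (j i)..p (Suc (j i))} \<subseteq> {x. u i x < 1/2}))}"

lemma partition_of_lift:
  assumes "partition_of 0 1 n s" "\<theta> 0 = 0" "\<theta> 1 = 1" "\<And>x y. 0 \<le> x ==> x \<le> y ==> y \<le> 1 ==> \<theta> x \<le> \<theta> y"
  shows "partition_of 0 1 n (\<lambda>i. \<theta> (s i))"
proof (rule partition_ofI)
  show "\<theta> (s i) \<le> \<theta> (s (Suc i))" if "i < n" for i
    using partition_of_mem[OF assms(1), of i] partition_of_mem[OF assms(1), of "Suc i"] partition_of_mono[OF assms(1), of i "Suc i"] that
    by (intro assms(4)) auto
  show "0 \<le> \<theta> (s 0)" using assms(4)[of 0 "s 0"] partition_of_mem[OF assms(1), of 0] assms(2) by simp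
  show "\<theta> (s n) \<le> 1" using assms(4)[of "s n" 1] partition_of_mem[OF assms(1), of n] assms(3) by simp
qed

lemma openin_visits:
  assumes u: "\<And>i. u i \<in> Lip_b d" shows "openin (RA_topology d) {Z \<in> RA d. rep Z \<in> visits n u}"
proof (rule openin_saturated)
  show "openin compact_open_topology (visits n u)"
  proof (rule openin_if_eventually)
    show "visits n u \<subseteq> topspace compact_open_topology" unfolding topspace_compact_open_topology visits_def by auto
    fix \<gamma>0 assume g0: "\<gamma>0 \<in> visits n u"
    then obtain s where s: "\<gamma>0 \<in> curves" "partition_of 0 1 n s" "\<forall>i\<le>n. 1/2 < u i (\<gamma>0 (s i))" unfolding visits_def by auto
    have "eventually (\<lambda>\<gamma>. \<forall>i\<in>{..n}. \<gamma> ` {s i} \<subseteq> {x. 1/2 < u i x}) (nhdsin compact_open_topology \<gamma>0)"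
    proof (rule eventually_ball_finite, safe)
      fix i assume i: "i \<le> n"
      have "open {x. 1/2 < u i x}" by (intro open_Collect_less Lip_b_continuous[OF u] continuous_intros)
      then show "eventually (\<lambda>\<gamma>. \<gamma> ` {s i} \<subseteq> {x. 1/2 < u i x}) (nhdsin compact_open_topology \<gamma>0)"
        using s i partition_of_mem[OF s(2) i] by (intro eventually_compact_open) auto
    qed
    then show "eventually (\<lambda>\<gamma>. \<gamma> \<in> visits n u) (nhdsin compact_open_topology \<gamma>0)"
      using eventually_curves[OF s(1)]
    proof eventually_elim
      case (elim \<gamma>)
      then show ?case using s(2) unfolding visits_def by (intro CollectI conjI exI[of _ s]) auto
    qed
  qed
  fix \<gamma> \<sigma> assume g: "\<gamma> \<in> visits n u" and rel: "(\<gamma>, \<sigma>) \<in> arc_rel"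
  then obtain s where s: "partition_of 0 1 n s" "\<forall>i\<le>n. 1/2 < u i (\<gamma> (s i))" unfolding visits_def by auto
  obtain \<theta> where th: "\<theta> 0 = 0" "\<theta> 1 = (1::real)" "\<And>x y. 0 \<le> x ==> x \<le> y ==> y \<le> 1 ==> \<theta> x \<le> \<theta> y"
    "\<And>x y. 0 \<le> x ==> x \<le> y ==> y \<le> 1 ==> \<sigma> ` {\<theta> x..\<theta> y} = \<gamma> ` {x..y}" using arc_rel_lift[OF rel] by metis
  have "\<sigma> (\<theta> (s i)) = \<gamma> (s i)" if "i \<le> n" for i using th(4)[of "s i" "s i"] partition_of_mem[OF s(1) that] by auto
  then show "\<sigma> \<in> visits n u"
    using rel s partition_of_lift[OF s(1) th(1-3)] unfolding visits_def arc_rel_def by fastforce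
qed

lemma openin_misses:
  assumes u: "\<And>i. u i \<in> Lip_b d" shows "openin (RA_topology d) {Z \<in> RA d. rep Z \<in> misses n u}"
proof (rule openin_saturated)
  show "openin compact_open_topology (misses n u)"
  proof (rule openin_if_eventually)
    show "misses n u \<subseteq> topspace compact_open_topology" unfolding topspace_compact_open_topology misses_def by auto
    fix \<gamma>0 assume g0: "\<gamma>0 \<in> misses n u"
    then obtain N p where p: "\<gamma>0 \<in> curves" "partition_of 0 1 N p" "p 0 = 0" "p N = 1"
      "\<And>j. mono_on {..n} j ==> j ` {..n} \<subseteq> {..<N} ==> \<exists>i\<le>n. \<gamma>0 ` {p (j i)..p (Suc (j i))} \<subseteq> {x. u i x < 1/2}"
      unfolding misses_def by auto
    \<comment> \<open>Restricting assignments to \<open>{..n}\<close> leaves finitely many of them,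
      so finitely many open conditions are intersected.\<close>
    define J where "J = {j \<in> {..n} \<rightarrow>\<^sub>E {..<N}. mono_on {..n} j}"
    have finJ: "finite J" unfolding J_def by (rule finite_subset[of _ "{..n} \<rightarrow>\<^sub>E {..<N}"]) (auto intro!: finite_PiE)
    have "eventually (\<lambda>\<gamma>. \<forall>j\<in>J. \<exists>i\<le>n. \<gamma> ` {p (j i)..p (Suc (j i))} \<subseteq> {x. u i x < 1/2}) (nhdsin compact_open_topology \<gamma>0)"
    proof (rule eventually_ball_finite[OF finJ], safe)
      fix j assume j: "j \<in> J"
      then have jm: "mono_on {..n} j" "j ` {..n} \<subseteq> {..<N}" unfolding J_def by auto
      obtain i where i: "i \<le> n" "\<gamma>0 ` {p (j i)..p (Suc (j i))} \<subseteq> {x. u i x < 1/2}" using p(5)[OF jm] by auto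
      have "open {x. u i x < 1/2}" by (intro open_Collect_less Lip_b_continuous[OF u] continuous_intros)
      moreover have "j i < N" using jm i by auto
      then have "{p (j i)..p (Suc (j i))} \<subseteq> {0..1}"
        using partition_of_mem[OF p(2), of "j i"] partition_of_mem[OF p(2), of "Suc (j i)"] by auto
      ultimately have "eventually (\<lambda>\<gamma>. \<gamma> ` {p (j i)..p (Suc (j i))} \<subseteq> {x. u i x < 1/2}) (nhdsin compact_open_topology \<gamma>0)"
        using i p(1) by (intro eventually_compact_open) auto
      then show "eventually (\<lambda>\<gamma>. \<exists>i\<le>n. \<gamma> ` {p (j i)..p (Suc (j i))} \<subseteq> {x. u i x < 1/2}) (nhdsin compact_open_topology \<gamma>0)"
        by eventually_elim (use i in auto)
    qed
    with eventually_curves[OF p(1)] show "eventually (\<lambda>\<gamma>. \<gamma> \<in> misses n u) (nhdsin compact_open_topology \<gamma>0)"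
    proof eventually_elim
      case (elim \<gamma>)
      have "\<exists>i\<le>n. \<gamma> ` {p (j i)..p (Suc (j i))} \<subseteq> {x. u i x < 1/2}" if j: "mono_on {..n} j" "j ` {..n} \<subseteq> {..<N}" for j
      proof -
        have "restrict j {..n} \<in> J" using j unfolding J_def mono_on_def by auto
        then obtain i where "i \<le> n" "\<gamma> ` {p (restrict j {..n} i)..p (Suc (restrict j {..n} i))} \<subseteq> {x. u i x < 1/2}" using elim(2) by blast
        then show ?thesis by auto
      qed
      then show ?case using elim(1) p unfolding misses_def by blast
    qed
  qed
  fix \<gamma> \<sigma> assume g: "\<gamma> \<in> misses n u" and rel: "(\<gamma>, \<sigma>) \<in> arc_rel"
  then obtain N p where p: "partition_of 0 1 N p" "p 0 = 0" "p N = 1"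
      "\<And>j. mono_on {..n} j ==> j ` {..n} \<subseteq> {..<N} ==> \<exists>i\<le>n. \<gamma> ` {p (j i)..p (Suc (j i))} \<subseteq> {x. u i x < 1/2}"
      unfolding misses_def by auto
  obtain \<theta> where th: "\<theta> 0 = 0" "\<theta> 1 = (1::real)" "\<And>x y. 0 \<le> x ==> x \<le> y ==> y \<le> 1 ==> \<theta> x \<le> \<theta> y"
    "\<And>x y. 0 \<le> x ==> x \<le> y ==> y \<le> 1 ==> \<sigma> ` {\<theta> x..\<theta> y} = \<gamma> ` {x..y}" using arc_rel_lift[OF rel] by metis
  have im: "\<sigma> ` {\<theta> (p k)..\<theta> (p (Suc k))} = \<gamma> ` {p k..p (Suc k)}" if "k < N" for k
    using that partition_of_mem[OF p(1), of k] partition_of_mem[OF p(1), of "Suc k"] partition_of_mono[OF p(1), of k "Suc k"] by (intro th(4)) auto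
  have "\<exists>i\<le>n. \<sigma> ` {\<theta> (p (j i))..\<theta> (p (Suc (j i)))} \<subseteq> {x. u i x < 1/2}" if j: "mono_on {..n} j" "j ` {..n} \<subseteq> {..<N}" for j
  proof -
    obtain i where i: "i \<le> n" "\<gamma> ` {p (j i)..p (Suc (j i))} \<subseteq> {x. u i x < 1/2}" using p(4)[OF j] by auto
    then have "j i < N" using j by auto
    then have "\<sigma> ` {\<theta> (p (j i))..\<theta> (p (Suc (j i)))} \<subseteq> {x. u i x < 1/2}" using i(2) im by metis
    then show ?thesis using i(1) by (intro exI[of _ i] conjI)
  qed
  moreover have "\<sigma> \<in> curves" using rel unfolding arc_rel_def by auto
  ultimately show "\<sigma> \<in> misses n u"
    using partition_of_lift[OF p(1) th(1-3)] p(2,3) th(1,2) unfolding misses_def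
    by (intro CollectI conjI exI[of _ N] exI[of _ "\<lambda>k. \<theta> (p k)"]) auto
qed

text \<open>Sending \<open>i\<close> to the first cell whose right end reaches the time
  \<open>s i\<close> is a monotone assignment, and the certificate contradicts the visit at one of
  these cells.\<close>

lemma visits_misses_disjoint: "visits n u \<inter> misses n u = {}"
proof safe
  fix \<gamma> assume "\<gamma> \<in> visits n u" "\<gamma> \<in> misses n u"
  then obtain s N p where s: "partition_of 0 1 n s" "\<forall>i\<le>n. 1/2 < u i (\<gamma> (s i))"
    and p: "partition_of 0 1 N p" "p 0 = 0" "p N = 1"
      "\<And>j. mono_on {..n} j ==> j ` {..n} \<subseteq> {..<N} ==> \<exists>i\<le>n. \<gamma> ` {p (j i)..p (Suc (j i))} \<subseteq> {x. u i x < 1/2}"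
    unfolding visits_def misses_def by blast
  have N: "N > 0" using p by (cases N) auto
  define j where "j i = (LEAST k. s i \<le> p (Suc k))" for i
  have ex: "s i \<le> p (Suc (N - 1))" if "i \<le> n" for i using partition_of_mem[OF s(1) that] p N by simp
  have j1: "s i \<le> p (Suc (j i))" if "i \<le> n" for i unfolding j_def by (rule LeastI[of _ "N - 1"]) (rule ex[OF that])
  have j2: "j i \<le> N - 1" if "i \<le> n" for i unfolding j_def by (rule Least_le) (rule ex[OF that])
  have j3: "p (j i) \<le> s i" if "i \<le> n" for i
  proof (cases "j i")
    case 0
    then show ?thesis using p(2) partition_of_mem[OF s(1) that] by simp
  next
    case (Suc k)
    then have "\<not> s i \<le> p (Suc k)" using not_less_Least[of k "\<lambda>k. s i \<le> p (Suc k)"] unfolding j_def by simp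
    then show ?thesis using Suc by simp
  qed
  have "mono_on {..n} j" unfolding mono_on_def
  proof (intro allI impI)
    fix a b assume "a \<in> {..n} \<and> b \<in> {..n} \<and> a \<le> b"
    then have ab: "a \<le> n" "b \<le> n" "a \<le> b" by auto
    have "s a \<le> p (Suc (j b))" using partition_of_mono[OF s(1) ab(3,2)] j1[OF ab(2)] by simp
    then show "j a \<le> j b" unfolding j_def[of a] by (rule Least_le)
  qed
  moreover have "j ` {..n} \<subseteq> {..<N}" using j2 N by fastforce
  ultimately obtain i where i: "i \<le> n" "\<gamma> ` {p (j i)..p (Suc (j i))} \<subseteq> {x. u i x < 1/2}" using p(4) by blast
  then have "u i (\<gamma> (s i)) < 1/2" using j1 j3 by (auto simp: image_subset_iff)
  moreover have "1/2 < u i (\<gamma> (s i))" using s(2) i(1) by blast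
  ultimately show "\<gamma> \<in> {}" by linarith
qed

text \<open>Along the arc each \<open>u i\<close> is Lipschitz with constant at most
  \<open>K\<close>; on a grid of mesh below \<open>1 / (2 * K)\<close> a zero at the left end of a
  cell keeps the function under 1/2 on the whole cell. The left ends of the assigned cells are
  ordered times, so \<open>z\<close> applies to them.\<close>

lemma misses_if_not_visits:
  assumes G: "Z \<in> RA d" and u: "\<And>i. u i \<in> Lip_b d"
    and z: "\<And>s. partition_of 0 1 n s ==> \<exists>i\<le>n. u i (rep Z (s i)) = 0" shows "rep Z \<in> misses n u"
proof -
  define K where "K = (\<Sum>i\<le>n. lipc (u i) * rlen Z)"
  have Ki: "lipc (u i) * rlen Z \<le> K" if "i \<le> n" for i
    unfolding K_def using that lipc_pos[OF u] by (intro member_le_sum mult_nonneg_nonneg rlen_nonneg) (auto intro: less_imp_le)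
  obtain N where N: "2 * K < real N" "0 < N" using reals_Archimedean2[of "max (2 * K) 0"]
    by (metis max_less_iff_conj of_nat_0_less_iff)
  define p where "p k = real k / real N" for k
  have pp: "partition_of 0 1 N p" by (rule partition_ofI) (use N in \<open>auto simp: p_def divide_right_mono\<close>)
  have "\<exists>i\<le>n. rep Z ` {p (j i)..p (Suc (j i))} \<subseteq> {x. u i x < 1/2}" if j: "mono_on {..n} j" "j ` {..n} \<subseteq> {..<N}" for j
  proof -
    have "partition_of 0 1 n (\<lambda>i. p (j i))" unfolding partition_of_def mono_on_def
    proof (intro conjI allI impI image_subsetI)
      fix r s assume "r \<in> {..n} \<and> s \<in> {..n} \<and> r \<le> s"
      then have "j r \<le> j s" "j s \<le> N" using j unfolding mono_on_def by auto
      then show "p (j r) \<le> p (j s)" using partition_of_mono[OF pp] by simp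
    next
      fix i assume "i \<in> {..n}"
      then have "j i \<le> N" using j by auto
      then show "p (j i) \<in> {0..1}" using partition_of_mem[OF pp] by auto
    qed
    then obtain i where i: "i \<le> n" "u i (rep Z (p (j i))) = 0" using z by blast
    then have jN: "j i < N" using j by auto
    have "u i (rep Z t) < 1/2" if t: "p (j i) \<le> t" "t \<le> p (Suc (j i))" for t
    proof -
      have b: "0 \<le> p (j i)" "p (Suc (j i)) \<le> 1" using jN partition_of_mem[OF pp, of "j i"] partition_of_mem[OF pp, of "Suc (j i)"] by auto
      have "t - p (j i) \<le> 1 / real N" using t unfolding p_def by (simp add: add_divide_distrib)
      moreover have K0: "0 \<le> K" using Ki[of 0] lipc_pos[OF u, of 0] by (meson le0 less_imp_le mult_nonneg_nonneg order_trans rlen_nonneg)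
      moreover have "\<bar>u i (crep Z t) - u i (crep Z (p (j i)))\<bar> \<le> lipc (u i) * rlen Z * (t - p (j i))"
        using lipschitz_with_crep[OF lipc[OF u] G, of "p (j i)" t i] t b by simp
      moreover have "... \<le> K * (t - p (j i))" using Ki[OF i(1)] t by (intro mult_right_mono) auto
      moreover have "K * (t - p (j i)) \<le> K * (1 / real N)" using calculation by (intro mult_left_mono) auto
      moreover have "K * (1 / real N) < 1/2" using N by (simp add: field_simps)
      ultimately have "\<bar>u i (crep Z t) - u i (crep Z (p (j i)))\<bar> < 1/2" by linarith
      then show ?thesis using i(2) t b by (simp add: crep_eq)
    qed
    then show ?thesis using i(1) by auto
  qed
  then show ?thesis unfolding misses_def using pp rep_curve(1)[OF G] N
    by (intro CollectI conjI exI[of _ N] exI[of _ p]) (auto simp: p_def)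
qed

text \<open>The failure of the Hausdorff property for a pair; its consequences are collected until
  the two arcs turn out to be equal.\<close>

definition inseparable :: "'a arc => 'a arc => bool" where
  "inseparable Z1 Z2 \<longleftrightarrow> \<not> (\<exists>U V. openin (RA_topology d) U \<and> openin (RA_topology d) V \<and> Z1 \<in> U \<and> Z2 \<in> V \<and> disjnt U V)"

text \<open>Bumps at the visited points vanish outside the sets \<open>X i\<close>. If every ordered
  tuple of times on \<open>Z2\<close> met a zero, \<open>visits\<close> and \<open>misses\<close>
  would separate the two arcs.\<close>

lemma inseparable_visits:
  assumes G: "Z1 \<in> RA d" "Z2 \<in> RA d" and ins: "inseparable Z1 Z2"
    and s: "partition_of 0 1 n s" and X: "\<And>i. i \<le> n ==> open (X i) \<and> rep Z1 (s i) \<in> X i"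
  obtains s' where "partition_of 0 1 n s'" "\<And>i. i \<le> n ==> rep Z2 (s' i) \<in> X i"
proof -
  have "\<exists>u\<in>Lip_b d. i \<le> n \<longrightarrow> u (rep Z1 (s i)) = 1 \<and> (\<forall>y. y \<notin> X i \<longrightarrow> u y = 0)" for i
  proof (cases "i \<le> n")
    case True
    then show ?thesis using ex_bump[of "X i" "rep Z1 (s i)"] X by metis
  qed (use Lip_b_const in auto)
  then obtain u where u: "\<And>i. u i \<in> Lip_b d" "\<And>i. i \<le> n ==> u i (rep Z1 (s i)) = 1" "\<And>i y. i \<le> n ==> y \<notin> X i ==> u i y = 0"
    by metis
  have "rep Z1 \<in> visits n u" unfolding visits_def using rep_curve(1)[OF G(1)] s u(2) by auto
  then have "rep Z2 \<notin> misses n u"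
    using ins G openin_visits[where u = u and n = n, OF u(1)] openin_misses[where u = u and n = n, OF u(1)] visits_misses_disjoint[of n u]
    unfolding inseparable_def disjnt_def by blast
  then obtain s' where s': "partition_of 0 1 n s'" "\<And>i. i \<le> n ==> u i (rep Z2 (s' i)) \<noteq> 0"
    using misses_if_not_visits[where u = u and n = n, OF G(2) u(1)] by blast
  then show ?thesis using that u(3) by metis
qed

lemma eventually_coordinate:
  fixes z :: "nat => 'a"
  assumes "open W" "z j \<in> W" shows "eventually (\<lambda>x. x j \<in> W) (nhds z)"
proof -
  have "open ((\<lambda>x :: nat => 'a. x j) -` W)"
    by (rule open_vimage[OF assms(1)]) (rule continuous_on_product_coordinates)
  then show ?thesis using assms(2) unfolding eventually_nhds by (intro exI[of _ "(\<lambda>x. x j) -` W"]) auto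
qed

text \<open>The alternative \<open>c = 0\<close> covers the trivial bound, which a vanishing sum
  does not exceed strictly. The shift \<open>k\<close> selects a block of coordinates.\<close>

lemma sum_d_lsc:
  fixes z :: "nat => 'a"
  assumes c: "c = 0 \<or> c < (\<Sum>i<n. d (z (i + k)) (z (Suc i + k)))"
  shows "eventually (\<lambda>x. c = 0 \<or> c < (\<Sum>i<n. d (x (i + k)) (x (Suc i + k)))) (nhds z)"
proof (cases "c = 0")
  case False
  then have "c < (\<Sum>i<n. d (z (i + k)) (z (Suc i + k)))" using c by simp
  then have "eventually (\<lambda>x. c < (\<Sum>i<n. d (x (i + k)) (x (Suc i + k)))) (nhds z)"
  proof (rule sum_lsc[where f = "\<lambda>i x. d (x (i + k)) (x (Suc i + k))" and p = z, rotated 2])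
    fix i c assume "c < d (z (i + k)) (z (Suc i + k))"
    then obtain U V where UV: "open U" "open V" "z (i + k) \<in> U" "z (Suc i + k) \<in> V" "\<And>x y. x \<in> U ==> y \<in> V ==> c < d x y"
      using d_lsc by metis
    show "eventually (\<lambda>x. c < d (x (i + k)) (x (Suc i + k))) (nhds z)"
      using eventually_coordinate[where z = z and j = "i + k", OF UV(1,3)] eventually_coordinate[where z = z and j = "Suc i + k", OF UV(2,4)]
      by eventually_elim (rule UV(5))
  qed simp
  then show ?thesis by eventually_elim simp
qed simp

lemma rep_lipschitz:
  assumes "\<phi> \<in> Lip_b d" "Z \<in> RA d" "0 \<le> a" "a \<le> 1" "0 \<le> b" "b \<le> 1"
  shows "\<bar>\<phi> (rep Z a) - \<phi> (rep Z b)\<bar> \<le> lipc \<phi> * \<bar>rlen Z * a - rlen Z * b\<bar>"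
proof -
  have "\<bar>\<phi> (rep Z s) - \<phi> (rep Z t)\<bar> \<le> lipc \<phi> * (rlen Z * (s - t))" if "0 \<le> t" "t \<le> s" "s \<le> 1" for s t
    using lipschitz_with_crep[OF lipc[OF assms(1)] assms(2) that(2)] that by (simp add: crep_eq mult.assoc)
  from this[of a b] this[of b a] show ?thesis using assms(3-)
    by (cases "a \<le> b") (auto simp: right_diff_distrib[symmetric] abs_mult abs_minus_commute)
qed

text \<open>A partition of \<open>[0,t]\<close>, the time \<open>t\<close> and a partition of
  \<open>[t,1]\<close> form one tuple of points. Both sums are lower semicontinuous in the tuple, so
  a product neighbourhood of it keeps the bounds, and the other arc passes through this
  neighbourhood in order.\<close>

lemma inseparable_transfer:
  assumes G: "Z1 \<in> RA d" "Z2 \<in> RA d" and ins: "inseparable Z1 Z2" and t: "0 \<le> t" "t \<le> 1"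
    and c: "c0 = 0 \<or> c0 < variation d (rep Z1) 0 t" "c1 = 0 \<or> c1 < variation d (rep Z1) t 1"
    and U: "open U" "rep Z1 t \<in> U"
  obtains t' where "0 \<le> t'" "t' \<le> 1" "c0 \<le> variation d (rep Z2) 0 t'" "c1 \<le> variation d (rep Z2) t' 1" "rep Z2 t' \<in> U"
proof -
  let ?R = "rep Z1" and ?S = "rep Z2"
  have triv: "partition_of a b 0 (\<lambda>_. a)" if "a \<le> b" for a b :: real by (rule partition_ofI) (use that in auto)
  obtain n s where s: "partition_of 0 t n s" "c0 = 0 \<or> c0 < gsum d UNIV ?R n s"
    using c(1) triv[OF t(1)] unfolding variation_eq_gvar less_gvar_iff by metis
  obtain l r where r: "partition_of t 1 l r" "c1 = 0 \<or> c1 < gsum d UNIV ?R l r"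
    using c(2) triv[OF t(2)] unfolding variation_eq_gvar less_gvar_iff by metis
  \<comment> \<open>Index \<open>Suc n\<close> carries the time \<open>t\<close> itself; the second
    partition starts at index \<open>n + 2\<close>.\<close>
  define w where "w i = (if i \<le> n then s i else if i = Suc n then t else r (i - (n + 2)))" for i
  define M where "M = n + 2 + l"
  have w: "partition_of 0 1 M w"
  proof (rule partition_ofI)
    fix i assume i: "i < M"
    consider "i < n" | "i = n" | "i = Suc n" | "i \<ge> n + 2" by linarith
    then show "w i \<le> w (Suc i)"
    proof cases
      case 1
      then show ?thesis using partition_of_mono[OF s(1), of i "Suc i"] by (simp add: w_def)
    next
      case 2
      then show ?thesis using partition_of_mem[OF s(1), of n] by (simp add: w_def)
    next
      case 3
      then show ?thesis using partition_of_mem[OF r(1), of 0] by (simp add: w_def)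
    next
      case 4
      then have "Suc i - (n + 2) = Suc (i - (n + 2))" by simp
      then show ?thesis using 4 i partition_of_mono[OF r(1), of "i - (n + 2)" "Suc (i - (n + 2))"] by (simp add: w_def M_def)
    qed
  next
    show "0 \<le> w 0" "w M \<le> 1" using partition_of_mem[OF s(1), of 0] partition_of_mem[OF r(1), of l] by (auto simp: w_def M_def)
  qed
  define z0 where "z0 i = ?R (w i)" for i
  have "gsum d UNIV ?R n s = (\<Sum>i<n. d (z0 (i + 0)) (z0 (Suc i + 0)))"
    unfolding gsum_def z0_def by (intro sum.cong) (auto simp: w_def)
  then have e0: "eventually (\<lambda>x. c0 = 0 \<or> c0 < (\<Sum>i<n. d (x (i + 0)) (x (Suc i + 0)))) (nhds z0)"
    using s(2) by (intro sum_d_lsc) simp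
  have wr: "w (i + (n + 2)) = r i" for i by (simp add: w_def)
  have "gsum d UNIV ?R l r = (\<Sum>i<l. d (z0 (i + (n + 2))) (z0 (Suc i + (n + 2))))"
    unfolding gsum_def z0_def wr add_Suc by (intro sum.cong) (auto simp: w_def)
  then have e1: "eventually (\<lambda>x. c1 = 0 \<or> c1 < (\<Sum>i<l. d (x (i + (n + 2))) (x (Suc i + (n + 2))))) (nhds z0)"
    using r(2) by (intro sum_d_lsc) simp
  obtain Q where Q: "open Q" "z0 \<in> Q" "\<And>x. x \<in> Q ==> (c0 = 0 \<or> c0 < (\<Sum>i<n. d (x (i + 0)) (x (Suc i + 0)))) \<and> (c1 = 0 \<or> c1 < (\<Sum>i<l. d (x (i + (n + 2))) (x (Suc i + (n + 2)))))"
    using eventually_conj[OF e0 e1] unfolding eventually_nhds by blast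
  obtain X where X: "z0 \<in> (\<Pi>\<^sub>E i\<in>UNIV. X i)" "\<And>i. openin euclidean (X i)" "(\<Pi>\<^sub>E i\<in>UNIV. X i) \<subseteq> Q"
    using product_topology_open_contains_basis[of "\<lambda>_. euclidean" UNIV Q z0] Q unfolding open_fun_def by auto
  \<comment> \<open>The set \<open>U\<close> constrains only the coordinate that belongs to the time
    \<open>t\<close>.\<close>
  define X' where "X' i = (if i = Suc n then X i \<inter> U else X i)" for i
  have zX: "z0 i \<in> X i" for i using X(1) by auto
  have "z0 (Suc n) \<in> U" using U(2) by (simp add: z0_def w_def)
  then have "open (X' i) \<and> ?R (w i) \<in> X' i" for i
    using X(2)[of i] zX[of i] U(1) unfolding X'_def z0_def by auto
  then obtain s' where s': "partition_of 0 1 M s'" "\<And>i. i \<le> M ==> ?S (s' i) \<in> X' i"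
    using inseparable_visits[OF G ins w, of X'] by blast
  define x where "x i = (if i \<le> M then ?S (s' i) else z0 i)" for i
  have "x i \<in> X i" for i
  proof (cases "i \<le> M")
    case True
    then show ?thesis using s'(2)[OF True] unfolding x_def X'_def by (simp split: if_splits)
  qed (use zX in \<open>simp add: x_def\<close>)
  then have "x \<in> (\<Pi>\<^sub>E i\<in>UNIV. X i)" by auto
  then have "x \<in> Q" using X(3) by blast
  note xO = Q(3)[OF this]
  have t': "0 \<le> s' (Suc n)" "s' (Suc n) \<le> 1" using partition_of_mem[OF s'(1), of "Suc n"] by (auto simp: M_def)
  have p0: "partition_of 0 (s' (Suc n)) n s'"
    by (rule partition_ofI) (use partition_of_mono[OF s'(1)] partition_of_mem[OF s'(1), of 0] in \<open>auto simp: M_def\<close>)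
  have "c0 \<le> gsum d UNIV ?S n s'" using xO unfolding gsum_def x_def M_def by (auto intro: less_imp_le)
  then have a0: "c0 \<le> variation d ?S 0 (s' (Suc n))" using gvar_ge[OF p0, of d UNIV ?S] unfolding variation_eq_gvar by simp
  have p1: "partition_of (s' (Suc n)) 1 l (\<lambda>i. s' (i + (n + 2)))"
    by (rule partition_ofI) (use partition_of_mono[OF s'(1)] partition_of_mem[OF s'(1), of M] in \<open>auto simp: M_def add.commute\<close>)
  have "c1 \<le> gsum d UNIV ?S l (\<lambda>i. s' (i + (n + 2)))" using xO unfolding gsum_def x_def M_def by (auto intro: less_imp_le)
  then have a1: "c1 \<le> variation d ?S (s' (Suc n)) 1" using gvar_ge[OF p1, of d UNIV ?S] unfolding variation_eq_gvar by simp
  have "?S (s' (Suc n)) \<in> U" using s'(2)[of "Suc n"] unfolding X'_def M_def by auto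
  then show ?thesis using that t' a0 a1 by blast
qed

lemma variation_rep:
  assumes "Z \<in> RA d" "0 \<le> s" "s \<le> t" "t \<le> 1"
  shows "variation d (rep Z) s t = ennreal (rlen Z * (t - s))"
  using rep_in(2)[OF assms(1)] assms(2-) unfolding unit_speed_def by blast

lemma ennreal_zero_or_less: "e > 0 ==> ennreal (x - e) = 0 \<or> ennreal (x - e) < ennreal x"
  by (cases "x - e \<le> 0") (auto simp: ennreal_neg ennreal_less_iff)

lemma ennreal_minus_le: "ennreal (x - e) \<le> ennreal y ==> 0 \<le> y ==> x - e \<le> y"
  by (cases "x - e \<le> 0") (auto simp: ennreal_le_iff)

text \<open>The transfer at \<open>t = 1\<close>; the loss \<open>e\<close> is needed because the
  transferred bound has to be strict.\<close>

lemma inseparable_rlen: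
  assumes G: "Z1 \<in> RA d" "Z2 \<in> RA d" and ins: "inseparable Z1 Z2" shows "rlen Z1 \<le> rlen Z2"
proof (rule field_le_epsilon)
  fix e :: real assume e: "e > 0"
  obtain t' where t': "0 \<le> t'" "t' \<le> 1" "ennreal (rlen Z1 - e) \<le> variation d (rep Z2) 0 t'"
    using inseparable_transfer[OF G ins, of 1 "ennreal (rlen Z1 - e)" 0 UNIV] variation_rep[OF G(1), of 0 1] ennreal_zero_or_less[OF e] by auto
  have "rlen Z1 - e \<le> rlen Z2 * t'"
    using t' variation_rep[OF G(2), of 0 t'] by (intro ennreal_minus_le) auto
  also have "... \<le> rlen Z2 * 1" using t' by (intro mult_left_mono) auto
  finally show "rlen Z1 \<le> rlen Z2 + e" by simp
qed

text \<open>Inseparable arcs have equal length. The transferred point near \<open>rep Z1 t\<close>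
  has almost the prescribed length before and after it, hence lies on \<open>Z2\<close> close to the
  time \<open>t\<close> when measured in length, and the points at time \<open>t\<close> cannot
  differ. Consequently compact sets of arcs are closed, as the Radon arguments require.\<close>

lemma Hausdorff_RA: "Hausdorff_space (RA_topology d)" unfolding Hausdorff_space_def topspace_RA
proof (intro allI impI)
  fix Z1 Z2 assume "Z1 \<in> RA d \<and> Z2 \<in> RA d \<and> Z1 \<noteq> Z2"
  then have G: "Z1 \<in> RA d" "Z2 \<in> RA d" and ne: "Z1 \<noteq> Z2" by auto
  show "\<exists>U V. openin (RA_topology d) U \<and> openin (RA_topology d) V \<and> Z1 \<in> U \<and> Z2 \<in> V \<and> disjnt U V"
  proof (rule ccontr)
    assume "\<not> ?thesis"
    then have ins: "inseparable Z1 Z2" unfolding inseparable_def .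
    then have ins': "inseparable Z2 Z1" unfolding inseparable_def by (metis disjnt_sym)
    define L where "L = rlen Z1"
    have L: "rlen Z1 = L" "rlen Z2 = L" "L \<ge> 0"
      using inseparable_rlen[OF G ins] inseparable_rlen[OF G(2,1) ins'] by (auto simp: L_def)
    have "rep Z1 t = rep Z2 t" if t: "0 \<le> t" "t \<le> 1" for t
    proof (rule ccontr)
      assume neq: "rep Z1 t \<noteq> rep Z2 t"
      obtain u where u: "u \<in> Lip_b d" "u (rep Z1 t) = 1" "u (rep Z2 t) = 0"
        using ex_bump[OF open_Compl[OF closed_singleton], of "rep Z1 t" "rep Z2 t"] neq by (metis Compl_iff singletonD singletonI)
      define C where "C = lipc u"
      have C: "C > 0" using lipc_pos[OF u(1)] by (simp add: C_def)
      \<comment> \<open>Between \<open>t\<close> and \<open>t'\<close> the bump changes by at most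
        \<open>C * e = 1/4\<close>, which is less than the gap between 0 and 1/2.\<close>
      define e where "e = 1 / (4 * C)"
      have e: "e > 0" using C by (simp add: e_def)
      have oU: "open {x. 1/2 < u x}" by (intro open_Collect_less Lip_b_continuous[OF u(1)] continuous_intros)
      obtain t' where t': "0 \<le> t'" "t' \<le> 1" "ennreal (L * t - e) \<le> variation d (rep Z2) 0 t'" "ennreal (L * (1 - t) - e) \<le> variation d (rep Z2) t' 1"
        "1/2 < u (rep Z2 t')"
        using inseparable_transfer[OF G ins t, of "ennreal (L * t - e)" "ennreal (L * (1 - t) - e)" "{x. 1/2 < u x}"] oU u
          variation_rep[OF G(1), of 0 t] variation_rep[OF G(1), of t 1] ennreal_zero_or_less[OF e] t L by auto
      have "L * t - e \<le> L * t'" "L * (1 - t) - e \<le> L * (1 - t')"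
        using t' variation_rep[OF G(2), of 0 t'] variation_rep[OF G(2), of t' 1] L by (auto intro!: ennreal_minus_le)
      then have "\<bar>L * t' - L * t\<bar> \<le> e" by (auto simp: algebra_simps abs_le_iff)
      have "\<bar>u (rep Z2 t') - u (rep Z2 t)\<bar> \<le> C * \<bar>L * t' - L * t\<bar>"
        using rep_lipschitz[OF u(1) G(2) t'(1,2) t] L by (simp add: C_def)
      also have "... \<le> C * e" using \<open>\<bar>L * t' - L * t\<bar> \<le> e\<close> C by simp
      also have "... = 1/4" using C by (simp add: e_def)
      finally show False using t'(5) u(3) by simp
    qed
    then have "rep Z1 = rep Z2" using rep_curve(1)[OF G(1)] rep_curve(1)[OF G(2)] by (intro curves_eqI) auto
    then show False using RA_eqI[OF G] ne by blast
  qed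
qed

section \<open>Continuity of the representatives on compact sets of arcs\<close>

lemma compactin_RA_closed: "compactin (RA_topology d) K ==> closedin (RA_topology d) K"
  by (rule compactin_imp_closedin[OF Hausdorff_RA])

text \<open>Evaluation at a fixed interior time is not a condition on curves that reparametrizations
  preserve; reaching \<open>U\<close> with prescribed amounts of length on both sides is. Once the
  total length is controlled, this locates the point at a given fraction of the length.\<close>

lemma openin_split_variation:
  assumes U: "open U"
  shows "openin (RA_topology d) {Z \<in> RA d. \<exists>a. 0 \<le> a \<and> a \<le> 1 \<and> (c0 = 0 \<or> c0 < variation d (rep Z) 0 a) \<and> (c1 = 0 \<or> c1 < variation d (rep Z) a 1) \<and> rep Z a \<in> U}"
proof -
  define S where "S = {\<gamma> \<in> curves. \<exists>a. 0 \<le> a \<and> a \<le> 1 \<and> (c0 = 0 \<or> c0 < variation d \<gamma> 0 a) \<and> (c1 = 0 \<or> c1 < variation d \<gamma> a 1) \<and> \<gamma> a \<in> U}"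
  have "openin (RA_topology d) {Z \<in> RA d. rep Z \<in> S}"
  proof (rule openin_saturated)
    show "openin compact_open_topology S"
    proof (rule openin_if_eventually)
      show "S \<subseteq> topspace compact_open_topology" unfolding topspace_compact_open_topology S_def by auto
      fix \<gamma>0 assume "\<gamma>0 \<in> S"
      then obtain a where a: "\<gamma>0 \<in> curves" "0 \<le> a" "a \<le> 1" "c0 = 0 \<or> c0 < variation d \<gamma>0 0 a" "c1 = 0 \<or> c1 < variation d \<gamma>0 a 1" "\<gamma>0 a \<in> U"
        unfolding S_def by auto
      have ev: "eventually (\<lambda>\<gamma>. c = 0 \<or> c < variation d \<gamma> x y) (nhdsin compact_open_topology \<gamma>0)"
        if c: "c = 0 \<or> c < variation d \<gamma>0 x y" and xy: "0 \<le> x" "y \<le> 1" for c x y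
      proof (cases "c = 0")
        case False
        then obtain n t where t: "partition_of x y n t" "c < gsum d UNIV \<gamma>0 n t" using c unfolding variation_eq_gvar less_gvar_iff by auto
        have t': "partition_of 0 1 n t" using t(1) xy unfolding partition_of_def by fastforce
        have "eventually (\<lambda>\<gamma>. c < gsum d UNIV \<gamma> n t) (nhdsin compact_open_topology \<gamma>0)"
          by (rule gsum_lsc[OF lower_semicts_d _ t' a(1) t(2)]) simp
        then show ?thesis by eventually_elim (use t(1) in \<open>auto simp: variation_eq_gvar less_gvar_iff\<close>)
      qed simp
      have "eventually (\<lambda>\<gamma>. \<gamma> ` {a} \<subseteq> U) (nhdsin compact_open_topology \<gamma>0)" using a U by (intro eventually_compact_open) auto
      then show "eventually (\<lambda>\<gamma>. \<gamma> \<in> S) (nhdsin compact_open_topology \<gamma>0)"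
        using ev[OF a(4) order_refl a(3)] ev[OF a(5,2) order_refl] eventually_curves[OF a(1)]
      proof eventually_elim
        case (elim \<gamma>)
        then show ?case using a(2,3) unfolding S_def by (intro CollectI conjI exI[of _ a]) auto
      qed
    qed
    fix \<gamma> \<sigma> assume g: "\<gamma> \<in> S" and rel: "(\<gamma>, \<sigma>) \<in> arc_rel"
    then obtain a where a: "\<gamma> \<in> curves" "0 \<le> a" "a \<le> 1" "c0 = 0 \<or> c0 < variation d \<gamma> 0 a" "c1 = 0 \<or> c1 < variation d \<gamma> a 1" "\<gamma> a \<in> U"
      unfolding S_def by auto
    obtain \<theta> where th: "\<theta> 0 = 0" "\<theta> 1 = (1::real)" "\<And>x y. 0 \<le> x ==> x \<le> y ==> y \<le> 1 ==> \<theta> x \<le> \<theta> y"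
      "\<And>x y. 0 \<le> x ==> x \<le> y ==> y \<le> 1 ==> \<sigma> ` {\<theta> x..\<theta> y} = \<gamma> ` {x..y}" using arc_rel_lift[OF rel] by metis
    have pt: "\<sigma> (\<theta> x) = \<gamma> x" if "0 \<le> x" "x \<le> 1" for x using th(4)[of x x] that by auto
    have vle: "variation d \<gamma> x y \<le> variation d \<sigma> (\<theta> x) (\<theta> y)" if xy: "0 \<le> x" "y \<le> 1" for x y
      unfolding variation_eq_gvar
    proof (rule gvar_le)
      fix n t assume t: "partition_of x y n t"
      have ti: "0 \<le> t i" "t i \<le> 1" "x \<le> t i" "t i \<le> y" if "i \<le> n" for i using partition_of_mem[OF t that] xy by auto
      have p: "partition_of (\<theta> x) (\<theta> y) n (\<lambda>i. \<theta> (t i))"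
        by (rule partition_ofI) (use ti partition_of_mono[OF t] xy in \<open>auto intro!: th(3)\<close>)
      have "gsum d UNIV \<gamma> n t = gsum d UNIV \<sigma> n (\<lambda>i. \<theta> (t i))"
        unfolding gsum_def using ti pt by (intro sum.cong) auto
      then show "gsum d UNIV \<gamma> n t \<le> gvar d UNIV \<sigma> (\<theta> x) (\<theta> y)" using gvar_ge[OF p] by simp
    qed
    have "0 \<le> \<theta> a" "\<theta> a \<le> 1" using th(3)[of 0 a] th(3)[of a 1] th(1,2) a by auto
    moreover have "\<sigma> (\<theta> a) \<in> U" using pt a by simp
    moreover have "c0 = 0 \<or> c0 < variation d \<sigma> 0 (\<theta> a)" "c1 = 0 \<or> c1 < variation d \<sigma> (\<theta> a) 1"
      using vle[of 0 a] vle[of a 1] th(1,2) a by (auto intro: less_le_trans)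
    moreover have "\<sigma> \<in> curves" using rel unfolding arc_rel_def by auto
    ultimately show "\<sigma> \<in> S" unfolding S_def by blast
  qed
  moreover have "{Z \<in> RA d. rep Z \<in> S} = {Z \<in> RA d. \<exists>a. 0 \<le> a \<and> a \<le> 1 \<and> (c0 = 0 \<or> c0 < variation d (rep Z) 0 a) \<and> (c1 = 0 \<or> c1 < variation d (rep Z) a 1) \<and> rep Z a \<in> U}"
    using rep_curve(1) unfolding S_def by auto
  ultimately show ?thesis by simp
qed

text \<open>On a compact set of arcs on which the length is continuous, the constant speed representative
  depends continuously on the arc.\<close>

definition good_compact :: "'a arc set => bool" where
  "good_compact K \<longleftrightarrow> compactin (RA_topology d) K \<and> (\<forall>r\<in>\<rat>. closedin (RA_topology d) {Z \<in> K. r \<le> rlen Z})"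

lemma good_compact_RA: "good_compact K ==> K \<subseteq> RA d"
  unfolding good_compact_def using compactin_subset_topspace topspace_RA by metis

text \<open>Near \<open>Z0\<close> the length on \<open>K\<close> cannot jump up, by the closed sets
  in \<open>good_compact\<close>, nor drop below what the split variation guarantees. So the point
  \<open>rep Z a\<close> in \<open>U\<close> is separated from \<open>rep Z t\<close> by a short
  piece of the arc only.\<close>

lemma good_compact_nhd:
  assumes K: "good_compact K" and G0: "Z0 \<in> K" and \<phi>: "\<phi> \<in> Lip_b d" and t: "0 \<le> t" "t \<le> 1" and e: "e > 0"
  obtains N where "openin (RA_topology d) N" "Z0 \<in> N"
    "\<And>Z. Z \<in> N ==> Z \<in> K ==> \<bar>\<phi> (rep Z t) - \<phi> (rep Z0 t)\<bar> < e \<and> rlen Z < rlen Z0 + 1"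
proof -
  have R0: "Z0 \<in> RA d" using K G0 good_compact_RA by auto
  define C where "C = lipc \<phi>"
  have C: "C > 0" using lipc_pos[OF \<phi>] by (simp add: C_def)
  \<comment> \<open>All errors in length amount to at most \<open>4 * \<epsilon>\<close>, and the
    choice gives \<open>C * (4 * \<epsilon>) \<le> e / 2\<close>.\<close>
  define \<epsilon> where "\<epsilon> = min 1 (e / (8 * (C + 1)))"
  have eps: "\<epsilon> > 0" "\<epsilon> \<le> 1" using e C by (auto simp: \<epsilon>_def)
  have "C * \<epsilon> \<le> C * (e / (8 * (C + 1)))" using C by (intro mult_left_mono) (auto simp: \<epsilon>_def)
  also have "... \<le> (C + 1) * (e / (8 * (C + 1)))" using C e by (intro mult_right_mono) auto
  also have "... = e / 8" using C by (simp add: field_simps)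
  finally have Ce: "C * \<epsilon> \<le> e / 8" .
  define L0 where "L0 = rlen Z0"
  obtain r where r: "r \<in> \<rat>" "L0 < r" "r < L0 + \<epsilon>" using Rats_dense_in_real[of L0 "L0 + \<epsilon>"] eps by auto
  define U where "U = {x. \<bar>\<phi> x - \<phi> (rep Z0 t)\<bar> < e / 4}"
  have U: "open U" unfolding U_def by (intro open_Collect_less continuous_intros Lip_b_continuous[OF \<phi>])
  define c0 c1 where "c0 = ennreal (L0 * t - \<epsilon>)" and "c1 = ennreal (L0 * (1 - t) - \<epsilon>)"
  define N1 where "N1 = {Z \<in> RA d. \<exists>a. 0 \<le> a \<and> a \<le> 1 \<and> (c0 = 0 \<or> c0 < variation d (rep Z) 0 a) \<and> (c1 = 0 \<or> c1 < variation d (rep Z) a 1) \<and> rep Z a \<in> U}"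
  define N where "N = N1 \<inter> (RA d - {Z \<in> K. r \<le> rlen Z})"
  have oN: "openin (RA_topology d) N"
    unfolding N_def N1_def using openin_split_variation[OF U] K r(1) topspace_RA[of d] unfolding good_compact_def closedin_def by (metis (no_types, lifting) openin_Int)
  have "Z0 \<in> N1" unfolding N1_def c0_def c1_def
    using R0 t variation_rep[OF R0, of 0 t] variation_rep[OF R0, of t 1] ennreal_zero_or_less[OF eps(1)] e
    by (intro CollectI conjI exI[of _ t]) (auto simp: U_def L0_def)
  then have "Z0 \<in> N" unfolding N_def using R0 r L0_def by auto
  moreover have "\<bar>\<phi> (rep Z t) - \<phi> (rep Z0 t)\<bar> < e \<and> rlen Z < rlen Z0 + 1" if G: "Z \<in> N" "Z \<in> K" for Z
  proof -
    define L where "L = rlen Z"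
    have R: "Z \<in> RA d" and Lr: "L < r" using G unfolding N_def L_def by auto
    obtain a where a: "0 \<le> a" "a \<le> 1" "c0 = 0 \<or> c0 < variation d (rep Z) 0 a" "c1 = 0 \<or> c1 < variation d (rep Z) a 1" "rep Z a \<in> U"
      using G unfolding N_def N1_def by auto
    have "c0 \<le> variation d (rep Z) 0 a" "c1 \<le> variation d (rep Z) a 1" using a by (auto simp: less_imp_le)
    then have "L0 * t - \<epsilon> \<le> L * a" "L0 * (1 - t) - \<epsilon> \<le> L * (1 - a)"
      using a variation_rep[OF R, of 0 a] variation_rep[OF R, of a 1] unfolding c0_def c1_def by (auto intro!: ennreal_minus_le simp: L_def)
    then have la: "L0 * t - \<epsilon> \<le> L * a" "L * a \<le> L - L0 + L0 * t + \<epsilon>" by (auto simp: algebra_simps)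
    have LL: "L < L0 + \<epsilon>" using Lr r by simp
    have "L0 - 2 * \<epsilon> \<le> L" using la by linarith
    then have "(L0 - 2 * \<epsilon>) * t \<le> L * t" "L * t \<le> (L0 + \<epsilon>) * t" using LL t by (auto intro!: mult_right_mono)
    moreover have "\<epsilon> * t \<le> \<epsilon>" using t eps by (simp add: mult_left_le)
    ultimately have lt: "L0 * t - 2 * \<epsilon> \<le> L * t" "L * t \<le> L0 * t + \<epsilon>" by (auto simp: algebra_simps)
    have "\<bar>L * t - L * a\<bar> \<le> 4 * \<epsilon>" using la lt LL by linarith
    have "\<bar>\<phi> (rep Z t) - \<phi> (rep Z a)\<bar> \<le> C * \<bar>L * t - L * a\<bar>"
      using rep_lipschitz[OF \<phi> R t a(1,2)] by (simp add: C_def L_def)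
    also have "... \<le> C * (4 * \<epsilon>)" using \<open>\<bar>L * t - L * a\<bar> \<le> 4 * \<epsilon>\<close> C by (intro mult_left_mono) auto
    also have "... \<le> e / 2" using Ce by simp
    finally have "\<bar>\<phi> (rep Z t) - \<phi> (rep Z a)\<bar> \<le> e / 2" .
    moreover have "\<bar>\<phi> (rep Z a) - \<phi> (rep Z0 t)\<bar> < e / 4" using a(5) unfolding U_def by simp
    ultimately show ?thesis using LL eps e unfolding L_def L0_def by linarith
  qed
  ultimately show ?thesis using that oN by blast
qed

text \<open>Continuity in the arc at a fixed time combines with the Lipschitz bound in time, which
  is uniform near \<open>Z0\<close> because lengths there stay below \<open>rlen Z0 + 1\<close>.
  Each contributes less than 1/2, so a bump cannot fall from 1 to 0.\<close>

lemma good_compact_joint_continuous: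
  assumes K: "good_compact K"
  shows "continuous_map (prod_topology (subtopology (RA_topology d) K) (top_of_set {0..1})) euclidean (\<lambda>(Z, t). rep Z t)"
proof -
  let ?P = "prod_topology (subtopology (RA_topology d) K) (top_of_set {0..1::real})"
  have top: "topspace ?P = K \<times> {0..1}" using good_compact_RA[OF K] by (auto simp: topspace_RA)
  show ?thesis unfolding continuous_map_def
  proof (intro conjI allI impI)
    fix U :: "'a set" assume "openin euclidean U"
    then have U: "open U" by simp
    show "openin ?P {z \<in> topspace ?P. (case z of (Z, t) => rep Z t) \<in> U}"
    proof (subst openin_subopen, safe)
      fix Z0 t0 assume *: "(Z0, t0) \<in> topspace ?P" "rep Z0 t0 \<in> U"
      then have z: "Z0 \<in> K" "0 \<le> t0" "t0 \<le> 1" unfolding top by auto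
      obtain u where u: "u \<in> Lip_b d" "u (rep Z0 t0) = 1" "\<And>y. y \<notin> U ==> u y = 0" using ex_bump[OF U *(2)] by metis
      obtain N where N: "openin (RA_topology d) N" "Z0 \<in> N"
        "\<And>Z. Z \<in> N ==> Z \<in> K ==> \<bar>u (rep Z t0) - u (rep Z0 t0)\<bar> < 1/2 \<and> rlen Z < rlen Z0 + 1"
        using good_compact_nhd[OF K z(1) u(1) z(2,3), of "1/2"] by auto
      define C where "C = lipc u * (rlen Z0 + 1)"
      have C: "C > 0" unfolding C_def using lipc_pos[OF u(1)] rlen_nonneg[of Z0] by (intro mult_pos_pos) linarith+
      define V where "V = {0..1} \<inter> ball t0 (1 / (2 * C))"
      have op: "openin ?P ((K \<inter> N) \<times> V)" unfolding openin_prod_Times_iff V_def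
        using N(1) by (auto simp: openin_subtopology_Int2 openin_subtopology_Int Int_commute intro: openin_open_Int)
      have "rep Z t \<in> U" if "Z \<in> K" "Z \<in> N" "t \<in> V" for Z t
      proof (rule ccontr)
        assume "rep Z t \<notin> U"
        then have u0: "u (rep Z t) = 0" by (rule u(3))
        have G: "Z \<in> RA d" using that good_compact_RA[OF K] by auto
        have tV: "0 \<le> t" "t \<le> 1" "\<bar>t - t0\<bar> < 1 / (2 * C)" using that unfolding V_def by (auto simp: dist_real_def abs_minus_commute)
        have "\<bar>u (rep Z t) - u (rep Z t0)\<bar> \<le> lipc u * rlen Z * \<bar>t - t0\<bar>"
          using rep_lipschitz[OF u(1) G tV(1,2) z(2,3)] by (simp add: right_diff_distrib[symmetric] abs_mult)
        also have "... \<le> C * \<bar>t - t0\<bar>" unfolding C_def using N(3)[OF that(2,1)] lipc_pos[OF u(1)] by (intro mult_right_mono mult_left_mono) auto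
        also have "... < C * (1 / (2 * C))" using tV C by (intro mult_strict_left_mono) auto
        also have "... = 1/2" using C by simp
        finally show False using N(3)[OF that(2,1)] u(2) u0 by simp
      qed
      moreover have "(Z0, t0) \<in> (K \<inter> N) \<times> V" using z N C unfolding V_def by auto
      ultimately show "\<exists>T. openin ?P T \<and> (Z0, t0) \<in> T \<and> T \<subseteq> {z \<in> topspace ?P. (case z of (Z, t) => rep Z t) \<in> U}"
        using op by (intro exI[of _ "(K \<inter> N) \<times> V"]) (auto simp del: topspace_prod_topology simp: top V_def)
    qed
  qed auto
qed
end

section \<open>Subarcs\<close>

context emt
begin

text \<open>The two times may come in any order and may lie outside \<open>[0,1]\<close>. Sorting
  and clamping make \<open>subarc\<close> defined on the whole plane and let subarcs end exactly at
  an end of the arc for a set of times of positive measure.\<close>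

definition lo :: "real \<times> real => real" where "lo z = max 0 (min 1 (min (fst z) (snd z)))"
definition hi :: "real \<times> real => real" where "hi z = max 0 (min 1 (max (fst z) (snd z)))"

lemma lo_hi: "0 \<le> lo z" "lo z \<le> hi z" "hi z \<le> 1" unfolding lo_def hi_def by auto

lemma continuous_lo_hi: "continuous_on A lo" "continuous_on A hi"
  unfolding lo_def[abs_def] hi_def[abs_def] by (intro continuous_intros)+

lemma lo_hi_affine: "0 \<le> u ==> u \<le> 1 ==> 0 \<le> lo z + (hi z - lo z) * u \<and> lo z + (hi z - lo z) * u \<le> 1"
  using lo_hi[of z] mult_left_le[of u "hi z - lo z"] mult_nonneg_nonneg[of "hi z - lo z" u] by (intro conjI) linarith+

definition subarc :: "'a arc => real \<times> real => 'a arc" where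
  "subarc Z z = arc_rel `` {restrict (\<lambda>u. rep Z (lo z + (hi z - lo z) * u)) {0..1}}"

lemma subarc_speed:
  assumes G: "Z \<in> RA d"
  shows "unit_speed (rlen Z * (hi z - lo z)) (restrict (\<lambda>u. rep Z (lo z + (hi z - lo z) * u)) {0..1})" (is "unit_speed ?L (restrict ?R _)")
proof (rule unit_speedI)
  have "continuous_on {0..1} ?R"
    by (rule continuous_on_compose2[OF rep_curve(2)[OF G]]) (use lo_hi_affine[of _ z] in \<open>auto intro!: continuous_intros\<close>)
  then have "continuous_on {0..1} (restrict ?R {0..1})" by (rule continuous_on_eq) simp
  then show "restrict ?R {0..1} \<in> curves" unfolding curves_def by simp
  show "0 \<le> ?L" using lo_hi[of z] by simp
  fix t :: real assume t: "0 \<le> t" "t \<le> 1"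
  have "variation d (restrict ?R {0..1}) 0 t = gvar d UNIV ?R 0 t"
    unfolding variation_eq_gvar by (rule gvar_cong) (use t in auto)
  also have "... = gvar d UNIV (rep Z) (lo z + (hi z - lo z) * 0) (lo z + (hi z - lo z) * t)"
  proof (rule gvar_reparam[where \<phi> = "\<lambda>u. lo z + (hi z - lo z) * u"])
    show "mono_on {0..t} (\<lambda>u. lo z + (hi z - lo z) * u)" using lo_hi[of z] by (auto intro!: mono_onI mult_left_mono)
  qed (use t in \<open>auto intro!: continuous_intros\<close>)
  also have "... = ennreal (?L * t)" unfolding variation_eq_gvar[symmetric]
    by (subst variation_rep[OF G]) (use lo_hi[of z] lo_hi_affine[OF t, of z] t in \<open>auto simp: mult.assoc\<close>)
  finally show "variation d (restrict ?R {0..1}) 0 t = ennreal (?L * t)" .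
qed

lemma subarc:
  assumes "Z \<in> RA d"
  shows subarc_RA: "subarc Z z \<in> RA d" and rlen_subarc: "rlen (subarc Z z) = rlen Z * (hi z - lo z)"
    and rep_subarc: "0 \<le> u ==> u \<le> 1 ==> rep (subarc Z z) u = rep Z (lo z + (hi z - lo z) * u)"
  using unit_speed_arc[OF subarc_speed[OF assms, of z]] unfolding subarc_def by auto

text \<open>An affine change of variables; the degenerate interval is treated apart, where both
  sides are 0.\<close>

lemma kint_subarc:
  assumes G: "Z \<in> RA d" and u: "u \<in> borel_measurable borel"
  shows "kint len_kernel (subarc Z z) u = (\<integral>\<^sup>+x\<in>{lo z..hi z}. (ennreal (rlen Z) * u (crep Z x)) \<partial>lborel)"
proof (cases "lo z = hi z")
  case True
  have "kint len_kernel (subarc Z z) u = 0" unfolding kint_def len_kernel_def rlen_subarc[OF G] using True by simp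
  moreover have "(\<integral>\<^sup>+x\<in>{lo z..hi z}. (ennreal (rlen Z) * u (crep Z x)) \<partial>lborel) = (\<integral>\<^sup>+(x::real). 0 \<partial>lborel)"
  proof (rule nn_integral_cong_AE)
    show "AE x in lborel. ennreal (rlen Z) * u (crep Z x) * indicator {lo z..hi z} x = 0"
      using AE_lborel_singleton[of "hi z"] by eventually_elim (use True in \<open>simp add: indicator_def\<close>)
  qed
  ultimately show ?thesis by simp
next
  case False
  define c where "c = hi z - lo z"
  have c: "c > 0" using False lo_hi[of z] by (simp add: c_def)
  note cm = measurable_compose[OF crep_measurable[OF G] u]
  let ?f = "\<lambda>x. ennreal (rlen Z) * u (crep Z x) * indicator {lo z..hi z} x"
  have "(\<integral>\<^sup>+x. ?f x \<partial>lborel) = ennreal \<bar>c\<bar> * (\<integral>\<^sup>+x. ?f (lo z + c * x) \<partial>lborel)"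
    by (rule nn_integral_real_affine) (use c cm in auto)
  also have "... = (\<integral>\<^sup>+x. ennreal \<bar>c\<bar> * ?f (lo z + c * x) \<partial>lborel)"
  proof (rule nn_integral_cmult[symmetric])
    have "?f \<in> borel_measurable borel" using cm by measurable
    moreover have "(\<lambda>x. lo z + c * x) \<in> borel_measurable borel" by measurable
    ultimately show "(\<lambda>x. ?f (lo z + c * x)) \<in> borel_measurable lborel" using measurable_compose by force
  qed
  also have "... = kint len_kernel (subarc Z z) u" unfolding kint_def
  proof (rule nn_integral_cong)
    fix x :: real
    have i: "indicator {lo z..hi z} (lo z + c * x) = (indicator {0..1} x :: ennreal)"
    proof -
      have "lo z \<le> lo z + c * x \<longleftrightarrow> 0 \<le> x" using c by (simp add: zero_le_mult_iff)
      moreover have "lo z + c * x \<le> hi z \<longleftrightarrow> c * x \<le> c * 1" unfolding c_def by auto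
      ultimately show ?thesis using c by (simp add: indicator_def)
    qed
    have "crep (subarc Z z) x = crep Z (lo z + c * x)" if "0 \<le> x" "x \<le> 1"
      using that lo_hi_affine[OF that, of z] by (simp add: crep_eq rep_subarc[OF G] c_def)
    then show "ennreal \<bar>c\<bar> * ?f (lo z + c * x) = len_kernel (subarc Z z) x * u (crep (subarc Z z) x) * indicator {0..1} x"
      unfolding i len_kernel_def rlen_subarc[OF G] c_def[symmetric]
      using c by (cases "0 \<le> x \<and> x \<le> 1") (auto simp: ennreal_mult ac_simps)
  qed
  finally show ?thesis by simp
qed

text \<open>Already as a curve the restricted representative depends continuously on arc and times:
  the parameters for which it leaves \<open>U\<close> somewhere on the compact set \<open>C\<close>
  form the projection along \<open>C\<close> of a closed set, which is closed. The quotient map then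
  preserves continuity.\<close>

lemma subarc_continuous:
  assumes K: "good_compact K"
  shows "continuous_map (prod_topology (subtopology (RA_topology d) K) (euclidean :: (real \<times> real) topology)) (RA_topology d) (\<lambda>p. subarc (fst p) (snd p))"
    (is "continuous_map ?P _ _")
proof -
  define \<sigma> where "\<sigma> p = restrict (\<lambda>u. rep (fst p) (lo (snd p) + (hi (snd p) - lo (snd p)) * u)) {0..1}" for p :: "'a arc \<times> (real \<times> real)"
  have top: "p \<in> topspace ?P \<longleftrightarrow> fst p \<in> K" for p using good_compact_RA[OF K] by (cases p) (auto simp: topspace_RA)
  have Pr: "fst p \<in> RA d" if "p \<in> topspace ?P" for p using that good_compact_RA[OF K] unfolding top by auto
  have \<sigma>c: "\<sigma> p \<in> curves" if "p \<in> topspace ?P" for p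
    using subarc_speed[OF Pr[OF that], of "snd p"] unfolding unit_speed_def \<sigma>_def by blast
  have "continuous_map ?P compact_open_topology \<sigma>" unfolding compact_open_topology_def
  proof (rule continuous_on_generated_topo)
    fix W :: "(real => 'a) set" assume "W \<in> {{\<gamma> \<in> curves. \<gamma> ` K \<subseteq> U} | K U. compact K \<and> K \<subseteq> {0..1} \<and> open U}"
    then obtain C U where W: "W = {\<gamma> \<in> curves. \<gamma> ` C \<subseteq> U}" and C: "compact C" "C \<subseteq> {0..1}" and U: "open U" by blast
    let ?Y = "prod_topology ?P (top_of_set C)"
    define g where "g y = lo (snd (fst y)) + (hi (snd (fst y)) - lo (snd (fst y))) * snd y" for y :: "('a arc \<times> (real \<times> real)) \<times> real"
    have f1: "continuous_map ?Y (subtopology (RA_topology d) K) (\<lambda>y. fst (fst y))"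
      using continuous_map_compose[OF continuous_map_fst[of ?P "top_of_set C"] continuous_map_fst] by (simp add: o_def)
    have f2: "continuous_map ?Y euclidean (\<lambda>y. snd (fst y))"
      using continuous_map_compose[OF continuous_map_fst[of ?P "top_of_set C"] continuous_map_snd] by (simp add: o_def)
    have f3: "continuous_map ?Y euclideanreal (\<lambda>y. snd y)"
      using continuous_map_snd[of ?P "top_of_set C"] unfolding continuous_map_in_subtopology by simp
    have f4: "continuous_map ?Y euclideanreal (\<lambda>y. f (snd (fst y)))" if "continuous_on UNIV f" for f :: "real \<times> real => real"
      using continuous_map_compose[OF f2, of euclidean f] that by (simp add: o_def continuous_map_iff_continuous2)
    have "continuous_map ?Y euclideanreal g"
      unfolding g_def by (intro continuous_map_add continuous_map_real_mult continuous_map_diff f3 f4 continuous_lo_hi)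
    moreover have "g y \<in> {0..1}" if "y \<in> topspace ?Y" for y
      unfolding g_def using lo_hi_affine[of "snd y" "snd (fst y)"] that C(2) by auto
    ultimately have "continuous_map ?Y (top_of_set {0..1}) g" unfolding continuous_map_in_subtopology by auto
    then have "continuous_map ?Y (prod_topology (subtopology (RA_topology d) K) (top_of_set {0..1})) (\<lambda>y. (fst (fst y), g y))"
      by (intro continuous_map_pairedI f1)
    from continuous_map_compose[OF this good_compact_joint_continuous[OF K]]
    have Fc: "continuous_map ?Y euclidean (\<lambda>y. rep (fst (fst y)) (g y))" by (simp add: o_def)
    have "closedin ?Y {y \<in> topspace ?Y. rep (fst (fst y)) (g y) \<in> - U}"
      by (rule closedin_continuous_map_preimage[OF Fc]) (use U in auto)
    moreover have "closed_map ?Y ?P fst"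
      by (rule Abstract_Topological_Spaces.closed_map_fst) (use C(1) in \<open>simp add: compact_space_subtopology\<close>)
    ultimately have cl: "closedin ?P (fst ` {y \<in> topspace ?Y. rep (fst (fst y)) (g y) \<in> - U})" unfolding closed_map_def by blast
    have "\<sigma> -` W \<inter> topspace ?P = topspace ?P - fst ` {y \<in> topspace ?Y. rep (fst (fst y)) (g y) \<in> - U}"
    proof (intro equalityI subsetI)
      fix p assume p: "p \<in> \<sigma> -` W \<inter> topspace ?P"
      have "rep (fst p) (g (p, u)) \<in> U" if "u \<in> C" for u
      proof -
        have "\<sigma> p u \<in> U" using p that unfolding W by auto
        then show ?thesis using that C(2) unfolding \<sigma>_def g_def by auto
      qed
      then show "p \<in> topspace ?P - fst ` {y \<in> topspace ?Y. rep (fst (fst y)) (g y) \<in> - U}" using p by auto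
    next
      fix p assume p: "p \<in> topspace ?P - fst ` {y \<in> topspace ?Y. rep (fst (fst y)) (g y) \<in> - U}"
      have "\<sigma> p u \<in> U" if u: "u \<in> C" for u
      proof (rule ccontr)
        assume "\<sigma> p u \<notin> U"
        then have "(p, u) \<in> {y \<in> topspace ?Y. rep (fst (fst y)) (g y) \<in> - U}" using p u C(2) unfolding \<sigma>_def g_def by auto
        then show False using p by force
      qed
      then show "p \<in> \<sigma> -` W \<inter> topspace ?P" unfolding W using p \<sigma>c by auto
    qed
    then show "openin ?P (\<sigma> -` W \<inter> topspace ?P)" using openin_diff[OF openin_topspace cl] by simp
  next
    have "curves \<in> {{\<gamma> \<in> curves. \<gamma> ` K \<subseteq> U} | K (U :: 'a set). compact K \<and> K \<subseteq> {0..1} \<and> open U}"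
      by (rule CollectI, rule exI[of _ "{}"], rule exI[of _ UNIV]) auto
    then show "\<sigma> ` topspace ?P \<subseteq> \<Union> {{\<gamma> \<in> curves. \<gamma> ` K \<subseteq> U} | K (U :: 'a set). compact K \<and> K \<subseteq> {0..1} \<and> open U}"
      using \<sigma>c by blast
  qed
  note \<sigma>cont = this
  have sub: "subarc (fst p) (snd p) = arc_rel `` {\<sigma> p}" for p unfolding subarc_def \<sigma>_def ..
  have "RA d \<subseteq> topspace arc_topology" using topspace_RA[of d] unfolding RA_topology_def by auto
  then have "continuous_map ?P arc_topology (\<lambda>p. subarc (fst p) (snd p))"
    unfolding continuous_map_def
  proof (intro conjI allI impI)
    fix V :: "'a arc set" assume "openin arc_topology V"
    then have "openin compact_open_topology {\<gamma> \<in> curves. arc_rel `` {\<gamma>} \<in> V}" unfolding openin_arc_topology by auto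
    then have "openin ?P {p \<in> topspace ?P. \<sigma> p \<in> {\<gamma> \<in> curves. arc_rel `` {\<gamma>} \<in> V}}" using \<sigma>cont by (rule openin_continuous_map_preimage[rotated])
    moreover have "{p \<in> topspace ?P. \<sigma> p \<in> {\<gamma> \<in> curves. arc_rel `` {\<gamma>} \<in> V}} = {p \<in> topspace ?P. subarc (fst p) (snd p) \<in> V}"
      using \<sigma>c sub by auto
    ultimately show "openin ?P {p \<in> topspace ?P. subarc (fst p) (snd p) \<in> V}" by simp
  next
    show "(\<lambda>p. subarc (fst p) (snd p)) \<in> topspace ?P \<rightarrow> topspace arc_topology"
      using subarc_RA[OF Pr] \<open>RA d \<subseteq> topspace arc_topology\<close> by blast
  qed
  then show ?thesis unfolding RA_topology_def continuous_map_in_subtopology using subarc_RA[OF Pr] unfolding RA_topology_def by blast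
qed
end

section \<open>Radon measures\<close>

abbreviation borel_of :: "'b topology => 'b measure" where
  "borel_of T \<equiv> sigma (topspace T) {U. openin T U}"

lemma openin_borel_of: "openin T U ==> U \<in> sets (borel_of T)"
  using openin_subset by (subst sets_measure_of) auto

lemma closedin_borel_of:
  assumes "closedin T C" shows "C \<in> sets (borel_of T)"
proof -
  have "space (borel_of T) - (topspace T - C) \<in> sets (borel_of T)"
    using assms by (intro sets.compl_sets openin_borel_of) (auto simp: closedin_def)
  moreover have "space (borel_of T) = topspace T" using openin_subset by (intro space_measure_of) blast
  ultimately show ?thesis using closedin_subset[OF assms] by (simp add: double_diff)
qed

lemma space_eq_topspace: "sets M = sets (borel_of T) ==> space M = topspace T"
  using openin_subset by (subst sets_eq_imp_space_eq) (auto intro!: space_measure_of)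

lemma (in finite_measure) ex_finite_union:
  assumes "\<And>i::nat. F i \<in> sets M" "0 < e" shows "\<exists>N. measure M ((\<Union>i. F i) - (\<Union>i<N. F i)) < e"
proof -
  have lim: "(\<lambda>N. measure M ((\<Union>i. F i) - (\<Union>i<N. F i))) \<longlonglongrightarrow> measure M (\<Inter>N. (\<Union>i. F i) - (\<Union>i<N. F i))"
    by (rule finite_Lim_measure_decseq) (use assms(1) in \<open>auto simp: decseq_def\<close>)
  have "(\<Union>i. F i) \<subseteq> (\<Union>N. \<Union>i<N. F i)" using lessI by blast
  then have empty: "(\<Inter>N. (\<Union>i. F i) - (\<Union>i<N. F i)) = {}" by blast
  have "(\<lambda>N. measure M ((\<Union>i. F i) - (\<Union>i<N. F i))) \<longlonglongrightarrow> 0" using lim unfolding empty measure_empty .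
  then have "eventually (\<lambda>N. measure M ((\<Union>i. F i) - (\<Union>i<N. F i)) < e) sequentially"
    using assms(2) by (rule order_tendstoD(2))
  then show ?thesis unfolding eventually_sequentially by blast
qed

text \<open>Finitely many of the sets \<open>C i\<close> already exhaust \<open>B\<close> up to
  \<open>e\<close>, and a finite union of compact sets is compact.\<close>

lemma (in finite_measure) ex_compact_approx:
  assumes T: "Hausdorff_space T" and M: "sets M = sets (borel_of T)" and B: "B \<in> sets M" and e: "0 < e"
    and C: "\<And>i::nat. compactin T (C i) \<and> C i \<subseteq> B" "emeasure M (B - (\<Union>i. C i)) = 0"
  obtains D where "compactin T D" "D \<subseteq> B" "measure M (B - D) < e"
proof -
  have Cm: "C i \<in> sets M" for i using C(1) compactin_imp_closedin[OF T] closedin_borel_of M by metis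
  obtain N where N: "measure M ((\<Union>i. C i) - (\<Union>i<N. C i)) < e" using ex_finite_union[of C, OF Cm e] by auto
  have "B - (\<Union>i<N. C i) \<subseteq> ((\<Union>i. C i) - (\<Union>i<N. C i)) \<union> (B - (\<Union>i. C i))" by blast
  then have "measure M (B - (\<Union>i<N. C i)) \<le> measure M (((\<Union>i. C i) - (\<Union>i<N. C i)) \<union> (B - (\<Union>i. C i)))"
    by (rule finite_measure_mono) (use Cm B in auto)
  also have "... \<le> measure M ((\<Union>i. C i) - (\<Union>i<N. C i)) + measure M (B - (\<Union>i. C i))"
    by (rule measure_Un_le) (use Cm B in auto)
  also have "measure M (B - (\<Union>i. C i)) = 0" using C(2) by (simp add: measure_def)
  finally have "measure M (B - (\<Union>i<N. C i)) < e" using N by simp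
  moreover have "compactin T (\<Union>i<N. C i)" using C(1) by (intro compactin_Union) auto
  ultimately show ?thesis using that C(1) by blast
qed

text \<open>Inner regularity recast as exhaustion by countably many compact sets up to a null set,
  the form that is convenient for densities, subspaces and images of products.\<close>

lemma radon_sigma_compact:
  assumes T: "Hausdorff_space T" and M: "radon_measure T M" and B: "B \<in> sets M"
  obtains C :: "nat => 'b set" where "\<And>i. compactin T (C i) \<and> C i \<subseteq> B" "emeasure M (B - (\<Union>i. C i)) = 0"
proof -
  interpret finite_measure M using M unfolding radon_measure_def by auto
  have sM: "sets M = sets (borel_of T)" using M unfolding radon_measure_def by auto
  have Bs: "emeasure M B = (SUP K \<in> {K. compactin T K \<and> K \<subseteq> B}. emeasure M K)" using M B unfolding radon_measure_def by auto
  have "{K. compactin T K \<and> K \<subseteq> B} \<noteq> {}" by (auto intro!: exI[of _ "{}"])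
  then obtain f :: "nat => ennreal" where f: "range f \<subseteq> emeasure M ` {K. compactin T K \<and> K \<subseteq> B}" "emeasure M B = Sup (range f)"
    using ennreal_Sup_countable_SUP[of "emeasure M ` {K. compactin T K \<and> K \<subseteq> B}"] unfolding Bs by auto
  have "\<forall>n. \<exists>C. (compactin T C \<and> C \<subseteq> B) \<and> f n = emeasure M C" using f(1) by auto
  then obtain C where C: "\<And>n. compactin T (C n) \<and> C n \<subseteq> B" "\<And>n. f n = emeasure M (C n)" by metis
  have Cm: "C i \<in> sets M" for i using C(1) compactin_imp_closedin[OF T] closedin_borel_of sM by metis
  have "emeasure M B \<le> emeasure M (\<Union>i. C i)" unfolding f(2)
  proof (rule Sup_least)
    fix y assume "y \<in> range f"
    then obtain n where "y = emeasure M (C n)" using C(2) by auto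
    then show "y \<le> emeasure M (\<Union>i. C i)" using Cm by (auto intro!: emeasure_mono)
  qed
  then have "emeasure M (B - (\<Union>i. C i)) = 0"
    using Cm B C(1) by (subst emeasure_Diff) (auto intro: diff_eq_0_ennreal simp: less_top[symmetric])
  then show ?thesis using that C(1) by blast
qed

lemma radon_compact_approx:
  assumes T: "Hausdorff_space T" and M: "radon_measure T M" and B: "B \<in> sets M" and e: "(0::real) < e"
  obtains D where "compactin T D" "D \<subseteq> B" "measure M (B - D) < e"
proof -
  interpret finite_measure M using M unfolding radon_measure_def by auto
  have sM: "sets M = sets (borel_of T)" using M unfolding radon_measure_def by auto
  obtain C :: "nat => 'a set" where C: "\<And>i. compactin T (C i) \<and> C i \<subseteq> B" "emeasure M (B - (\<Union>i. C i)) = 0"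
    using radon_sigma_compact[OF T M B] by metis
  show ?thesis using ex_compact_approx[OF T sM B e C] that by metis
qed

text \<open>It suffices to approximate open sets from inside: the sets which are approximated by closed sets
  both from inside and from outside form a \<open>\<sigma>\<close>-algebra.\<close>

lemma radon_measureI:
  assumes T: "Hausdorff_space T" and M: "sets M = sets (borel_of T)" and fin: "finite_measure M"
    and inner: "\<And>V. openin T V ==> \<exists>C::nat => 'b set. (\<forall>i. compactin T (C i) \<and> C i \<subseteq> V) \<and> emeasure M (V - (\<Union>i. C i)) = 0"
  shows "radon_measure T M"
proof -
  interpret finite_measure M by (rule fin)
  have sp: "space M = topspace T" by (rule space_eq_topspace[OF M])
  have clM: "F \<in> sets M" if "closedin T F" for F using closedin_borel_of[OF that] M by simp
  have opM: "F \<in> sets M" if "openin T F" for F using openin_borel_of[OF that] M by simp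
  have approx: "\<exists>D. compactin T D \<and> D \<subseteq> V \<and> measure M (V - D) < e" if V: "openin T V" and e: "e > 0" for V e
  proof -
    obtain C :: "nat => 'b set" where C: "\<And>i. compactin T (C i) \<and> C i \<subseteq> V" "emeasure M (V - (\<Union>i. C i)) = 0" using inner[OF V] by auto
    show ?thesis using ex_compact_approx[OF T M opM[OF V] e C] by metis
  qed
  \<comment> \<open>The property is symmetric in \<open>B\<close> and its complement,
    \<open>F'\<close> being for the complement what \<open>F\<close> is for
    \<open>B\<close>.\<close>
  define R where "R B \<longleftrightarrow> (\<forall>e>0. \<exists>F F'. closedin T F \<and> closedin T F' \<and> F \<subseteq> B \<and> F' \<subseteq> topspace T - B \<and> measure M (topspace T - F - F') < e)" for B
  have R: "R B" if "B \<in> sigma_sets (topspace T) {U. openin T U}" for B using that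
  proof (induction rule: sigma_sets.induct)
    case (Basic V)
    then have V: "openin T V" by simp
    show ?case unfolding R_def
    proof (intro allI impI)
      fix e :: real assume "e > 0"
      then obtain D where D: "compactin T D" "D \<subseteq> V" "measure M (V - D) < e" using approx[OF V] by blast
      have "topspace T - D - (topspace T - V) = V - D" using openin_subset[OF V] by auto
      then show "\<exists>F F'. closedin T F \<and> closedin T F' \<and> F \<subseteq> V \<and> F' \<subseteq> topspace T - V \<and> measure M (topspace T - F - F') < e"
        using D compactin_imp_closedin[OF T D(1)] V by (intro exI[of _ D] exI[of _ "topspace T - V"]) auto
    qed
  next
    case Empty
    show ?case unfolding R_def by (intro allI impI exI[of _ "{}"] exI[of _ "topspace T"]) auto
  next
    case (Compl B)
    have "B \<subseteq> topspace T" using sigma_sets_into_sp[OF _ Compl(1)] openin_subset by blast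
    then have c: "topspace T - (topspace T - B) = B" by (rule double_diff) simp
    show ?case unfolding R_def c
    proof (intro allI impI)
      fix e :: real assume "e > 0"
      then obtain F F' where F: "closedin T F" "closedin T F'" "F \<subseteq> B" "F' \<subseteq> topspace T - B" "measure M (topspace T - F - F') < e"
        using R_def[THEN iffD1, OF Compl(2), rule_format, OF \<open>e > 0\<close>] by metis
      have "topspace T - F' - F = topspace T - F - F'" by auto
      then show "\<exists>F F'. closedin T F \<and> closedin T F' \<and> F \<subseteq> topspace T - B \<and> F' \<subseteq> B \<and> measure M (topspace T - F - F') < e"
        using F by (intro exI[of _ F'] exI[of _ F]) auto
    qed
  next
    case (Union B)
    show ?case unfolding R_def
    proof (intro allI impI)
      fix e :: real assume e: "e > 0"
      \<comment> \<open>These errors add up to \<open>e / 2\<close>; the other half pays for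
        replacing the union of all \<open>F i\<close> by a finite one, which is closed.\<close>
      have "\<exists>F F'. closedin T F \<and> closedin T F' \<and> F \<subseteq> B i \<and> F' \<subseteq> topspace T - B i \<and> measure M (topspace T - F - F') < e / 4 * (1/2) ^ i" for i
        by (rule R_def[THEN iffD1, OF Union(2), rule_format]) (use e in simp)
      then obtain F F' where F: "\<And>i. closedin T (F i)" "\<And>i. closedin T (F' i)" "\<And>i. F i \<subseteq> B i" "\<And>i. F' i \<subseteq> topspace T - B i"
        "\<And>i. measure M (topspace T - F i - F' i) < e / 4 * (1/2) ^ i" by metis
      obtain N where N: "measure M ((\<Union>i. F i) - (\<Union>i<N. F i)) < e / 2" using ex_finite_union[of F "e / 2"] clM[OF F(1)] e by auto
      define G where "G i = topspace T - F i - F' i" for i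
      have Gm: "G i \<in> sets M" for i unfolding G_def using clM[OF F(1)] clM[OF F(2)] sets.top[of M] sp by (metis sets.Diff)
      have geo: "(\<lambda>i. e / 4 * (1/2) ^ i) sums (e / 4 * (1 / (1 - 1/2)))" by (intro sums_mult geometric_sums) auto
      have sG: "summable (\<lambda>i. measure M (G i))"
        by (rule summable_comparison_test'[OF sums_summable[OF geo], of 0]) (use F(5) in \<open>auto simp: G_def less_imp_le\<close>)
      have "measure M (\<Union>i. G i) \<le> (\<Sum>i. measure M (G i))" by (rule finite_measure_subadditive_countably) (use Gm sG in auto)
      also have "... \<le> (\<Sum>i. e / 4 * (1/2) ^ i)" by (rule suminf_le) (use F(5) sG sums_summable[OF geo] in \<open>auto simp: G_def less_imp_le\<close>)
      also have "... = e / 2" using sums_unique[OF geo] by simp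
      finally have Ge: "measure M (\<Union>i. G i) \<le> e / 2" .
      have "topspace T - (\<Union>i<N. F i) - (\<Inter>i. F' i) \<subseteq> ((\<Union>i. F i) - (\<Union>i<N. F i)) \<union> (\<Union>i. G i)" unfolding G_def by blast
      then have "measure M (topspace T - (\<Union>i<N. F i) - (\<Inter>i. F' i)) \<le> measure M (((\<Union>i. F i) - (\<Union>i<N. F i)) \<union> (\<Union>i. G i))"
        by (rule finite_measure_mono) (use clM[OF F(1)] Gm in auto)
      also have "... \<le> measure M ((\<Union>i. F i) - (\<Union>i<N. F i)) + measure M (\<Union>i. G i)"
        by (rule measure_Un_le) (use clM[OF F(1)] Gm in auto)
      also have "... < e" using N Ge by simp
      finally have "measure M (topspace T - (\<Union>i<N. F i) - (\<Inter>i. F' i)) < e" .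
      moreover have "closedin T (\<Union>i<N. F i)" using F(1) by (intro closedin_Union) auto
      moreover have "closedin T (\<Inter>i. F' i)" using F(2) by (intro closedin_Inter) auto
      moreover have "(\<Union>i<N. F i) \<subseteq> \<Union> (range B)" "(\<Inter>i. F' i) \<subseteq> topspace T - \<Union> (range B)" using F(3,4) by blast+
      ultimately show "\<exists>F F'. closedin T F \<and> closedin T F' \<and> F \<subseteq> \<Union> (range B) \<and> F' \<subseteq> topspace T - \<Union> (range B) \<and> measure M (topspace T - F - F') < e"
        by blast
    qed
  qed
  have "emeasure M B = (SUP K \<in> {K. compactin T K \<and> K \<subseteq> B}. emeasure M K)" if B: "B \<in> sets M" for B
  proof (rule antisym)
    show "(SUP K \<in> {K. compactin T K \<and> K \<subseteq> B}. emeasure M K) \<le> emeasure M B" using B by (auto intro!: SUP_least emeasure_mono)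
    show "emeasure M B \<le> (SUP K \<in> {K. compactin T K \<and> K \<subseteq> B}. emeasure M K)"
    proof (rule ennreal_le_epsilon)
      fix e :: real assume e: "0 < e"
      \<comment> \<open>Intersecting with a compact set that carries almost all the mass turns
        closed approximations into compact ones.\<close>
      obtain D where D: "compactin T D" "D \<subseteq> topspace T" "measure M (topspace T - D) < e / 2" using approx[OF openin_topspace, of "e / 2"] e by auto
      have "B \<in> sigma_sets (topspace T) {U. openin T U}"
        using B M openin_subset by (metis (no_types, lifting) CollectD PowI sets_measure_of subsetI)
      then obtain F F' where F: "closedin T F" "closedin T F'" "F \<subseteq> B" "F' \<subseteq> topspace T - B" "measure M (topspace T - F - F') < e / 2"
        using R e unfolding R_def by (meson half_gt_zero)
      have Bt: "B \<subseteq> topspace T" using sets.sets_into_space[OF B] sp by simp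
      have c: "compactin T (F \<inter> D)" using closed_Int_compactin[OF F(1) D(1)] by simp
      have ms: "topspace T - D \<in> sets M" "topspace T - F - F' \<in> sets M" "F \<inter> D \<in> sets M"
        using clM[OF F(1)] clM[OF F(2)] clM[OF compactin_imp_closedin[OF T D(1)]] sets.top[of M] sp by (auto simp del: sets.top)
      have "measure M B \<le> measure M (F \<inter> D \<union> ((topspace T - D) \<union> (topspace T - F - F')))"
        by (rule finite_measure_mono) (use ms Bt F(4) in auto)
      also have "... \<le> measure M (F \<inter> D) + measure M ((topspace T - D) \<union> (topspace T - F - F'))"
        by (rule measure_Un_le) (use ms in auto)
      also have "measure M ((topspace T - D) \<union> (topspace T - F - F')) \<le> measure M (topspace T - D) + measure M (topspace T - F - F')"
        by (rule measure_Un_le) (use ms in auto)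
      finally have "measure M B \<le> measure M (F \<inter> D) + e" using D(3) F(5) by linarith
      then have "emeasure M B \<le> emeasure M (F \<inter> D) + ennreal e"
        unfolding emeasure_eq_measure using e by (simp add: ennreal_plus[symmetric] del: ennreal_plus)
      also have "emeasure M (F \<inter> D) \<le> (SUP K \<in> {K. compactin T K \<and> K \<subseteq> B}. emeasure M K)" using c F(3) by (intro SUP_upper) auto
      finally show "emeasure M B \<le> (SUP K \<in> {K. compactin T K \<and> K \<subseteq> B}. emeasure M K) + ennreal e" by (simp add: add_right_mono)
    qed
  qed
  then show ?thesis unfolding radon_measure_def using M fin by auto
qed

text \<open>Rational closed boxes \<open>q n\<close> form a countable family, and \<open>A n\<close>
  is the largest open set whose product with \<open>q n\<close> fits into \<open>W\<close>.
  Countability in the plane suffices whatever \<open>T\<close> is, so open sets of the product lie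
  in the product \<sigma>-algebra.\<close>

lemma openin_prod_eq_Union:
  assumes W: "openin (prod_topology T (euclidean :: (real \<times> real) topology)) W"
  obtains A :: "nat => 'b set" and B :: "nat => (real \<times> real) set"
  where "\<And>n. openin T (A n)" "\<And>n. compact (B n)" "W = (\<Union>n. A n \<times> B n)"
proof -
  define I where "I = (\<rat> :: real set) \<times> (\<rat> :: real set) \<times> (\<rat> :: real set) \<times> (\<rat> :: real set)"
  have I: "countable I" "I \<noteq> {}" unfolding I_def by (auto intro!: countable_SIGMA countable_rat)
  define box where "box = (\<lambda>(a, b, c, e). {a..b::real} \<times> {c..e::real})"
  define q where "q n = box (from_nat_into I n)" for n
  define A where "A n = \<Union>{A. openin T A \<and> A \<times> q n \<subseteq> W}" for n
  have rat: "\<exists>a\<in>\<rat>. \<exists>b\<in>\<rat>. a \<le> s \<and> s \<le> b \<and> {a..b} \<subseteq> S" if "open S" "s \<in> S" for s and S :: "real set"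
  proof -
    obtain e where e: "e > 0" "cball s e \<subseteq> S" using \<open>open S\<close> \<open>s \<in> S\<close> open_contains_cball by blast
    obtain a b where "a \<in> \<rat>" "s - e < a" "a < s" "b \<in> \<rat>" "s < b" "b < s + e"
      using Rats_dense_in_real[of "s - e" s] Rats_dense_in_real[of s "s + e"] e by auto
    moreover then have "{a..b} \<subseteq> cball s e" by (auto simp: dist_real_def)
    ultimately show ?thesis using e by (intro bexI[of _ a] bexI[of _ b]) auto
  qed
  have "p \<in> (\<Union>n. A n \<times> q n)" if p: "p \<in> W" for p
  proof -
    obtain x s t where pst: "p = (x, (s, t))" by (metis surj_pair)
    obtain U V where UV: "openin T U" "open V" "x \<in> U" "(s, t) \<in> V" "U \<times> V \<subseteq> W"
      using W p unfolding pst openin_prod_topology_alt by (metis open_openin)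
    obtain V1 V2 where V: "open V1" "open V2" "(s, t) \<in> V1 \<times> V2" "V1 \<times> V2 \<subseteq> V" using open_prod_elim[OF UV(2,4)] by metis
    obtain a b where ab: "a \<in> \<rat>" "b \<in> \<rat>" "a \<le> s" "s \<le> b" "{a..b} \<subseteq> V1" using rat[OF V(1), of s] V(3) by auto
    obtain c e where ce: "c \<in> \<rat>" "e \<in> \<rat>" "c \<le> t" "t \<le> e" "{c..e} \<subseteq> V2" using rat[OF V(2), of t] V(3) by auto
    have "(a, b, c, e) \<in> I" unfolding I_def using ab ce by auto
    then obtain n where n: "from_nat_into I n = (a, b, c, e)" using from_nat_into_surj[OF I(1)] by metis
    have "q n \<subseteq> V1 \<times> V2" using ab(5) ce(5) unfolding q_def n box_def by auto
    then have "U \<times> q n \<subseteq> W" using UV(5) V(4) by blast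
    then have "x \<in> A n" unfolding A_def using UV by blast
    moreover have "(s, t) \<in> q n" unfolding q_def n box_def using ab ce by auto
    ultimately show ?thesis unfolding pst by blast
  qed
  moreover have "(\<Union>n. A n \<times> q n) \<subseteq> W" unfolding A_def by blast
  ultimately have "W = (\<Union>n. A n \<times> q n)" by blast
  moreover have "openin T (A n)" for n unfolding A_def by auto
  moreover have "compact (q n)" for n unfolding q_def box_def by (auto split: prod.splits intro!: compact_Times)
  ultimately show ?thesis by (intro that[of A q])
qed

text \<open>Preimages of open sets are countable unions of rectangles with compact second factor.
  Exhausting the first factors by compact sets exhausts the preimage up to a null set, and
  continuous images of compact rectangles are compact.\<close>

lemma radon_distr_prod:
  fixes \<alpha> :: "'b measure" and \<beta> :: "(real \<times> real) measure"
  assumes T: "Hausdorff_space T" and \<Phi>: "continuous_map (prod_topology S euclidean) T \<Phi>"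
    and f\<alpha>: "finite_measure \<alpha>" and sp\<alpha>: "space \<alpha> = topspace S" and S: "\<And>U. openin S U ==> U \<in> sets \<alpha>"
    and \<alpha>: "\<And>U. openin S U ==> \<exists>C::nat => 'b set. (\<forall>i. compactin S (C i) \<and> C i \<subseteq> U \<and> C i \<in> sets \<alpha>) \<and> emeasure \<alpha> (U - (\<Union>i. C i)) = 0"
    and \<beta>: "sets \<beta> = sets borel" "finite_measure \<beta>"
  shows "\<Phi> \<in> measurable (\<alpha> \<Otimes>\<^sub>M \<beta>) (borel_of T)" "radon_measure T (distr (\<alpha> \<Otimes>\<^sub>M \<beta>) (borel_of T) \<Phi>)"
proof -
  let ?P = "prod_topology S (euclidean :: (real \<times> real) topology)"
  let ?\<nu> = "\<alpha> \<Otimes>\<^sub>M \<beta>"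
  interpret A: finite_measure \<alpha> by (rule f\<alpha>)
  interpret B: finite_measure \<beta> by (rule \<beta>(2))
  interpret P: pair_sigma_finite \<alpha> \<beta> ..
  have sp: "space ?\<nu> = topspace ?P" using sets_eq_imp_space_eq[OF \<beta>(1)] by (simp add: space_pair_measure sp\<alpha>)
  have op: "W \<in> sets ?\<nu>" if W: "openin ?P W" for W
  proof -
    obtain A :: "nat => 'b set" and B where AB: "\<And>n. openin S (A n)" "\<And>n. compact (B n)" "W = (\<Union>n. A n \<times> B n)"
      by (fact openin_prod_eq_Union[OF W])
    have "A n \<times> B n \<in> sets ?\<nu>" for n
      using S[OF AB(1)] AB(2) \<beta>(1) by (intro pair_measureI) (auto intro: borel_compact)
    then show ?thesis unfolding AB(3) by auto
  qed
  have pre: "openin ?P (\<Phi> -` V \<inter> space ?\<nu>)" if "openin T V" for V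
    using openin_continuous_map_preimage[OF \<Phi> that] unfolding sp by (simp add: vimage_def Int_def conj_commute)
  have meas: "\<Phi> \<in> measurable ?\<nu> (borel_of T)"
  proof (rule measurable_measure_of)
    show "\<Phi> \<in> space ?\<nu> \<rightarrow> topspace T" using \<Phi> unfolding sp continuous_map_def by auto
  qed (use op pre in \<open>auto dest: openin_subset\<close>)
  then show "\<Phi> \<in> measurable ?\<nu> (borel_of T)" .
  have "emeasure ?\<nu> (space ?\<nu>) = emeasure \<alpha> (space \<alpha>) * emeasure \<beta> (space \<beta>)"
    unfolding space_pair_measure by (rule B.emeasure_pair_measure_Times) auto
  then have "finite_measure ?\<nu>" by (intro finite_measureI) (simp add: ennreal_mult_eq_top_iff)
  then have dsp: "finite_measure (distr ?\<nu> (borel_of T) \<Phi>)" using meas by (rule finite_measure.finite_measure_distr)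
  show "radon_measure T (distr ?\<nu> (borel_of T) \<Phi>)"
  proof (rule radon_measureI[OF T _ dsp])
    fix V assume V: "openin T V"
    obtain A :: "nat => 'b set" and B where AB: "\<And>n. openin S (A n)" "\<And>n. compact (B n)" "\<Phi> -` V \<inter> space ?\<nu> = (\<Union>n. A n \<times> B n)"
      by (fact openin_prod_eq_Union[OF pre[OF V]])
    have Am: "A n \<in> sets \<alpha>" for n by (rule S[OF AB(1)])
    have Bm: "B n \<in> sets \<beta>" for n using AB(2) \<beta>(1) by (auto intro: borel_compact)
    have "\<forall>n. \<exists>C::nat => 'b set. (\<forall>i. compactin S (C i) \<and> C i \<subseteq> A n \<and> C i \<in> sets \<alpha>) \<and> emeasure \<alpha> (A n - (\<Union>i. C i)) = 0"
      using \<alpha>[OF AB(1)] by blast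
    then obtain C :: "nat => nat => 'b set" where C: "\<And>n i. compactin S (C n i)" "\<And>n i. C n i \<subseteq> A n" "\<And>n. emeasure \<alpha> (A n - (\<Union>i. C n i)) = 0"
      and Cm: "\<And>n i. C n i \<in> sets \<alpha>" by metis
    define D where "D k = \<Phi> ` (C (fst (prod_decode k)) (snd (prod_decode k)) \<times> B (fst (prod_decode k)))" for k
    have Dn: "D (prod_encode (n, i)) = \<Phi> ` (C n i \<times> B n)" for n i unfolding D_def by simp
    have Dc: "compactin T (D k)" for k unfolding D_def
      by (rule image_compactin[OF _ \<Phi>]) (use C(1) AB(2) in \<open>auto simp: compactin_Times\<close>)
    have Dsub: "D k \<subseteq> V" for k
    proof -
      have "C (fst (prod_decode k)) (snd (prod_decode k)) \<times> B (fst (prod_decode k)) \<subseteq> \<Phi> -` V \<inter> space ?\<nu>" unfolding AB(3) using C(2) by blast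
      then show ?thesis unfolding D_def by auto
    qed
    have Dm: "D k \<in> sets (borel_of T)" for k by (rule closedin_borel_of[OF compactin_imp_closedin[OF T Dc]])
    have "\<Phi> -` (V - (\<Union>k. D k)) \<inter> space ?\<nu> \<subseteq> (\<Union>n. (A n - (\<Union>i. C n i)) \<times> B n)"
    proof
      fix p assume p: "p \<in> \<Phi> -` (V - (\<Union>k. D k)) \<inter> space ?\<nu>"
      then have "p \<in> (\<Union>n. A n \<times> B n)" unfolding AB(3)[symmetric] by auto
      then obtain n where n: "p \<in> A n \<times> B n" by auto
      have "fst p \<notin> C n i" for i
      proof
        assume "fst p \<in> C n i"
        then have "\<Phi> p \<in> D (prod_encode (n, i))" unfolding Dn using n by (intro imageI) auto
        then show False using p by auto
      qed
      then show "p \<in> (\<Union>n. (A n - (\<Union>i. C n i)) \<times> B n)" using n by auto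
    qed
    moreover have "(A n - (\<Union>i. C n i)) \<times> B n \<in> null_sets ?\<nu>" for n
    proof (rule null_setsI)
      have "A n - (\<Union>i. C n i) \<in> sets \<alpha>" using Am Cm by auto
      then show "(A n - (\<Union>i. C n i)) \<times> B n \<in> sets ?\<nu>" "emeasure ?\<nu> ((A n - (\<Union>i. C n i)) \<times> B n) = 0"
        using Bm C(3) by (auto simp: B.emeasure_pair_measure_Times)
    qed
    then have "(\<Union>n. (A n - (\<Union>i. C n i)) \<times> B n) \<in> null_sets ?\<nu>" by (rule null_sets_UN)
    moreover have VD: "V - (\<Union>k. D k) \<in> sets (borel_of T)" using Dm openin_borel_of[OF V] by (intro sets.Diff sets.countable_UN) auto
    ultimately have "\<Phi> -` (V - (\<Union>k. D k)) \<inter> space ?\<nu> \<in> null_sets ?\<nu>"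
      using measurable_sets[OF meas VD] null_sets_subset by blast
    then have "emeasure (distr ?\<nu> (borel_of T) \<Phi>) (V - (\<Union>k. D k)) = 0"
      using emeasure_distr[OF meas VD] by (simp add: null_setsD1)
    then show "\<exists>C::nat => _ set. (\<forall>i. compactin T (C i) \<and> C i \<subseteq> V) \<and> emeasure (distr ?\<nu> (borel_of T) \<Phi>) (V - (\<Union>i. C i)) = 0"
      using Dc Dsub by blast
  qed simp
qed

section \<open>Test plans concentrated on subarcs\<close>

lemma Hausdorff_euclidean: "Hausdorff_space (euclidean :: 'b::t2_space topology)"
  unfolding Hausdorff_space_def disjnt_def by (simp, metis hausdorff)

context emtm
begin

lemma RAB_eq: "RAB d = borel_of (RA_topology d)" unfolding RAB_def ..

lemma test_plan_radon: "\<pi> \<in> test_plans d m q ==> radon_measure (RA_topology d) \<pi>"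
  unfolding test_plans_def dynamic_plan_def by auto

text \<open>A Lusin type argument: for each rational level, compact sets \<open>C n\<close> and
  \<open>D n\<close> approximate the parts of \<open>A\<close> above and below it. On the
  intersection \<open>K\<close> of the sets \<open>C n \<union> D n\<close> the superlevel set of
  the length is \<open>K \<inter> C n\<close>, hence closed.\<close>

lemma ex_good_compact:
  assumes \<pi>: "radon_measure (RA_topology d) \<pi>" and A: "A \<in> sets \<pi>" "measure \<pi> A > 0"
  obtains K where "good_compact K" "K \<subseteq> A" "K \<in> sets \<pi>" "measure \<pi> K > 0"
proof -
  interpret finite_measure \<pi> using \<pi> unfolding radon_measure_def by auto
  have s\<pi>: "sets \<pi> = sets (RAB d)" using \<pi> unfolding radon_measure_def RAB_def by auto
  have sp: "space \<pi> = RA d" using sets_eq_imp_space_eq[OF s\<pi>] by simp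
  define e where "e = measure \<pi> A"
  have e: "e > 0" using A by (simp add: e_def)
  define r :: "nat => real" where "r = from_nat_into \<rat>"
  have [measurable]: "rlen \<in> borel_measurable \<pi>" using rlen_measurable unfolding measurable_cong_sets[OF s\<pi> refl] .
  define A1 where "A1 n = A \<inter> {Z \<in> space \<pi>. r n \<le> rlen Z}" for n
  define A2 where "A2 n = A \<inter> {Z \<in> space \<pi>. rlen Z < r n}" for n
  have A12: "A1 n \<in> sets \<pi>" "A2 n \<in> sets \<pi>" for n using A(1) unfolding A1_def A2_def by measurable
  \<comment> \<open>With two approximations per level the errors sum to \<open>e / 2\<close>, which
    leaves at least half of the mass of \<open>A\<close>.\<close>
  have pos: "e / 8 * (1/2) ^ n > 0" for n :: nat using e by simp
  have "\<exists>C. compactin (RA_topology d) C \<and> C \<subseteq> A1 n \<and> measure \<pi> (A1 n - C) < e / 8 * (1/2) ^ n" for n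
    by (rule radon_compact_approx[OF Hausdorff_RA \<pi> A12(1)[of n] pos[of n]]) blast
  then obtain C where C: "\<And>n. compactin (RA_topology d) (C n)" "\<And>n. C n \<subseteq> A1 n" "\<And>n. measure \<pi> (A1 n - C n) < e / 8 * (1/2) ^ n" by metis
  have "\<exists>C. compactin (RA_topology d) C \<and> C \<subseteq> A2 n \<and> measure \<pi> (A2 n - C) < e / 8 * (1/2) ^ n" for n
    by (rule radon_compact_approx[OF Hausdorff_RA \<pi> A12(2)[of n] pos[of n]]) blast
  then obtain D where D: "\<And>n. compactin (RA_topology d) (D n)" "\<And>n. D n \<subseteq> A2 n" "\<And>n. measure \<pi> (A2 n - D n) < e / 8 * (1/2) ^ n" by metis
  have cl: "closedin (RA_topology d) (C n)" "closedin (RA_topology d) (D n)" for n using C(1) D(1) compactin_RA_closed by auto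
  have CDm: "C n \<in> sets \<pi>" "D n \<in> sets \<pi>" for n using cl closedin_sets_RAB s\<pi> by auto
  define K where "K = (\<Inter>n. C n \<union> D n)"
  have Kc: "closedin (RA_topology d) K" unfolding K_def using cl by (intro closedin_Inter) auto
  have "compactin (RA_topology d) (C 0 \<union> D 0)" using C(1) D(1) by (rule compactin_Un)
  then have Kco: "compactin (RA_topology d) K" by (rule closed_compactin) (use Kc in \<open>auto simp: K_def\<close>)
  have "closedin (RA_topology d) {Z \<in> K. q \<le> rlen Z}" if q: "q \<in> \<rat>" for q
  proof -
    obtain n where n: "r n = q" unfolding r_def using from_nat_into_surj[OF countable_rat q] by metis
    have "{Z \<in> K. q \<le> rlen Z} = K \<inter> C n"
      unfolding K_def using C(2)[of n] D(2)[of n] n unfolding A1_def A2_def by fastforce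
    then show ?thesis using Kc cl by auto
  qed
  then have good: "good_compact K" unfolding good_compact_def using Kco by auto
  define G where "G n = (A1 n - C n) \<union> (A2 n - D n)" for n
  have Gm: "G n \<in> sets \<pi>" for n unfolding G_def using A12 CDm by auto
  have Gle: "measure \<pi> (G n) \<le> e / 4 * (1/2) ^ n" for n
  proof -
    have "measure \<pi> (G n) \<le> measure \<pi> (A1 n - C n) + measure \<pi> (A2 n - D n)"
      unfolding G_def by (rule measure_Un_le) (use A12 CDm in auto)
    then show ?thesis using C(3)[of n] D(3)[of n] by simp
  qed
  have geo: "(\<lambda>i. e / 4 * (1/2) ^ i) sums (e / 4 * (1 / (1 - 1/2)))" by (intro sums_mult geometric_sums) auto
  have sG: "summable (\<lambda>i. measure \<pi> (G i))"
    by (rule summable_comparison_test'[OF sums_summable[OF geo], of 0]) (use Gle in auto)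
  have "A - K \<subseteq> (\<Union>n. G n)"
  proof
    fix Z assume g: "Z \<in> A - K"
    then obtain n where "Z \<notin> C n" "Z \<notin> D n" unfolding K_def by auto
    then show "Z \<in> (\<Union>n. G n)" using g sets.sets_into_space[OF A(1)] unfolding G_def A1_def A2_def by force
  qed
  then have "measure \<pi> (A - K) \<le> measure \<pi> (\<Union>n. G n)" by (rule finite_measure_mono) (use Gm in auto)
  also have "... \<le> (\<Sum>i. measure \<pi> (G i))" by (rule finite_measure_subadditive_countably) (use Gm sG in auto)
  also have "... \<le> (\<Sum>i. e / 4 * (1/2) ^ i)" by (rule suminf_le) (use Gle sG sums_summable[OF geo] in auto)
  also have "... = e / 2" using sums_unique[OF geo] by simp
  finally have "measure \<pi> (A - K) \<le> e / 2" .
  moreover have KA: "K \<subseteq> A" unfolding K_def using C(2) D(2) unfolding A1_def A2_def by blast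
  moreover have Km: "K \<in> sets \<pi>" using closedin_sets_RAB[OF Kc] s\<pi> by simp
  ultimately have "measure \<pi> K \<ge> e / 2" using finite_measure_Diff[OF A(1) Km KA] by (simp add: e_def)
  then show ?thesis using that[OF good KA Km] e by simp
qed

text \<open>Null sets of \<open>m\<close> remain null, so exhaustions by compact sets are
  inherited.\<close>

lemma radon_density:
  assumes \<rho>: "integrable m \<rho>" "\<And>x. 0 \<le> \<rho> x"
  shows "radon_measure euclidean (density m (\<lambda>x. ennreal (\<rho> x)))"
proof (rule radon_measureI)
  have sm: "sets m = sets (borel_of euclidean)" using radon_m unfolding radon_measure_def by auto
  then show "sets (density m (\<lambda>x. ennreal (\<rho> x))) = sets (borel_of euclidean)" by simp
  show "Hausdorff_space (euclidean :: 'a topology)" by (rule Hausdorff_euclidean)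
  have \<rho>m: "\<rho> \<in> borel_measurable m" using \<rho>(1) by auto
  have "emeasure (density m (\<lambda>x. ennreal (\<rho> x))) UNIV = ennreal (\<integral>x. \<rho> x \<partial>m)"
    using \<rho>m nn_integral_eq_integral[OF \<rho>(1)] \<rho>(2) by (subst emeasure_density) auto
  then show "finite_measure (density m (\<lambda>x. ennreal (\<rho> x)))" by (intro finite_measureI) simp
  fix V :: "'a set" assume "openin euclidean V"
  then have V: "V \<in> sets m" by simp
  obtain C :: "nat => 'a set" where C: "\<And>i. compactin euclidean (C i) \<and> C i \<subseteq> V" "emeasure m (V - (\<Union>i. C i)) = 0"
    using radon_sigma_compact[OF Hausdorff_euclidean radon_m V] by metis
  have "C i \<in> sets m" for i using C(1)[of i] by (auto intro: borel_compact)
  then have "V - (\<Union>i. C i) \<in> null_sets m" using V C(2) by (intro null_setsI) auto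
  then have "V - (\<Union>i. C i) \<in> null_sets (density m (\<lambda>x. ennreal (\<rho> x)))"
    using absolutely_continuousI_density[of "\<lambda>x. ennreal (\<rho> x)" m] \<rho>m unfolding absolutely_continuous_def by auto
  then show "\<exists>C::nat => 'a set. (\<forall>i. compactin euclidean (C i) \<and> C i \<subseteq> V) \<and> emeasure (density m (\<lambda>x. ennreal (\<rho> x))) (V - (\<Union>i. C i)) = 0"
    using C(1) by (intro exI[of _ C]) auto
qed

lemma plan_lint:
  assumes plan: "arc_plan \<pi> \<rho> \<rho>0 \<rho>1" and f: "bdd_borel f"
  shows "(\<integral>Z. lint f Z \<partial>\<pi>) = (\<integral>x. f x * \<rho> x \<partial>m)"
proof -
  obtain B where B: "\<And>x. \<bar>f x\<bar> \<le> B" using f unfolding bdd_borel_def by auto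
  have B0: "0 \<le> B" using B[of undefined] by linarith
  have c: "bdd_borel (\<lambda>_. B)" "bdd_borel (\<lambda>x. f x + B)"
  proof -
    show "bdd_borel (\<lambda>_. B)" unfolding bdd_borel_def by auto
    have "\<bar>f x + B\<bar> \<le> 2 * B" for x using B[of x] by linarith
    then show "bdd_borel (\<lambda>x. f x + B)" using bdd_borel_measurable[OF f] unfolding bdd_borel_def by auto
  qed
  have nn: "\<And>x. 0 \<le> f x + B" using B by (metis abs_le_iff add.commute add_increasing2 diff_ge_0_iff_ge diff_minus_eq_add minus_le_iff order_refl)
  note P = plan_lint_nonneg[OF plan c(2) nn] and Q = plan_lint_nonneg[OF plan c(1) B0]
  have "lint f Z = lint (\<lambda>x. f x + B) Z - lint (\<lambda>_. B) Z" if "Z \<in> space \<pi>" for Z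
  proof -
    have G: "Z \<in> RA d" using that plan_space[OF plan] by simp
    show ?thesis unfolding lint_def
      by (subst Bochner_Integration.integral_diff[symmetric, OF lint_integrable[OF c(2) G] lint_integrable[OF c(1) G]])
        (auto simp: algebra_simps)
  qed
  then have "(\<integral>Z. lint f Z \<partial>\<pi>) = (\<integral>Z. lint (\<lambda>x. f x + B) Z - lint (\<lambda>_. B) Z \<partial>\<pi>)" by (rule Bochner_Integration.integral_cong[OF refl])
  also have "... = (\<integral>x. (f x + B) * \<rho> x \<partial>m) - (\<integral>x. B * \<rho> x \<partial>m)" using P Q by simp
  also have "(\<integral>x. (f x + B) * \<rho> x \<partial>m) - (\<integral>x. B * \<rho> x \<partial>m) = (\<integral>x. f x * \<rho> x \<partial>m)"
  proof -
    have i: "integrable m (\<lambda>x. f x * \<rho> x)" by (rule integrable_bounded_mult[OF plan_dens_integrable(1)[OF plan] bdd_borel_measurable[OF f] B])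
    have "(\<integral>x. (f x + B) * \<rho> x \<partial>m) = (\<integral>x. f x * \<rho> x + B * \<rho> x \<partial>m)" by (simp add: distrib_right)
    also have "... = (\<integral>x. f x * \<rho> x \<partial>m) + (\<integral>x. B * \<rho> x \<partial>m)" using i plan_dens_integrable(1)[OF plan] by simp
    finally show ?thesis by simp
  qed
  finally show ?thesis .
qed

lemma arc_integral_lint: "arc_integral d Z f = lint f Z"
proof -
  have "set_lebesgue_integral lborel {0..1} (\<lambda>t. f (rep Z t)) = set_lebesgue_integral lborel {0..1} (\<lambda>t. f (crep Z t))"
    by (rule set_lebesgue_integral_cong) (auto simp: crep_eq)
  then have "arc_integral d Z f = rlen Z * (\<integral>t. indicator {0..1} t * f (crep Z t) \<partial>lborel)"
    unfolding arc_integral_def rlen_def set_lebesgue_integral_def by simp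
  also have "... = lint f Z" unfolding lint_def
    by (subst integral_mult_right_zero[symmetric]) (auto simp: ac_simps)
  finally show ?thesis .
qed

text \<open>A single function \<open>R\<close> dominates all three measures, so their densities lie
  below it and inherit membership in \<open>Lp\<close>. The integral of the length is the mass of
  the barycenter and therefore finite.\<close>

lemma test_planI:
  assumes \<Lambda>: "radon_measure (RA_topology d) \<Lambda>" and R: "R \<in> Lp m q" "\<And>x. 0 \<le> R x" "integrable m R" and q: "0 \<le> q"
    and len: "\<And>B. B \<in> sets borel ==> (\<integral>\<^sup>+Z. kint len_kernel Z (indicator B) \<partial>\<Lambda>) \<le> (\<integral>\<^sup>+x\<in>B. ennreal (R x) \<partial>m)"
    and e0: "\<And>B. B \<in> sets borel ==> (\<integral>\<^sup>+Z. indicator B (rep Z 0) \<partial>\<Lambda>) \<le> (\<integral>\<^sup>+x\<in>B. ennreal (R x) \<partial>m)"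
    and e1: "\<And>B. B \<in> sets borel ==> (\<integral>\<^sup>+Z. indicator B (rep Z 1) \<partial>\<Lambda>) \<le> (\<integral>\<^sup>+x\<in>B. ennreal (R x) \<partial>m)"
  shows "\<Lambda> \<in> test_plans d m q"
proof -
  have s: "sets \<Lambda> = sets (RAB d)" and fin: "finite_measure \<Lambda>" using \<Lambda> unfolding radon_measure_def RAB_def by auto
  have sp: "space \<Lambda> = RA d" using sets_eq_imp_space_eq[OF s] by simp
  obtain \<rho> \<rho>0 \<rho>1 where plan: "arc_plan \<Lambda> \<rho> \<rho>0 \<rho>1" and le: "\<And>x. \<rho> x \<le> R x" "\<And>x. \<rho>0 x \<le> R x" "\<And>x. \<rho>1 x \<le> R x"
    using ex_arc_plan[OF s fin R(2,3) R(2,3) R(2,3) len e0 e1] by metis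
  note nn = plan_dens_nonneg[OF plan] and di = plan_dens_integrable[OF plan] and dm = plan_dens_measurable[OF plan]
  have LR: "r \<in> Lp m q" if "r \<in> borel_measurable borel" "\<And>x. 0 \<le> r x" "\<And>x. r x \<le> R x" for r
    by (rule Lp_dominated[OF R(1)]) (use that q in \<open>auto simp: meas_m intro: AE_I2 order_trans[OF _ abs_ge_self]\<close>)
  note r = LR[OF dm(1) nn(1) le(1)] and r0 = LR[OF dm(2) nn(2) le(2)] and r1 = LR[OF dm(3) nn(3) le(3)]
  have ac: "ac_with_Lp_density m q (density m (\<lambda>x. ennreal (r x)))" if "r \<in> Lp m q" "\<And>x. 0 \<le> r x" for r
    unfolding ac_with_Lp_density_def Lp_nonneg_def using that
    by (auto simp: Lp_def intro!: absolutely_continuousI_density)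
  have "(\<integral>\<^sup>+Z. arc_length d Z \<partial>\<Lambda>) = (\<integral>\<^sup>+Z. kint len_kernel Z (\<lambda>_. 1) \<partial>\<Lambda>)"
    by (rule nn_integral_cong) (use sp in \<open>auto simp: kint_len_one arc_length_eq\<close>)
  also have "... = ennreal (\<integral>x. \<rho> x \<partial>m)" using plan_kint[OF plan, of "\<lambda>_. 1"] nn nn_integral_eq_integral[OF di(1)] by simp
  finally have dp: "dynamic_plan d \<Lambda>" unfolding dynamic_plan_def using \<Lambda> by simp
  have "is_barycenter d \<Lambda> (density m (\<lambda>x. ennreal (\<rho> x)))" unfolding is_barycenter_def
  proof (intro conjI ballI impI radon_density di(1) nn(1))
    fix f :: "'a => real" assume f: "f \<in> borel_measurable borel" "bounded (range f)"
    then have b: "bdd_borel f" unfolding bdd_borel_def bounded_iff by auto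
    have "(\<integral>x. f x \<partial>density m (\<lambda>x. ennreal (\<rho> x))) = (\<integral>x. \<rho> x * f x \<partial>m)"
      using f(1) dm(1) nn(1) by (subst integral_density) (auto simp: meas_m)
    also have "... = (\<integral>Z. lint f Z \<partial>\<Lambda>)" using plan_lint[OF plan b] by (simp add: mult.commute)
    also have "... = (\<integral>Z. arc_integral d Z f \<partial>\<Lambda>)" by (rule Bochner_Integration.integral_cong) (use sp in \<open>auto simp: arc_integral_lint\<close>)
    finally show "(\<integral>x. f x \<partial>density m (\<lambda>x. ennreal (\<rho> x))) = (\<integral>Z. arc_integral d Z f \<partial>\<Lambda>)" .
  qed
  moreover have "arc_eval d t = (\<lambda>Z. rep Z t)" for t unfolding arc_eval_def[abs_def] ..
  ultimately show ?thesis
    unfolding test_plans_def using dp ac[OF r nn(1)] ac[OF r0 nn(2)] ac[OF r1 nn(3)] plan_distr[OF plan] by auto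
qed
end

section \<open>The distribution of random subarcs\<close>

context emtm
begin

text \<open>Clamping sends \<open>[-1,0]\<close> and \<open>[1,2]\<close> to the two ends of the
  arc, so each end carries weight 1 and the total mass is 3. This makes the values of
  \<open>f\<close> at the ends visible to statements that hold for almost every time.\<close>

abbreviation \<beta>1 :: "real measure" where "\<beta>1 \<equiv> density lborel (indicator {-1..2})"

lemma \<beta>1: "emeasure \<beta>1 UNIV = 3" "finite_measure \<beta>1"
proof -
  show "emeasure \<beta>1 UNIV = 3" by (subst emeasure_density) (auto simp: ennreal_numeral)
  then show "finite_measure \<beta>1" by (intro finite_measureI) simp
qed

lemma nn_integral_\<beta>1: "h \<in> borel_measurable borel ==> (\<integral>\<^sup>+s. h s \<partial>\<beta>1) = (\<integral>\<^sup>+s. indicator {-1..2} s * h s \<partial>lborel)"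
  by (rule nn_integral_density) auto

text \<open>The outer intervals give the end points with weight 1; inside, time is converted into
  length at the price \<open>1 / rlen Z \<le> 1 / l\<close>. The summand 1 makes the factor at least
  1, so the same expression also dominates the length measure of a subarc.\<close>

lemma nn_integral_crep_\<beta>1:
  assumes G: "Z \<in> RA d" and u: "u \<in> borel_measurable borel" and l: "0 < l" "l \<le> rlen Z"
  shows "(\<integral>\<^sup>+s. u (crep Z s) \<partial>\<beta>1) \<le> u (rep Z 0) + u (rep Z 1) + ennreal (1 + 1 / l) * kint len_kernel Z u"
proof -
  note cm = measurable_compose[OF crep_measurable[OF G] u]
  have km: "(\<lambda>t. len_kernel Z t * u (crep Z t) * indicator {0..1} t) \<in> borel_measurable lborel"
    unfolding len_kernel_def using cm by measurable
  let ?F = "\<lambda>s. indicator {-1..0} s * u (rep Z 0) + (indicator {1..2} s * u (rep Z 1)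
        + ennreal (1 + 1 / l) * (len_kernel Z s * u (crep Z s) * indicator {0..1} s))"
  have "indicator {-1..2} s * u (crep Z s) \<le> ?F s" for s :: real
  proof -
    consider "s < -1 \<or> s > 2" | "-1 \<le> s" "s < 0" | "0 \<le> s" "s \<le> 1" | "1 < s" "s \<le> 2" by linarith
    then show ?thesis
    proof cases
      case 3
      have "1 \<le> ennreal ((1 + 1 / l) * rlen Z)"
      proof -
        have "1 \<le> 1 / l * rlen Z" using l by (simp add: field_simps)
        also have "... \<le> (1 + 1 / l) * rlen Z" by (simp add: distrib_right)
        finally show ?thesis by (simp add: ennreal_ge_1)
      qed
      then have "1 * u (crep Z s) \<le> ennreal ((1 + 1 / l) * rlen Z) * u (crep Z s)" by (rule mult_right_mono) simp
      also have "... = ennreal (1 + 1 / l) * (len_kernel Z s * u (crep Z s) * indicator {0..1} s)"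
        using 3 l by (simp add: ennreal_mult len_kernel_def mult.assoc)
      finally show ?thesis using 3 by (simp add: add_increasing)
    qed (auto simp: crep_def add_increasing2)
  qed
  then have "(\<integral>\<^sup>+s. indicator {-1..2} s * u (crep Z s) \<partial>lborel) \<le> (\<integral>\<^sup>+s. ?F s \<partial>lborel)" by (intro nn_integral_mono) auto
  also have "... = u (rep Z 0) + (u (rep Z 1) + ennreal (1 + 1 / l) * kint len_kernel Z u)"
    unfolding kint_def using km by (simp add: nn_integral_add nn_integral_cmult nn_integral_multc)
  finally show ?thesis unfolding nn_integral_\<beta>1[OF cm] by (simp add: add.assoc)
qed

text \<open>A subarc has no more length measure than the whole arc, and its ends are points of the
  arc at random times, controlled by \<open>nn_integral_crep_\<beta>1\<close>. So a combination of
  the old densities dominates all three measures, while continuity of \<open>subarc\<close> on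
  \<open>K\<close> gives Radon regularity.\<close>

lemma subarc_plan:
  assumes \<pi>: "\<pi> \<in> test_plans d m q" and q: "1 < q" and K: "good_compact K" and l: "0 < l" "\<And>Z. Z \<in> K ==> l \<le> rlen Z"
  shows "(\<lambda>p. subarc (fst p) (snd p)) \<in> measurable (restrict_space \<pi> K \<Otimes>\<^sub>M (\<beta>1 \<Otimes>\<^sub>M \<beta>1)) (RAB d)" (is "?\<Phi> \<in> measurable ?\<nu> _")
    and "distr (restrict_space \<pi> K \<Otimes>\<^sub>M (\<beta>1 \<Otimes>\<^sub>M \<beta>1)) (RAB d) (\<lambda>p. subarc (fst p) (snd p)) \<in> test_plans d m q" (is "?\<Lambda> \<in> _")
proof -
  note rad = test_plan_radon[OF \<pi>]
  have s\<pi>: "sets \<pi> = sets (RAB d)" by (rule test_plan_RAB[OF \<pi>])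
  have sp: "space \<pi> = RA d" using sets_eq_imp_space_eq[OF s\<pi>] by simp
  have KR: "K \<subseteq> RA d" by (rule good_compact_RA[OF K])
  have Km: "K \<in> sets \<pi>" using K closedin_sets_RAB[OF compactin_RA_closed] s\<pi> unfolding good_compact_def by auto
  interpret pi: finite_measure \<pi> using rad unfolding radon_measure_def by auto
  interpret b1: finite_measure \<beta>1 by (rule \<beta>1(2))
  interpret bb: pair_sigma_finite \<beta>1 \<beta>1 ..
  let ?\<alpha> = "restrict_space \<pi> K" and ?\<beta> = "\<beta>1 \<Otimes>\<^sub>M \<beta>1" and ?S = "subtopology (RA_topology d) K"
  have b9: "emeasure ?\<beta> UNIV = 9"
    using b1.emeasure_pair_measure_Times[of UNIV \<beta>1 UNIV] \<beta>1(1) by simp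
  have s\<beta>: "sets ?\<beta> = sets borel"
    by (metis borel_prod sets_density sets_lborel sets_pair_measure_cong)
  have sp\<beta>: "space ?\<beta> = UNIV" by (simp add: space_pair_measure)
  have fin\<beta>: "finite_measure ?\<beta>" by (intro finite_measureI) (simp add: sp\<beta> b9)
  interpret bt: finite_measure ?\<beta> by (rule fin\<beta>)
  have sp\<alpha>: "space ?\<alpha> = K" using KR sp by (auto simp: space_restrict_space)
  have KI: "K \<inter> space \<pi> \<in> sets \<pi>" using Km by auto
  have fin\<alpha>: "finite_measure ?\<alpha>"
    using KI by (intro finite_measureI) (simp add: sp\<alpha> emeasure_restrict_space)
  have R: "?\<Phi> \<in> measurable (?\<alpha> \<Otimes>\<^sub>M ?\<beta>) (borel_of (RA_topology d))" "radon_measure (RA_topology d) (distr (?\<alpha> \<Otimes>\<^sub>M ?\<beta>) (borel_of (RA_topology d)) ?\<Phi>)"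
  proof -
    have op: "openin ?S U ==> U \<in> sets ?\<alpha> \<and> U \<in> sets \<pi> \<and> U \<subseteq> K" for U
      unfolding openin_subtopology using openin_sets_RAB s\<pi> Km by (auto simp: sets_restrict_space image_iff Int_commute)
    have ap: "\<exists>C::nat => 'a arc set. (\<forall>i. compactin ?S (C i) \<and> C i \<subseteq> U \<and> C i \<in> sets ?\<alpha>) \<and> emeasure ?\<alpha> (U - (\<Union>i. C i)) = 0" if U: "openin ?S U" for U
    proof -
      obtain C :: "nat => 'a arc set" where C: "\<And>i. compactin (RA_topology d) (C i) \<and> C i \<subseteq> U" "emeasure \<pi> (U - (\<Union>i. C i)) = 0"
        using radon_sigma_compact[OF Hausdorff_RA rad, of U] op[OF U] by metis
      have Cm: "C i \<in> sets \<pi>" "C i \<subseteq> K" for i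
        using C(1)[of i] op[OF U] closedin_sets_RAB[OF compactin_RA_closed] s\<pi> by auto
      then have "C i \<in> sets ?\<alpha>" for i by (auto simp: sets_restrict_space_iff[OF KI])
      moreover have "emeasure ?\<alpha> (U - (\<Union>i. C i)) = 0"
        using C(2) op[OF U] by (subst emeasure_restrict_space[OF KI]) auto
      ultimately show ?thesis using C(1) Cm by (intro exI[of _ C]) (auto simp: compactin_subtopology)
    qed
    have sS: "space ?\<alpha> = topspace ?S" using sp\<alpha> KR topspace_RA[of d] by auto
    show "?\<Phi> \<in> measurable (?\<alpha> \<Otimes>\<^sub>M ?\<beta>) (borel_of (RA_topology d))" "radon_measure (RA_topology d) (distr (?\<alpha> \<Otimes>\<^sub>M ?\<beta>) (borel_of (RA_topology d)) ?\<Phi>)"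
      using radon_distr_prod[OF Hausdorff_RA subarc_continuous[OF K] fin\<alpha> sS _ ap s\<beta> fin\<beta>] op by blast+
  qed
  show \<Phi>m: "?\<Phi> \<in> measurable ?\<nu> (RAB d)" using R(1) unfolding RAB_eq .
  obtain \<rho> \<rho>0 \<rho>1 where plan: "arc_plan \<pi> \<rho> \<rho>0 \<rho>1" and Lr: "\<rho> \<in> Lp m q" "\<rho>0 \<in> Lp m q" "\<rho>1 \<in> Lp m q"
    using test_plan_arc_plan[OF \<pi> q] by metis
  note nn = plan_dens_nonneg[OF plan] and di = plan_dens_integrable[OF plan] and dm = plan_dens_measurable[OF plan]
  \<comment> \<open>The factor 9 is the total mass of the distribution of the pair of times.\<close>
  define R0 where "R0 x = 9 * (\<rho>0 x + (\<rho>1 x + (1 + 1 / l) * \<rho> x))" for x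
  have l0: "0 \<le> 1 + 1 / l" using l by simp
  have R0: "R0 \<in> Lp m q" "\<And>x. 0 \<le> R0 x" "integrable m R0"
    unfolding R0_def[abs_def] using nn di Lr l0 q by (auto intro!: Lp_cmult Lp_add_nonneg)
  define T where "T u Z = u (rep Z 0) + u (rep Z 1) + ennreal (1 + 1 / l) * kint len_kernel Z u" for u and Z
  have Tle: "(\<integral>\<^sup>+Z. F Z \<partial>?\<Lambda>) \<le> (\<integral>\<^sup>+x\<in>B. ennreal (R0 x) \<partial>m)"
    if B: "B \<in> sets borel" and F: "F \<in> borel_measurable (RAB d)"
      and le: "\<And>Z. Z \<in> K ==> (\<integral>\<^sup>+z. F (subarc Z z) \<partial>?\<beta>) \<le> 9 * T (indicator B) Z" for F B
  proof -
    let ?u = "indicator B :: 'a => ennreal"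
    have um [measurable]: "?u \<in> borel_measurable borel" using B by simp
    have "(\<integral>\<^sup>+Z. F Z \<partial>?\<Lambda>) = (\<integral>\<^sup>+p. F (?\<Phi> p) \<partial>?\<nu>)" by (rule nn_integral_distr) (use \<Phi>m F in auto)
    also have "... = (\<integral>\<^sup>+Z. (\<integral>\<^sup>+z. F (?\<Phi> (Z, z)) \<partial>?\<beta>) \<partial>?\<alpha>)"
      by (rule sigma_finite_measure.nn_integral_fst[OF finite_measure.axioms(1)[OF fin\<beta>], symmetric]) (rule measurable_compose[OF \<Phi>m F])
    also have "... \<le> (\<integral>\<^sup>+Z. 9 * T ?u Z \<partial>?\<alpha>)" by (rule nn_integral_mono) (use le sp\<alpha> in auto)
    also have "... = (\<integral>\<^sup>+Z. 9 * T ?u Z * indicator K Z \<partial>\<pi>)" by (rule nn_integral_restrict_space[OF KI])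
    also have "... \<le> (\<integral>\<^sup>+Z. 9 * T ?u Z \<partial>\<pi>)" by (rule nn_integral_mono) (auto simp: indicator_def)
    also have "... = 9 * ((\<integral>\<^sup>+Z. ?u (rep Z 0) \<partial>\<pi>) + (\<integral>\<^sup>+Z. ?u (rep Z 1) \<partial>\<pi>) + ennreal (1 + 1 / l) * (\<integral>\<^sup>+Z. kint len_kernel Z ?u \<partial>\<pi>))"
    proof -
      have [measurable]: "(\<lambda>Z. ?u (rep Z 0)) \<in> borel_measurable \<pi>" "(\<lambda>Z. ?u (rep Z 1)) \<in> borel_measurable \<pi>"
        using measurable_compose[OF endpoint_measurable(1) um] measurable_compose[OF endpoint_measurable(2) um] unfolding plan_meas[OF plan] by auto
      have [measurable]: "(\<lambda>Z. kint len_kernel Z ?u) \<in> borel_measurable \<pi>"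
        using kint_measurable[OF arc_kernel_len um] unfolding plan_meas[OF plan] .
      show ?thesis unfolding T_def by (simp add: nn_integral_cmult nn_integral_add)
    qed
    also have "... = 9 * ((\<integral>\<^sup>+x. ennreal (\<rho>0 x) * ?u x \<partial>m) + (\<integral>\<^sup>+x. ennreal (\<rho>1 x) * ?u x \<partial>m) + ennreal (1 + 1 / l) * (\<integral>\<^sup>+x. ennreal (\<rho> x) * ?u x \<partial>m))"
      unfolding plan_kint[OF plan um] plan_end0[OF plan um] plan_end1[OF plan um] ..
    also have "... = (\<integral>\<^sup>+x. 9 * (ennreal (\<rho>0 x) * ?u x + ennreal (\<rho>1 x) * ?u x + ennreal (1 + 1 / l) * (ennreal (\<rho> x) * ?u x)) \<partial>m)"
    proof -
      have [measurable]: "\<rho> \<in> borel_measurable m" "\<rho>0 \<in> borel_measurable m" "\<rho>1 \<in> borel_measurable m" "?u \<in> borel_measurable m"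
        using dm um by (auto simp: meas_m)
      show ?thesis by (simp add: nn_integral_cmult nn_integral_add)
    qed
    also have "... = (\<integral>\<^sup>+x\<in>B. ennreal (R0 x) \<partial>m)"
    proof (rule nn_integral_cong)
      fix x
      have "ennreal (R0 x) = 9 * (ennreal (\<rho>0 x) + ennreal (\<rho>1 x) + ennreal (1 + 1 / l) * ennreal (\<rho> x))"
        unfolding R0_def using nn[of x] l0 by (simp add: ennreal_mult ennreal_plus ennreal_numeral add.assoc del: ennreal_plus[symmetric])
      then show "9 * (ennreal (\<rho>0 x) * ?u x + ennreal (\<rho>1 x) * ?u x + ennreal (1 + 1 / l) * (ennreal (\<rho> x) * ?u x)) = ennreal (R0 x) * ?u x"
        by (cases "x \<in> B") auto
    qed
    finally show ?thesis .
  qed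
  have ends: "(\<integral>\<^sup>+z. indicator B (crep Z (f z)) \<partial>?\<beta>) \<le> 9 * T (indicator B) Z"
    if B: "B \<in> sets borel" and G: "Z \<in> K" and f: "\<And>z. crep Z (f z) = crep Z (fst z) \<or> crep Z (f z) = crep Z (snd z)" for B Z and f :: "real \<times> real => real"
  proof -
    have um [measurable]: "(indicator B :: 'a => ennreal) \<in> borel_measurable borel" using B by simp
    have GR: "Z \<in> RA d" using G KR by auto
    define h :: "real => ennreal" where "h s = indicator B (crep Z s)" for s
    have hm [measurable]: "h \<in> borel_measurable borel" unfolding h_def[abs_def] using measurable_compose[OF crep_measurable[OF GR] um] .
    define J where "J = (\<integral>\<^sup>+s. h s \<partial>\<beta>1)"
    have J: "J \<le> T (indicator B) Z" unfolding J_def h_def T_def by (rule nn_integral_crep_\<beta>1[OF GR um l(1) l(2)[OF G]])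
    have "(\<integral>\<^sup>+z. indicator B (crep Z (f z)) \<partial>?\<beta>) \<le> (\<integral>\<^sup>+z. h (fst z) + h (snd z) \<partial>?\<beta>)"
    proof (rule nn_integral_mono)
      fix z
      show "indicator B (crep Z (f z)) \<le> h (fst z) + h (snd z)" using f[of z] unfolding h_def by (auto simp: add_increasing add_increasing2)
    qed
    also have "... = (\<integral>\<^sup>+s. (\<integral>\<^sup>+t. h (fst (s, t)) + h (snd (s, t)) \<partial>\<beta>1) \<partial>\<beta>1)"
      by (rule b1.nn_integral_fst[symmetric]) measurable
    \<comment> \<open>Either time is integrated out against the mass 3 of the other, which gives
      \<open>6 * J\<close>; rounding up to 9 matches the bound for the length measure.\<close>
    also have "... = (\<integral>\<^sup>+s. 3 * h s + J \<partial>\<beta>1)" by (simp add: nn_integral_add J_def \<beta>1(1) mult.commute)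
    also have "... = 3 * J + J * 3" by (simp add: nn_integral_add nn_integral_cmult J_def[symmetric] \<beta>1(1))
    also have "... = (3 + 3) * J" by (subst distrib_right) (simp add: mult.commute)
    also have "... \<le> 9 * T (indicator B) Z" by (rule mult_mono[OF _ J]) auto
    finally show ?thesis .
  qed
  show "?\<Lambda> \<in> test_plans d m q"
  proof (rule test_planI)
    show "radon_measure (RA_topology d) ?\<Lambda>" using R(2) unfolding RAB_eq .
    show "R0 \<in> Lp m q" "\<And>x. 0 \<le> R0 x" "integrable m R0" "0 \<le> q" using R0 q by auto
    fix B :: "'a set" assume B: "B \<in> sets borel"
    have um [measurable]: "(indicator B :: 'a => ennreal) \<in> borel_measurable borel" using B by simp
    show "(\<integral>\<^sup>+Z. kint len_kernel Z (indicator B) \<partial>?\<Lambda>) \<le> (\<integral>\<^sup>+x\<in>B. ennreal (R0 x) \<partial>m)"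
    proof (rule Tle[OF B kint_measurable[OF arc_kernel_len um]])
      fix Z assume G: "Z \<in> K"
      have "kint len_kernel (subarc Z z) (indicator B) \<le> kint len_kernel Z (indicator B)" for z
      proof -
        have "Z \<in> RA d" using G KR by auto
        then show ?thesis unfolding kint_subarc[OF \<open>Z \<in> RA d\<close> um] unfolding kint_def len_kernel_def
          using lo_hi[of z] by (intro nn_integral_mono mult_left_mono) (auto simp: indicator_def)
      qed
      then have "(\<integral>\<^sup>+z. kint len_kernel (subarc Z z) (indicator B) \<partial>?\<beta>) \<le> (\<integral>\<^sup>+z. kint len_kernel Z (indicator B) \<partial>?\<beta>)" by (rule nn_integral_mono)
      also have "... = 9 * kint len_kernel Z (indicator B)" by (simp add: sp\<beta> b9 mult.commute)
      also have "1 * kint len_kernel Z (indicator B) \<le> ennreal (1 + 1 / l) * kint len_kernel Z (indicator B)"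
        using l by (intro mult_right_mono) (auto simp: ennreal_ge_1)
      then have "9 * kint len_kernel Z (indicator B) \<le> 9 * T (indicator B) Z"
        unfolding T_def by (intro mult_left_mono) (auto intro: add_increasing)
      finally show "(\<integral>\<^sup>+z. kint len_kernel (subarc Z z) (indicator B) \<partial>?\<beta>) \<le> 9 * T (indicator B) Z" .
    qed
    have crepz: "rep (subarc Z z) 0 = crep Z (lo z)" "rep (subarc Z z) 1 = crep Z (hi z)" if "Z \<in> K" for Z z
      using that KR rep_subarc[of Z 0 z] rep_subarc[of Z 1 z] lo_hi[of z] by (auto simp: crep_eq)
    have clamp: "crep Z (lo z) = crep Z (fst z) \<or> crep Z (lo z) = crep Z (snd z)" "crep Z (hi z) = crep Z (fst z) \<or> crep Z (hi z) = crep Z (snd z)" for Z and z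
      unfolding crep_def lo_def hi_def by (auto simp: min_def max_def)
    show "(\<integral>\<^sup>+Z. indicator B (rep Z 0) \<partial>?\<Lambda>) \<le> (\<integral>\<^sup>+x\<in>B. ennreal (R0 x) \<partial>m)"
      by (rule Tle[OF B measurable_compose[OF endpoint_measurable(1) um]]) (simp add: crepz ends[OF B _ clamp(1)])
    show "(\<integral>\<^sup>+Z. indicator B (rep Z 1) \<partial>?\<Lambda>) \<le> (\<integral>\<^sup>+x\<in>B. ennreal (R0 x) \<partial>m)"
      by (rule Tle[OF B measurable_compose[OF endpoint_measurable(2) um]]) (simp add: crepz ends[OF B _ clamp(2)])
  qed
qed

text \<open>What holds almost surely for all test plans holds for almost every random subarc, since
  these are distributed by a test plan; Fubini then separates the arc from the two times.\<close>

lemma subarc_AE: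
  assumes \<pi>: "\<pi> \<in> test_plans d m q" and q: "1 < q" and K: "good_compact K" and l: "0 < l" "\<And>Z. Z \<in> K ==> l \<le> rlen Z"
    and P: "\<And>\<Lambda>. \<Lambda> \<in> test_plans d m q ==> AE Z in \<Lambda>. P Z"
  shows "AE Z in \<pi>. Z \<in> K \<longrightarrow> (AE s in lborel. s \<in> {-1..2} \<longrightarrow> (AE t in lborel. t \<in> {-1..2} \<longrightarrow> P (subarc Z (s, t))))"
proof -
  have s\<pi>: "sets \<pi> = sets (RAB d)" by (rule test_plan_RAB[OF \<pi>])
  have Km: "K \<inter> space \<pi> \<in> sets \<pi>" using K closedin_sets_RAB[OF compactin_RA_closed] s\<pi> unfolding good_compact_def by auto
  interpret pi: finite_measure \<pi> using test_plan_radon[OF \<pi>] unfolding radon_measure_def by auto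
  interpret b1: finite_measure \<beta>1 by (rule \<beta>1(2))
  interpret bb: pair_sigma_finite \<beta>1 \<beta>1 ..
  have "emeasure (restrict_space \<pi> K) (space (restrict_space \<pi> K)) \<noteq> \<infinity>"
    by (subst emeasure_restrict_space[OF Km]) (auto simp: space_restrict_space)
  then have "pair_sigma_finite (restrict_space \<pi> K) (\<beta>1 \<Otimes>\<^sub>M \<beta>1)"
    by (intro pair_sigma_finite.intro finite_measure.axioms(1) finite_measureI bb.P.sigma_finite_measure_axioms)
  note AP = pair_sigma_finite.AE_pair[OF this]
  have "AE p in (restrict_space \<pi> K \<Otimes>\<^sub>M (\<beta>1 \<Otimes>\<^sub>M \<beta>1)). P (subarc (fst p) (snd p))"
    by (rule AE_distrD[OF subarc_plan(1)[OF \<pi> q K l] P[OF subarc_plan(2)[OF \<pi> q K l]]])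
  then have "AE Z in restrict_space \<pi> K. AE z in \<beta>1 \<Otimes>\<^sub>M \<beta>1. P (subarc (fst (Z, z)) (snd (Z, z)))"
    by (rule AP)
  then have "AE Z in restrict_space \<pi> K. AE s in \<beta>1. AE t in \<beta>1. P (subarc Z (s, t))"
  proof eventually_elim
    case (elim Z)
    then have "AE z in \<beta>1 \<Otimes>\<^sub>M \<beta>1. P (subarc Z z)" by simp
    then show ?case by (rule bb.AE_pair)
  qed
  moreover have "0 < (indicator {-1..2} s :: ennreal) \<longleftrightarrow> s \<in> {-1..2}" for s :: real by (simp add: indicator_def)
  ultimately show ?thesis unfolding AE_restrict_space_iff[OF Km] by (simp add: AE_density)
qed
end

section \<open>Infima of weak upper gradients\<close>

lemma AE_lborel_ex:
  fixes a b :: real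
  assumes "AE t in lborel. P t" "a < b"
  obtains t where "a < t" "t < b" "P t"
proof (cases "\<exists>t. a < t \<and> t < b \<and> P t")
  case False
  obtain N where N: "{t \<in> space lborel. \<not> P t} \<subseteq> N" "emeasure lborel N = 0" "N \<in> sets lborel" using assms(1) by (rule AE_E)
  have "{a<..<b} \<subseteq> N" using False N(1) by auto
  then have "emeasure lborel {a<..<b} \<le> emeasure lborel N" using N(3) by (rule emeasure_mono)
  then show ?thesis using N(2) assms(2) by simp
qed (use that in blast)

lemma nn_integral_Ioc_eq_prim:
  assumes h: "integrable lborel h" "\<And>x. 0 \<le> h x" and "a \<le> b"
  shows "(\<integral>\<^sup>+x\<in>{a<..b}. ennreal (h x) \<partial>lborel) = ennreal (prim h b - prim h a)"
  using emeasure_density_Ioc[OF h, of "{a<..b}"] prim_diff[OF h(1) \<open>a \<le> b\<close>] h(1)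
  by (simp add: emeasure_density)

lemma prim_mono:
  assumes h: "integrable lborel h" "\<And>x. 0 \<le> h x" and "a \<le> b" shows "prim h a \<le> prim h b"
proof -
  have "0 \<le> ioc_integral h a b" unfolding set_lebesgue_integral_def using h(2) by (intro Bochner_Integration.integral_nonneg) (auto simp: indicator_def)
  then show ?thesis using prim_diff[OF h(1) \<open>a \<le> b\<close>] by simp
qed

text \<open>The set \<open>S\<close> below has full measure and \<open>g\<close> satisfies on it the bounds for all pairs of points, since
  almost every point in between can be inserted; \<open>g\<close> then extends from \<open>S\<close> to a function with a density.\<close>

lemma increment_le_nn_integral_INF:
  fixes g :: "real => real" and H :: "nat => real => real"
  assumes H: "\<And>n. integrable lborel (H n)" "\<And>n x. 0 \<le> H n x" "\<And>n x. x \<notin> {0<..1} ==> H n x = 0"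
    and g: "\<And>x. x \<le> 0 ==> g x = g 0" "\<And>x. 1 \<le> x ==> g x = g 1"
    and ae: "AE s in lborel. s \<in> {-1..2} \<longrightarrow> (AE t in lborel. t \<in> {-1..2} \<longrightarrow>
      (\<forall>n. ennreal \<bar>g s - g t\<bar> \<le> (\<integral>\<^sup>+x\<in>{min s t<..max s t}. ennreal (H n x) \<partial>lborel)))"
  shows "ennreal \<bar>g 1 - g 0\<bar> \<le> (\<integral>\<^sup>+x\<in>{0<..1}. ennreal (INF n. H n x) \<partial>lborel)"
proof -
  define F where "F n = prim (H n)" for n
  have mono: "F n a \<le> F n b" if "a \<le> b" for n a b unfolding F_def by (rule prim_mono[OF H(1,2) that])
  have Fc: "continuous_on UNIV (F n)" for n unfolding F_def using isCont_prim[OF H(1)] by (simp add: continuous_at_imp_continuous_on)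
  define near where "near s t \<longleftrightarrow> (\<forall>n. \<bar>g s - g t\<bar> \<le> \<bar>F n s - F n t\<bar>)" for s t
  have near: "near s t \<longleftrightarrow> (\<forall>n. ennreal \<bar>g s - g t\<bar> \<le> (\<integral>\<^sup>+x\<in>{min s t<..max s t}. ennreal (H n x) \<partial>lborel))" for s t
  proof -
    have "(\<integral>\<^sup>+x\<in>{min s t<..max s t}. ennreal (H n x) \<partial>lborel) = ennreal \<bar>F n s - F n t\<bar>" for n
      using nn_integral_Ioc_eq_prim[OF H(1,2), of "min s t" "max s t" n] mono[of s t n] mono[of t s n] by (cases "s \<le> t") (auto simp: F_def)
    then show ?thesis unfolding near_def by simp
  qed
  define S where "S = {s \<in> {-1..2}. AE t in lborel. t \<in> {-1..2} \<longrightarrow> near s t}"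
  have aeS: "AE s in lborel. s \<in> {-1..2} \<longrightarrow> s \<in> S" using ae unfolding S_def near by (rule AE_mp) (rule AE_I2, auto)
  have dense: "\<exists>s\<in>S. a < s \<and> s < b" if "-1 \<le> a" "a < b" "b \<le> 2" for a b
    using AE_lborel_ex[OF aeS that(2)] that by (metis atLeastAtMost_iff less_eq_real_def order_trans)
  have S: "\<bar>g s - g s'\<bar> \<le> \<bar>F n s - F n s'\<bar>" if "s \<in> S" "s' \<in> S" for s s' n
  proof -
    have *: "\<bar>g s - g s'\<bar> \<le> \<bar>F n s - F n s'\<bar>" if s: "s \<in> S" "s' \<in> S" "s < s'" for s s'
    proof -
      have "AE t in lborel. t \<in> {-1..2} \<longrightarrow> near s t \<and> near s' t" using s(1,2) unfolding S_def by auto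
      from AE_lborel_ex[OF this s(3)] obtain t where t: "s < t" "t < s'" "t \<in> {-1..2} \<longrightarrow> near s t \<and> near s' t" by blast
      moreover have "t \<in> {-1..2}" using s(1,2) t(1,2) unfolding S_def by auto
      ultimately have "\<bar>g s - g t\<bar> \<le> \<bar>F n s - F n t\<bar>" "\<bar>g s' - g t\<bar> \<le> \<bar>F n s' - F n t\<bar>" unfolding near_def by auto
      then show ?thesis using mono[of s t n] mono[of t s' n] t(1,2) by linarith
    qed
    show ?thesis using *[of s s'] *[of s' s] that by (cases s s' rule: linorder_cases) (auto simp: abs_minus_commute)
  qed
  obtain s0 where s0: "s0 \<in> S" "-1 < s0" "s0 < 0" using dense[of "-1" 0] by auto
  obtain s1 where s1: "s1 \<in> S" "1 < s1" "s1 < 2" using dense[of 1 2] by auto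
  \<comment> \<open>The McShane extension of \<open>g\<close> from \<open>S\<close> for the
    pseudometric \<open>\<bar>F 0 s - F 0 t\<bar>\<close>. The index 0 alone already yields a
    continuous function; the bounds for the other indices follow on the closure of
    \<open>S\<close>.\<close>
  define G where "G t = (INF s\<in>S. g s + \<bar>F 0 s - F 0 t\<bar>)" for t
  have bdd: "bdd_below ((\<lambda>s. g s + \<bar>F 0 s - F 0 t\<bar>) ` S)" for t
  proof (rule bdd_belowI2)
    fix s assume "s \<in> S"
    then show "g s0 - \<bar>F 0 s0 - F 0 t\<bar> \<le> g s + \<bar>F 0 s - F 0 t\<bar>" using S[OF s0(1), of s 0] by linarith
  qed
  have Gle: "G t \<le> g s + \<bar>F 0 s - F 0 t\<bar>" if "s \<in> S" for s t unfolding G_def by (rule cINF_lower[OF bdd that])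
  have Gge: "y \<le> G t" if "\<And>s. s \<in> S ==> y \<le> g s + \<bar>F 0 s - F 0 t\<bar>" for y t
    unfolding G_def by (rule cINF_greatest) (use s0 that in auto)
  have GS: "G s = g s" if "s \<in> S" for s
  proof (rule antisym)
    show "G s \<le> g s" using Gle[OF that, of s] by simp
    show "g s \<le> G s"
    proof (rule Gge)
      fix r assume "r \<in> S"
      then show "g s \<le> g r + \<bar>F 0 r - F 0 s\<bar>" using S[OF that, of r 0] by linarith
    qed
  qed
  have G1: "G a \<le> G b + \<bar>F 0 a - F 0 b\<bar>" for a b
  proof -
    have "G a - \<bar>F 0 a - F 0 b\<bar> \<le> G b"
    proof (rule Gge)
      fix s assume "s \<in> S"
      then show "G a - \<bar>F 0 a - F 0 b\<bar> \<le> g s + \<bar>F 0 s - F 0 b\<bar>" using Gle[of s a] by linarith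
    qed
    then show ?thesis by simp
  qed
  have Gc: "continuous_on UNIV G" unfolding continuous_on_def
  proof
    fix a
    have "((\<lambda>b. F 0 b) \<longlongrightarrow> F 0 a) (at a)" using Fc[of 0] unfolding continuous_on_def by auto
    then have "((\<lambda>b. \<bar>F 0 b - F 0 a\<bar>) \<longlongrightarrow> \<bar>F 0 a - F 0 a\<bar>) (at a)" by (intro tendsto_intros)
    then have "((\<lambda>b. \<bar>F 0 b - F 0 a\<bar>) \<longlongrightarrow> 0) (at a)" by simp
    moreover have "norm (G b - G a) \<le> \<bar>F 0 b - F 0 a\<bar>" for b
      using G1[of a b] G1[of b a] unfolding real_norm_def abs_minus_commute[of "F 0 a"] by linarith
    ultimately have "((\<lambda>b. G b - G a) \<longlongrightarrow> 0) (at a)"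
      by (rule Lim_null_comparison[OF always_eventually[OF allI], rotated])
    then show "(G \<longlongrightarrow> G a) (at a)" by (rule LIM_zero_cancel)
  qed
  have GF: "\<bar>G a - G b\<bar> \<le> \<bar>F n a - F n b\<bar>" if ab: "a \<in> closure S" "b \<in> closure S" for a b n
  proof -
    have c1: "continuous_on UNIV (\<lambda>z :: real \<times> real. \<bar>h (fst z) - h (snd z)\<bar>)" if "continuous_on UNIV h" for h :: "real => real"
      by (intro continuous_intros continuous_on_compose2[OF that]) auto
    have "closed {z. \<bar>G (fst z) - G (snd z)\<bar> \<le> \<bar>F n (fst z) - F n (snd z)\<bar>}"
      by (rule closed_Collect_le[OF c1[OF Gc] c1[OF Fc]])
    moreover have "S \<times> S \<subseteq> {z. \<bar>G (fst z) - G (snd z)\<bar> \<le> \<bar>F n (fst z) - F n (snd z)\<bar>}" using S GS by auto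
    ultimately have "closure (S \<times> S) \<subseteq> {z. \<bar>G (fst z) - G (snd z)\<bar> \<le> \<bar>F n (fst z) - F n (snd z)\<bar>}" by (rule closure_minimal[rotated])
    then show ?thesis using ab unfolding closure_Times by auto
  qed
  have clS: "x \<in> closure S" if "0 \<le> x" "x \<le> 1" for x unfolding closure_approachable
  proof (intro allI impI)
    fix e :: real assume "0 < e"
    then have "- 1 \<le> x" "x < x + min e 1" "x + min e 1 \<le> 2" using that by auto
    then obtain s where "s \<in> S" "x < s" "s < x + min e 1" using dense by blast
    then show "\<exists>y\<in>S. dist y x < e" by (intro bexI[of _ s]) (auto simp: dist_real_def)
  qed
  have zero: "F n b = F n a" if "a \<le> b" "b \<le> 0 \<or> 1 \<le> a" for a b n
  proof -
    have eq: "(\<lambda>x. indicator {a<..b} x *\<^sub>R H n x) = (\<lambda>_. 0)"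
    proof
      fix x show "indicator {a<..b} x *\<^sub>R H n x = 0" using H(3)[of x n] that(2) by (auto simp: indicator_def)
    qed
    have "ioc_integral (H n) a b = 0" unfolding set_lebesgue_integral_def eq by simp
    then show ?thesis using prim_diff[OF H(1)[of n] that(1)] by (simp add: F_def)
  qed
  \<comment> \<open>\<open>H n\<close> vanishes outside \<open>{0<..1}\<close>, so neither
    \<open>g\<close> nor the primitives change between an end and a nearby point of \<open>S\<close>
    beyond it. Here the times outside \<open>[0,1]\<close> pay off.\<close>
  have G01: "G 0 = g 0" "G 1 = g 1"
  proof -
    have "\<bar>G 0 - G s0\<bar> \<le> \<bar>F 0 0 - F 0 s0\<bar>" using clS[of 0] s0(1) closure_subset by (intro GF) auto
    then show "G 0 = g 0" using zero[of s0 0 0] s0 g(1)[of s0] GS[OF s0(1)] by simp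
    have "\<bar>G s1 - G 1\<bar> \<le> \<bar>F 0 s1 - F 0 1\<bar>" using clS[of 1] s1(1) closure_subset by (intro GF) auto
    then show "G 1 = g 1" using zero[of 1 s1 0] s1 g(2)[of s1] GS[OF s1(1)] by simp
  qed
  \<comment> \<open>The estimates are available on \<open>[0,1]\<close>, so the function is frozen
    outside before a density is taken.\<close>
  define c :: "real => real" where "c t = max 0 (min 1 t)" for t
  have GH: "\<bar>G (c b) - G (c a)\<bar> \<le> ioc_integral (H n) a b" if "a \<le> b" for a b n
  proof -
    have "\<bar>G (c b) - G (c a)\<bar> \<le> \<bar>F n (c b) - F n (c a)\<bar>" by (intro GF clS) (auto simp: c_def)
    also have "... = F n (c b) - F n (c a)" using mono[of "c a" "c b" n] that by (auto simp: c_def)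
    also have "... \<le> F n b - F n a"
    proof (cases "c a = c b")
      case False
      then have "a \<le> c a" "c b \<le> b" using that by (auto simp: c_def)
      then show ?thesis using mono[of a "c a" n] mono[of "c b" b n] by linarith
    qed (use mono[OF that, of n] in simp)
    also have "... = ioc_integral (H n) a b" using prim_diff[OF H(1) that] by (simp add: F_def)
    finally show ?thesis .
  qed
  obtain h where h: "has_density (\<lambda>t. G (c t)) h" using ex_density[OF H(1)[of 0] H(2) GH[where n = 0]] by blast
  have hi: "integrable lborel h" using h unfolding has_density_def by auto
  have "AE x in lborel. \<forall>n. \<bar>h x\<bar> \<le> H n x" unfolding AE_all_countable using has_density_abs_le[OF h H(1) GH] by blast
  then have hle: "AE x in lborel. \<bar>h x\<bar> \<le> (INF n. H n x)" by eventually_elim (auto intro: cINF_greatest)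
  have "G (c 1) - G (c 0) = ioc_integral h 0 1" using h unfolding has_density_def by (metis zero_le_one)
  then have "g 1 - g 0 = ioc_integral h 0 1" by (simp add: c_def G01)
  also have "\<bar>...\<bar> \<le> (\<integral>x. \<bar>indicator {0<..1} x * h x\<bar> \<partial>lborel)" unfolding set_lebesgue_integral_def by (simp add: integral_abs_bound)
  finally have "ennreal \<bar>g 1 - g 0\<bar> \<le> ennreal (\<integral>x. \<bar>indicator {0<..1} x * h x\<bar> \<partial>lborel)" by (rule ennreal_leI)
  also have "... = (\<integral>\<^sup>+x. ennreal \<bar>indicator {0<..1} x * h x\<bar> \<partial>lborel)"
    by (rule nn_integral_eq_integral[symmetric]) (use set_integrable_lborel[OF hi, of "{0<..1}"] in \<open>auto simp: set_integrable_def\<close>)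
  also have "... \<le> (\<integral>\<^sup>+x\<in>{0<..1}. ennreal (INF n. H n x) \<partial>lborel)"
    using hle by (intro nn_integral_mono_AE) (auto elim!: eventually_mono simp: indicator_def intro: ennreal_leI)
  finally show ?thesis .
qed

context emtm
begin

lemma subarc_ends:
  assumes G: "Z \<in> RA d"
  shows "\<bar>f (rep (subarc Z (s, t)) 1) - f (rep (subarc Z (s, t)) 0)\<bar> = \<bar>f (crep Z s) - f (crep Z t) :: real\<bar>"
proof -
  have "rep (subarc Z (s, t)) 0 = crep Z (min s t)" "rep (subarc Z (s, t)) 1 = crep Z (max s t)"
    using rep_subarc[OF G, of 0 "(s, t)"] rep_subarc[OF G, of 1 "(s, t)"] by (auto simp: crep_def lo_def hi_def)
  then show ?thesis by (cases "s \<le> t") (auto simp: min_def max_def abs_minus_commute)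
qed

text \<open>Along the arc, bounds for subarcs become bounds for increments of \<open>f\<close> over
  intervals, and the real variable lemma replaces countably many integrands by their infimum.
  Positivity of the length allows the speed to be divided out of the infimum.\<close>

lemma INF_increment_le:
  assumes G: "Z \<in> RA d" and l: "0 < rlen Z" and u: "\<And>n. u n \<in> borel_measurable borel" "\<And>n x. 0 \<le> u n x"
    and fin: "\<And>n. kint len_kernel Z (\<lambda>x. ennreal (u n x)) < \<infinity>"
    and ae: "AE s in lborel. s \<in> {-1..2} \<longrightarrow> (AE t in lborel. t \<in> {-1..2} \<longrightarrow> (\<forall>n::nat.
      ennreal \<bar>f (rep (subarc Z (s, t)) 1) - f (rep (subarc Z (s, t)) 0)\<bar> \<le> kint len_kernel (subarc Z (s, t)) (\<lambda>x. ennreal (u n x))))"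
  shows "ennreal \<bar>f (rep Z 1) - f (rep Z 0)\<bar> \<le> kint len_kernel Z (\<lambda>x. ennreal (INF n. u n x))"
proof -
  define L where "L = rlen Z"
  have L: "L > 0" using l by (simp add: L_def)
  define H where "H n x = indicator {0<..1} x * (L * u n (crep Z x))" for n x
  have H0: "0 \<le> H n x" for n x unfolding H_def using L u(2) by simp
  have cm: "(\<lambda>x. u n (crep Z x)) \<in> borel_measurable borel" for n by (rule measurable_compose[OF crep_measurable[OF G] u(1)])
  have Hm: "H n \<in> borel_measurable borel" for n unfolding H_def[abs_def] using cm by measurable
  have "(\<integral>\<^sup>+x. ennreal (H n x) \<partial>lborel) \<le> kint len_kernel Z (\<lambda>x. ennreal (u n x))" for n
    unfolding kint_def len_kernel_def H_def using L u(2)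
    by (intro nn_integral_mono) (auto simp: indicator_def ennreal_mult L_def)
  then have Hi: "integrable lborel (H n)" for n
    using Hm H0 fin[of n] by (intro integrableI_nonneg) (auto intro: le_less_trans)
  have "ennreal \<bar>f (crep Z 1) - f (crep Z 0)\<bar> \<le> (\<integral>\<^sup>+x\<in>{0<..1}. ennreal (INF n. H n x) \<partial>lborel)"
  proof (rule increment_le_nn_integral_INF[OF Hi H0])
    show "H n x = 0" if "x \<notin> {0<..1}" for n x using that by (simp add: H_def)
    show "f (crep Z x) = f (crep Z 0)" if "x \<le> 0" for x using that by (simp add: crep_def)
    show "f (crep Z x) = f (crep Z 1)" if "1 \<le> x" for x using that by (simp add: crep_def)
    have le: "kint len_kernel (subarc Z (s, t)) (\<lambda>x. ennreal (u n x)) \<le> (\<integral>\<^sup>+x\<in>{min s t<..max s t}. ennreal (H n x) \<partial>lborel)" for s t n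
    proof -
      have "kint len_kernel (subarc Z (s, t)) (\<lambda>x. ennreal (u n x)) = (\<integral>\<^sup>+x\<in>{lo (s, t)..hi (s, t)}. (ennreal L * ennreal (u n (crep Z x))) \<partial>lborel)"
        unfolding L_def by (rule kint_subarc[OF G]) (use u(1) in simp)
      also have "... \<le> (\<integral>\<^sup>+x\<in>{min s t<..max s t}. ennreal (H n x) \<partial>lborel)"
      proof (rule nn_integral_mono_AE)
        show "AE x in lborel. ennreal L * ennreal (u n (crep Z x)) * indicator {lo (s, t)..hi (s, t)} x \<le> ennreal (H n x) * indicator {min s t<..max s t} x"
          using AE_lborel_singleton[of "lo (s, t)"]
        proof eventually_elim
          case (elim x)
          show ?case
          proof (cases "x \<in> {lo (s, t)..hi (s, t)}")
            case True
            then have "x \<in> {0<..1}" "x \<in> {min s t<..max s t}" using elim unfolding lo_def hi_def by (auto simp: min_def max_def split: if_splits)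
            then show ?thesis using True L u(2)[of n "crep Z x"] by (simp add: H_def ennreal_mult)
          qed simp
        qed
      qed
      finally show ?thesis .
    qed
    show "AE s in lborel. s \<in> {-1..2} \<longrightarrow> (AE t in lborel. t \<in> {-1..2} \<longrightarrow>
      (\<forall>n. ennreal \<bar>f (crep Z s) - f (crep Z t)\<bar> \<le> (\<integral>\<^sup>+x\<in>{min s t<..max s t}. ennreal (H n x) \<partial>lborel)))"
      using ae
    proof eventually_elim
      case (elim s)
      show ?case
      proof
        assume "s \<in> {-1..2}"
        with elim have "AE t in lborel. t \<in> {-1..2} \<longrightarrow> (\<forall>n.
          ennreal \<bar>f (rep (subarc Z (s, t)) 1) - f (rep (subarc Z (s, t)) 0)\<bar> \<le> kint len_kernel (subarc Z (s, t)) (\<lambda>x. ennreal (u n x)))" by blast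
        then show "AE t in lborel. t \<in> {-1..2} \<longrightarrow> (\<forall>n. ennreal \<bar>f (crep Z s) - f (crep Z t)\<bar> \<le> (\<integral>\<^sup>+x\<in>{min s t<..max s t}. ennreal (H n x) \<partial>lborel))"
          by eventually_elim (use le order_trans in \<open>simp only: subarc_ends[OF G], blast\<close>)
      qed
    qed
  qed
  also have "... \<le> kint len_kernel Z (\<lambda>x. ennreal (INF n. u n x))" unfolding kint_def len_kernel_def
  proof (rule nn_integral_mono)
    fix x :: real
    show "ennreal (INF n. H n x) * indicator {0<..1} x \<le> ennreal (rlen Z) * ennreal (INF n. u n (crep Z x)) * indicator {0..1} x"
    proof (cases "x \<in> {0<..1}")
      case True
      have "(INF n. H n x) / L \<le> (INF n. u n (crep Z x))"
      proof (rule cINF_greatest)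
        fix n
        have "(INF n. H n x) \<le> H n x" by (rule cINF_lower) (use H0 in \<open>auto intro!: bdd_belowI2\<close>)
        then show "(INF n. H n x) / L \<le> u n (crep Z x)" using True L by (simp add: H_def field_simps)
      qed simp
      then have "(INF n. H n x) \<le> L * (INF n. u n (crep Z x))" using L by (simp add: field_simps)
      moreover have "0 \<le> (INF n. u n (crep Z x))" using u(2) by (intro cINF_greatest) auto
      ultimately have "ennreal (INF n. H n x) \<le> ennreal L * ennreal (INF n. u n (crep Z x))" using L by (simp add: ennreal_mult[symmetric] ennreal_leI)
      then show ?thesis using True by (simp add: L_def)
    qed simp
  qed
  finally show ?thesis by (simp add: crep_eq)
qed

text \<open>If the inequality failed with positive measure on arcs of length at least
  \<open>1 / real (Suc k)\<close>, a good compact set of such arcs would have positive measure, and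
  the random subarcs of these arcs would contradict the failure.\<close>

lemma weak_upper_gradient_INF:
  assumes q: "1 < q" and u: "\<And>n::nat. weak_upper_gradient d m q f (u n)"
  shows "weak_upper_gradient d m q f (\<lambda>x. INF n. u n x)"
proof -
  have fm: "f \<in> borel_measurable borel" and um: "\<And>n. u n \<in> borel_measurable borel" and u0: "\<And>n x. 0 \<le> u n x"
    using u unfolding weak_upper_gradient_def by auto
  define v where "v x = (INF n. u n x)" for x
  have bdd: "bdd_below (range (\<lambda>n. u n x))" for x using u0 by (auto intro!: bdd_belowI2)
  have vle: "v x \<le> u n x" for x n unfolding v_def by (rule cINF_lower[OF bdd]) simp
  have v0: "0 \<le> v x" for x unfolding v_def by (rule cINF_greatest) (use u0 in auto)
  have vm: "v \<in> borel_measurable borel" unfolding v_def[abs_def] by (rule borel_measurable_cINF) (use um bdd in auto)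
  define I where "I w Z = kint len_kernel Z (\<lambda>x. ennreal (w x))" for w Z
  define D where "D Z = ennreal \<bar>f (rep Z 1) - f (rep Z 0)\<bar>" for Z
  have Iv: "I v Z \<le> I (u n) Z" for Z n unfolding I_def by (rule kint_mono) (use vle in \<open>auto intro: ennreal_leI\<close>)
  have wug: "AE Z in \<pi>. D Z \<le> I (u n) Z \<and> I (u n) Z < \<infinity>" if \<pi>: "\<pi> \<in> test_plans d m q" for \<pi> n
  proof -
    have sp: "space \<pi> = RA d" using sets_eq_imp_space_eq[OF test_plan_RAB[OF \<pi>]] by simp
    have "AE Z in \<pi>. ennreal \<bar>f (arc_eval d 1 Z) - f (arc_eval d 0 Z)\<bar> \<le> arc_nn_integral d Z (\<lambda>x. ennreal (u n x)) \<and> arc_nn_integral d Z (\<lambda>x. ennreal (u n x)) < \<infinity>"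
      using u[of n] \<pi> unfolding weak_upper_gradient_def by auto
    then show ?thesis using AE_space
    proof eventually_elim
      case (elim Z)
      then show ?case using arc_nn_integral_eq[of Z "\<lambda>x. ennreal (u n x)"] um[of n] sp unfolding D_def I_def arc_eval_def by simp
    qed
  qed
  have main: "AE Z in \<pi>. D Z \<le> I v Z" if \<pi>: "\<pi> \<in> test_plans d m q" for \<pi>
  proof -
    note rad = test_plan_radon[OF \<pi>] and s\<pi> = test_plan_RAB[OF \<pi>]
    have sp: "space \<pi> = RA d" using sets_eq_imp_space_eq[OF s\<pi>] by simp
    interpret finite_measure \<pi> using rad unfolding radon_measure_def by auto
    note mc = measurable_cong_sets[OF s\<pi> refl]
    have [measurable]: "I v \<in> borel_measurable \<pi>" unfolding mc I_def[abs_def] by (rule kint_measurable[OF arc_kernel_len]) (use vm in simp)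
    have [measurable]: "rlen \<in> borel_measurable \<pi>" using rlen_measurable unfolding mc .
    have [measurable]: "D \<in> borel_measurable \<pi>"
      using measurable_compose[OF endpoint_measurable(1) fm] measurable_compose[OF endpoint_measurable(2) fm] unfolding mc D_def[abs_def] by measurable
    \<comment> \<open>The lower bound on the length is what \<open>subarc_plan\<close> requires.
      Arcs of length 0 need no level \<open>k\<close>: almost surely their increment is bounded by
      an integral equal to 0.\<close>
    define Bad where "Bad k = {Z \<in> space \<pi>. \<not> D Z \<le> I v Z \<and> 1 / real (Suc k) \<le> rlen Z}" for k
    have Badm: "Bad k \<in> sets \<pi>" for k unfolding Bad_def by measurable
    have Bad0: "measure \<pi> (Bad k) = 0" for k
    proof (rule ccontr)
      assume "measure \<pi> (Bad k) \<noteq> 0"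
      then have pos: "measure \<pi> (Bad k) > 0" by (simp add: zero_less_measure_iff)
      obtain K where K: "good_compact K" "K \<subseteq> Bad k" "K \<in> sets \<pi>" "measure \<pi> K > 0" using ex_good_compact[OF rad Badm pos] by metis
      have l: "0 < 1 / real (Suc k)" "\<And>Z. Z \<in> K ==> 1 / real (Suc k) \<le> rlen Z" using K(2) unfolding Bad_def by auto
      have ae: "AE Z in \<pi>. Z \<in> K \<longrightarrow> (AE s in lborel. s \<in> {-1..2} \<longrightarrow> (AE t in lborel. t \<in> {-1..2} \<longrightarrow> (\<forall>n. D (subarc Z (s, t)) \<le> I (u n) (subarc Z (s, t)))))"
      proof (rule subarc_AE[OF \<pi> q K(1) l])
        fix \<Lambda> assume L: "\<Lambda> \<in> test_plans d m q"
        show "AE Z in \<Lambda>. \<forall>n. D Z \<le> I (u n) Z" unfolding AE_all_countable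
        proof
          fix n show "AE Z in \<Lambda>. D Z \<le> I (u n) Z" using wug[OF L, of n] by auto
        qed
      qed
      have "AE Z in \<pi>. \<forall>n. I (u n) Z < \<infinity>" unfolding AE_all_countable using wug[OF \<pi>] by auto
      then have "AE Z in \<pi>. Z \<notin> K" using ae
      proof eventually_elim
        case (elim Z)
        show ?case
        proof
          assume GK: "Z \<in> K"
          then have G: "Z \<in> RA d" "0 < rlen Z" "\<not> D Z \<le> I v Z" using K(2) less_le_trans[OF l(1) l(2)[OF GK]] sp unfolding Bad_def by auto
          have "D Z \<le> I v Z" unfolding D_def I_def v_def
            by (rule INF_increment_le[OF G(1,2) um u0]) (use elim GK in \<open>auto simp: D_def I_def\<close>)
          then show False using G(3) by simp
        qed
      qed
      then have "K \<in> null_sets \<pi>" using K(3) by (simp add: AE_iff_null_sets)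
      then show False using K(4) by (simp add: null_setsD1 measure_def)
    qed
    have "Bad k \<in> null_sets \<pi>" for k using Bad0[of k] Badm[of k] by (intro null_setsI) (auto simp: emeasure_eq_measure)
    then have "(\<Union>k. Bad k) \<in> null_sets \<pi>" by (rule null_sets_UN)
    then have "AE Z in \<pi>. Z \<notin> (\<Union>k. Bad k)" by (rule AE_not_in)
    then show ?thesis using wug[OF \<pi>, of 0] AE_space
    proof eventually_elim
      case (elim Z)
      show ?case
      proof (rule ccontr)
        assume bad: "\<not> D Z \<le> I v Z"
        have "rlen Z \<noteq> 0"
        proof
          assume "rlen Z = 0"
          then have "I (u 0) Z = 0" unfolding I_def kint_def len_kernel_def by simp
          then show False using elim(2) bad by simp
        qed
        then obtain k where "1 / real (Suc k) < rlen Z" using nat_approx_posE[of "rlen Z"] rlen_nonneg[of Z] by auto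
        then have "Z \<in> Bad k" unfolding Bad_def using elim(3) bad by (simp add: less_imp_le)
        then show False using elim(1) by blast
      qed
    qed
  qed
  show ?thesis unfolding weak_upper_gradient_def v_def[symmetric]
  proof (intro conjI ballI allI fm vm v0)
    fix \<pi> assume \<pi>: "\<pi> \<in> test_plans d m q"
    have sp: "space \<pi> = RA d" using sets_eq_imp_space_eq[OF test_plan_RAB[OF \<pi>]] by simp
    show "AE Z in \<pi>. ennreal \<bar>f (arc_eval d 1 Z) - f (arc_eval d 0 Z)\<bar> \<le> arc_nn_integral d Z (\<lambda>x. ennreal (v x)) \<and> arc_nn_integral d Z (\<lambda>x. ennreal (v x)) < \<infinity>"
      using main[OF \<pi>] wug[OF \<pi>, of 0] AE_space
    proof eventually_elim
      case (elim Z)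
      then show ?case using arc_nn_integral_eq[of Z "\<lambda>x. ennreal (v x)"] vm sp Iv[of Z 0] le_less_trans unfolding D_def I_def arc_eval_def by auto
    qed
  qed
qed

lemma ex_minimal_weak_upper_gradient:
  assumes q: "1 < q" and p: "0 \<le> p" and W: "W \<in> Lp m p" "weak_upper_gradient d m q f W"
  shows "\<exists>G. G \<in> Lp m p \<and> weak_upper_gradient d m q f G \<and> (\<forall>H. weak_upper_gradient d m q f H \<longrightarrow> (AE x in m. G x \<le> H x))"
proof -
  define S where "S = {G. weak_upper_gradient d m q f G}"
  have S: "S \<noteq> {}" "S \<subseteq> borel_measurable m" "\<And>G. G \<in> S ==> AE x in m. 0 \<le> G x"
    using W unfolding S_def weak_upper_gradient_def by (auto simp: meas_m)
  obtain g :: "nat => 'a => real" where g: "range g \<subseteq> S" "is_ess_inf m S (\<lambda>x. INF n. max 0 (g n x))"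
    using ex_ess_inf_seq[OF fin_m S] by metis
  have gw: "weak_upper_gradient d m q f (g n)" for n using g(1) unfolding S_def by auto
  \<comment> \<open>Weak upper gradients are nonnegative at every point, so the truncation coming
    from the essential infimum disappears.\<close>
  then have g0: "max 0 (g n x) = g n x" for n x unfolding weak_upper_gradient_def by (simp add: max_def)
  define G where "G x = (INF n. g n x)" for x
  have Gw: "weak_upper_gradient d m q f G" unfolding G_def[abs_def] by (rule weak_upper_gradient_INF[OF q gw])
  have min: "AE x in m. G x \<le> H x" if "weak_upper_gradient d m q f H" for H
    using g(2) that unfolding is_ess_inf_def S_def g0 G_def by blast
  have G0: "\<And>x. 0 \<le> G x" "G \<in> borel_measurable m" using Gw unfolding weak_upper_gradient_def by (auto simp: meas_m)
  have "AE x in m. \<bar>G x\<bar> \<le> \<bar>W x\<bar>" using min[OF W(2)] by eventually_elim (use G0(1) in auto)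
  then have "G \<in> Lp m p" by (intro Lp_dominated[OF W(1) G0(2) _ p])
  then show ?thesis using Gw min by blast
qed
end

theorem theorem5p9:
  fixes d :: "'a::t2_space \<Rightarrow> 'a \<Rightarrow> ennreal" and m :: "'a measure" and p :: real
  assumes "emtm_space d m" and "1 < p"
  shows "W1p d m p \<subseteq> B1p d m p \<and>
    (\<forall>f \<in> W1p d m p. AE x in m. B_gradient d m p f x \<le> W_gradient d m p f x)"
proof -
  let ?q = "conjugate_exponent p"
  interpret emtm d m using assms(1) unfolding emtm_space_def by unfold_locales auto
  have main: "f \<in> B1p d m p \<and> (AE x in m. B_gradient d m p f x \<le> W_gradient d m p f x)" if f: "f \<in> W1p d m p" for f
  proof -
    have fL: "f \<in> Lp m p" using f unfolding W1p_def by simp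
    obtain W L where W: "W \<in> borel_measurable borel" "\<And>x. 0 \<le> W x" "W \<in> Lp m p" "AE x in m. W x = W_gradient d m p f x"
      and L: "is_weak_derivative_operator d m p f L"
        "\<And>b. b \<in> Der_div d m ?q ==> AE x in m. \<bar>L b x\<bar> \<le> W x * derivation_norm d m ?q b x"
      by (fact W_gradient_version[OF assms(2) f])
    have wug: "weak_upper_gradient d m ?q f W" by (rule operator_bound_weak_upper_gradient[OF assms(2) fL L(1) W(1-3) L(2)])
    \<comment> \<open>Existence is what gives the choice operator in \<open>B_gradient\<close> a
      minimal weak upper gradient to select.\<close>
    have "\<exists>G. G \<in> Lp m p \<and> weak_upper_gradient d m ?q f G \<and> (\<forall>H. weak_upper_gradient d m ?q f H \<longrightarrow> (AE x in m. G x \<le> H x))"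
      by (rule ex_minimal_weak_upper_gradient[OF conjugate_exponent_gt[OF assms(2)] _ W(3) wug]) (use assms(2) in simp)
    then have "\<forall>H. weak_upper_gradient d m ?q f H \<longrightarrow> (AE x in m. B_gradient d m p f x \<le> H x)"
      unfolding B_gradient_def by (rule someI2_ex) blast
    then have "AE x in m. B_gradient d m p f x \<le> W x" using wug by blast
    then show ?thesis using W(4) fL W(3) wug unfolding B1p_def by auto
  qed
  then show ?thesis by blast
qed

end
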